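(* Let $\omega\in\widehat{\mathcal{D}}$. Then $(A^1_\omega)^\star$ can be identified with $\mathrm{BMOA}(\infty,\omega)$ via the $\langle\cdot,\cdot\rangle_{\omega\circ\omega}$-pairing with equivalence of norms.
   Context: $\mathbb{D}$ is the open unit disc of $\mathbb{C}$, $\mathcal{H}(\mathbb{D})$ the space of analytic functions in $\mathbb{D}$, and $dA(z)=\frac{dx\,dy}{\pi}$. A radial weight is a nonnegative function $\omega\in L^1([0,1))$ extended to $\mathbb{D}$ by $\omega(z)=\omega(|z|)$; it is assumed throughout that $\widehat{\omega}(z)=\int_{|z|}^1\omega(s)\,ds>0$ for all $z\in\mathbb{D}$. A radial weight $\omega$ belongs to $\widehat{\mathcal{D}}$ if there is $C=C(\omega)\ge1$ with $\widehat{\omega}(r)\le C\widehat{\omega}\left(\frac{1+r}{2}\right)$ for all $0\le r<1$. $A^1_\omega$ is the space of $f\in\mathcal{H}(\mathbb{D})$ with $\|f\|_{A^1_\omega}=\int_{\mathbb{D}}|f(z)|\omega(z)\,dA(z)<\infty$, and $(A^1_\omega)^\star$ its dual. Write $\omega_x=\int_0^1r^x\omega(r)\,dr$ for $x\ge0$. For $f(z)=\sum_{k=0}^\infty\widehat{f}(k)z^k$ and $g(z)=\sum_{k=0}^\infty\widehat{g}(k)z^k$ in $\mathcal{H}(\mathbb{D})$, $$\langle f,g\rangle_{\omega\circ\omega}=\lim_{r\to1^-}\sum_{k=0}^\infty\widehat{f}(k)\overline{\widehat{g}(k)}\,r^{2k+1}(\omega_{2k+1})^2,$$ whenever the limit exists.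 $\mathrm{BMOA}$ is the space of functions in the Hardy space $H^1$ having bounded mean oscillation on the boundary, with a standard norm, and $\mathrm{BMOA}(\infty,\omega)=\{f\in\mathcal{H}(\mathbb{D}):\|f\|_{\mathrm{BMOA}(\infty,\omega)}=\sup_{0<r<1}\|f_r\|_{\mathrm{BMOA}}\,\widehat{\omega}(r)<\infty\}$, where $f_r(z)=f(rz)$. "$X^\star$ can be identified with $Y$ via a pairing $\langle\cdot,\cdot\rangle$ with equivalence of norms" means that each $g\in Y$ induces a bounded linear functional $L_g(f)=\langle f,g\rangle$ on $X$, each element of $X^\star$ equals $L_g$ for a unique $g\in Y$, and $\|L_g\|$ and $\|g\|_Y$ are comparable with constants independent of $g$. *)

theory Defs
  imports "HOL-Complex_Analysis.Complex_Analysis"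
begin

text \<open>
  Analytic functions on the unit disc are represented by total functions
  \<open>complex \<Rightarrow> complex\<close> that are holomorphic on \<open>ball 0 1\<close>; their values off the disc
  carry no information, so elements are identified when they agree on \<open>ball 0 1\<close>.
  A radial weight is given by its profile on \<open>[0,1)\<close>.
\<close>

definition weight_tail :: "(real \<Rightarrow> real) \<Rightarrow> real \<Rightarrow> real" where
  "weight_tail \<omega> r = (LINT s:{r..<1}|lebesgue. \<omega> s)"

definition radial_weight :: "(real \<Rightarrow> real) \<Rightarrow> bool" where
  "radial_weight \<omega> \<longleftrightarrow>
     (\<forall>r\<in>{0..<1}. 0 \<le> \<omega> r) \<and> set_integrable lebesgue {0..<1} \<omega> \<and>
     (\<forall>r\<in>{0..<1}. 0 < weight_tail \<omega> r)"

definition D_hat :: "(real \<Rightarrow> real) set" where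
  "D_hat = {\<omega>. radial_weight \<omega> \<and>
     (\<exists>C\<ge>1. \<forall>r\<in>{0..<1}. weight_tail \<omega> r \<le> C * weight_tail \<omega> ((1 + r) / 2))}"

definition moment :: "(real \<Rightarrow> real) \<Rightarrow> real \<Rightarrow> real" where
  "moment \<omega> x = (LINT r:{0..<1}|lebesgue. r powr x * \<omega> r)"

definition A1 :: "(real \<Rightarrow> real) \<Rightarrow> (complex \<Rightarrow> complex) set" where
  "A1 \<omega> = {f. f holomorphic_on ball 0 1 \<and>
     set_integrable lebesgue (ball 0 1) (\<lambda>z. norm (f z) * \<omega> (norm z))}"

definition A1_norm :: "(real \<Rightarrow> real) \<Rightarrow> (complex \<Rightarrow> complex) \<Rightarrow> real" where
  "A1_norm \<omega> f = (LINT z:ball 0 1|lebesgue. norm (f z) * \<omega> (norm z)) / pi"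

definition taylor_coeff :: "(complex \<Rightarrow> complex) \<Rightarrow> nat \<Rightarrow> complex" where
  "taylor_coeff f k = (deriv ^^ k) f 0 / fact k"

definition pairing_sum ::
  "(real \<Rightarrow> real) \<Rightarrow> (complex \<Rightarrow> complex) \<Rightarrow> (complex \<Rightarrow> complex) \<Rightarrow> real \<Rightarrow> complex" where
  "pairing_sum \<omega> f g r =
     (\<Sum>k. taylor_coeff f k * cnj (taylor_coeff g k)
          * of_real (r ^ (2 * k + 1) * (moment \<omega> (real (2 * k + 1)))\<^sup>2))"

definition pairing_exists ::
  "(real \<Rightarrow> real) \<Rightarrow> (complex \<Rightarrow> complex) \<Rightarrow> (complex \<Rightarrow> complex) \<Rightarrow> bool" where
  "pairing_exists \<omega> f g \<longleftrightarrow> (\<exists>l. (pairing_sum \<omega> f g \<longlongrightarrow> l) (at_left 1))"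

text \<open>Only meaningful when \<open>pairing_exists \<omega> f g\<close> holds.\<close>

definition pairing ::
  "(real \<Rightarrow> real) \<Rightarrow> (complex \<Rightarrow> complex) \<Rightarrow> (complex \<Rightarrow> complex) \<Rightarrow> complex" where
  "pairing \<omega> f g = Lim (at_left 1) (pairing_sum \<omega> f g)"

definition H1 :: "(complex \<Rightarrow> complex) set" where
  "H1 = {f. f holomorphic_on ball 0 1 \<and>
     bdd_above ((\<lambda>r. (LINT t:{0..2*pi}|lebesgue. norm (f (of_real r * cis t))) / (2 * pi))
       ` {0<..<1})}"

text \<open>
  Radial limits. For functions in \<open>H1\<close> they exist at almost every \<open>t\<close>; on the exceptional
  null set \<open>Lim\<close> has a fixed unspecified value.
\<close>

definition boundary_fun :: "(complex \<Rightarrow> complex) \<Rightarrow> real \<Rightarrow> complex" where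
  "boundary_fun f t = Lim (at_left 1) (\<lambda>r. f (of_real r * cis t))"

definition mean :: "(real \<Rightarrow> 'a::euclidean_space) \<Rightarrow> real \<times> real \<Rightarrow> 'a" where
  "mean u = (\<lambda>(a, b). (LINT t:{a..b}|lebesgue. u t) /\<^sub>R (b - a))"

definition mean_osc :: "(real \<Rightarrow> complex) \<Rightarrow> real \<times> real \<Rightarrow> real" where
  "mean_osc u I = mean (\<lambda>t. norm (u t - mean u I)) I"

text \<open>The pair \<open>(a, b)\<close> stands for the arc of all \<open>cis t\<close> with \<open>a \<le> t \<le> b\<close>.\<close>

definition arcs :: "(real \<times> real) set" where
  "arcs = {(a, b). a < b \<and> b \<le> a + 2 * pi}"

definition BMOA :: "(complex \<Rightarrow> complex) set" where
  "BMOA = {f \<in> H1. bdd_above (mean_osc (boundary_fun f) ` arcs)}"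

definition BMOA_norm :: "(complex \<Rightarrow> complex) \<Rightarrow> real" where
  "BMOA_norm f = norm (f 0) + (SUP I\<in>arcs. mean_osc (boundary_fun f) I)"

definition dilate :: "real \<Rightarrow> (complex \<Rightarrow> complex) \<Rightarrow> complex \<Rightarrow> complex" where
  "dilate r f z = f (of_real r * z)"

definition BMOA_inf :: "(real \<Rightarrow> real) \<Rightarrow> (complex \<Rightarrow> complex) set" where
  "BMOA_inf \<omega> = {f. f holomorphic_on ball 0 1 \<and> (\<forall>r\<in>{0<..<1}. dilate r f \<in> BMOA) \<and>
     bdd_above ((\<lambda>r. BMOA_norm (dilate r f) * weight_tail \<omega> r) ` {0<..<1})}"

definition BMOA_inf_norm :: "(real \<Rightarrow> real) \<Rightarrow> (complex \<Rightarrow> complex) \<Rightarrow> real" where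
  "BMOA_inf_norm \<omega> f = (SUP r\<in>{0<..<1}. BMOA_norm (dilate r f) * weight_tail \<omega> r)"

text \<open>
  Bounded linear functionals on a linear space \<open>X\<close> of functions with norm \<open>N\<close>. When \<open>N\<close> vanishes
  exactly on the functions that are zero on the disc, boundedness makes such a functional
  independent of the values off the disc.
\<close>

definition bounded_functional_on ::
  "(complex \<Rightarrow> complex) set \<Rightarrow> ((complex \<Rightarrow> complex) \<Rightarrow> real) \<Rightarrow>
   ((complex \<Rightarrow> complex) \<Rightarrow> complex) \<Rightarrow> bool" where
  "bounded_functional_on X N L \<longleftrightarrow>
     (\<forall>f\<in>X. \<forall>g\<in>X. L (\<lambda>z. f z + g z) = L f + L g) \<and>
     (\<forall>c. \<forall>f\<in>X. L (\<lambda>z. c * f z) = c * L f) \<and>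
     (\<exists>C. \<forall>f\<in>X. norm (L f) \<le> C * N f)"

definition functional_norm ::
  "(complex \<Rightarrow> complex) set \<Rightarrow> ((complex \<Rightarrow> complex) \<Rightarrow> real) \<Rightarrow>
   ((complex \<Rightarrow> complex) \<Rightarrow> complex) \<Rightarrow> real" where
  "functional_norm X N L = (SUP f\<in>{f\<in>X. N f \<le> 1}. norm (L f))"

end

theory Submission
  imports Defs
begin

text \<open>
  Write \<open>\<nu>\<close> for the measure \<open>\<omega> ds\<close> on \<open>[0,1)\<close>, \<open>T\<close> for its tail and \<open>M\<^sub>1(s, f)\<close> for the circle means of
  \<open>|f|\<close>, so that the norm of \<open>f\<close> is a multiple of the integral of \<open>s M\<^sub>1(s, f)\<close> against \<open>\<nu>\<close>.

  Every \<open>g\<close> defines a functional: the pairing is the integral over \<open>(s, t)\<close> against \<open>\<nu> \<otimes> \<nu>\<close> of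
  \<open>s t\<close> times the circle mean of \<open>f \<cdot> cnj g\<close> on \<open>|z| = s t\<close>. By Fefferman's inequality this mean is at
  most \<open>C M\<^sub>1(s t, f) / T(s t)\<close>; for \<open>s \<le> t\<close> this is at most \<open>C M\<^sub>1(s, f) / T(s)\<close>, and integration over
  \<open>t \<ge> s\<close> cancels \<open>T(s)\<close>. Fefferman's inequality itself follows from the subharmonicity of
  \<open>2 N u + 2 N u e\<^sup>-\<^sup>G - Re (f \<cdot> cnj g)\<close>, where \<open>u\<close> is a regularised \<open>|f|\<close> and \<open>N\<^sup>2 G\<close> is the Poisson
  integral of \<open>|g|\<^sup>2\<close> minus \<open>|g|\<^sup>2\<close>, which John--Nirenberg bounds by the square of the oscillation.

  Conversely \<open>L\<close> forces \<open>g\<close> to have the coefficients \<open>cnj (L(z\<^sup>k)) / \<omega>\<^sub>2\<^sub>k\<^sub>+\<^sub>1\<^sup>2\<close>. The oscillation of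
  \<open>g(\<rho> e\<^sup>i\<^sup>t)\<close> on an arc is \<open>L\<close> applied to the image of an atom under the multiplier
  \<open>\<rho>\<^sup>k / \<omega>\<^sub>2\<^sub>k\<^sub>+\<^sub>1\<^sup>2\<close>. The doubling condition gives \<open>\<omega>\<^sub>n \<le> C \<omega>\<^sub>2\<^sub>n\<close>, whence the multiplier
  \<open>a\<^sub>k = r\<^sup>k / \<omega>\<^sub>2\<^sub>k\<^sub>+\<^sub>1\<^sup>2\<close> satisfies \<open>|a\<^sub>k| + (k + 1) |a\<^sub>k\<^sub>+\<^sub>1 - a\<^sub>k| \<le> C / T(r)\<^sup>2\<close>, and this bounds the \<open>L\<^sup>1\<close> norm of
  the image of an atom. The integral of \<open>1 / T(\<rho> s)\<^sup>2\<close> against \<open>\<nu>\<close> is at most \<open>9 / T(\<rho>)\<close>.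
\<close>

section \<open>Polar coordinates\<close>

text \<open>Both halves work on one circle |z| = \<rho> < 1 at a time, where f and g are holomorphic
  across the circle; the weight enters through integration over the radii. The potential theory is
  reduced to one fact: circle means of a subharmonic function increase. In the coordinate log z they
  are convex functions of log r that stay bounded near -\<infinity>.

  The factor e^(-G) is there because the Laplacian of Re (f cnj g) may reach 4 |f'| |g'|, while that
  of u yields only |f'|^2 / u. The Laplacian of -G is 4 |g'|^2 / N^2, so u e^(-G) supplies a
  multiple of u |g'|^2 / N^2, and the two gains are balanced by the arithmetic-geometric mean
  inequality.

  In the converse the mean zero of an atom makes its k-th coefficient of order k \<delta>^2 at low
  frequencies; this is what lets the estimate scale with the length \<delta> of the arc. The bound 1
  / T(r)^2 reflects the squared moments of the pairing. One power of T is won back on integrating,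
  since \<nu> behaves like -dT. What remains, 1 / T(\<rho>), is exactly the growth allowed in
  BMOA(\<infinity>, \<omega>).\<close>

lemma lborel_complex_distr:
  "lborel = distr (lborel \<Otimes>\<^sub>M lborel) borel (\<lambda>(x, y). Complex x y)"
proof (rule lborel_eqI)
  have [measurable]: "(\<lambda>(x, y). Complex x y) \<in> (lborel \<Otimes>\<^sub>M lborel) \<rightarrow>\<^sub>M borel"
    unfolding Complex_eq by measurable
  show "sets (distr (lborel \<Otimes>\<^sub>M lborel) borel (\<lambda>(x, y). Complex x y)) = sets borel" by simp
  fix l u :: complex
  assume le: "\<And>b. b \<in> Basis \<Longrightarrow> l \<bullet> b \<le> u \<bullet> b"
  have le': "Re l \<le> Re u" "Im l \<le> Im u"
    using le[of 1] le[of \<i>] by (auto simp: Basis_complex_def)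
  have "(\<lambda>(x, y). Complex x y) -` box l u = {Re l<..<Re u} \<times> {Im l<..<Im u}"
    by (auto simp: in_box_complex_iff)
  then have "emeasure (distr (lborel \<Otimes>\<^sub>M lborel) borel (\<lambda>(x, y). Complex x y)) (box l u)
      = emeasure (lborel \<Otimes>\<^sub>M lborel) ({Re l<..<Re u} \<times> {Im l<..<Im u})"
    by (subst emeasure_distr) (auto simp: space_pair_measure)
  also have "\<dots> = ennreal (Re u - Re l) * ennreal (Im u - Im l)"
    using le' by (subst lborel.emeasure_pair_measure_Times) auto
  finally show "emeasure (distr (lborel \<Otimes>\<^sub>M lborel) borel (\<lambda>(x, y). Complex x y)) (box l u)
      = ennreal (\<Prod>b\<in>Basis. (u - l) \<bullet> b)"
    using le' by (simp add: Basis_complex_def ennreal_mult'')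
qed

lemma nn_integral_complex:
  fixes f :: "complex \<Rightarrow> ennreal"
  assumes [measurable]: "f \<in> borel_measurable borel"
  shows "(\<integral>\<^sup>+z. f z \<partial>lborel) = (\<integral>\<^sup>+y. \<integral>\<^sup>+x. f (Complex x y) \<partial>lborel \<partial>lborel)"
    and "(\<integral>\<^sup>+z. f z \<partial>lborel) = (\<integral>\<^sup>+x. \<integral>\<^sup>+y. f (Complex x y) \<partial>lborel \<partial>lborel)"
proof -
  have [measurable]: "(\<lambda>(x, y). Complex x y) \<in> (lborel \<Otimes>\<^sub>M lborel) \<rightarrow>\<^sub>M borel"
    unfolding Complex_eq by measurable
  have *: "(\<integral>\<^sup>+z. f z \<partial>lborel) = (\<integral>\<^sup>+p. f (case p of (x, y) \<Rightarrow> Complex x y) \<partial>(lborel \<Otimes>\<^sub>M lborel))"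
    by (subst lborel_complex_distr, subst nn_integral_distr) auto
  show "(\<integral>\<^sup>+z. f z \<partial>lborel) = (\<integral>\<^sup>+y. \<integral>\<^sup>+x. f (Complex x y) \<partial>lborel \<partial>lborel)"
    unfolding * by (subst lborel_pair.nn_integral_snd[symmetric]) auto
  show "(\<integral>\<^sup>+z. f z \<partial>lborel) = (\<integral>\<^sup>+x. \<integral>\<^sup>+y. f (Complex x y) \<partial>lborel \<partial>lborel)"
    unfolding * by (subst lborel.nn_integral_fst[symmetric]) auto
qed

text \<open>On each horizontal or vertical line a shear is a translation, so Fubini reduces the
  claim to translation invariance.\<close>

lemma nn_integral_shear:
  fixes f :: "complex \<Rightarrow> ennreal" and t :: real
  assumes [measurable]: "f \<in> borel_measurable borel"
  shows "(\<integral>\<^sup>+z. f (z + of_real (t * Im z)) \<partial>lborel) = (\<integral>\<^sup>+z. f z \<partial>lborel)"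
    and "(\<integral>\<^sup>+z. f (z + \<i> * of_real (t * Re z)) \<partial>lborel) = (\<integral>\<^sup>+z. f z \<partial>lborel)"
proof -
  have shift: "(\<integral>\<^sup>+x. g (x + c) \<partial>lborel) = (\<integral>\<^sup>+x. g x \<partial>lborel)"
    if [measurable]: "g \<in> borel_measurable borel" for g :: "real \<Rightarrow> ennreal" and c
    using nn_integral_real_affine[of g 1 c] by (simp add: add.commute)
  have [measurable]: "(\<lambda>x. f (Complex x y)) \<in> borel_measurable borel" for y
    unfolding Complex_eq by measurable
  have [measurable]: "(\<lambda>y. f (Complex x y)) \<in> borel_measurable borel" for x
    unfolding Complex_eq by measurable
  have e1: "Complex x y + of_real (t * y) = Complex (x + t * y) y" for x y
    by (simp add: complex_eq_iff)
  have e2: "Complex x y + \<i> * of_real (t * x) = Complex x (y + t * x)" for x y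
    by (simp add: complex_eq_iff)
  have "(\<integral>\<^sup>+z. f (z + of_real (t * Im z)) \<partial>lborel)
      = (\<integral>\<^sup>+y. \<integral>\<^sup>+x. f (Complex x y + of_real (t * y)) \<partial>lborel \<partial>lborel)"
    by (subst nn_integral_complex(1)) auto
  also have "\<dots> = (\<integral>\<^sup>+y. \<integral>\<^sup>+x. f (Complex (x + t * y) y) \<partial>lborel \<partial>lborel)"
    by (simp only: e1)
  also have "\<dots> = (\<integral>\<^sup>+y. \<integral>\<^sup>+x. f (Complex x y) \<partial>lborel \<partial>lborel)"
    by (rule nn_integral_cong, rule shift) measurable
  finally show "(\<integral>\<^sup>+z. f (z + of_real (t * Im z)) \<partial>lborel) = (\<integral>\<^sup>+z. f z \<partial>lborel)"
    by (subst nn_integral_complex(1)) auto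
  have "(\<integral>\<^sup>+z. f (z + \<i> * of_real (t * Re z)) \<partial>lborel)
      = (\<integral>\<^sup>+x. \<integral>\<^sup>+y. f (Complex x y + \<i> * of_real (t * x)) \<partial>lborel \<partial>lborel)"
    by (subst nn_integral_complex(2)) auto
  also have "\<dots> = (\<integral>\<^sup>+x. \<integral>\<^sup>+y. f (Complex x (y + t * x)) \<partial>lborel \<partial>lborel)"
    by (simp only: e2)
  also have "\<dots> = (\<integral>\<^sup>+x. \<integral>\<^sup>+y. f (Complex x y) \<partial>lborel \<partial>lborel)"
    by (rule nn_integral_cong, rule shift) measurable
  finally show "(\<integral>\<^sup>+z. f (z + \<i> * of_real (t * Re z)) \<partial>lborel) = (\<integral>\<^sup>+z. f z \<partial>lborel)"
    by (subst nn_integral_complex(2)) auto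
qed

text \<open>A rotation other than the half turn is a product of three shears.\<close>

lemma nn_integral_rotate:
  fixes f :: "complex \<Rightarrow> ennreal"
  assumes [measurable]: "f \<in> borel_measurable borel"
  shows "(\<integral>\<^sup>+z. f (z * cis \<theta>) \<partial>lborel) = (\<integral>\<^sup>+z. f z \<partial>lborel)"
proof -
  have A: "(\<integral>\<^sup>+z. f (z * c) \<partial>lborel) = (\<integral>\<^sup>+z. f z \<partial>lborel)"
    if c: "norm c = 1" "c \<noteq> -1" and [measurable]: "f \<in> borel_measurable borel"
    for c and f :: "complex \<Rightarrow> ennreal"
  proof -
    have sq: "(Re c)\<^sup>2 + (Im c)\<^sup>2 = 1" using c(1) by (simp add: cmod_def)
    have ne: "1 + Re c \<noteq> 0"
    proof
      assume "1 + Re c = 0"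
      then have "Re c = -1" by simp
      then have "c = -1" using sq by (simp add: complex_eq_iff)
      then show False using c by simp
    qed
    \<comment> \<open>For c = cis \<theta> this is - tan (\<theta> / 2), the parameter of the outer
      two shears; the middle one has parameter sin \<theta>. The tangent breaks down exactly at the
      half turn.\<close>
    define t where "t = - Im c / (1 + Re c)"
    have t1: "t * Im c = Re c - 1"
      using ne sq unfolding t_def by (simp add: field_simps power2_eq_square)
    have t2: "2 * t + t * t * Im c = - Im c"
    proof -
      have "2 * t + t * t * Im c = 2 * t + t * (t * Im c)" by simp
      also have "\<dots> = t * (1 + Re c)" unfolding t1 by (simp add: algebra_simps)
      also have "\<dots> = - Im c" using ne by (simp add: t_def)
      finally show ?thesis .
    qed
    define S where "S = (\<lambda>z::complex. z + of_real (t * Im z))"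
    define R where "R = (\<lambda>z::complex. z + \<i> * of_real (Im c * Re z))"
    have [measurable]: "S \<in> borel_measurable borel" "R \<in> borel_measurable borel"
      unfolding S_def R_def by measurable
    have eq: "z * c = S (R (S z))" for z
    proof -
      have "Re z * Re c - Im z * Im c
        = Re z + t * Im z + t * (Im z + Im c * (Re z + t * Im z))"
      proof -
        have "Re z + t * Im z + t * (Im z + Im c * (Re z + t * Im z))
          = Re z * (1 + t * Im c) + Im z * (2 * t + t * t * Im c)" by (simp add: algebra_simps)
        then show ?thesis unfolding t1 t2 by (simp add: algebra_simps)
      qed
      moreover have "Re z * Im c + Im z * Re c = Im z + Im c * (Re z + t * Im z)"
      proof -
        have "Im z + Im c * (Re z + t * Im z) = Re z * Im c + Im z * (1 + t * Im c)"
          by (simp add: algebra_simps)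
        then show ?thesis unfolding t1 by simp
      qed
      ultimately show ?thesis by (simp add: complex_eq_iff S_def R_def)
    qed
    have "(\<integral>\<^sup>+z. f (z * c) \<partial>lborel) = (\<integral>\<^sup>+z. f (S (R (S z))) \<partial>lborel)" by (simp add: eq)
    also have "\<dots> = (\<integral>\<^sup>+z. f (S (R z)) \<partial>lborel)"
      using nn_integral_shear(1)[of "\<lambda>z. f (S (R z))" t] by (simp add: S_def)
    also have "\<dots> = (\<integral>\<^sup>+z. f (S z) \<partial>lborel)"
      using nn_integral_shear(2)[of "\<lambda>z. f (S z)" "Im c"] by (simp add: R_def)
    also have "\<dots> = (\<integral>\<^sup>+z. f z \<partial>lborel)"
      using nn_integral_shear(1)[of f t] by (simp add: S_def)
    finally show ?thesis .
  qed
  show ?thesis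
  proof (cases "cis \<theta> = -1")
    case True
    have i: "norm \<i> = 1" "\<i> \<noteq> -1" by (auto simp: complex_eq_iff)
    have "(\<integral>\<^sup>+z. f (z * cis \<theta>) \<partial>lborel) = (\<integral>\<^sup>+z. f ((z * \<i>) * \<i>) \<partial>lborel)"
      by (intro nn_integral_cong arg_cong[of _ _ f]) (simp add: True mult.assoc)
    also have "\<dots> = (\<integral>\<^sup>+z. f (z * \<i>) \<partial>lborel)"
      by (rule A[OF i, of "\<lambda>z. f (z * \<i>)"]) measurable
    also have "\<dots> = (\<integral>\<^sup>+z. f z \<partial>lborel)" by (rule A[OF i]) measurable
    finally show ?thesis .
  next
    case False then show ?thesis by (intro A) auto
  qed
qed

lemma measurable_indicator_unit_disc [measurable]:
  "(indicator (ball 0 1) :: complex \<Rightarrow> ennreal) \<in> borel_measurable borel"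
  by (rule borel_measurable_indicator) simp

text \<open>Finite measures on the line agree once they agree on all half-lines
  \<open>{x<..}\<close>; here both give the area \<pi> - \<pi> x^2 of an annulus.\<close>

lemma distr_norm_ball:
  "distr (density lborel (indicator (ball 0 1))) borel (norm :: complex \<Rightarrow> real)
    = density lborel (\<lambda>s. ennreal (2 * pi * s) * indicator {0..1} s)" (is "?M = ?N")
proof (rule measure_eqI_lessThan)
  have M: "emeasure ?M {x<..} = emeasure lborel ({z::complex. x < norm z} \<inter> ball 0 1)" for x
  proof -
    have "emeasure ?M {x<..} = emeasure (density lborel (indicator (ball 0 1))) {z::complex. x < norm z}"
      by (subst emeasure_distr) (auto intro!: arg_cong2[where f=emeasure])
    also have "\<dots> = (\<integral>\<^sup>+z. indicator (ball 0 1) z * indicator {z::complex. x < norm z} z \<partial>lborel)"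
      by (rule emeasure_density) measurable
    also have "\<dots> = (\<integral>\<^sup>+z. indicator ({z::complex. x < norm z} \<inter> ball 0 1) z \<partial>lborel)"
      by (intro nn_integral_cong) (auto split: split_indicator)
    also have "\<dots> = emeasure lborel ({z::complex. x < norm z} \<inter> ball 0 1)"
      by (rule nn_integral_indicator) auto
    finally show ?thesis .
  qed
  have c: "emeasure lborel (ball (0::complex) r) = ennreal (pi * r\<^sup>2)"
    "emeasure lborel (cball (0::complex) r) = ennreal (pi * r\<^sup>2)" if "0 \<le> r" for r
    using that by (simp_all add: emeasure_ball emeasure_cball unit_ball_vol_2)
  show "emeasure ?M {x<..} < \<infinity>" for x
  proof -
    have "emeasure ?M {x<..} \<le> emeasure lborel (ball (0::complex) 1)"
      unfolding M by (rule emeasure_mono) auto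
    also have "\<dots> < \<infinity>" using c(1)[of 1] by simp
    finally show ?thesis .
  qed
  fix x :: real
  have N: "emeasure ?N {x<..} = (\<integral>\<^sup>+s. ennreal (2 * pi * s) * indicator {max 0 x..1} s \<partial>lborel)"
    using AE_lborel_singleton[of x]
    by (subst emeasure_density) (auto intro!: nn_integral_cong_AE split: split_indicator)
  have N': "emeasure ?N {x<..} = ennreal (pi - pi * (max 0 x)\<^sup>2)" if "x \<le> 1"
    unfolding N using that
    by (subst nn_integral_FTC_Icc[where F="\<lambda>s. pi * s\<^sup>2"])
      (auto intro!: derivative_eq_intros simp: has_real_derivative_iff_has_vector_derivative[symmetric])
  consider "x < 0" | "0 \<le> x" "x \<le> 1" | "1 < x" by linarith
  then show "emeasure ?M {x<..} = emeasure ?N {x<..}"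
  proof cases
    case 1
    then have "{z::complex. x < norm z} \<inter> ball 0 1 = ball 0 1"
      by (auto intro: less_le_trans)
    then show ?thesis using 1 M N' c[of 1] by simp
  next
    case 2
    then have "{z::complex. x < norm z} \<inter> ball 0 1 = ball 0 1 - cball 0 x" by auto
    moreover have "emeasure lborel (ball 0 1 - cball (0::complex) x) = ennreal (pi - pi * x\<^sup>2)" if "x < 1"
      using that 2 by (subst emeasure_Diff) (auto simp: c ennreal_minus)
    moreover have e: "ball 0 1 - cball (0::complex) 1 = {}" by auto
    ultimately show ?thesis using 2 M N' by (cases "x = 1") (auto simp del: Diff_eq_empty_iff simp: e)
  next
    case 3
    then have "{z::complex. x < norm z} \<inter> ball 0 1 = {}" by auto
    moreover have "{max 0 x..1} = {}" using 3 by auto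
    ultimately show ?thesis unfolding M N by simp
  qed
qed (auto)

lemma nn_integral_radial:
  fixes f :: "real \<Rightarrow> ennreal"
  assumes [measurable]: "f \<in> borel_measurable borel"
  shows "(\<integral>\<^sup>+z. f (norm (z::complex)) * indicator (ball 0 1) z \<partial>lborel)
    = (\<integral>\<^sup>+s. f s * (ennreal (2 * pi * s) * indicator {0..1} s) \<partial>lborel)"
proof -
  have "(\<integral>\<^sup>+z. f (norm (z::complex)) * indicator (ball 0 1) z \<partial>lborel)
     = integral\<^sup>N (distr (density lborel (indicator (ball 0 1))) borel (norm :: complex \<Rightarrow> real)) f"
    by (subst nn_integral_distr, simp, simp, subst nn_integral_density, measurable)
       (simp add: mult.commute)
  also have "\<dots> = (\<integral>\<^sup>+s. f s * (ennreal (2 * pi * s) * indicator {0..1} s) \<partial>lborel)"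
    unfolding distr_norm_ball by (subst nn_integral_density) (auto simp: mult.commute)
  finally show ?thesis .
qed

lemma nn_integral_cis_shift:
  fixes f :: "complex \<Rightarrow> ennreal"
  assumes [measurable]: "f \<in> borel_measurable borel" and a: "0 \<le> a" "a \<le> 2 * pi"
  shows "(\<integral>\<^sup>+\<theta>. f (cis (\<theta> + a)) * indicator {0..2*pi} \<theta> \<partial>lborel)
     = (\<integral>\<^sup>+\<theta>. f (cis \<theta>) * indicator {0..2*pi} \<theta> \<partial>lborel)"
proof -
  have [measurable]: "cis \<in> borel_measurable borel"
    by (intro borel_measurable_continuous_onI continuous_intros)
  have per: "cis (x + 2 * pi) = cis x" for x by (simp add: complex_eq_iff)
  have sh: "(\<integral>\<^sup>+x. g x \<partial>lborel) = (\<integral>\<^sup>+x. g (x + c) \<partial>lborel)"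
    if [measurable]: "g \<in> borel_measurable borel" for g :: "real \<Rightarrow> ennreal" and c
    using nn_integral_real_affine[of g 1 c] by (simp add: add.commute)
  have "(\<integral>\<^sup>+\<theta>. f (cis (\<theta> + a)) * indicator {0..2*pi} \<theta> \<partial>lborel)
     = (\<integral>\<^sup>+\<theta>. f (cis \<theta>) * indicator {a..a+2*pi} \<theta> \<partial>lborel)"
    by (subst sh[of "\<lambda>\<theta>. f (cis \<theta>) * indicator {a..a+2*pi} \<theta>" a])
       (auto intro!: nn_integral_cong split: split_indicator)
  also have "\<dots> = (\<integral>\<^sup>+\<theta>. f (cis \<theta>) * indicator {a..2*pi} \<theta> + f (cis \<theta>) * indicator {2*pi..2*pi+a} \<theta> \<partial>lborel)"
  proof (rule nn_integral_cong_AE)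
    show "AE \<theta> in lborel. f (cis \<theta>) * indicator {a..a+2*pi} \<theta>
      = f (cis \<theta>) * indicator {a..2*pi} \<theta> + f (cis \<theta>) * indicator {2*pi..2*pi+a} \<theta>"
      using AE_lborel_singleton[of "2*pi"] by eventually_elim (use a in \<open>auto split: split_indicator\<close>)
  qed
  also have "\<dots> = (\<integral>\<^sup>+\<theta>. f (cis \<theta>) * indicator {a..2*pi} \<theta> \<partial>lborel)
      + (\<integral>\<^sup>+\<theta>. f (cis \<theta>) * indicator {2*pi..2*pi+a} \<theta> \<partial>lborel)"
    by (rule nn_integral_add) measurable
  also have "(\<integral>\<^sup>+\<theta>. f (cis \<theta>) * indicator {2*pi..2*pi+a} \<theta> \<partial>lborel)
      = (\<integral>\<^sup>+\<theta>. f (cis \<theta>) * indicator {0..a} \<theta> \<partial>lborel)"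
    by (subst sh[of "\<lambda>\<theta>. f (cis \<theta>) * indicator {2*pi..2*pi+a} \<theta>" "2*pi"])
       (measurable, auto intro!: nn_integral_cong split: split_indicator simp: per)
  also have "(\<integral>\<^sup>+\<theta>. f (cis \<theta>) * indicator {a..2*pi} \<theta> \<partial>lborel)
      + (\<integral>\<^sup>+\<theta>. f (cis \<theta>) * indicator {0..a} \<theta> \<partial>lborel)
      = (\<integral>\<^sup>+\<theta>. f (cis \<theta>) * indicator {a..2*pi} \<theta> + f (cis \<theta>) * indicator {0..a} \<theta> \<partial>lborel)"
    by (rule nn_integral_add[symmetric]) measurable
  also have "\<dots> = (\<integral>\<^sup>+\<theta>. f (cis \<theta>) * indicator {0..2*pi} \<theta> \<partial>lborel)"
  proof (rule nn_integral_cong_AE)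
    show "AE \<theta> in lborel. f (cis \<theta>) * indicator {a..2*pi} \<theta> + f (cis \<theta>) * indicator {0..a} \<theta>
      = f (cis \<theta>) * indicator {0..2*pi} \<theta>"
      using AE_lborel_singleton[of "a"] by eventually_elim (use a in \<open>auto split: split_indicator\<close>)
  qed
  finally show ?thesis .
qed

text \<open>The integral is averaged over all rotations. After exchanging the order of integration
  the inner integral depends on |z| only, so the radial formula applies; the total angle 2 \<pi> is
  cancelled at the end.\<close>

lemma nn_integral_polar:
  fixes f :: "complex \<Rightarrow> ennreal"
  assumes [measurable]: "f \<in> borel_measurable borel"
  shows "(\<integral>\<^sup>+z. f z * indicator (ball 0 1) z \<partial>lborel)
    = (\<integral>\<^sup>+s. (\<integral>\<^sup>+\<theta>. f (of_real s * cis \<theta>) * indicator {0..2*pi} \<theta> \<partial>lborel)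
          * (ennreal s * indicator {0..1} s) \<partial>lborel)"
proof -
  have [measurable]: "cis \<in> borel_measurable borel"
    by (intro borel_measurable_continuous_onI continuous_intros)
  have [measurable]: "Measurable.pred borel (\<lambda>x::complex. x \<in> ball 0 1)"
    unfolding mem_ball by measurable
  define \<Phi> where "\<Phi> s = (\<integral>\<^sup>+\<theta>. f (of_real s * cis \<theta>) * indicator {0..2*pi} \<theta> \<partial>lborel)" for s :: real
  have [measurable]: "\<Phi> \<in> borel_measurable borel" unfolding \<Phi>_def by measurable
  have \<Phi>: "(\<integral>\<^sup>+\<theta>. f (z * cis \<theta>) * indicator {0..2*pi} \<theta> \<partial>lborel) = \<Phi> (norm z)" for z
  proof -
    obtain r b where z: "z = rcis r b" "0 \<le> r" "0 \<le> b" "b < 2*pi"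
      using Arg2pi[of z] by (metis rcis_def is_Arg_def cis_conv_exp norm_ge_zero)
    have "(\<integral>\<^sup>+\<theta>. f (z * cis \<theta>) * indicator {0..2*pi} \<theta> \<partial>lborel)
       = (\<integral>\<^sup>+\<theta>. f (of_real r * cis (\<theta> + b)) * indicator {0..2*pi} \<theta> \<partial>lborel)"
      by (intro nn_integral_cong) (simp add: z rcis_def cis_mult[symmetric] mult_ac)
    also have "\<dots> = (\<integral>\<^sup>+\<theta>. f (of_real r * cis \<theta>) * indicator {0..2*pi} \<theta> \<partial>lborel)"
      using z by (intro nn_integral_cis_shift[where f="\<lambda>w. f (of_real r * w)"]) auto
    finally show ?thesis using z by (simp add: \<Phi>_def)
  qed
  have "(\<integral>\<^sup>+\<theta>. (\<integral>\<^sup>+z. f z * indicator (ball 0 1) z \<partial>lborel) * indicator {0..2*pi} \<theta> \<partial>lborel)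
      = (\<integral>\<^sup>+\<theta>. (\<integral>\<^sup>+z. f (z * cis \<theta>) * indicator (ball 0 1) z * indicator {0..2*pi} \<theta> \<partial>lborel) \<partial>lborel)"
  proof (intro nn_integral_cong)
    fix \<theta>
    have "(\<integral>\<^sup>+z. f z * indicator (ball 0 1) z \<partial>lborel) =
      (\<integral>\<^sup>+z. f (z * cis \<theta>) * indicator (ball 0 1) (z * cis \<theta>) \<partial>lborel)"
      by (rule nn_integral_rotate[symmetric]) measurable
    also have "\<dots> = (\<integral>\<^sup>+z. f (z * cis \<theta>) * indicator (ball 0 1) z \<partial>lborel)"
      by (intro nn_integral_cong) (auto split: split_indicator simp: norm_mult)
    finally show "(\<integral>\<^sup>+z. f z * indicator (ball 0 1) z \<partial>lborel) * indicator {0..2*pi} \<theta>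
       = (\<integral>\<^sup>+z. f (z * cis \<theta>) * indicator (ball 0 1) z * indicator {0..2*pi} \<theta> \<partial>lborel)"
      by (simp add: nn_integral_multc)
  qed
  also have "\<dots> = (\<integral>\<^sup>+z. (\<integral>\<^sup>+\<theta>. f (z * cis \<theta>) * indicator (ball 0 1) z * indicator {0..2*pi} \<theta> \<partial>lborel) \<partial>lborel)"
    by (rule lborel_pair.Fubini') measurable
  also have "\<dots> = (\<integral>\<^sup>+z. \<Phi> (norm (z::complex)) * indicator (ball 0 1) z \<partial>lborel)"
    by (rule nn_integral_cong) (auto simp: \<Phi>[symmetric] split: split_indicator)
  also have "\<dots> = (\<integral>\<^sup>+s. \<Phi> s * (ennreal (2 * pi * s) * indicator {0..1} s) \<partial>lborel)"
    by (rule nn_integral_radial) measurable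
  also have "\<dots> = ennreal (2 * pi) * (\<integral>\<^sup>+s. \<Phi> s * (ennreal s * indicator {0..1} s) \<partial>lborel)"
    by (subst nn_integral_cmult[symmetric])
       (auto intro!: nn_integral_cong simp: ennreal_mult' mult_ac split: split_indicator)
  also have "(\<integral>\<^sup>+\<theta>. (\<integral>\<^sup>+z. f z * indicator (ball 0 1) z \<partial>lborel) * indicator {0..2*pi} \<theta> \<partial>lborel)
     = ennreal (2 * pi) * (\<integral>\<^sup>+z. f z * indicator (ball 0 1) z \<partial>lborel)"
    by (subst nn_integral_cmult) (auto simp: mult.commute)
  finally show ?thesis
    unfolding \<Phi>_def by (subst (asm) ennreal_mult_cancel_left) (use pi_gt_zero in \<open>auto simp: ennreal_eq_0_iff simp del: pi_gt_zero\<close>)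
qed

section \<open>Circle means of subharmonic functions\<close>

definition circ :: "(complex \<Rightarrow> 'a::euclidean_space) \<Rightarrow> real \<Rightarrow> 'a" where
  "circ f r = integral {0..2*pi} (\<lambda>t. f (of_real r * cis t))"

section \<open>Second derivatives along a direction; the directions 1 and \<i> together give the
  Laplacian\<close>

definition C2_dir :: "complex \<Rightarrow> complex set \<Rightarrow> (complex \<Rightarrow> real) \<Rightarrow> (complex \<Rightarrow> real) \<Rightarrow> (complex \<Rightarrow> real) \<Rightarrow> bool" where
  "C2_dir d U \<phi> \<phi>' \<phi>'' \<longleftrightarrow>
     continuous_on U \<phi> \<and> continuous_on U \<phi>' \<and> continuous_on U \<phi>'' \<and>
     (\<forall>w\<in>U. ((\<lambda>t. \<phi> (w + of_real t * d)) has_real_derivative \<phi>' w) (at 0) \<and>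
             ((\<lambda>t. \<phi>' (w + of_real t * d)) has_real_derivative \<phi>'' w) (at 0))"

lemma C2_dirD:
  assumes "C2_dir d U \<phi> \<phi>' \<phi>''"
  shows "continuous_on U \<phi>" "continuous_on U \<phi>'" "continuous_on U \<phi>''"
    "\<And>w. w \<in> U \<Longrightarrow> ((\<lambda>t. \<phi> (w + of_real t * d)) has_real_derivative \<phi>' w) (at 0)"
    "\<And>w. w \<in> U \<Longrightarrow> ((\<lambda>t. \<phi>' (w + of_real t * d)) has_real_derivative \<phi>'' w) (at 0)"
  using assms by (auto simp: C2_dir_def)

text \<open>Replaces the derivatives produced by the calculus rules by closed forms. Openness of
  \<open>U\<close> keeps a short piece of the line inside \<open>U\<close>, where both forms
  agree.\<close>

lemma C2_dir_cong:
  assumes "C2_dir d U \<phi> \<phi>' \<phi>''" "\<And>w. w \<in> U \<Longrightarrow> \<psi>' w = \<phi>' w" "\<And>w. w \<in> U \<Longrightarrow> \<psi>'' w = \<phi>'' w"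
    and "open U"
  shows "C2_dir d U \<phi> \<psi>' \<psi>''"
proof -
  note D = C2_dirD[OF assms(1)]
  have "((\<lambda>t. \<psi>' (w + of_real t * d)) has_real_derivative \<psi>'' w) (at 0)" if "w \<in> U" for w
  proof (rule has_field_derivative_transform_within_open)
    show "((\<lambda>t. \<phi>' (w + of_real t * d)) has_real_derivative \<psi>'' w) (at 0)"
      using D(5)[OF that] assms(3)[OF that] by simp
    have "continuous_on UNIV (\<lambda>t::real. w + of_real t * d)" by (intro continuous_intros)
    then show "open ((\<lambda>t::real. w + of_real t * d) -` U)"
      by (rule open_vimage[OF \<open>open U\<close>])
  qed (use that assms(2) in auto)
  then show ?thesis
    using D assms(2,3) by (auto simp: C2_dir_def cong: continuous_on_cong)
qed

lemma C2_dir_const: "C2_dir d U (\<lambda>_. c) (\<lambda>_. 0) (\<lambda>_. 0)"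
  by (auto simp: C2_dir_def)

lemma C2_dir_add:
  assumes "C2_dir d U \<phi> \<phi>' \<phi>''" "C2_dir d U \<psi> \<psi>' \<psi>''"
  shows "C2_dir d U (\<lambda>w. \<phi> w + \<psi> w) (\<lambda>w. \<phi>' w + \<psi>' w) (\<lambda>w. \<phi>'' w + \<psi>'' w)"
  using assms by (auto simp: C2_dir_def intro!: continuous_intros derivative_intros)

lemma C2_dir_cmult:
  assumes "C2_dir d U \<phi> \<phi>' \<phi>''"
  shows "C2_dir d U (\<lambda>w. c * \<phi> w) (\<lambda>w. c * \<phi>' w) (\<lambda>w. c * \<phi>'' w)"
  using assms by (auto simp: C2_dir_def intro!: continuous_intros DERIV_cmult)

lemma C2_dir_mult:
  assumes "C2_dir d U \<phi> \<phi>' \<phi>''" "C2_dir d U \<psi> \<psi>' \<psi>''"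
  shows "C2_dir d U (\<lambda>w. \<phi> w * \<psi> w) (\<lambda>w. \<phi>' w * \<psi> w + \<phi> w * \<psi>' w)
     (\<lambda>w. \<phi>'' w * \<psi> w + 2 * \<phi>' w * \<psi>' w + \<phi> w * \<psi>'' w)"
proof -
  note A = C2_dirD[OF assms(1)] and B = C2_dirD[OF assms(2)]
  have "((\<lambda>t. \<phi> (w + of_real t * d) * \<psi> (w + of_real t * d)) has_real_derivative
      \<phi>' w * \<psi> w + \<phi> w * \<psi>' w) (at 0)" if "w \<in> U" for w
    using DERIV_mult[OF A(4)[OF that] B(4)[OF that]] by (simp add: algebra_simps)
  moreover have "((\<lambda>t. \<phi>' (w + of_real t * d) * \<psi> (w + of_real t * d)
        + \<phi> (w + of_real t * d) * \<psi>' (w + of_real t * d)) has_real_derivative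
      \<phi>'' w * \<psi> w + 2 * \<phi>' w * \<psi>' w + \<phi> w * \<psi>'' w) (at 0)" if "w \<in> U" for w
    using DERIV_add[OF DERIV_mult[OF A(5)[OF that] B(4)[OF that]] DERIV_mult[OF A(4)[OF that] B(5)[OF that]]]
    by (simp add: algebra_simps)
  ultimately show ?thesis
    unfolding C2_dir_def
    by (intro conjI ballI continuous_on_add continuous_on_mult continuous_on_const A(1-3) B(1-3)) blast+
qed

lemma C2_dir_compose:
  assumes \<phi>: "C2_dir d U \<phi> \<phi>' \<phi>''"
    and V: "\<And>w. w \<in> U \<Longrightarrow> \<phi> w \<in> V"
    and h: "\<And>x. x \<in> V \<Longrightarrow> (h has_real_derivative h' x) (at x)"
      "\<And>x. x \<in> V \<Longrightarrow> (h' has_real_derivative h'' x) (at x)" "continuous_on V h''"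
  shows "C2_dir d U (\<lambda>w. h (\<phi> w)) (\<lambda>w. h' (\<phi> w) * \<phi>' w)
     (\<lambda>w. h'' (\<phi> w) * (\<phi>' w)\<^sup>2 + h' (\<phi> w) * \<phi>'' w)"
proof -
  note D = C2_dirD[OF \<phi>]
  have c: "continuous_on V h" "continuous_on V h'"
    by (rule DERIV_continuous_on, rule has_field_derivative_at_within, erule h)+
  have c3: "continuous_on U (\<lambda>w. h (\<phi> w))" "continuous_on U (\<lambda>w. h' (\<phi> w))" "continuous_on U (\<lambda>w. h'' (\<phi> w))"
    by (rule continuous_on_compose2[OF c(1) D(1)] continuous_on_compose2[OF c(2) D(1)]
        continuous_on_compose2[OF h(3) D(1)]; use V in blast)+
  have d1: "((\<lambda>t. h (\<phi> (w + of_real t * d))) has_real_derivative h' (\<phi> w) * \<phi>' w) (at 0)" if "w \<in> U" for w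
    by (rule DERIV_chain2[where g="\<lambda>t. \<phi> (w + of_real t * d)"]) (use that V h D in auto)
  have d2: "((\<lambda>t. h' (\<phi> (w + of_real t * d))) has_real_derivative h'' (\<phi> w) * \<phi>' w) (at 0)" if "w \<in> U" for w
    by (rule DERIV_chain2[where g="\<lambda>t. \<phi> (w + of_real t * d)"]) (use that V h D in auto)
  have "((\<lambda>t. h' (\<phi> (w + of_real t * d)) * \<phi>' (w + of_real t * d)) has_real_derivative
      h'' (\<phi> w) * (\<phi>' w)\<^sup>2 + h' (\<phi> w) * \<phi>'' w) (at 0)" if "w \<in> U" for w
    using DERIV_mult[OF d2[OF that] D(5)[OF that]] by (simp add: power2_eq_square algebra_simps)
  then show ?thesis
    using d1 D c3 by (auto simp: C2_dir_def intro!: continuous_intros)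
qed

lemma C2_dir_line:
  assumes "C2_dir d U \<phi> \<phi>' \<phi>''" "w + of_real t * d \<in> U"
  shows "((\<lambda>t. \<phi> (w + of_real t * d)) has_real_derivative \<phi>' (w + of_real t * d)) (at t)"
    "((\<lambda>t. \<phi>' (w + of_real t * d)) has_real_derivative \<phi>'' (w + of_real t * d)) (at t)"
proof -
  note D = C2_dirD(4,5)[OF assms(1) assms(2)]
  have *: "(g has_real_derivative g') (at t)"
    if "((\<lambda>s. g (t + s)) has_real_derivative g') (at 0)" for g g'
    using DERIV_shift[of g g' 0 t] that by (simp add: add.commute)
  show "((\<lambda>t. \<phi> (w + of_real t * d)) has_real_derivative \<phi>' (w + of_real t * d)) (at t)"
    by (rule *) (use D(1) in \<open>simp add: algebra_simps\<close>)
  show "((\<lambda>t. \<phi>' (w + of_real t * d)) has_real_derivative \<phi>'' (w + of_real t * d)) (at t)"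
    by (rule *) (use D(2) in \<open>simp add: algebra_simps\<close>)
qed

section \<open>Convexity in log r and monotonicity of circle means\<close>

lemma bounded_convex_mono:
  fixes m :: "real \<Rightarrow> real"
  assumes cvx: "convex_on {..<0} m" and bd: "\<And>s. s \<le> b \<Longrightarrow> m s \<le> B" and ab: "a \<le> b" "b < 0"
  shows "m a \<le> m b"
proof (rule ccontr)
  assume "\<not> m a \<le> m b"
  then have lt: "m b < m a" by simp
  then have "a < b" using ab by (cases "a = b") auto
  \<comment> \<open>To the left of \<open>a\<close> a convex function stays above the chord through
    \<open>a\<close> and \<open>b\<close>. If \<open>m\<close> fell from \<open>a\<close> to
    \<open>b\<close>, this chord would be unbounded there.\<close>
  have key: "(m a - m b) * (b - s) \<le> (m s - m b) * (b - a)" if "s < a" for s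
  proof -
    define l where "l = (b - a) / (b - s)"
    have l: "0 \<le> l" "l \<le> 1" using \<open>a < b\<close> that by (auto simp: l_def)
    have "l * (b - s) = b - a" using \<open>a < b\<close> that by (simp add: l_def)
    then have "a = (1 - l) * b + l * s" by (simp add: algebra_simps)
    then have "m a \<le> (1 - l) * m b + l * m s"
      using convex_onD[OF cvx, of l b s] l that ab \<open>a < b\<close> by simp
    then have "m a - m b \<le> l * (m s - m b)" by (simp add: algebra_simps)
    then have "(m a - m b) * (b - s) \<le> (l * (m s - m b)) * (b - s)"
      using that \<open>a < b\<close> by (intro mult_right_mono) auto
    also have "\<dots> = (m s - m b) * (b - a)" using that \<open>a < b\<close> by (simp add: l_def)
    finally show ?thesis .
  qed
  \<comment> \<open>The distance from \<open>b\<close> at which the extended chord reaches the level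
    \<open>B\<close>.\<close>
  define K where "K = (B - m b) * (b - a) / (m a - m b)"
  define s where "s = min (a - 1) (b - K - 1)"
  have s: "s < a" "K < b - s" by (auto simp: s_def)
  have "m s \<le> B" using s \<open>a < b\<close> by (intro bd) auto
  then have "(m s - m b) * (b - a) \<le> (B - m b) * (b - a)"
    using \<open>a < b\<close> by (intro mult_right_mono) auto
  then have "(m a - m b) * (b - s) \<le> (B - m b) * (b - a)" using key[OF s(1)] by linarith
  then have "b - s \<le> K" using lt by (simp add: K_def pos_le_divide_eq mult.commute)
  then show False using s by simp
qed

lemma continuous_circle:
  assumes "continuous_on (ball 0 1) f" "0 \<le> r" "r < 1"
  shows "continuous_on S (\<lambda>t. f (of_real r * cis t))"
  by (rule continuous_on_compose2[OF assms(1)])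
     (use assms in \<open>auto intro!: continuous_intros simp: norm_mult\<close>)

lemma circ_zero_limit:
  fixes f :: "complex \<Rightarrow> 'a::euclidean_space"
  assumes "continuous_on (ball 0 1) f" "R < 1"
  shows "continuous_on {0..R} (circ f)"
proof -
  have "continuous_on ({0..R} \<times> cbox 0 (2*pi)) (\<lambda>(r, t). f (of_real r * cis t))"
    unfolding split_beta
    by (rule continuous_on_compose2[OF assms(1)])
       (use assms in \<open>auto intro!: continuous_intros simp: norm_mult\<close>)
  from integral_continuous_on_param[OF this] show ?thesis
    unfolding circ_def by simp
qed

text \<open>With z = exp (s + i t) the mean becomes an integral over a vertical segment of length 2
  \<pi>. Its second derivative in s is the integral of \<open>p'\<close>, and adding
  \<open>q'\<close> changes nothing, because \<open>q'\<close> integrates to zero over a period. So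
  the mean is convex in s = log r. Continuity of \<Psi> near 0 bounds it as s tends to -\<infinity>,
  which makes it nondecreasing.\<close>

theorem circ_mono_subharmonic:
  fixes \<Psi> :: "complex \<Rightarrow> real"
  assumes cont: "continuous_on (ball 0 1) \<Psi>"
    and d1: "C2_dir 1 {w. Re w < 0} (\<lambda>w. \<Psi> (exp w)) p p'"
    and d2: "C2_dir \<i> {w. Re w < 0} (\<lambda>w. \<Psi> (exp w)) q q'"
    and sub: "\<And>w. Re w < 0 \<Longrightarrow> 0 \<le> p' w + q' w"
    and r: "0 \<le> r" "r \<le> R" "R < 1"
  shows "circ \<Psi> r \<le> circ \<Psi> R"
proof -
  let ?U = "{w. Re w < 0}"
  define m where "m s = integral {0..2*pi} (\<lambda>t. \<Psi> (exp (Complex s t)))" for s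
  define m1 where "m1 s = integral {0..2*pi} (\<lambda>t. p (Complex s t))" for s
  define m2 where "m2 s = integral {0..2*pi} (\<lambda>t. p' (Complex s t))" for s
  have Cx: "Complex s t = \<i> * of_real t + of_real s" for s t by (simp add: complex_eq_iff)
  have Cx2: "Complex s t = of_real s + of_real t * \<i>" for s t by (simp add: complex_eq_iff)
  note C1 = C2_dirD[OF d1] and C2 = C2_dirD[OF d2]
  have cs: "continuous_on S (\<lambda>t. g (Complex s t))" if "continuous_on ?U g" "s < 0"
    for g :: "complex \<Rightarrow> real" and s S
    by (rule continuous_on_compose2[OF that(1)]) (use that in \<open>auto simp: Cx intro!: continuous_intros\<close>)
  have cp: "continuous_on ({..<0} \<times> cbox 0 (2*pi)) (\<lambda>(s, t). g (Complex s t))"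
    if "continuous_on ?U g" for g :: "complex \<Rightarrow> real"
    unfolding split_beta
    by (rule continuous_on_compose2[OF that(1)]) (auto simp: Cx intro!: continuous_intros)
  have leib: "((\<lambda>s. integral {0..2*pi} (\<lambda>t. g (Complex s t))) has_real_derivative
      integral {0..2*pi} (\<lambda>t. g' (Complex s t))) (at s)"
    if "s < 0" "continuous_on ?U g" "continuous_on ?U g'"
      and D: "\<And>w. w \<in> ?U \<Longrightarrow> ((\<lambda>t. g (w + of_real t)) has_real_derivative g' w) (at 0)"
    for g g' s
  proof -
    have "((\<lambda>s. integral (cbox 0 (2*pi)) (\<lambda>t. g (Complex s t))) has_field_derivative
      integral (cbox 0 (2*pi)) (\<lambda>t. g' (Complex s t))) (at s within {..<0})"
    proof (rule leibniz_rule_field_derivative)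
      fix x t :: real assume "x \<in> {..<0}"
      then have *: "((\<lambda>u. g (Complex x t + of_real u)) has_real_derivative g' (Complex x t)) (at 0)"
        by (intro D) auto
      have "((\<lambda>x. g (Complex x t)) has_real_derivative g' (Complex x t)) (at x)"
        using DERIV_shift[of "\<lambda>x. g (Complex x t)" "g' (Complex x t)" 0 x] *
        by (simp add: Cx algebra_simps)
      then show "((\<lambda>x. g (Complex x t)) has_real_derivative g' (Complex x t)) (at x within {..<0})"
        by (rule has_field_derivative_at_within)
    qed (use that cs cp in \<open>auto intro!: integrable_continuous_real\<close>)
    then show ?thesis using that by (simp add: at_within_open[of s "{..<0}"])
  qed
  have dm: "(m has_real_derivative m1 s) (at s)" "(m1 has_real_derivative m2 s) (at s)" if "s < 0" for s
    unfolding m_def m1_def m2_def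
    by (rule leib; use that C1 in auto)+
  have m2: "0 \<le> m2 s" if "s < 0" for s
  proof -
    \<comment> \<open>\<open>q\<close> is the angular derivative of a function with period 2 \<pi>
      \<i>, hence periodic itself; this cancels the boundary terms in the integral of
      \<open>q'\<close>.\<close>
    have per: "q (w + of_real (2*pi) * \<i>) = q w" if "w \<in> ?U" for w
    proof -
      have "exp (w + 2 * of_real pi * \<i> + z) = exp (w + z)" for z :: complex
        by (simp add: exp_add exp_two_pi_i)
      then have e: "(\<lambda>t. \<Psi> (exp (w + of_real (2*pi) * \<i> + of_real t * \<i>)))
         = (\<lambda>t. \<Psi> (exp (w + of_real t * \<i>)))" by simp
      have "((\<lambda>t. \<Psi> (exp (w + of_real (2*pi) * \<i> + of_real t * \<i>))) has_real_derivative
          q (w + of_real (2*pi) * \<i>)) (at 0)"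
        using that by (intro C2(4)) auto
      from this[unfolded e] C2(4)[OF that] show ?thesis by (rule DERIV_unique)
    qed
    have "((\<lambda>t. q' (Complex s t)) has_integral (q (Complex s (2*pi)) - q (Complex s 0))) {0..2*pi}"
    proof (rule fundamental_theorem_of_calculus)
      fix t :: real
      have "((\<lambda>t. q (of_real s + of_real t * \<i>)) has_real_derivative q' (of_real s + of_real t * \<i>)) (at t)"
        by (rule C2_dir_line(2)[OF d2]) (use \<open>s < 0\<close> in auto)
      then show "((\<lambda>t. q (Complex s t)) has_vector_derivative q' (Complex s t)) (at t within {0..2*pi})"
        unfolding has_real_derivative_iff_has_vector_derivative[symmetric]
        unfolding Cx2 by (rule has_field_derivative_at_within)
    qed simp
    also have "q (Complex s (2*pi)) = q (Complex s 0)"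
      using per[of "of_real s"] \<open>s < 0\<close> by (simp add: Cx algebra_simps)
    finally have q0: "((\<lambda>t. q' (Complex s t)) has_integral 0) {0..2*pi}" by simp
    have "((\<lambda>t. p' (Complex s t)) has_integral m2 s) {0..2*pi}"
      unfolding m2_def using cs[OF C1(3) \<open>s < 0\<close>]
      by (intro integrable_integral integrable_continuous_real) auto
    from has_integral_add[OF this q0] show ?thesis
      by (rule has_integral_nonneg[THEN order_trans[OF _ eq_refl]]) (use sub \<open>s < 0\<close> in auto)
  qed
  have cvx: "convex_on {..<0} m"
    by (rule f''_ge0_imp_convex[where f'=m1 and f''=m2]) (use dm m2 in auto)
  have mcirc: "circ \<Psi> x = m (ln x)" if "0 < x" for x
    unfolding circ_def m_def
    by (intro integral_cong) (use that in \<open>simp add: exp_eq_polar exp_of_real[symmetric]\<close>)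
  have mono: "circ \<Psi> x \<le> circ \<Psi> R" if x: "0 < x" "x \<le> R" for x
  proof -
    have "continuous_on (cball 0 R) \<Psi>"
      by (rule continuous_on_subset[OF cont]) (use r in auto)
    then obtain z0 where "\<forall>z\<in>cball 0 R. \<Psi> z \<le> \<Psi> z0"
      using continuous_attains_sup[of "cball 0 R" \<Psi>] r by auto
    then obtain B where B: "\<And>z. z \<in> cball 0 R \<Longrightarrow> \<Psi> z \<le> B" by blast
    have "m (ln x) \<le> m (ln R)"
    proof (rule bounded_convex_mono[OF cvx])
      fix s assume s: "s \<le> ln R"
      moreover have "ln R < 0" using x r by (intro ln_less_zero) auto
      ultimately have "s < 0" by simp
      have "m s \<le> integral {0..2*pi} (\<lambda>t. B)"
        unfolding m_def
      proof (rule integral_le)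
        have "exp s \<le> R" using s x by (simp add: ln_ge_iff)
        then show "\<Psi> (exp (Complex s t)) \<le> B" for t by (intro B) simp
      qed (use cs[OF C1(1) \<open>s < 0\<close>] in \<open>auto intro: integrable_continuous_real\<close>)
      then show "m s \<le> integral {0..2*pi} (\<lambda>t. B)" .
    qed (use x r in \<open>auto\<close>)
    then show ?thesis using mcirc x by simp
  qed
  show ?thesis
  proof (cases "r = 0")
    case False then show ?thesis using mono r by auto
  next
    case True
    show ?thesis
    proof (cases "R = 0")
      case False
      then have R: "0 < R" using r by simp
      \<comment> \<open>Radius 0 lies at s = -\<infinity>, out of reach of the logarithmic
        coordinate, and is obtained as a limit.\<close>
      have "((circ \<Psi>) \<longlongrightarrow> circ \<Psi> 0) (at 0 within {0..R})"
        using circ_zero_limit[OF cont \<open>R < 1\<close>] R by (auto simp: continuous_on_def)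
      moreover have "at (0::real) within {0..R} = at_right 0"
        using R by (rule at_within_Icc_at_right)
      ultimately have "((circ \<Psi>) \<longlongrightarrow> circ \<Psi> 0) (at_right 0)" by simp
      moreover have "eventually (\<lambda>x. circ \<Psi> x \<le> circ \<Psi> R) (at_right 0)"
        unfolding eventually_at_right_field using mono R by (intro exI[of _ R]) auto
      ultimately show ?thesis using True
        by (auto intro: tendsto_upperbound)
    qed (use True in auto)
  qed
qed

text \<open>The constant \<open>c\<close> makes one computation serve twice: each differentiation
  multiplies it by \<open>d\<close>, and \<open>c = - \<i>\<close> turns the real part into the
  imaginary part.\<close>

lemma C2_dir_Re_cmult_holomorphic:
  assumes f: "f holomorphic_on U" and U: "open U"
  shows "C2_dir d U (\<lambda>w. Re (c * f w)) (\<lambda>w. Re (c * (d * deriv f w))) (\<lambda>w. Re (c * (d * d * deriv (deriv f) w)))"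
proof -
  have f': "deriv f holomorphic_on U" and f'': "deriv (deriv f) holomorphic_on U"
    using f U by (auto intro: holomorphic_deriv)
  have D: "((\<lambda>t::real. Re (c * g (w + of_real t * d))) has_real_derivative Re (c * (d * deriv g w))) (at 0)"
    if "g holomorphic_on U" "w \<in> U" for g w c
  proof -
    have "(g has_field_derivative deriv g w) (at w)"
      using that U holomorphic_derivI by blast
    then have "(g has_field_derivative deriv g w) (at (w + of_real 0 * d))" by simp
    moreover have "((\<lambda>t::real. w + of_real t * d) has_vector_derivative d) (at 0)"
      by (auto intro!: derivative_eq_intros simp: has_vector_derivative_def scaleR_conv_of_real)
    ultimately have "((\<lambda>t::real. g (w + of_real t * d)) has_vector_derivative d * deriv g w) (at 0)"
      using field_vector_diff_chain_at by (fastforce simp: o_def)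
    then have "((\<lambda>t::real. c * g (w + of_real t * d)) has_vector_derivative c * (d * deriv g w)) (at 0)"
      by (rule has_vector_derivative_mult_right)
    then show ?thesis
      unfolding has_real_derivative_iff_has_vector_derivative
      by (rule bounded_linear.has_vector_derivative[OF bounded_linear_Re])
  qed
  show ?thesis unfolding C2_dir_def
    using holomorphic_on_imp_continuous_on[OF f] holomorphic_on_imp_continuous_on[OF f']
      holomorphic_on_imp_continuous_on[OF f''] D[OF f, of _ c] D[OF f', of _ "c * d"]
    by (auto intro!: continuous_intros simp: mult.assoc)
qed

lemma C2_dir_Re_holomorphic:
  assumes "f holomorphic_on U" "open U"
  shows "C2_dir d U (\<lambda>w. Re (f w)) (\<lambda>w. Re (d * deriv f w)) (\<lambda>w. Re (d * d * deriv (deriv f) w))"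
  using C2_dir_Re_cmult_holomorphic[OF assms, of d 1] by simp

lemma C2_dir_Im_holomorphic:
  assumes "f holomorphic_on U" "open U"
  shows "C2_dir d U (\<lambda>w. Im (f w)) (\<lambda>w. Im (d * deriv f w)) (\<lambda>w. Im (d * d * deriv (deriv f) w))"
proof -
  have e: "Re (- \<i> * z) = Im z" for z by simp
  show ?thesis using C2_dir_Re_cmult_holomorphic[OF assms, of d "- \<i>"] unfolding e .
qed

section \<open>The regularised modulus, smooth also at the zeros of f, and its Laplacian\<close>

definition modeps :: "real \<Rightarrow> (complex \<Rightarrow> complex) \<Rightarrow> complex \<Rightarrow> real" where
  "modeps \<epsilon> f w = sqrt ((Re (f w))\<^sup>2 + (Im (f w))\<^sup>2 + \<epsilon>)"

definition modeps' :: "complex \<Rightarrow> real \<Rightarrow> (complex \<Rightarrow> complex) \<Rightarrow> complex \<Rightarrow> real" where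
  "modeps' d \<epsilon> f w = (Re (f w) * Re (d * deriv f w) + Im (f w) * Im (d * deriv f w)) / modeps \<epsilon> f w"

text \<open>Solved from u u'' + u'^2 = (u u')', where u u' = Re f Re (d f') + Im f Im (d
  f').\<close>

definition modeps'' :: "complex \<Rightarrow> real \<Rightarrow> (complex \<Rightarrow> complex) \<Rightarrow> complex \<Rightarrow> real" where
  "modeps'' d \<epsilon> f w = ((Re (d * deriv f w))\<^sup>2 + (Im (d * deriv f w))\<^sup>2
     + Re (f w) * Re (d * d * deriv (deriv f) w) + Im (f w) * Im (d * d * deriv (deriv f) w)
     - (modeps' d \<epsilon> f w)\<^sup>2) / modeps \<epsilon> f w"

lemma modeps_pos: "0 < \<epsilon> \<Longrightarrow> 0 < modeps \<epsilon> f w"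
  unfolding modeps_def by (smt (verit) real_sqrt_gt_zero zero_le_power2)

lemma C2_dir_modeps:
  assumes "f holomorphic_on U" "open U" "0 < \<epsilon>"
  shows "C2_dir d U (modeps \<epsilon> f) (modeps' d \<epsilon> f) (modeps'' d \<epsilon> f)"
proof -
  note R = C2_dir_Re_holomorphic[OF assms(1,2), of d] and I = C2_dir_Im_holomorphic[OF assms(1,2), of d]
  have pos: "0 < Re (f w) * Re (f w) + Im (f w) * Im (f w) + \<epsilon>" for w
    using assms(3) by (smt (verit) zero_le_square)
  have "C2_dir d U (\<lambda>w. sqrt (Re (f w) * Re (f w) + Im (f w) * Im (f w) + \<epsilon>)) (modeps' d \<epsilon> f) (modeps'' d \<epsilon> f)"
  proof (rule C2_dir_cong[OF C2_dir_compose[OF C2_dir_add[OF C2_dir_add[OF C2_dir_mult[OF R R] C2_dir_mult[OF I I]] C2_dir_const[where c=\<epsilon>]],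
      where V="{0<..}" and h=sqrt and h'="\<lambda>x. 1 / (2 * sqrt x)" and h''="\<lambda>x. - 1 / (4 * x * sqrt x)"]])
    show "((\<lambda>x. 1 / (2 * sqrt x)) has_real_derivative - 1 / (4 * x * sqrt x)) (at x)" if "x \<in> {0<..}" for x
      using that by (auto intro!: derivative_eq_intros simp: field_simps)
    show "(sqrt has_real_derivative 1 / (2 * sqrt x)) (at x)" if "x \<in> {0<..}" for x
      using that by (auto intro!: derivative_eq_intros simp: field_simps)
    show "continuous_on {0<..} (\<lambda>x. - 1 / (4 * x * sqrt x))"
      by (auto intro!: continuous_intros)
    fix w assume "w \<in> U"
    define s where "s = modeps \<epsilon> f w"
    have s: "0 < s" "sqrt (Re (f w) * Re (f w) + Im (f w) * Im (f w) + \<epsilon>) = s"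
       "Re (f w) * Re (f w) + Im (f w) * Im (f w) + \<epsilon> = s\<^sup>2"
      using modeps_pos[OF assms(3), of f w] pos[of w] by (auto simp: s_def modeps_def power2_eq_square)
    show "modeps' d \<epsilon> f w = 1 / (2 * sqrt (Re (f w) * Re (f w) + Im (f w) * Im (f w) + \<epsilon>)) *
        (Re (d * deriv f w) * Re (f w) + Re (f w) * Re (d * deriv f w)
         + (Im (d * deriv f w) * Im (f w) + Im (f w) * Im (d * deriv f w)) + 0)"
      unfolding s modeps'_def s_def[symmetric] using s(1) by (simp add: field_simps)
    define X where "X = Re (f w) * Re (d * deriv f w) + Im (f w) * Im (d * deriv f w)"
    have X: "Re (d * deriv f w) * Re (f w) + Re (f w) * Re (d * deriv f w)
         + (Im (d * deriv f w) * Im (f w) + Im (f w) * Im (d * deriv f w)) + 0 = 2 * X"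
      by (simp add: X_def)
    show "modeps'' d \<epsilon> f w = - 1 / (4 * (Re (f w) * Re (f w) + Im (f w) * Im (f w) + \<epsilon>)
          * sqrt (Re (f w) * Re (f w) + Im (f w) * Im (f w) + \<epsilon>)) *
        (Re (d * deriv f w) * Re (f w) + Re (f w) * Re (d * deriv f w)
         + (Im (d * deriv f w) * Im (f w) + Im (f w) * Im (d * deriv f w)) + 0)\<^sup>2
       + 1 / (2 * sqrt (Re (f w) * Re (f w) + Im (f w) * Im (f w) + \<epsilon>)) *
         (Re (d * d * deriv (deriv f) w) * Re (f w) + 2 * Re (d * deriv f w) * Re (d * deriv f w)
           + Re (f w) * Re (d * d * deriv (deriv f) w) +
          (Im (d * d * deriv (deriv f) w) * Im (f w) + 2 * Im (d * deriv f w) * Im (d * deriv f w)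
           + Im (f w) * Im (d * d * deriv (deriv f) w)) + 0)"
      unfolding X unfolding s modeps''_def modeps'_def s_def[symmetric] X_def[symmetric]
      using s(1) by (simp add: field_simps power2_eq_square)
  qed (use pos assms in auto)
  then show ?thesis by (simp add: modeps_def[abs_def] power2_eq_square)
qed

text \<open>With \<open>f = a + i b\<close> and \<open>f' = x + i y\<close>, the sum of the second derivatives in the two coordinate
  directions is the Laplacian; the terms with \<open>f''\<close> cancel.\<close>

lemma laplacian_modeps:
  fixes f :: "complex \<Rightarrow> complex" and w :: complex and \<epsilon> :: real
  assumes "0 < \<epsilon>"
  defines "u \<equiv> modeps \<epsilon> f w"
  shows "(modeps' 1 \<epsilon> f w)\<^sup>2 + (modeps' \<i> \<epsilon> f w)\<^sup>2 \<le> (norm (deriv f w))\<^sup>2"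
    and "u * (modeps'' 1 \<epsilon> f w + modeps'' \<i> \<epsilon> f w) \<ge> (norm (deriv f w))\<^sup>2"
proof -
  define a b x y where ab: "a = Re (f w)" "b = Im (f w)" "x = Re (deriv f w)" "y = Im (deriv f w)"
  have u: "0 < u" "a\<^sup>2 + b\<^sup>2 \<le> u\<^sup>2"
    using modeps_pos[OF assms(1), of f w] assms(1) by (auto simp: u_def modeps_def ab)
  have n: "(norm (deriv f w))\<^sup>2 = x\<^sup>2 + y\<^sup>2" by (simp add: ab cmod_power2)
  have "(modeps' 1 \<epsilon> f w)\<^sup>2 + (modeps' \<i> \<epsilon> f w)\<^sup>2 = ((a * x + b * y)\<^sup>2 + (b * x - a * y)\<^sup>2) / u\<^sup>2"
    unfolding modeps'_def u_def[symmetric] by (simp add: ab[symmetric] power_divide flip: add_divide_distrib)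
  also have "(a * x + b * y)\<^sup>2 + (b * x - a * y)\<^sup>2 = (a\<^sup>2 + b\<^sup>2) * (x\<^sup>2 + y\<^sup>2)"
    by (simp add: power2_eq_square algebra_simps)
  also have "\<dots> / u\<^sup>2 \<le> (u\<^sup>2 * (x\<^sup>2 + y\<^sup>2)) / u\<^sup>2"
    by (intro divide_right_mono mult_right_mono u(2)) auto
  finally show 1: "(modeps' 1 \<epsilon> f w)\<^sup>2 + (modeps' \<i> \<epsilon> f w)\<^sup>2 \<le> (norm (deriv f w))\<^sup>2"
    using u n by simp
  have "u * (modeps'' 1 \<epsilon> f w + modeps'' \<i> \<epsilon> f w)
     = 2 * (x\<^sup>2 + y\<^sup>2) - ((modeps' 1 \<epsilon> f w)\<^sup>2 + (modeps' \<i> \<epsilon> f w)\<^sup>2)"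
    unfolding modeps''_def u_def[symmetric] using u(1)
    by (simp add: ab[symmetric] field_simps)
  then show "u * (modeps'' 1 \<epsilon> f w + modeps'' \<i> \<epsilon> f w) \<ge> (norm (deriv f w))\<^sup>2"
    using 1 n by simp
qed

text \<open>The function \<open>u e\<^sup>v\<close> with \<open>u\<close> a regularised modulus and \<open>v = (|g|\<^sup>2 - Re k) / N\<^sup>2\<close> has Laplacian
  at least \<open>u e\<^sup>v \<Delta>v\<close>, which together with \<open>\<Delta>u\<close> absorbs the Laplacian of \<open>Re (f \<cdot> cnj g)\<close>.\<close>

lemma laplacian_product_bound:
  fixes u u1 u2 U v1 v2 V E fn gn N P :: real
  assumes u: "0 < u" "u1\<^sup>2 + u2\<^sup>2 \<le> fn\<^sup>2" "fn\<^sup>2 \<le> u * U"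
    and E: "1 / 4 \<le> E" and V: "V = 4 * gn\<^sup>2 / N\<^sup>2" and N: "0 < N" and P: "P \<le> 4 * (fn * gn)"
  shows "0 \<le> 2 * N * U + 2 * N * (U * E + 2 * (u1 * (E * v1) + u2 * (E * v2))
      + u * (E * (v1\<^sup>2 + v2\<^sup>2) + E * V)) - P"
proof -
  \<comment> \<open>This is |\<nabla>u + u \<nabla>v|^2. Expanding it and using |\<nabla>u|^2 \<le>
    u \<Delta>u absorbs the cross term of \<Delta>(u e^v) and leaves at least u e^v
    \<Delta>v.\<close>
  have "0 \<le> (u1 + u * v1)\<^sup>2 + (u2 + u * v2)\<^sup>2" by simp
  also have "\<dots> = (u1\<^sup>2 + u2\<^sup>2) + u * (2 * (u1 * v1 + u2 * v2) + u * (v1\<^sup>2 + v2\<^sup>2))"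
    by (simp add: power2_eq_square algebra_simps)
  also have "\<dots> \<le> u * U + u * (2 * (u1 * v1 + u2 * v2) + u * (v1\<^sup>2 + v2\<^sup>2))"
    using u by simp
  also have "\<dots> = u * (U + 2 * (u1 * v1 + u2 * v2) + u * (v1\<^sup>2 + v2\<^sup>2))"
    by (simp add: algebra_simps)
  finally have *: "0 \<le> U + 2 * (u1 * v1 + u2 * v2) + u * (v1\<^sup>2 + v2\<^sup>2)"
    using u(1) by (simp add: zero_le_mult_iff)
  have V0: "0 \<le> V" by (simp add: V)
  have "U * E + 2 * (u1 * (E * v1) + u2 * (E * v2)) + u * (E * (v1\<^sup>2 + v2\<^sup>2) + E * V)
     = E * (U + 2 * (u1 * v1 + u2 * v2) + u * (v1\<^sup>2 + v2\<^sup>2)) + E * (u * V)"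
    by (simp add: algebra_simps)
  also have "\<dots> \<ge> 0 + (1/4) * (u * V)"
    using * E u(1) V0 by (intro add_mono mult_nonneg_nonneg mult_right_mono) auto
  finally have 1: "u * gn\<^sup>2 / N\<^sup>2 \<le> U * E + 2 * (u1 * (E * v1) + u2 * (E * v2)) + u * (E * (v1\<^sup>2 + v2\<^sup>2) + E * V)"
    by (simp add: V)
  have 2: "fn\<^sup>2 / u \<le> U" using u by (simp add: pos_divide_le_eq mult.commute)
  \<comment> \<open>Arithmetic-geometric mean for 2 N fn^2 / u and 2 u gn^2 / N, whose product is (2
    fn gn)^2; this is where the coefficient 2 N comes from.\<close>
  have "0 \<le> (N * fn - u * gn)\<^sup>2 * (2 / (N * u))" using N u by simp
  also have "\<dots> = 2 * N * (fn\<^sup>2 / u) + 2 * N * (u * gn\<^sup>2 / N\<^sup>2) - 4 * (fn * gn)"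
    using N u by (simp add: field_simps power2_eq_square)
  also have "\<dots> \<le> 2 * N * U + 2 * N * (U * E + 2 * (u1 * (E * v1) + u2 * (E * v2))
      + u * (E * (v1\<^sup>2 + v2\<^sup>2) + E * V)) - P"
    using 1 2 N P by (intro diff_mono add_mono mult_left_mono) auto
  finally show ?thesis .
qed

text \<open>Re k is harmonic, so v = (|g|^2 - Re k) / N^2 has Laplacian 4 |g'|^2 / N^2, while
  \<open>G\<close> keeps v \<ge> -1 and hence e^v \<ge> 1/4. In the application f, g and k are
  composed with exp, and Re k is a Poisson integral of boundary values of |g|^2.\<close>

lemma C2_dir_fefferman:
  assumes hol: "f holomorphic_on U" "g holomorphic_on U" "k holomorphic_on U" and U: "open U"
    and G: "\<And>w. w \<in> U \<Longrightarrow> Re (k w) - (norm (g w))\<^sup>2 \<le> N\<^sup>2"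
    and N: "0 < N" and \<epsilon>: "0 < \<epsilon>"
  defines "\<Psi> \<equiv> \<lambda>w. 2 * N * modeps \<epsilon> f w
      + 2 * N * (modeps \<epsilon> f w * exp (((norm (g w))\<^sup>2 - Re (k w)) / N\<^sup>2)) - Re (f w * cnj (g w))"
  shows "\<exists>p p' q q'. C2_dir 1 U \<Psi> p p' \<and> C2_dir \<i> U \<Psi> q q' \<and> (\<forall>w\<in>U. 0 \<le> p' w + q' w)"
proof -
  define v where "v w = 1 / N\<^sup>2 * (Re (g w) * Re (g w) + Im (g w) * Im (g w) + (-1) * Re (k w))" for w
  define v' where "v' d w = 1 / N\<^sup>2 * (Re (d * deriv g w) * Re (g w) + Re (g w) * Re (d * deriv g w)
     + (Im (d * deriv g w) * Im (g w) + Im (g w) * Im (d * deriv g w)) + (-1) * Re (d * deriv k w))" for d w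
  define v'' where "v'' d w = 1 / N\<^sup>2 *
     (Re (d * d * deriv (deriv g) w) * Re (g w) + 2 * Re (d * deriv g w) * Re (d * deriv g w)
        + Re (g w) * Re (d * d * deriv (deriv g) w)
      + (Im (d * d * deriv (deriv g) w) * Im (g w) + 2 * Im (d * deriv g w) * Im (d * deriv g w)
        + Im (g w) * Im (d * d * deriv (deriv g) w)) + (-1) * Re (d * d * deriv (deriv k) w))" for d w
  have Cv: "C2_dir d U v (v' d) (v'' d)" for d
    unfolding v_def[abs_def] v'_def[abs_def] v''_def[abs_def]
    by (intro C2_dir_cmult C2_dir_add C2_dir_mult C2_dir_Re_holomorphic C2_dir_Im_holomorphic hol U)
  have Ce: "C2_dir d U (\<lambda>w. exp (v w)) (\<lambda>w. exp (v w) * v' d w) (\<lambda>w. exp (v w) * (v' d w)\<^sup>2 + exp (v w) * v'' d w)" for d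
    by (rule C2_dir_compose[OF Cv, where V=UNIV]) (auto intro!: derivative_eq_intros continuous_intros)
  define r'' where "r'' d w = 
      Re (d * d * deriv (deriv f) w) * Re (g w) + 2 * Re (d * deriv f w) * Re (d * deriv g w)
        + Re (f w) * Re (d * d * deriv (deriv g) w)
      + (Im (d * d * deriv (deriv f) w) * Im (g w) + 2 * Im (d * deriv f w) * Im (d * deriv g w)
        + Im (f w) * Im (d * d * deriv (deriv g) w))" for d w
  define u where "u = modeps \<epsilon> f"
  note Cu = C2_dir_modeps[OF hol(1) U \<epsilon>, folded u_def]
  define p where "p d w = 2 * N * modeps' d \<epsilon> f w
     + 2 * N * (modeps' d \<epsilon> f w * exp (v w) + u w * (exp (v w) * v' d w))
     + (-1) * (Re (d * deriv f w) * Re (g w) + Re (f w) * Re (d * deriv g w)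
      + (Im (d * deriv f w) * Im (g w) + Im (f w) * Im (d * deriv g w)))" for d w
  define p' where "p' d w = 2 * N * modeps'' d \<epsilon> f w
     + 2 * N * (modeps'' d \<epsilon> f w * exp (v w) + 2 * modeps' d \<epsilon> f w * (exp (v w) * v' d w)
         + u w * (exp (v w) * (v' d w)\<^sup>2 + exp (v w) * v'' d w))
     + (-1) * r'' d w" for d w
  have \<Psi>: "\<Psi> = (\<lambda>w. 2 * N * u w + 2 * N * (u w * exp (v w)) + (-1) * (Re (f w) * Re (g w) + Im (f w) * Im (g w)))"
    unfolding \<Psi>_def v_def u_def cmod_power2 by (intro ext) (simp add: power2_eq_square)
  have C: "C2_dir d U \<Psi> (p d) (p' d)" for d
    unfolding \<Psi> p_def[abs_def] p'_def[abs_def] r''_def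
    by (intro C2_dir_cmult C2_dir_add C2_dir_mult C2_dir_Re_holomorphic C2_dir_Im_holomorphic hol U Cu Ce)
  have "0 \<le> p' 1 w + p' \<i> w" if "w \<in> U" for w
  proof -
    have E: "1 / 4 \<le> exp (v w)"
    proof -
      have "- 1 \<le> v w"
        using G[OF that, unfolded cmod_power2] N by (simp add: v_def power2_eq_square field_simps)
      then have "exp (- 1) \<le> exp (v w)" by simp
      moreover have "1 / 4 \<le> exp (- 1 :: real)"
        using exp_le by (simp add: exp_minus field_simps)
      ultimately show ?thesis by linarith
    qed
    have V: "v'' 1 w + v'' \<i> w = 4 * (norm (deriv g w))\<^sup>2 / N\<^sup>2"
      unfolding v''_def cmod_power2 by (simp add: power2_eq_square add_divide_distrib[symmetric])
    have "r'' 1 w + r'' \<i> w = 4 * Re (deriv f w * cnj (deriv g w))"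
      by (simp add: r''_def algebra_simps)
    also have "\<dots> \<le> 4 * (norm (deriv f w) * norm (deriv g w))"
      using complex_Re_le_cmod[of "deriv f w * cnj (deriv g w)"] by (simp add: norm_mult)
    finally have P: "r'' 1 w + r'' \<i> w \<le> 4 * (norm (deriv f w) * norm (deriv g w))" .
    have "p' 1 w + p' \<i> w = 2 * N * (modeps'' 1 \<epsilon> f w + modeps'' \<i> \<epsilon> f w) + 2 * N * ((modeps'' 1 \<epsilon> f w + modeps'' \<i> \<epsilon> f w) * exp (v w)
      + 2 * (modeps' 1 \<epsilon> f w * (exp (v w) * v' 1 w) + modeps' \<i> \<epsilon> f w * (exp (v w) * v' \<i> w))
      + u w * (exp (v w) * ((v' 1 w)\<^sup>2 + (v' \<i> w)\<^sup>2) + exp (v w) * (v'' 1 w + v'' \<i> w))) - (r'' 1 w + r'' \<i> w)"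
      unfolding p'_def by (simp add: algebra_simps)
    also have "\<dots> \<ge> 0"
      by (rule laplacian_product_bound[OF _ _ _ E V N P])
        (use modeps_pos[OF \<epsilon>] laplacian_modeps[OF \<epsilon>] in \<open>auto simp: u_def\<close>)
    finally show ?thesis .
  qed
  with C show ?thesis by blast
qed

section \<open>Comparison of circle means, with Re k as a harmonic majorant of |g|^2\<close>

lemma circ_0: "circ f 0 = (2 * pi) *\<^sub>R f 0"
  by (simp add: circ_def)

lemma circ_continuous_integrable:
  fixes f :: "complex \<Rightarrow> 'a::euclidean_space"
  assumes "continuous_on (ball 0 1) f" "0 \<le> r" "r < 1"
  shows "(\<lambda>t. f (of_real r * cis t)) integrable_on {0..2*pi}"
  by (rule integrable_continuous_real, rule continuous_circle[OF assms])

lemma modeps_bounds: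
  assumes "0 < \<epsilon>"
  shows "norm (f w) \<le> modeps \<epsilon> f w" "modeps \<epsilon> f w \<le> norm (f w) + sqrt \<epsilon>"
proof -
  have m: "modeps \<epsilon> f w = sqrt ((norm (f w))\<^sup>2 + \<epsilon>)" by (simp add: modeps_def cmod_power2)
  show "norm (f w) \<le> modeps \<epsilon> f w" unfolding m using assms by (intro real_le_rsqrt) auto
  show "modeps \<epsilon> f w \<le> norm (f w) + sqrt \<epsilon>"
    unfolding m using sqrt_add_le_add_sqrt[of "(norm (f w))\<^sup>2" \<epsilon>] assms by simp
qed

lemma continuous_on_modeps:
  assumes "continuous_on S f"
  shows "continuous_on S (modeps \<epsilon> f)"
  unfolding modeps_def[abs_def] using assms by (intro continuous_intros)

lemma holomorphic_on_compose_exp: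
  assumes "f holomorphic_on ball 0 1"
  shows "(\<lambda>w. f (exp w)) holomorphic_on {w. Re w < 0}"
  using holomorphic_on_compose_gen[of exp "{w. Re w < 0}" f "ball 0 1"] assms
  by (auto simp: o_def holomorphic_on_exp image_subset_iff)

lemma open_left_half_plane: "open {w. Re w < 0}"
  by (rule open_Collect_less) (auto intro: continuous_intros)

lemma le_epsI:
  fixes x y C :: real
  assumes "\<And>\<epsilon>. 0 < \<epsilon> \<Longrightarrow> x \<le> y + C * sqrt \<epsilon>"
  shows "x \<le> y"
proof (rule tendsto_lowerbound[where F="at_right (0::real)" and f="\<lambda>\<epsilon>. y + C * sqrt \<epsilon>"])
  show "((\<lambda>\<epsilon>. y + C * sqrt \<epsilon>) \<longlongrightarrow> y) (at_right 0)"
    by (auto intro!: tendsto_eq_intros)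
  show "\<forall>\<^sub>F \<epsilon> in at_right 0. x \<le> y + C * sqrt \<epsilon>"
    using assms by (auto simp: eventually_at_right_field intro: exI[of _ 1])
qed simp

text \<open>Monotonicity holds for the subharmonic \<open>modeps \<epsilon> f\<close>, which exceeds
  |f| by at most sqrt \<epsilon>. This costs 2 \<pi> sqrt \<epsilon> on the circle, and \<epsilon>
  is arbitrary.\<close>

theorem circ_norm_mono:
  assumes f: "f holomorphic_on ball 0 1" and r: "0 \<le> r" "r \<le> R" "R < 1"
  shows "circ (\<lambda>z. norm (f z)) r \<le> circ (\<lambda>z. norm (f z)) R"
proof (rule le_epsI[where C="2*pi"])
  fix \<epsilon> :: real assume \<epsilon>: "0 < \<epsilon>"
  note fe = holomorphic_on_compose_exp[OF f]
  note cf = holomorphic_on_imp_continuous_on[OF f]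
  note cm = continuous_on_modeps[OF cf, of \<epsilon>]
  note cn = continuous_on_norm[OF cf]
  have e: "modeps \<epsilon> (\<lambda>w. f (exp w)) = (\<lambda>w. modeps \<epsilon> f (exp w))"
    by (auto simp: modeps_def)
  note I = circ_continuous_integrable
  have rR: "0 \<le> R" "r < 1" using r by auto
  have "circ (\<lambda>z. norm (f z)) r \<le> circ (modeps \<epsilon> f) r"
    unfolding circ_def by (intro integral_le I cm cn modeps_bounds \<epsilon> r rR)
  also have "circ (modeps \<epsilon> f) r \<le> circ (modeps \<epsilon> f) R"
  proof (rule circ_mono_subharmonic[OF cm _ _ _ r])
    note C = C2_dir_modeps[OF fe open_left_half_plane \<epsilon>]
    show "C2_dir 1 {w. Re w < 0} (\<lambda>w. modeps \<epsilon> f (exp w)) (modeps' 1 \<epsilon> (\<lambda>w. f (exp w))) (modeps'' 1 \<epsilon> (\<lambda>w. f (exp w)))"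
      "C2_dir \<i> {w. Re w < 0} (\<lambda>w. modeps \<epsilon> f (exp w)) (modeps' \<i> \<epsilon> (\<lambda>w. f (exp w))) (modeps'' \<i> \<epsilon> (\<lambda>w. f (exp w)))"
      using C by (simp_all add: e)
    fix w
    have "0 \<le> (norm (deriv (\<lambda>w. f (exp w)) w))\<^sup>2" by simp
    then have "0 \<le> modeps \<epsilon> (\<lambda>w. f (exp w)) w *
        (modeps'' 1 \<epsilon> (\<lambda>w. f (exp w)) w + modeps'' \<i> \<epsilon> (\<lambda>w. f (exp w)) w)"
      using laplacian_modeps(2)[OF \<epsilon>, of "\<lambda>w. f (exp w)" w] by (rule order_trans)
    then show "0 \<le> modeps'' 1 \<epsilon> (\<lambda>w. f (exp w)) w + modeps'' \<i> \<epsilon> (\<lambda>w. f (exp w)) w"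
      using modeps_pos[OF \<epsilon>, of "\<lambda>w. f (exp w)" w] by (simp add: zero_le_mult_iff)
  qed
  also have "circ (modeps \<epsilon> f) R \<le> integral {0..2*pi} (\<lambda>t. norm (f (of_real R * cis t)) + sqrt \<epsilon>)"
    unfolding circ_def
    by (intro integral_le integrable_add I[OF cn rR(1) r(3)] I[OF cm rR(1) r(3)] modeps_bounds \<epsilon> r rR) auto
  also have "\<dots> = circ (\<lambda>z. norm (f z)) R + 2 * pi * sqrt \<epsilon>"
    unfolding circ_def using I[OF cn rR(1) r(3)] by (subst integral_add) auto
  finally show "circ (\<lambda>z. norm (f z)) r \<le> circ (\<lambda>z. norm (f z)) R + 2 * pi * sqrt \<epsilon>" .
qed

text \<open>The circle means of \<Psi> are compared at radii 0 and R. Since 0 < \<open>E\<close>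
  \<le> 1, \<Psi> is at least - Re (f cnj g) at the centre and at most 4 N u - Re (f cnj g) on the
  circle. The value at the centre is paid for by |g(0)| times the mean of |f|, again by
  monotonicity.\<close>

lemma circ_pairing_bound_aux:
  assumes hol: "f holomorphic_on ball 0 1" "g holomorphic_on ball 0 1" "k holomorphic_on ball 0 1"
    and G: "\<And>z. z \<in> ball 0 1 \<Longrightarrow> (norm (g z))\<^sup>2 \<le> Re (k z) \<and> Re (k z) \<le> (norm (g z))\<^sup>2 + N\<^sup>2"
    and N: "0 < N" and R: "0 \<le> R" "R < 1"
  shows "Re (circ (\<lambda>z. f z * cnj (g z)) R) \<le> (4 * N + norm (g 0)) * circ (\<lambda>z. norm (f z)) R"
proof (rule le_epsI[where C="8 * pi * N"])
  fix \<epsilon> :: real assume \<epsilon>: "0 < \<epsilon>"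
  let ?H = "{w. Re w < 0}"
  define E where "E z = exp (((norm (g z))\<^sup>2 - Re (k z)) / N\<^sup>2)" for z
  define \<Psi> where "\<Psi> z = 2 * N * modeps \<epsilon> f z + 2 * N * (modeps \<epsilon> f z * E z) - Re (f z * cnj (g z))" for z
  note fe = hol[THEN holomorphic_on_compose_exp]
  note c = hol[THEN holomorphic_on_imp_continuous_on]
  note cm = continuous_on_modeps[OF c(1), of \<epsilon>]
  note cn = continuous_on_norm[OF c(1)]
  note I = circ_continuous_integrable[OF _ R]
  have cr: "continuous_on (ball 0 1) (\<lambda>z. Re (f z * cnj (g z)))"
    using c by (auto intro!: continuous_intros)
  have cont: "continuous_on (ball 0 1) \<Psi>"
    unfolding \<Psi>_def[abs_def] E_def using c cm N by (auto intro!: continuous_intros)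
  obtain p p' q q' where pq: "C2_dir 1 ?H (\<lambda>w. \<Psi> (exp w)) p p'" "C2_dir \<i> ?H (\<lambda>w. \<Psi> (exp w)) q q'"
     "\<forall>w\<in>?H. 0 \<le> p' w + q' w"
    using C2_dir_fefferman[OF fe open_left_half_plane _ N \<epsilon>] G
    unfolding \<Psi>_def E_def modeps_def by (fastforce simp: algebra_simps)
  have "circ \<Psi> 0 \<le> circ \<Psi> R"
    by (rule circ_mono_subharmonic[OF cont pq(1,2)]) (use pq(3) R in auto)
  moreover have "- (2 * pi * Re (f 0 * cnj (g 0))) \<le> circ \<Psi> 0"
    unfolding circ_0 \<Psi>_def E_def using N modeps_pos[OF \<epsilon>, of f 0]
    by (simp add: algebra_simps mult_nonneg_nonneg add_nonneg_nonneg)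
  moreover have "circ \<Psi> R \<le> integral {0..2*pi} (\<lambda>t. 4 * N * (norm (f (of_real R * cis t)) + sqrt \<epsilon>)
       - Re (f (of_real R * cis t) * cnj (g (of_real R * cis t))))"
    unfolding circ_def
  proof (intro integral_le)
    fix t
    let ?z = "of_real R * cis t"
    have z: "?z \<in> ball 0 1" using R by (simp add: norm_mult)
    have "E ?z \<le> 1" using G[OF z] N by (simp add: E_def field_simps)
    then have "modeps \<epsilon> f ?z * E ?z \<le> modeps \<epsilon> f ?z * 1"
      using modeps_pos[OF \<epsilon>, of f ?z] by (intro mult_left_mono) auto
    then have "2 * N * (modeps \<epsilon> f ?z * E ?z) \<le> 2 * N * (norm (f ?z) + sqrt \<epsilon>)"
      using modeps_bounds(2)[OF \<epsilon>, of f ?z] N by (intro mult_left_mono) auto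
    moreover have "2 * N * modeps \<epsilon> f ?z \<le> 2 * N * (norm (f ?z) + sqrt \<epsilon>)"
      using modeps_bounds(2)[OF \<epsilon>, of f ?z] N by (intro mult_left_mono) auto
    ultimately show "\<Psi> ?z \<le> 4 * N * (norm (f ?z) + sqrt \<epsilon>) - Re (f ?z * cnj (g ?z))"
      unfolding \<Psi>_def by linarith
  next
    show "(\<lambda>t. 4 * N * (norm (f (of_real R * cis t)) + sqrt \<epsilon>)
       - Re (f (of_real R * cis t) * cnj (g (of_real R * cis t)))) integrable_on {0..2*pi}"
      by (rule I[of "\<lambda>z. 4 * N * (norm (f z) + sqrt \<epsilon>) - Re (f z * cnj (g z))"])
         (intro continuous_intros cn cr)
  qed (rule I[OF cont])
  moreover have "integral {0..2*pi} (\<lambda>t. 4 * N * (norm (f (of_real R * cis t)) + sqrt \<epsilon>)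
       - Re (f (of_real R * cis t) * cnj (g (of_real R * cis t))))
     = 4 * N * (circ (\<lambda>z. norm (f z)) R + 2 * pi * sqrt \<epsilon>) - circ (\<lambda>z. Re (f z * cnj (g z))) R"
  proof (rule integral_unique, rule has_integral_diff)
    have "((\<lambda>t. norm (f (of_real R * cis t)) + sqrt \<epsilon>) has_integral circ (\<lambda>z. norm (f z)) R + 2 * pi * sqrt \<epsilon>) {0..2*pi}"
      unfolding circ_def using I[OF cn] has_integral_const_real[of "sqrt \<epsilon>" 0 "2*pi"]
      by (intro has_integral_add) (auto simp: integrable_integral)
    then show "((\<lambda>t. 4 * N * (norm (f (of_real R * cis t)) + sqrt \<epsilon>)) has_integral
       4 * N * (circ (\<lambda>z. norm (f z)) R + 2 * pi * sqrt \<epsilon>)) {0..2*pi}"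
      by (rule has_integral_mult_right)
  qed (unfold circ_def, rule integrable_integral, rule I[OF cr])
  moreover have "circ (\<lambda>z. Re (f z * cnj (g z))) R = Re (circ (\<lambda>z. f z * cnj (g z)) R)"
    unfolding circ_def
    by (rule integral_linear[OF _ bounded_linear_Re, unfolded o_def])
       (rule I[of "\<lambda>z. f z * cnj (g z)"], intro continuous_intros c)
  moreover have "2 * pi * Re (f 0 * cnj (g 0)) \<le> norm (g 0) * circ (\<lambda>z. norm (f z)) R"
  proof -
    have "2 * pi * Re (f 0 * cnj (g 0)) \<le> 2 * pi * (norm (f 0) * norm (g 0))"
      using complex_Re_le_cmod[of "f 0 * cnj (g 0)"] by (simp add: norm_mult)
    also have "\<dots> = norm (g 0) * circ (\<lambda>z. norm (f z)) 0" by (simp add: circ_0)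
    also have "\<dots> \<le> norm (g 0) * circ (\<lambda>z. norm (f z)) R"
      using R by (intro mult_left_mono circ_norm_mono hol) auto
    finally show ?thesis .
  qed
  ultimately show "Re (circ (\<lambda>z. f z * cnj (g z)) R)
      \<le> (4 * N + norm (g 0)) * circ (\<lambda>z. norm (f z)) R + 8 * pi * N * sqrt \<epsilon>"
    by (simp add: algebra_simps)
qed

theorem circ_pairing_bound:
  assumes hol: "f holomorphic_on ball 0 1" "g holomorphic_on ball 0 1" "k holomorphic_on ball 0 1"
    and G: "\<And>z. z \<in> ball 0 1 \<Longrightarrow> (norm (g z))\<^sup>2 \<le> Re (k z) \<and> Re (k z) \<le> (norm (g z))\<^sup>2 + N\<^sup>2"
    and N: "0 < N" and R: "0 \<le> R" "R < 1"
  shows "norm (circ (\<lambda>z. f z * cnj (g z)) R) \<le> (4 * N + norm (g 0)) * circ (\<lambda>z. norm (f z)) R"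
proof -
  define I where "I = circ (\<lambda>z. f z * cnj (g z)) R"
  \<comment> \<open>Rotates the integral to a nonnegative real number. As \<open>sgn 0 = 0\<close>,
    the factor has modulus 1 or 0.\<close>
  define \<gamma> where "\<gamma> = cnj (sgn I)"
  have cf: "continuous_on (ball 0 1) (\<lambda>z. f z * cnj (g z))"
    by (intro continuous_intros hol[THEN holomorphic_on_imp_continuous_on])
  have \<gamma>I: "\<gamma> * I = of_real (norm I)"
    by (simp add: \<gamma>_def sgn_eq field_simps complex_norm_square[symmetric] power2_eq_square)
  have \<gamma>1: "norm \<gamma> \<le> 1" by (simp add: \<gamma>_def norm_sgn)
  have "circ (\<lambda>z. \<gamma> * f z * cnj (g z)) R = \<gamma> * I"
    unfolding I_def circ_def by (simp add: mult.assoc)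
  then have "norm I = Re (circ (\<lambda>z. \<gamma> * f z * cnj (g z)) R)" by (simp add: \<gamma>I)
  also have "\<dots> \<le> (4 * N + norm (g 0)) * circ (\<lambda>z. norm (\<gamma> * f z)) R"
    by (rule circ_pairing_bound_aux[OF _ hol(2,3) G N R]) (intro holomorphic_intros hol)
  also have "circ (\<lambda>z. norm (\<gamma> * f z)) R = norm \<gamma> * circ (\<lambda>z. norm (f z)) R"
    by (simp add: circ_def norm_mult)
  also have "(4 * N + norm (g 0)) * (norm \<gamma> * circ (\<lambda>z. norm (f z)) R)
      \<le> (4 * N + norm (g 0)) * (1 * circ (\<lambda>z. norm (f z)) R)"
  proof -
    have "0 \<le> circ (\<lambda>z. norm (f z)) R"
      unfolding circ_def
      by (intro integral_nonneg circ_continuous_integrable[OF _ R]) (auto intro!: continuous_intros hol holomorphic_on_imp_continuous_on)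
    then show ?thesis using \<gamma>1 N by (intro mult_left_mono mult_right_mono) auto
  qed
  finally show ?thesis by (simp add: I_def)
qed

section \<open>Bounded mean oscillation\<close>

definition avg :: "(real \<Rightarrow> complex) \<Rightarrow> real \<Rightarrow> real \<Rightarrow> complex" where
  "avg u a b = integral {a..b} u /\<^sub>R (b - a)"

lemma integrable_continuous_UNIV:
  fixes u :: "real \<Rightarrow> 'a::banach"
  assumes "continuous_on UNIV u"
  shows "u integrable_on {a..b}"
  using assms continuous_on_subset by (blast intro: integrable_continuous_real)

lemma norm_avg_diff_le:
  assumes u: "continuous_on UNIV u" and ab: "a < b"
  shows "norm (avg u a b - c) \<le> integral {a..b} (\<lambda>t. norm (u t - c)) / (b - a)"
proof -
  have "avg u a b - c = integral {a..b} (\<lambda>t. u t - c) /\<^sub>R (b - a)"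
    using ab integrable_continuous_UNIV[OF u, of a b]
    by (subst integral_diff) (auto simp: avg_def scaleR_diff_right)
  then have "norm (avg u a b - c) = norm (integral {a..b} (\<lambda>t. u t - c)) / (b - a)"
    using ab by (simp add: divide_inverse_commute)
  also have "\<dots> \<le> integral {a..b} (\<lambda>t. norm (u t - c)) / (b - a)"
    using ab continuous_on_subset[OF u]
    by (intro divide_right_mono continuous_on_imp_absolutely_integrable_on) (auto intro!: continuous_intros)
  finally show ?thesis .
qed

lemma integral_sq_dist_change:
  assumes u: "continuous_on UNIV u" and ab: "a \<le> b"
  shows "integral {a..b} (\<lambda>t. (norm (u t - c))\<^sup>2)
    \<le> 2 * integral {a..b} (\<lambda>t. (norm (u t - c'))\<^sup>2) + 2 * (norm (c' - c))\<^sup>2 * (b - a)"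
proof -
  have "integral {a..b} (\<lambda>t. (norm (u t - c))\<^sup>2)
    \<le> integral {a..b} (\<lambda>t. 2 * (norm (u t - c'))\<^sup>2 + 2 * (norm (c' - c))\<^sup>2)"
  proof (intro integral_le)
    fix t
    have "norm (u t - c) \<le> norm (u t - c') + norm (c' - c)"
      using norm_triangle_ineq[of "u t - c'" "c' - c"] by simp
    then have "(norm (u t - c))\<^sup>2 \<le> (norm (u t - c') + norm (c' - c))\<^sup>2" by (intro power_mono) auto
    also have "\<dots> \<le> 2 * (norm (u t - c'))\<^sup>2 + 2 * (norm (c' - c))\<^sup>2"
      using sum_squares_bound[of "norm (u t - c')" "norm (c' - c)"] by (simp add: power2_sum)
    finally show "(norm (u t - c))\<^sup>2 \<le> 2 * (norm (u t - c'))\<^sup>2 + 2 * (norm (c' - c))\<^sup>2" .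
  qed (intro integrable_continuous_UNIV continuous_intros u)+
  also have "\<dots> = 2 * integral {a..b} (\<lambda>t. (norm (u t - c'))\<^sup>2) + 2 * (norm (c' - c))\<^sup>2 * (b - a)"
    using ab by (subst integral_add)
      (auto intro!: integrable_continuous_UNIV continuous_intros u)
  finally show ?thesis .
qed

text \<open>The Calderon--Zygmund stopping argument: an interval is halved until the average of
  \<open>|u - c|\<close> exceeds \<open>\<mu>\<close>; on a stopped half, \<open>u\<close> is compared with its own average.\<close>

lemma stopping_time_bound:
  fixes u :: "real \<Rightarrow> complex"
  assumes u: "continuous_on UNIV u" and \<mu>: "0 < \<mu>" and B: "0 \<le> B"
    and sq: "\<And>a b. a0 \<le> a \<Longrightarrow> a < b \<Longrightarrow> b \<le> b0 \<Longrightarrow>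
        integral {a..b} (\<lambda>t. (norm (u t - avg u a b))\<^sup>2) \<le> B * (b - a)"
    and uc: "\<And>s t. s \<in> {a0..b0} \<Longrightarrow> t \<in> {a0..b0} \<Longrightarrow> \<bar>s - t\<bar> \<le> \<delta> \<Longrightarrow> norm (u s - u t) \<le> \<mu>"
  shows "a0 \<le> a \<Longrightarrow> a < b \<Longrightarrow> b \<le> b0 \<Longrightarrow> b - a \<le> \<delta> * 2 ^ n \<Longrightarrow>
    integral {a..b} (\<lambda>t. norm (u t - c)) \<le> \<mu> * (b - a) \<Longrightarrow>
    integral {a..b} (\<lambda>t. (norm (u t - c))\<^sup>2)
      \<le> 4 * \<mu>\<^sup>2 * (b - a) + (2 * B + 8 * \<mu>\<^sup>2) / \<mu> * integral {a..b} (\<lambda>t. norm (u t - c))"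
proof (induction n arbitrary: a b)
  case 0
  have I: "(\<lambda>t. norm (u t - c)) integrable_on {a..b}" for a b
    by (intro integrable_continuous_UNIV continuous_intros u)
  \<comment> \<open>On an interval this short u varies by at most \<mu>, so the bound \<mu> for the
    mean of |u - c| becomes a pointwise bound.\<close>
  have "norm (u t - c) \<le> 2 * \<mu>" if t: "t \<in> {a..b}" for t
  proof -
    have "norm (u t - c) * (b - a) = integral {a..b} (\<lambda>s. norm (u t - c))" using 0 by simp
    also have "\<dots> \<le> integral {a..b} (\<lambda>s. norm (u s - c) + \<mu>)"
    proof (intro integral_le)
      fix s assume s: "s \<in> {a..b}"
      have "norm (u t - u s) \<le> \<mu>" using s t 0 by (intro uc) auto
      then show "norm (u t - c) \<le> norm (u s - c) + \<mu>"
        using norm_triangle_ineq[of "u s - c" "u t - u s"] by simp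
    qed (auto intro!: integrable_add I)
    also have "\<dots> = integral {a..b} (\<lambda>s. norm (u s - c)) + \<mu> * (b - a)"
      using I 0 by (subst integral_add) auto
    also have "\<dots> \<le> 2 * \<mu> * (b - a)" using 0 by simp
    finally show ?thesis using 0 by simp
  qed
  then have "integral {a..b} (\<lambda>t. (norm (u t - c))\<^sup>2) \<le> integral {a..b} (\<lambda>t. (2 * \<mu>)\<^sup>2)"
    by (intro integral_le integrable_continuous_UNIV continuous_intros u power_mono) auto
  also have "\<dots> = 4 * \<mu>\<^sup>2 * (b - a)" using 0 by (simp add: power_mult_distrib)
  also have "\<dots> \<le> 4 * \<mu>\<^sup>2 * (b - a) + (2 * B + 8 * \<mu>\<^sup>2) / \<mu> * integral {a..b} (\<lambda>t. norm (u t - c))"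
  proof -
    have "0 \<le> integral {a..b} (\<lambda>t. norm (u t - c))" by (intro integral_nonneg I) auto
    then have "0 \<le> (2 * B + 8 * \<mu>\<^sup>2) / \<mu> * integral {a..b} (\<lambda>t. norm (u t - c))"
      using B \<mu> by (intro mult_nonneg_nonneg divide_nonneg_pos add_nonneg_nonneg) auto
    then show ?thesis by simp
  qed
  finally show ?case .
next
  case (Suc n)
  define D where "D = 2 * B + 8 * \<mu>\<^sup>2"
  define m where "m = (a + b) / 2"
  have m: "a < m" "m < b" "b - m = m - a" "b - a = 2 * (m - a)" using Suc.prems by (auto simp: m_def field_simps)
  have I: "(\<lambda>t. norm (u t - c)) integrable_on {a..b}" for a b
    by (intro integrable_continuous_UNIV continuous_intros u)
  have I2: "(\<lambda>t. (norm (u t - c))\<^sup>2) integrable_on {a..b}" for a b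
    by (intro integrable_continuous_UNIV continuous_intros u)
  have half: "integral {p..q} (\<lambda>t. (norm (u t - c))\<^sup>2)
      \<le> 4 * \<mu>\<^sup>2 * (q - p) + D / \<mu> * integral {p..q} (\<lambda>t. norm (u t - c))"
    if pq: "a0 \<le> p" "p < q" "q \<le> b0" "q - p = m - a" "{p..q} \<subseteq> {a..b}" for p q
  proof (cases "integral {p..q} (\<lambda>t. norm (u t - c)) \<le> \<mu> * (q - p)")
    case True
    then show ?thesis unfolding D_def using pq Suc.prems m by (intro Suc.IH) auto
  next
    case False
    \<comment> \<open>The half is stopped: the mean of |u - c| exceeds \<mu> there but is at most 2
      \<mu>, since the parent has twice the length. Hence its average is within 2 \<mu> of c, and
      its length is at most 1 / \<mu> times the integral of |u - c|.\<close>
    have "integral {p..q} (\<lambda>t. norm (u t - c)) \<le> integral {a..b} (\<lambda>t. norm (u t - c))"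
      by (intro integral_subset_le I pq(5)) auto
    also have "\<dots> \<le> \<mu> * (b - a)" by (rule Suc.prems)
    also have "\<dots> = 2 * \<mu> * (q - p)" using m(4) pq(4) by simp
    finally have "integral {p..q} (\<lambda>t. norm (u t - c)) / (q - p) \<le> 2 * \<mu>"
      using pq by (simp add: pos_divide_le_eq)
    with norm_avg_diff_le[OF u pq(2), of c] have "norm (avg u p q - c) \<le> 2 * \<mu>" by linarith
    then have "(norm (avg u p q - c))\<^sup>2 \<le> (2 * \<mu>)\<^sup>2" by (intro power_mono) auto
    then have "2 * (norm (avg u p q - c))\<^sup>2 * (q - p) \<le> 2 * (2 * \<mu>)\<^sup>2 * (q - p)"
      using pq by (intro mult_right_mono mult_left_mono) auto
    then have "integral {p..q} (\<lambda>t. (norm (u t - c))\<^sup>2) \<le> D * (q - p)"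
      using integral_sq_dist_change[OF u less_imp_le[OF pq(2)], of c "avg u p q"] sq[OF pq(1-3)]
      by (simp add: D_def algebra_simps power_mult_distrib)
    also have "\<dots> = D / \<mu> * (\<mu> * (q - p))" using \<mu> by simp
    also have "\<dots> \<le> D / \<mu> * integral {p..q} (\<lambda>t. norm (u t - c))"
      using False B \<mu> by (intro mult_left_mono) (auto simp: D_def)
    also have "\<dots> \<le> 4 * \<mu>\<^sup>2 * (q - p) + D / \<mu> * integral {p..q} (\<lambda>t. norm (u t - c))"
      using pq by simp
    finally show ?thesis .
  qed
  have "integral {a..b} (\<lambda>t. (norm (u t - c))\<^sup>2)
     = integral {a..m} (\<lambda>t. (norm (u t - c))\<^sup>2) + integral {m..b} (\<lambda>t. (norm (u t - c))\<^sup>2)"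
    using m by (intro Henstock_Kurzweil_Integration.integral_combine[symmetric] I2) auto
  also have "\<dots> \<le> (4 * \<mu>\<^sup>2 * (m - a) + D / \<mu> * integral {a..m} (\<lambda>t. norm (u t - c)))
      + (4 * \<mu>\<^sup>2 * (b - m) + D / \<mu> * integral {m..b} (\<lambda>t. norm (u t - c)))"
    using m Suc.prems by (intro add_mono half) auto
  also have "\<dots> = 4 * \<mu>\<^sup>2 * (b - a) + D / \<mu> * (integral {a..m} (\<lambda>t. norm (u t - c)) + integral {m..b} (\<lambda>t. norm (u t - c)))"
    by (simp add: algebra_simps)
  also have "integral {a..m} (\<lambda>t. norm (u t - c)) + integral {m..b} (\<lambda>t. norm (u t - c)) = integral {a..b} (\<lambda>t. norm (u t - c))"
    using m by (intro Henstock_Kurzweil_Integration.integral_combine I) auto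
  finally show ?case by (simp add: D_def)
qed

text \<open>A self-improving bound. The best L^2 constant \<open>B\<close> over all subintervals is
  finite by continuity, and the stopping argument returns B \<le> 6 \<mu>^2 + B / 2, so B \<le> 12
  \<mu>^2.\<close>

lemma john_nirenberg_L2:
  fixes u :: "real \<Rightarrow> complex"
  assumes u: "continuous_on UNIV u" and K: "0 < K"
    and osc: "\<And>a b. a < b \<Longrightarrow> b \<le> a + 2 * pi \<Longrightarrow>
        integral {a..b} (\<lambda>t. norm (u t - avg u a b)) \<le> K * (b - a)"
    and ab0: "a0 < b0" "b0 \<le> a0 + 2 * pi"
  shows "integral {a0..b0} (\<lambda>t. (norm (u t - avg u a0 b0))\<^sup>2) \<le> 192 * K\<^sup>2 * (b0 - a0)"
proof -
  define J where "J = {(a, b). a0 \<le> a \<and> a < b \<and> b \<le> b0}"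
  define X where "X = (\<lambda>(a, b). integral {a..b} (\<lambda>t. (norm (u t - avg u a b))\<^sup>2) / (b - a))"
  \<comment> \<open>The level 4 K turns (2 B + 8 \<mu>^2) K / \<mu> into B / 2 + 2 \<mu>^2, so that
    half of B can be absorbed.\<close>
  define \<mu> where "\<mu> = 4 * K"
  have \<mu>: "0 < \<mu>" using K by (simp add: \<mu>_def)
  have "compact (u ` {a0..b0})"
    using u by (intro compact_continuous_image) (auto intro: continuous_on_subset)
  then obtain M where M: "\<And>t. t \<in> {a0..b0} \<Longrightarrow> norm (u t) \<le> M"
    unfolding bounded_iff[THEN iffD1, OF compact_imp_bounded] by (meson bounded_iff compact_imp_bounded imageI)
  have "X p \<le> (2 * M)\<^sup>2" if pJ: "p \<in> J" for p
  proof -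
    obtain a b where p: "p = (a, b)" "a0 \<le> a" "a < b" "b \<le> b0" using pJ by (auto simp: J_def)
    have "norm (avg u a b - 0) \<le> integral {a..b} (\<lambda>t. norm (u t - 0)) / (b - a)"
      by (rule norm_avg_diff_le[OF u p(3)])
    also have "integral {a..b} (\<lambda>t. norm (u t - 0)) \<le> integral {a..b} (\<lambda>t. M)"
      using M p by (intro integral_le integrable_continuous_UNIV continuous_intros u) auto
    finally have "norm (avg u a b) \<le> M" using p by (simp add: divide_right_mono pos_divide_le_eq)
    then have "norm (u t - avg u a b) \<le> 2 * M" if "t \<in> {a..b}" for t
      using norm_triangle_ineq4[of "u t" "avg u a b"] M[of t] that p by auto
    then have "integral {a..b} (\<lambda>t. (norm (u t - avg u a b))\<^sup>2) \<le> integral {a..b} (\<lambda>t. (2 * M)\<^sup>2)"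
      by (intro integral_le integrable_continuous_UNIV continuous_intros u power_mono) auto
    then show ?thesis using p by (simp add: X_def pos_divide_le_eq algebra_simps)
  qed
  then have bdd: "bdd_above (X ` J)" by (intro bdd_aboveI2)
  define B where "B = (SUP p\<in>J. X p)"
  have J0: "(a0, b0) \<in> J" using ab0 by (simp add: J_def)
  have XB: "X p \<le> B" if "p \<in> J" for p
    unfolding B_def by (rule cSUP_upper[OF that bdd])
  have "0 \<le> X (a0, b0)"
    unfolding X_def using ab0 by (auto intro!: divide_nonneg_nonneg integral_nonneg integrable_continuous_UNIV continuous_intros u)
  then have B0: "0 \<le> B" using XB[OF J0] by linarith
  have sq: "integral {a..b} (\<lambda>t. (norm (u t - avg u a b))\<^sup>2) \<le> B * (b - a)"
    if "a0 \<le> a" "a < b" "b \<le> b0" for a b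
    using XB[of "(a, b)"] that by (simp add: X_def J_def pos_divide_le_eq)
  have "uniformly_continuous_on {a0..b0} u"
    using u by (intro compact_uniformly_continuous) (auto intro: continuous_on_subset)
  then obtain d where d: "0 < d" "\<And>s t. s \<in> {a0..b0} \<Longrightarrow> t \<in> {a0..b0} \<Longrightarrow> dist t s < d \<Longrightarrow> dist (u t) (u s) < \<mu>"
    unfolding uniformly_continuous_on_def using \<mu> by metis
  have uc: "norm (u s - u t) \<le> \<mu>" if "s \<in> {a0..b0}" "t \<in> {a0..b0}" "\<bar>s - t\<bar> \<le> d / 2" for s t
    using d(2)[of t s] that d(1) by (auto simp: dist_norm dist_real_def)
  have "X p \<le> 6 * \<mu>\<^sup>2 + B / 2" if pJ: "p \<in> J" for p
  proof -
    obtain a b where p: "p = (a, b)" "a0 \<le> a" "a < b" "b \<le> b0" using pJ by (auto simp: J_def)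
    obtain n where n: "(b - a) / (d / 2) < 2 ^ n" using real_arch_pow[of 2] by auto
    define h where "h = integral {a..b} (\<lambda>t. norm (u t - avg u a b))"
    have h: "h \<le> K * (b - a)" unfolding h_def using p ab0 by (intro osc) auto
    have "K * (b - a) \<le> \<mu> * (b - a)" using p K by (intro mult_right_mono) (auto simp: \<mu>_def)
    then have "integral {a..b} (\<lambda>t. (norm (u t - avg u a b))\<^sup>2)
       \<le> 4 * \<mu>\<^sup>2 * (b - a) + (2 * B + 8 * \<mu>\<^sup>2) / \<mu> * h"
      unfolding h_def using h n d(1) p
      by (intro stopping_time_bound[OF u \<mu> B0 sq uc, where n=n and \<delta>="d / 2"]) (auto simp: h_def field_simps)
    also have "\<dots> \<le> 4 * \<mu>\<^sup>2 * (b - a) + (2 * B + 8 * \<mu>\<^sup>2) / \<mu> * (K * (b - a))"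
      using h B0 \<mu> by (intro add_mono mult_left_mono) auto
    also have "\<dots> = (6 * \<mu>\<^sup>2 + B / 2) * (b - a)"
      using K by (simp add: \<mu>_def field_simps power2_eq_square)
    finally show ?thesis using p by (simp add: X_def pos_divide_le_eq)
  qed
  then have "B \<le> 6 * \<mu>\<^sup>2 + B / 2"
    unfolding B_def using J0 by (intro cSUP_least) auto
  then have "B \<le> 192 * K\<^sup>2" by (simp add: \<mu>_def power_mult_distrib)
  then have "B * (b0 - a0) \<le> 192 * K\<^sup>2 * (b0 - a0)" using ab0 by (intro mult_right_mono) auto
  with sq[OF order_refl ab0(1) order_refl] show ?thesis by (rule order_trans)
qed

section \<open>Oscillation measured by the Poisson kernel\<close>

lemma sin_ge_half: "0 \<le> y \<Longrightarrow> y \<le> pi / 2 \<Longrightarrow> y / 2 \<le> sin (y::real)"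
proof -
  assume y: "0 \<le> y" "y \<le> pi / 2"
  show ?thesis
  proof (cases "y \<le> pi / 3")
    case True
    have "sin 0 - 0 / 2 \<le> sin y - y / 2"
    proof (rule DERIV_nonneg_imp_nondecreasing[OF y(1)])
      fix x assume x: "0 \<le> x" "x \<le> y"
      have "cos (pi / 3) \<le> cos x" using x True by (intro cos_monotone_0_pi_le) auto
      then show "\<exists>D. ((\<lambda>y. sin y - y / 2) has_real_derivative D) (at x) \<and> 0 \<le> D"
        by (intro exI[of _ "cos x - 1 / 2"]) (auto intro!: derivative_eq_intros simp: cos_60)
    qed
    then show ?thesis by simp
  next
    case False
    have "sin (pi / 3) \<le> sin y" using False y by (intro sin_monotone_2pi_le) auto
    moreover have "17 / 10 \<le> sqrt 3" by (rule real_le_rsqrt) (simp add: power2_eq_square)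
    moreover have "y / 2 \<le> 8 / 10" using y pi_less_4 pi_approx by simp
    ultimately show ?thesis by (simp add: sin_60)
  qed
qed

lemma norm_one_minus_cis_ge:
  assumes "\<bar>x\<bar> \<le> pi"
  shows "\<bar>x\<bar> / 2 \<le> norm (1 - cis x)"
proof -
  have "(norm (1 - cis x))\<^sup>2 = 2 - 2 * cos x"
    by (simp add: cmod_power2 power2_diff sin_squared_eq)
  also have "\<dots> = (2 * sin (\<bar>x\<bar> / 2))\<^sup>2"
    using cos_double_sin[of "\<bar>x\<bar> / 2"] by (simp add: power_mult_distrib)
  finally have "norm (1 - cis x) = \<bar>2 * sin (\<bar>x\<bar> / 2)\<bar>" by (metis norm_ge_zero real_sqrt_abs real_sqrt_unique)
  moreover have "\<bar>x\<bar> / 2 / 2 \<le> sin (\<bar>x\<bar> / 2)" using assms by (intro sin_ge_half) auto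
  ultimately show ?thesis by simp
qed

lemma norm_one_minus_rcis_ge:
  assumes "0 \<le> r" "r \<le> 1" "\<bar>x\<bar> \<le> pi"
  shows "1 - r \<le> norm (1 - of_real r * cis x)" "\<bar>x\<bar> / 4 \<le> norm (1 - of_real r * cis x)"
proof -
  show 1: "1 - r \<le> norm (1 - of_real r * cis x)"
    using norm_triangle_ineq2[of 1 "of_real r * cis x"] assms by (simp add: norm_mult)
  have "norm (1 - cis x) \<le> norm (1 - of_real r * cis x) + norm (of_real r * cis x - cis x)"
    using norm_triangle_ineq[of "1 - of_real r * cis x" "of_real r * cis x - cis x"] by simp
  also have "norm (of_real r * cis x - cis x) = norm (of_real (r - 1) * cis x)" by (simp add: algebra_simps)
  also have "\<dots> = 1 - r" using assms by (simp only: norm_mult norm_of_real) simp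
  finally show "\<bar>x\<bar> / 4 \<le> norm (1 - of_real r * cis x)"
    using 1 norm_one_minus_cis_ge[OF assms(3)] by linarith
qed

text \<open>Selects the dyadic shell of x, cut off at level n. At the cut-off no lower bound for x
  is left; in the kernel estimate 1 - r takes its place.\<close>

lemma dyadic_scale:
  fixes x c :: real
  assumes "x \<le> c"
  obtains k where "k \<le> n" "x \<le> c / 2 ^ k" "k < n \<Longrightarrow> c / 2 ^ Suc k < x"
proof -
  have "\<exists>k\<le>n. x \<le> c / 2 ^ k \<and> (k < n \<longrightarrow> c / 2 ^ Suc k < x)"
  proof (induction n)
    case 0 then show ?case using assms by simp
  next
    case (Suc n)
    then obtain k where k: "k \<le> n" "x \<le> c / 2 ^ k" "k < n \<longrightarrow> c / 2 ^ Suc k < x" by blast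
    show ?case
    proof (cases "k = n \<and> x \<le> c / 2 ^ Suc n")
      case True then show ?thesis by (intro exI[of _ "Suc n"]) auto
    next
      case False then show ?thesis using k by (intro exI[of _ k]) auto
    qed
  qed
  then show thesis using that by blast
qed

text \<open>The full series sums to 192 * 2 + 4 * 6 = 408; the exact remainder makes the induction
  close.\<close>

lemma sum_sq_over_pow2: "(\<Sum>j\<le>n. (192 + 4 * (real j)\<^sup>2) / 2 ^ j) \<le> 408"
proof -
  have "(\<Sum>j\<le>n. (192 + 4 * (real j)\<^sup>2) / 2 ^ j) = 408 - (192 + 4 * ((real n)\<^sup>2 + 4 * real n + 6)) / 2 ^ n"
    by (induction n) (simp_all add: field_simps power2_eq_square)
  also have "\<dots> \<le> 408" by simp
  finally show ?thesis .
qed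

text \<open>Arcs of half-width \<pi> / 2^k around \<alpha> are used down to the scale \<delta> = 1 -
  r, and c is the average over the smallest one. On the k-th shell the kernel is at most 2 \<delta>
  4^(k+2). Averages over neighbouring arcs differ by at most 2 K, so their distance to c grows only
  linearly in n - k. The constant is 128 * 408 = 52224.\<close>

lemma poisson_osc_bound:
  fixes u :: "real \<Rightarrow> complex"
  assumes u: "continuous_on UNIV u" and K: "0 < K"
    and osc: "\<And>a b. a < b \<Longrightarrow> b \<le> a + 2 * pi \<Longrightarrow>
        integral {a..b} (\<lambda>t. norm (u t - avg u a b)) \<le> K * (b - a)"
    and r: "0 \<le> r" "r < 1"
  obtains c where "integral {\<alpha> - pi..\<alpha> + pi} (\<lambda>t. (1 - r\<^sup>2) / (norm (1 - of_real r * cis (t - \<alpha>)))\<^sup>2 * (norm (u t - c))\<^sup>2)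
     \<le> 52224 * pi * K\<^sup>2"
proof -
  define \<delta> where "\<delta> = 1 - r"
  have \<delta>: "0 < \<delta>" "\<delta> \<le> 1" using r by (auto simp: \<delta>_def)
  have "\<exists>n. \<delta> \<le> 1 / 2 ^ n \<and> 1 / 2 ^ Suc n < \<delta>"
  proof -
    obtain m where m: "(1/2) ^ m < \<delta>" using real_arch_pow_inv[of \<delta> "1/2"] \<delta> by auto
    define k where "k = (LEAST m. (1/2::real) ^ m < \<delta>)"
    have k: "(1/2) ^ k < \<delta>" unfolding k_def by (rule LeastI[of _ m]) (rule m)
    then have "k \<noteq> 0" using \<delta> by (metis power_0 not_less)
    then obtain n where n: "k = Suc n" using not0_implies_Suc by blast
    have "\<not> (1/2) ^ n < \<delta>" using not_less_Least[of n "\<lambda>m. (1/2::real) ^ m < \<delta>"] n k_def by simp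
    then show ?thesis using k n by (intro exI[of _ n]) (simp add: power_one_over field_simps)
  qed
  then obtain n where n: "\<delta> \<le> 1 / 2 ^ n" "1 / 2 ^ Suc n < \<delta>" by blast
  define lo hi where "lo = (\<lambda>k. \<alpha> - pi / 2 ^ k)" and "hi = (\<lambda>k. \<alpha> + pi / 2 ^ k)"
  have lh: "lo k < hi k" "hi k \<le> lo k + 2 * pi" "hi k - lo k = 2 * pi / 2 ^ k" for k :: nat
  proof -
    show "lo k < hi k" by (simp add: lo_def hi_def add_pos_pos)
    have "pi / 2 ^ k \<le> pi / 1" by (intro divide_left_mono) auto
    then show "hi k \<le> lo k + 2 * pi" by (simp add: lo_def hi_def)
    show "hi k - lo k = 2 * pi / 2 ^ k" by (simp add: lo_def hi_def)
  qed
  define cc where "cc k = avg u (lo k) (hi k)" for k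
  define c where "c = cc n"
  have step: "norm (cc (Suc k) - cc k) \<le> 2 * K" for k
  proof -
    have I: "(\<lambda>t. norm (u t - cc k)) integrable_on {a..b}" for a b
      by (intro integrable_continuous_UNIV continuous_intros u)
    have "{lo (Suc k)..hi (Suc k)} \<subseteq> {lo k..hi k}"
      by (auto simp: lo_def hi_def field_simps)
    then have "integral {lo (Suc k)..hi (Suc k)} (\<lambda>t. norm (u t - cc k)) \<le> integral {lo k..hi k} (\<lambda>t. norm (u t - cc k))"
      by (intro integral_subset_le I) auto
    also have "\<dots> \<le> K * (hi k - lo k)" unfolding cc_def by (intro osc lh)
    also have "\<dots> = 2 * K * (hi (Suc k) - lo (Suc k))" by (simp add: lh(3))
    finally have "integral {lo (Suc k)..hi (Suc k)} (\<lambda>t. norm (u t - cc k)) / (hi (Suc k) - lo (Suc k)) \<le> 2 * K"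
      using lh(1)[of "Suc k"] by (simp add: pos_divide_le_eq)
    with norm_avg_diff_le[OF u lh(1)[of "Suc k"], of "cc k"] show ?thesis unfolding cc_def[of "Suc k"] by linarith
  qed
  have chain: "norm (cc (k + j) - cc k) \<le> 2 * K * real j" for k j
  proof (induction j)
    case (Suc j)
    have "norm (cc (k + Suc j) - cc k) \<le> norm (cc (Suc (k + j)) - cc (k + j)) + norm (cc (k + j) - cc k)"
      using norm_triangle_ineq[of "cc (Suc (k + j)) - cc (k + j)" "cc (k + j) - cc k"] by simp
    also have "\<dots> \<le> 2 * K + 2 * K * real j" by (intro add_mono step Suc)
    finally show ?case by (simp add: algebra_simps)
  qed simp
  have sqk: "integral {lo k..hi k} (\<lambda>t. (norm (u t - c))\<^sup>2)
      \<le> 4 * pi / 2 ^ k * (K\<^sup>2 * (192 + 4 * (real (n - k))\<^sup>2))" if "k \<le> n" for k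
  proof -
    have "norm (cc k - c) \<le> 2 * K * real (n - k)"
      using chain[of k "n - k"] that by (simp add: c_def norm_minus_commute)
    then have "(norm (cc k - c))\<^sup>2 \<le> (2 * K * real (n - k))\<^sup>2" by (intro power_mono) auto
    then have a: "2 * (norm (cc k - c))\<^sup>2 * (hi k - lo k) \<le> 2 * (2 * K * real (n - k))\<^sup>2 * (hi k - lo k)"
      using lh(1)[of k] by (intro mult_right_mono mult_left_mono) auto
    have "integral {lo k..hi k} (\<lambda>t. (norm (u t - cc k))\<^sup>2) \<le> 192 * K\<^sup>2 * (hi k - lo k)"
      unfolding cc_def by (rule john_nirenberg_L2[OF u K osc]) (use lh in auto)
    with a integral_sq_dist_change[OF u less_imp_le[OF lh(1)[of k]], of c "cc k"]
    have "integral {lo k..hi k} (\<lambda>t. (norm (u t - c))\<^sup>2) \<le>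
       2 * (192 * K\<^sup>2 * (hi k - lo k)) + 2 * (2 * K * real (n - k))\<^sup>2 * (hi k - lo k)" by linarith
    also have "\<dots> = 4 * pi / 2 ^ k * (K\<^sup>2 * (192 + 4 * (real (n - k))\<^sup>2))"
      unfolding lh(3) by (simp add: power_mult_distrib field_simps)
    finally show ?thesis .
  qed
  define w where "w k t = (if t \<in> {lo k..hi k} then (norm (u t - c))\<^sup>2 else 0)" for k t
  have wi: "(w k has_integral integral {lo k..hi k} (\<lambda>t. (norm (u t - c))\<^sup>2)) {\<alpha> - pi..\<alpha> + pi}" for k
  proof -
    have sub: "{lo k..hi k} \<subseteq> {\<alpha> - pi..\<alpha> + pi}"
      using lh(2)[of k] by (auto simp: lo_def hi_def)
    have "((\<lambda>t. (norm (u t - c))\<^sup>2) has_integral integral {lo k..hi k} (\<lambda>t. (norm (u t - c))\<^sup>2)) {lo k..hi k}"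
      by (intro integrable_integral integrable_continuous_UNIV continuous_intros u)
    then show ?thesis unfolding w_def[abs_def]
      by (subst has_integral_restrict[OF sub])
  qed
  have S: "((\<lambda>t. \<Sum>k\<le>n. 2 * \<delta> * 4 ^ (k + 2) * w k t) has_integral
     (\<Sum>k\<le>n. 2 * \<delta> * 4 ^ (k + 2) * integral {lo k..hi k} (\<lambda>t. (norm (u t - c))\<^sup>2))) {\<alpha> - pi..\<alpha> + pi}"
    by (intro has_integral_sum has_integral_mult_right wi) auto
  have ne: "norm (1 - of_real r * cis x) \<noteq> 0" for x
  proof
    assume "norm (1 - of_real r * cis x) = 0"
    then have "norm (of_real r * cis x) = 1" by (metis eq_iff_diff_eq_0 norm_eq_zero norm_one)
    then show False using r by (simp add: norm_mult)
  qed
  have "integral {\<alpha> - pi..\<alpha> + pi} (\<lambda>t. (1 - r\<^sup>2) / (norm (1 - of_real r * cis (t - \<alpha>)))\<^sup>2 * (norm (u t - c))\<^sup>2)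
    \<le> (\<Sum>k\<le>n. 2 * \<delta> * 4 ^ (k + 2) * integral {lo k..hi k} (\<lambda>t. (norm (u t - c))\<^sup>2))"
  proof (rule has_integral_le[OF integrable_integral S])
    show "(\<lambda>t. (1 - r\<^sup>2) / (norm (1 - of_real r * cis (t - \<alpha>)))\<^sup>2 * (norm (u t - c))\<^sup>2) integrable_on {\<alpha> - pi..\<alpha> + pi}"
      using ne by (intro integrable_continuous_UNIV continuous_intros u) auto
    fix t assume t: "t \<in> {\<alpha> - pi..\<alpha> + pi}"
    define x where "x = t - \<alpha>"
    have x: "\<bar>x\<bar> \<le> pi" using t by (auto simp: x_def)
    obtain k where k: "k \<le> n" "\<bar>x\<bar> \<le> pi / 2 ^ k" "k < n \<Longrightarrow> pi / 2 ^ Suc k < \<bar>x\<bar>"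
      using dyadic_scale[OF x] by blast
    have "1 / 2 ^ (k + 2) \<le> norm (1 - of_real r * cis x)"
    proof (cases "k < n")
      case True
      have "1 / 2 ^ (k + 2) \<le> pi / 2 ^ Suc k / 4"
        using pi_gt3 by (simp add: field_simps)
      also have "\<dots> \<le> \<bar>x\<bar> / 4" using k(3)[OF True] by simp
      also have "\<dots> \<le> norm (1 - of_real r * cis x)" using r x by (intro norm_one_minus_rcis_ge) auto
      finally show ?thesis .
    next
      case False
      then have "1 / 2 ^ (k + 2) \<le> 1 / (2::real) ^ Suc n" using k(1) by (simp add: field_simps)
      also have "\<dots> \<le> \<delta>" using n by simp
      also have "\<dots> \<le> norm (1 - of_real r * cis x)" unfolding \<delta>_def using r x by (intro norm_one_minus_rcis_ge) auto
      finally show ?thesis .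
    qed
    then have "(1 / 2 ^ (k + 2))\<^sup>2 \<le> (norm (1 - of_real r * cis x))\<^sup>2" by (intro power_mono) auto
    also have "(1 / 2 ^ (k + 2))\<^sup>2 = (1::real) / 4 ^ (k + 2)"
      unfolding power_divide by (simp add: power2_eq_square flip: power_mult_distrib)
    finally have den: "1 / 4 ^ (k + 2) \<le> (norm (1 - of_real r * cis x))\<^sup>2" .
    have "1 - r\<^sup>2 = (1 - r) * (1 + r)" by (simp add: power2_eq_square algebra_simps)
    also have "\<dots> \<le> \<delta> * 2" unfolding \<delta>_def using r by (intro mult_left_mono) auto
    finally have "(1 - r\<^sup>2) / (norm (1 - of_real r * cis x))\<^sup>2 \<le> (2 * \<delta>) / (1 / 4 ^ (k + 2))"
      using den \<delta> by (intro frac_le) auto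
    then have "(1 - r\<^sup>2) / (norm (1 - of_real r * cis x))\<^sup>2 * (norm (u t - c))\<^sup>2
       \<le> 2 * \<delta> * 4 ^ (k + 2) * (norm (u t - c))\<^sup>2" by (intro mult_right_mono) auto
    also have "2 * \<delta> * 4 ^ (k + 2) * (norm (u t - c))\<^sup>2 = 2 * \<delta> * 4 ^ (k + 2) * w k t"
      using k(2) by (auto simp: w_def x_def lo_def hi_def)
    also have "\<dots> \<le> (\<Sum>k\<le>n. 2 * \<delta> * 4 ^ (k + 2) * w k t)"
      using k(1) \<delta> by (intro member_le_sum) (auto simp: w_def)
    finally show "(1 - r\<^sup>2) / (norm (1 - of_real r * cis (t - \<alpha>)))\<^sup>2 * (norm (u t - c))\<^sup>2
      \<le> (\<Sum>k\<le>n. 2 * \<delta> * 4 ^ (k + 2) * w k t)" by (simp add: x_def)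
  qed
  also have "\<dots> \<le> (\<Sum>k\<le>n. 2 * \<delta> * 4 ^ (k + 2) * (4 * pi / 2 ^ k * (K\<^sup>2 * (192 + 4 * (real (n - k))\<^sup>2))))"
    using \<delta> by (intro sum_mono mult_left_mono sqk) auto
  also have "\<dots> \<le> (\<Sum>k\<le>n. 128 * pi * K\<^sup>2 * ((192 + 4 * (real (n - k))\<^sup>2) / 2 ^ (n - k)))"
  proof (intro sum_mono)
    fix k assume "k \<in> {..n}"
    then have k: "k \<le> n" by simp
    \<comment> \<open>The kernel bound grows like \<delta> 4^k while the arcs shrink like 2^(-k); as
      \<delta> \<le> 2^(-n), the product decays like 2^(-(n - k)).\<close>
    have "2 ^ k * \<delta> \<le> 2 ^ k * (1 / 2 ^ n)" using n by (intro mult_left_mono) auto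
    also have "\<dots> = 1 / 2 ^ (n - k)" using k by (simp add: power_diff)
    finally have e: "2 ^ k * \<delta> \<le> 1 / 2 ^ (n - k)" .
    have "(4::real) ^ k = 2 ^ k * 2 ^ k" by (simp add: power_mult_distrib[symmetric])
    then have "2 * \<delta> * 4 ^ (k + 2) * (4 * pi / 2 ^ k * (K\<^sup>2 * (192 + 4 * (real (n - k))\<^sup>2)))
      = 128 * pi * K\<^sup>2 * (192 + 4 * (real (n - k))\<^sup>2) * (2 ^ k * \<delta>)"
      by (simp add: power_add field_simps)
    also have "\<dots> \<le> 128 * pi * K\<^sup>2 * (192 + 4 * (real (n - k))\<^sup>2) * (1 / 2 ^ (n - k))"
      using e by (intro mult_left_mono) auto
    finally show "2 * \<delta> * 4 ^ (k + 2) * (4 * pi / 2 ^ k * (K\<^sup>2 * (192 + 4 * (real (n - k))\<^sup>2)))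
      \<le> 128 * pi * K\<^sup>2 * ((192 + 4 * (real (n - k))\<^sup>2) / 2 ^ (n - k))" by simp
  qed
  also have "\<dots> = 128 * pi * K\<^sup>2 * (\<Sum>j\<le>n. (192 + 4 * (real j)\<^sup>2) / 2 ^ j)"
    unfolding sum_distrib_left
    by (rule sum.reindex_bij_witness[of _ "\<lambda>j. n - j" "\<lambda>j. n - j"]) auto
  also have "\<dots> \<le> 128 * pi * K\<^sup>2 * 408"
    by (intro mult_left_mono sum_sq_over_pow2) auto
  finally show thesis by (intro that[of c]) simp
qed

section \<open>Poisson and Herglotz integrals\<close>

lemma integral_periodic_shift:
  fixes \<phi> :: "real \<Rightarrow> 'a::euclidean_space"
  assumes c: "continuous_on UNIV \<phi>" and per: "\<And>t. \<phi> (t + p) = \<phi> t" and p: "0 \<le> p"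
  shows "integral {a..a+p} \<phi> = integral {0..p} \<phi>"
proof -
  define m where "m = min a 0 - 1"
  define M where "M = max a 0 + p + 1"
  define F where "F x = integral {m..x} \<phi>" for x
  have I: "\<phi> integrable_on {x..y}" for x y
    using c continuous_on_subset by (blast intro: integrable_continuous_real)
  have dF: "(F has_vector_derivative \<phi> x) (at x)" if "m < x" "x < M" for x
  proof -
    have "(F has_vector_derivative \<phi> x) (at x within {m..M})"
      unfolding F_def[abs_def] using that c
      by (intro integral_has_vector_derivative) (auto intro: continuous_on_subset)
    then show ?thesis using that at_within_Icc_at[of m x M] by simp
  qed
  have d0: "((\<lambda>x. F (x + p) - F x) has_vector_derivative 0) (at x within {m<..<M-p})"
    if "x \<in> {m<..<M-p}" for x
  proof -
    have "(F has_vector_derivative \<phi> (x + p)) (at (x + p))" using that p by (intro dF) auto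
    moreover have "((\<lambda>x. x + p) has_vector_derivative 1) (at x)"
      by (auto intro!: derivative_eq_intros)
    ultimately have "((\<lambda>x. F (x + p)) has_vector_derivative \<phi> (x + p)) (at x)"
      using vector_diff_chain_at[of "\<lambda>x. x + p" 1 x F] by (simp add: o_def)
    then have "((\<lambda>x. F (x + p) - F x) has_vector_derivative \<phi> (x + p) - \<phi> x) (at x)"
      using that p by (intro has_vector_derivative_diff dF) auto
    then show ?thesis by (simp add: per has_vector_derivative_at_within)
  qed
  have "\<exists>k. \<forall>x\<in>{m<..<M-p}. F (x + p) - F x = k"
    by (rule has_vector_derivative_zero_constant[of "{m<..<M-p}", where f="\<lambda>x. F (x + p) - F x"])
       (use d0 in \<open>auto\<close>)
  then obtain k where k: "\<And>x. x \<in> {m<..<M-p} \<Longrightarrow> F (x + p) - F x = k" by blast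
  have F: "F (x + p) - F x = integral {x..x+p} \<phi>" if "m \<le> x" for x
    using Henstock_Kurzweil_Integration.integral_combine[of m x "x+p" \<phi>] that p I
    by (simp add: F_def algebra_simps)
  have "a \<in> {m<..<M-p}" "0 \<in> {m<..<M-p}" using p by (auto simp: m_def M_def)
  with k have "F (a + p) - F a = F (0 + p) - F 0" by metis
  then show ?thesis using F[of a] F[of 0] by (simp add: m_def)
qed

lemma cauchy_circle:
  fixes h :: "complex \<Rightarrow> complex"
  assumes h: "h holomorphic_on cball 0 1" and z: "norm z < 1"
  shows "((\<lambda>t. h (cis t) * cis t / (cis t - z)) has_integral 2 * pi * h z) {0..2*pi}"
proof -
  have "((\<lambda>u. h u / (u - z)) has_contour_integral (2 * of_real pi * \<i> * h z)) (part_circlepath 0 1 0 (2*pi))"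
    using Cauchy_integral_circlepath_simple[OF h, of z] z by (simp add: circlepath_def)
  then have "((\<lambda>t. h (cis t) / (cis t - z) * \<i> * cis t) has_integral (2 * of_real pi * \<i> * h z)) {0..2*pi}"
    by (subst (asm) has_contour_integral_part_circlepath_iff) auto
  from has_integral_mult_right[OF this, of "- \<i>"] show ?thesis
    by (simp add: mult_ac)
qed

definition poisson :: "complex \<Rightarrow> real \<Rightarrow> real" where
  "poisson z t = (1 - (norm z)\<^sup>2) / (norm (1 - z * cis (- t)))\<^sup>2"

lemma one_minus_mult_cis_nz:
  assumes "norm z < 1"
  shows "1 - z * cis t \<noteq> 0"
proof
  assume "1 - z * cis t = 0"
  then have "norm (z * cis t) = 1" by (metis eq_iff_diff_eq_0 norm_one)
  then show False using assms by (simp add: norm_mult)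
qed

text \<open>The Cauchy kernel plus a function of w = cis t that is holomorphic on the closed disc
  and vanishes at 0. Against a holomorphic h the first part reproduces h and the second integrates
  to 0, so the Poisson formula follows from Cauchy's.\<close>

lemma poisson_split:
  assumes "norm z < 1"
  shows "complex_of_real (poisson z t) = cis t / (cis t - z) + cnj z * cis t / (1 - cnj z * cis t)"
proof -
  define w where "w = z * cis (- t)"
  have w: "1 - w \<noteq> 0" "1 - cnj w \<noteq> 0"
    using one_minus_mult_cis_nz[OF assms] one_minus_mult_cis_nz[of "cnj z" t] assms
    by (auto simp: w_def cis_cnj)
  have cw: "cnj z * cis t = cnj w" by (simp add: w_def cis_cnj)
  have "cis t * (1 - w) = cis t - z" by (simp add: w_def algebra_simps cis_mult)
  then have e: "cis t / (cis t - z) = 1 / (1 - w)" using w by (metis cis_neq_zero nonzero_mult_divide_mult_cancel_left mult.right_neutral)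
  have "norm w = norm z" by (simp add: w_def norm_mult)
  then have "complex_of_real (poisson z t) = (1 - w * cnj w) / ((1 - w) * (1 - cnj w))"
    unfolding poisson_def w_def[symmetric]
    using complex_norm_square[of w] complex_norm_square[of "1 - w"] by (simp add: mult.commute)
  also have "\<dots> = 1 / (1 - w) + cnj w / (1 - cnj w)"
    using w by (simp add: field_simps)
  finally show ?thesis by (simp add: e cw)
qed

lemma poisson_nonneg: "norm z < 1 \<Longrightarrow> 0 \<le> poisson z t"
  unfolding poisson_def by (intro divide_nonneg_nonneg) (auto simp: power_le_one)

lemma poisson_reproduces:
  fixes h :: "complex \<Rightarrow> complex"
  assumes h: "h holomorphic_on cball 0 1" and z: "norm z < 1"
  shows "((\<lambda>t. of_real (poisson z t) * h (cis t)) has_integral 2 * pi * h z) {0..2*pi}"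
proof -
  have "(\<lambda>w. h w * (cnj z * w / (1 - cnj z * w))) holomorphic_on cball 0 1"
  proof (intro holomorphic_intros h)
    fix w :: complex assume "w \<in> cball 0 1"
    then have "norm (cnj z * w) \<le> norm z * 1" unfolding norm_mult by (intro mult_mono) auto
    then show "1 - cnj z * w \<noteq> 0" using z by (metis eq_iff_diff_eq_0 mult.right_neutral norm_one not_less)
  qed
  from cauchy_circle[OF this, of 0]
  have "((\<lambda>t. h (cis t) * (cnj z * cis t / (1 - cnj z * cis t))) has_integral 0) {0..2*pi}" by simp
  from has_integral_add[OF cauchy_circle[OF h z] this] show ?thesis
    by (simp add: poisson_split[OF z] algebra_simps)
qed

lemma continuous_on_poisson:
  assumes "norm z < 1"
  shows "continuous_on S (poisson z)"
  unfolding poisson_def[abs_def] using one_minus_mult_cis_nz[OF assms]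
  by (auto intro!: continuous_intros)

text \<open>The holomorphic function whose real part is the Poisson integral of \<phi>. Harmonic
  functions are used only in this form, as real parts, which fits the calculus of
  \<open>C2_dir\<close>.\<close>

definition herglotz :: "(real \<Rightarrow> real) \<Rightarrow> complex \<Rightarrow> complex" where
  "herglotz \<phi> z = integral {0..2*pi} (\<lambda>t. (1 + z * cis (- t)) / (1 - z * cis (- t)) * of_real (\<phi> t)) / of_real (2 * pi)"

lemma herglotz_holomorphic:
  assumes "continuous_on UNIV \<phi>"
  shows "herglotz \<phi> holomorphic_on ball 0 1"
proof -
  have "(\<lambda>z. integral (cbox 0 (2*pi)) (\<lambda>t. (1 + z * cis (- t)) / (1 - z * cis (- t)) * of_real (\<phi> t)))
     field_differentiable (at z within ball 0 1)" if z: "z \<in> ball 0 1" for z :: complex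
  proof (rule leibniz_rule_field_differentiable)
    fix z :: complex and t assume "z \<in> ball 0 1"
    then have nz: "1 - z * cis (- t) \<noteq> 0" by (intro one_minus_mult_cis_nz) auto
    show "((\<lambda>z. (1 + z * cis (- t)) / (1 - z * cis (- t)) * of_real (\<phi> t)) has_field_derivative
       2 * cis (- t) / (1 - z * cis (- t))\<^sup>2 * of_real (\<phi> t)) (at z within ball 0 1)"
      using nz by (auto intro!: derivative_eq_intros simp: power2_eq_square field_simps)
  next
    fix z :: complex assume "z \<in> ball 0 1"
    then have nz: "1 - z * cis (- t) \<noteq> 0" for t by (intro one_minus_mult_cis_nz) auto
    show "(\<lambda>t. (1 + z * cis (- t)) / (1 - z * cis (- t)) * of_real (\<phi> t)) integrable_on cbox 0 (2*pi)"
      using assms nz by (intro integrable_continuous continuous_intros) (auto intro: continuous_on_subset)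
  next
    show "continuous_on (ball 0 1 \<times> cbox 0 (2*pi)) (\<lambda>(z, t). 2 * cis (- t) / (1 - z * cis (- t))\<^sup>2 * of_real (\<phi> t))"
      unfolding split_beta
      using one_minus_mult_cis_nz by (intro continuous_intros continuous_on_compose2[OF assms]) auto
  qed (use z in auto)
  then show ?thesis
    unfolding herglotz_def[abs_def] holomorphic_on_def
    by (auto intro!: field_differentiable_divide)
qed

lemma Re_herglotz:
  assumes \<phi>: "continuous_on UNIV \<phi>" and z: "norm z < 1"
  shows "((\<lambda>t. poisson z t * \<phi> t) has_integral 2 * pi * Re (herglotz \<phi> z)) {0..2*pi}"
proof -
  have nz: "1 - z * cis (- t) \<noteq> 0" for t by (rule one_minus_mult_cis_nz[OF z])
  have "((\<lambda>t. (1 + z * cis (- t)) / (1 - z * cis (- t)) * of_real (\<phi> t)) has_integral 2 * pi * herglotz \<phi> z) {0..2*pi}"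
    unfolding herglotz_def using \<phi> nz
    by (auto intro!: integrable_integral integrable_continuous_real continuous_intros intro: continuous_on_subset)
  then have "((\<lambda>t. Re ((1 + z * cis (- t)) / (1 - z * cis (- t)) * of_real (\<phi> t))) has_integral Re (2 * pi * herglotz \<phi> z)) {0..2*pi}"
    by (rule has_integral_linear[OF _ bounded_linear_Re, unfolded o_def])
  moreover have "Re ((1 + z * cis (- t)) / (1 - z * cis (- t)) * of_real (\<phi> t)) = poisson z t * \<phi> t" for t
  proof -
    define w where "w = z * cis (- t)"
    have nw: "norm w = norm z" by (simp add: w_def norm_mult)
    have "Re ((1 + w) / (1 - w)) = Re ((1 + w) * cnj (1 - w)) / (norm (1 - w))\<^sup>2"
      by (simp add: Re_divide cmod_power2)
    also have "Re ((1 + w) * cnj (1 - w)) = 1 - (norm w)\<^sup>2"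
      unfolding cmod_power2 by (simp add: power2_eq_square algebra_simps)
    finally have "Re ((1 + w) / (1 - w)) = poisson z t" by (simp add: poisson_def w_def[symmetric] nw)
    moreover have "Re (x * of_real y) = Re x * y" for x y by simp
    ultimately show ?thesis unfolding w_def by metis
  qed
  ultimately show ?thesis by simp
qed

text \<open>Expansion of |h - c|^2, using that the Poisson integral of h is h itself. In
  probabilistic terms the excess of the Poisson integral of |h|^2 over |h z|^2 is the variance of h
  under harmonic measure at z.\<close>

lemma herglotz_variance:
  fixes h :: "complex \<Rightarrow> complex"
  assumes h: "h holomorphic_on cball 0 1" and z: "norm z < 1"
  shows "((\<lambda>t. poisson z t * (norm (h (cis t) - c))\<^sup>2) has_integral
    2 * pi * (Re (herglotz (\<lambda>t. (norm (h (cis t)))\<^sup>2) z) - (norm (h z))\<^sup>2 + (norm (h z - c))\<^sup>2)) {0..2*pi}"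
proof -
  have ch: "continuous_on UNIV (\<lambda>t. h (cis t))"
    by (rule continuous_on_compose2[OF holomorphic_on_imp_continuous_on[OF h]]) (auto intro!: continuous_intros)
  have cn: "continuous_on UNIV (\<lambda>t. (norm (h (cis t)))\<^sup>2)" by (intro continuous_intros ch)
  note A = Re_herglotz[OF cn z]
  have "((\<lambda>t. Re (cnj c * (of_real (poisson z t) * h (cis t)))) has_integral Re (cnj c * (2 * pi * h z))) {0..2*pi}"
    by (rule has_integral_linear[OF _ bounded_linear_Re, unfolded o_def],
        rule has_integral_mult_right, rule poisson_reproduces[OF h z])
  then have B: "((\<lambda>t. poisson z t * Re (cnj c * h (cis t))) has_integral 2 * pi * Re (cnj c * h z)) {0..2*pi}"
    by (simp add: algebra_simps)
  have "((\<lambda>t. Re (of_real (poisson z t) * 1)) has_integral Re (of_real (2 * pi) * 1)) {0..2*pi}"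
    by (rule has_integral_linear[OF poisson_reproduces[of "\<lambda>_. 1", OF _ z] bounded_linear_Re, unfolded o_def]) auto
  then have C: "((\<lambda>t. poisson z t * (norm c)\<^sup>2) has_integral 2 * pi * (norm c)\<^sup>2) {0..2*pi}"
    using has_integral_mult_left[of "poisson z" "2 * pi" "{0..2*pi}" "(norm c)\<^sup>2"] by simp
  have sq: "(norm (x - c))\<^sup>2 = (norm x)\<^sup>2 - 2 * Re (cnj c * x) + (norm c)\<^sup>2" for x :: complex
    by (simp add: cmod_power2 power2_diff algebra_simps)
  from has_integral_add[OF has_integral_diff[OF A has_integral_mult_right[OF B, of 2]] C]
  show ?thesis unfolding sq by (simp add: algebra_simps)
qed

text \<open>For the lower bound take the variance identity at c = h z. For the upper bound take the
  c of \<open>poisson_osc_bound\<close> and discard |h z - c|^2.\<close>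

lemma herglotz_bounds:
  fixes h :: "complex \<Rightarrow> complex"
  assumes h: "h holomorphic_on cball 0 1" and z: "norm z < 1" and K: "0 < K"
    and osc: "\<And>a b. a < b \<Longrightarrow> b \<le> a + 2 * pi \<Longrightarrow>
        integral {a..b} (\<lambda>t. norm (h (cis t) - avg (\<lambda>t. h (cis t)) a b)) \<le> K * (b - a)"
  shows "(norm (h z))\<^sup>2 \<le> Re (herglotz (\<lambda>t. (norm (h (cis t)))\<^sup>2) z)"
    and "Re (herglotz (\<lambda>t. (norm (h (cis t)))\<^sup>2) z) \<le> (norm (h z))\<^sup>2 + (162 * K)\<^sup>2"
proof -
  let ?H = "Re (herglotz (\<lambda>t. (norm (h (cis t)))\<^sup>2) z)"
  have ch: "continuous_on UNIV (\<lambda>t. h (cis t))"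
    by (rule continuous_on_compose2[OF holomorphic_on_imp_continuous_on[OF h]]) (auto intro!: continuous_intros)
  have "0 \<le> 2 * pi * (?H - (norm (h z))\<^sup>2 + (norm (h z - h z))\<^sup>2)"
    by (rule has_integral_nonneg[OF herglotz_variance[OF h z]]) (auto intro!: mult_nonneg_nonneg poisson_nonneg z)
  then show "(norm (h z))\<^sup>2 \<le> ?H" using pi_gt_zero by (auto simp: zero_le_mult_iff simp del: pi_gt_zero)
  obtain \<alpha> where \<alpha>: "z = of_real (norm z) * cis \<alpha>"
    using Arg2pi[of z] by (metis is_Arg_def cis_conv_exp)
  have P: "poisson z t = (1 - (norm z)\<^sup>2) / (norm (1 - of_real (norm z) * cis (t - \<alpha>)))\<^sup>2" for t
  proof -
    have "1 - z * cis (- t) = cnj (1 - of_real (norm z) * cis (t - \<alpha>))"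
      by (subst \<alpha>) (simp add: cis_cnj cis_mult algebra_simps)
    then have "norm (1 - z * cis (- t)) = norm (1 - of_real (norm z) * cis (t - \<alpha>))"
      by (metis complex_mod_cnj)
    then show ?thesis by (simp add: poisson_def)
  qed
  obtain c where c: "integral {\<alpha> - pi..\<alpha> + pi} (\<lambda>t. poisson z t * (norm (h (cis t) - c))\<^sup>2) \<le> 52224 * pi * K\<^sup>2"
    using poisson_osc_bound[OF ch K osc norm_ge_zero z, of \<alpha>] unfolding P by blast
  have "2 * pi * (?H - (norm (h z))\<^sup>2 + (norm (h z - c))\<^sup>2) =
     integral {0..2*pi} (\<lambda>t. poisson z t * (norm (h (cis t) - c))\<^sup>2)"
    by (rule integral_unique[symmetric], rule herglotz_variance[OF h z])
  also have "\<dots> = integral {\<alpha> - pi..\<alpha> - pi + 2*pi} (\<lambda>t. poisson z t * (norm (h (cis t) - c))\<^sup>2)"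
  proof (rule integral_periodic_shift[symmetric])
    have per: "cis (t + 2 * pi) = cis t" "cis (- (t + 2 * pi)) = cis (- t)" for t
      by (simp_all add: complex_eq_iff sin_diff cos_diff)
    show "poisson z (t + 2 * pi) * (norm (h (cis (t + 2 * pi)) - c))\<^sup>2 = poisson z t * (norm (h (cis t) - c))\<^sup>2" for t
      unfolding poisson_def per ..
  qed (auto intro!: continuous_intros ch continuous_on_poisson z)
  also have "\<dots> \<le> 52224 * pi * K\<^sup>2" using c by (simp add: add.commute)
  finally have "pi * (?H - (norm (h z))\<^sup>2 + (norm (h z - c))\<^sup>2) \<le> pi * (26112 * K\<^sup>2)" by simp
  then have "?H - (norm (h z))\<^sup>2 + (norm (h z - c))\<^sup>2 \<le> 26112 * K\<^sup>2"
    by (rule mult_left_le_imp_le) simp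
  then show "?H \<le> (norm (h z))\<^sup>2 + (162 * K)\<^sup>2"
  proof -
    \<comment> \<open>162^2 = 26244 is the first square above 26112 = 52224 / 2.\<close>
    have "26112 * K\<^sup>2 \<le> 26244 * K\<^sup>2" by (intro mult_right_mono) auto
    moreover have "(162 * K)\<^sup>2 = 26244 * K\<^sup>2" by (simp add: power_mult_distrib)
    moreover have "0 \<le> (norm (h z - c))\<^sup>2" by simp
    ultimately show ?thesis using \<open>?H - (norm (h z))\<^sup>2 + (norm (h z - c))\<^sup>2 \<le> 26112 * K\<^sup>2\<close> by linarith
  qed
qed

text \<open>Dilation by \<rho> makes g holomorphic on the closed unit disc, where the Herglotz
  integral of its boundary values is available. The estimate on circles of radius \<rho> R passes to
  R = 1 by continuity. As \<open>K\<close> may be 0, a slack \<eta> is added and then removed. The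
  constant is 648 = 4 * 162.\<close>

theorem fefferman_inequality:
  assumes f: "f holomorphic_on ball 0 1" and g: "g holomorphic_on ball 0 1" and \<rho>: "0 < \<rho>" "\<rho> < 1"
    and K: "0 \<le> K"
    and osc: "\<And>a b. a < b \<Longrightarrow> b \<le> a + 2 * pi \<Longrightarrow>
      integral {a..b} (\<lambda>t. norm (g (of_real \<rho> * cis t) - avg (\<lambda>t. g (of_real \<rho> * cis t)) a b)) \<le> K * (b - a)"
  shows "norm (circ (\<lambda>z. f z * cnj (g z)) \<rho>) \<le> (648 * K + norm (g 0)) * circ (\<lambda>z. norm (f z)) \<rho>"
proof -
  define h where "h z = g (of_real \<rho> * z)" for z
  define e where "e z = f (of_real \<rho> * z)" for z
  have sub: "of_real \<rho> * z \<in> ball 0 1" if "norm z \<le> 1" for z :: complex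
  proof -
    have "\<rho> * norm z \<le> \<rho> * 1" using that \<rho> by (intro mult_left_mono) auto
    then have "\<rho> * norm z < 1" using \<rho> by linarith
    then show ?thesis using \<rho> by (simp add: norm_mult)
  qed
  have hh: "h holomorphic_on cball 0 1"
    unfolding h_def[abs_def]
    by (rule holomorphic_on_compose_gen[OF _ g, unfolded o_def]) (use sub in \<open>auto intro!: holomorphic_intros\<close>)
  have ee: "e holomorphic_on cball 0 1"
    unfolding e_def[abs_def]
    by (rule holomorphic_on_compose_gen[OF _ f, unfolded o_def]) (use sub in \<open>auto intro!: holomorphic_intros\<close>)
  have hb: "h holomorphic_on ball 0 1" "e holomorphic_on ball 0 1"
    using hh ee by (auto intro: holomorphic_on_subset)
  define k where "k = herglotz (\<lambda>t. (norm (h (cis t)))\<^sup>2)"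
  have ch: "continuous_on UNIV (\<lambda>t. h (cis t))"
    by (rule continuous_on_compose2[OF holomorphic_on_imp_continuous_on[OF hh]]) (auto intro!: continuous_intros)
  have k: "k holomorphic_on ball 0 1"
    unfolding k_def by (intro herglotz_holomorphic continuous_intros ch)
  have main: "norm (circ (\<lambda>z. f z * cnj (g z)) (\<rho> * R)) \<le> (648 * (K + \<eta>) + norm (g 0)) * circ (\<lambda>z. norm (f z)) (\<rho> * R)"
    if R: "0 \<le> R" "R < 1" and \<eta>: "0 < \<eta>" for R \<eta>
  proof -
    have K': "0 < K + \<eta>" using K \<eta> by simp
    have osc': "integral {a..b} (\<lambda>t. norm (h (cis t) - avg (\<lambda>t. h (cis t)) a b)) \<le> (K + \<eta>) * (b - a)"
      if "a < b" "b \<le> a + 2 * pi" for a b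
    proof -
      have "K * (b - a) \<le> (K + \<eta>) * (b - a)" using that \<eta> by (intro mult_right_mono) auto
      then show ?thesis using osc[OF that] unfolding h_def by linarith
    qed
    have "norm (circ (\<lambda>z. e z * cnj (h z)) R) \<le> (4 * (162 * (K + \<eta>)) + norm (h 0)) * circ (\<lambda>z. norm (e z)) R"
    proof (rule circ_pairing_bound[OF hb(2,1) k _ _ R])
      fix z :: complex assume "z \<in> ball 0 1"
      then have z: "norm z < 1" by simp
      show "(norm (h z))\<^sup>2 \<le> Re (k z) \<and> Re (k z) \<le> (norm (h z))\<^sup>2 + (162 * (K + \<eta>))\<^sup>2"
        unfolding k_def using herglotz_bounds[OF hh z K' osc'] by blast
    qed (use K' in simp)
    then show ?thesis by (simp add: circ_def e_def h_def mult.assoc)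
  qed
  have lim: "((\<lambda>R. circ \<phi> (\<rho> * R)) \<longlongrightarrow> circ \<phi> \<rho>) (at_left 1)"
    if "continuous_on (ball 0 1) \<phi>" for \<phi> :: "complex \<Rightarrow> 'b::euclidean_space"
  proof -
    have "continuous_on {0..1} (\<lambda>R. circ \<phi> (\<rho> * R))"
      by (rule continuous_on_compose2[OF circ_zero_limit[OF that \<rho>(2)]])
         (use \<rho> in \<open>auto intro!: continuous_intros simp: mult_left_le\<close>)
    then have "((\<lambda>R. circ \<phi> (\<rho> * R)) \<longlongrightarrow> circ \<phi> (\<rho> * 1)) (at 1 within {0..1})"
      unfolding continuous_on_def by (rule bspec) auto
    then show ?thesis by (simp add: at_within_Icc_at_left)
  qed
  note cf = holomorphic_on_imp_continuous_on[OF f] and cg = holomorphic_on_imp_continuous_on[OF g]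
  have "norm (circ (\<lambda>z. f z * cnj (g z)) \<rho>) \<le> (648 * (K + \<eta>) + norm (g 0)) * circ (\<lambda>z. norm (f z)) \<rho>"
    if \<eta>: "0 < \<eta>" for \<eta>
  proof (rule tendsto_le[of "at_left (1::real)"])
    show "((\<lambda>R. norm (circ (\<lambda>z. f z * cnj (g z)) (\<rho> * R))) \<longlongrightarrow> norm (circ (\<lambda>z. f z * cnj (g z)) \<rho>)) (at_left 1)"
      by (intro tendsto_norm lim continuous_intros cf cg)
    show "((\<lambda>R. (648 * (K + \<eta>) + norm (g 0)) * circ (\<lambda>z. norm (f z)) (\<rho> * R)) \<longlongrightarrow>
        (648 * (K + \<eta>) + norm (g 0)) * circ (\<lambda>z. norm (f z)) \<rho>) (at_left 1)"
      by (intro tendsto_intros lim continuous_intros cf)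
    show "\<forall>\<^sub>F R in at_left 1. norm (circ (\<lambda>z. f z * cnj (g z)) (\<rho> * R))
        \<le> (648 * (K + \<eta>) + norm (g 0)) * circ (\<lambda>z. norm (f z)) (\<rho> * R)"
      unfolding eventually_at_left_field using main \<eta> by (intro exI[of _ 0]) auto
  qed simp
  then have ev: "\<forall>\<^sub>F \<eta> in at_right 0. norm (circ (\<lambda>z. f z * cnj (g z)) \<rho>)
     \<le> (648 * (K + \<eta>) + norm (g 0)) * circ (\<lambda>z. norm (f z)) \<rho>"
    by (auto simp: eventually_at_right_field intro: exI[of _ 1])
  show ?thesis
    by (rule tendsto_lowerbound[OF _ ev]) (auto intro!: tendsto_eq_intros)
qed

section \<open>The measure of a radial weight\<close>

text \<open>The circle mean without the factor 1 / (2 \<pi>). Off the disc f is arbitrary, so the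
  value 0 outside [0,1) is what makes \<open>M1 f\<close> Borel.\<close>

definition M1 :: "(complex \<Rightarrow> complex) \<Rightarrow> real \<Rightarrow> real" where
  "M1 f s = (if s \<in> {0..<1} then circ (\<lambda>z. norm (f z)) s else 0)"

lemma M1_nonneg:
  assumes "f holomorphic_on ball 0 1"
  shows "0 \<le> M1 f s"
  unfolding M1_def circ_def
  using circ_continuous_integrable[of "\<lambda>z. norm (f z)" s] holomorphic_on_imp_continuous_on[OF assms]
  by (auto intro!: integral_nonneg continuous_intros)

lemma continuous_on_M1:
  assumes "f holomorphic_on ball 0 1"
  shows "continuous_on {0..<1} (M1 f)"
proof -
  have c: "continuous_on (ball 0 1) (\<lambda>z. norm (f z))"
    by (intro continuous_intros holomorphic_on_imp_continuous_on[OF assms])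
  have "continuous (at s within {0..<1}) (circ (\<lambda>z. norm (f z)))" if s: "s \<in> {0..<1}" for s
  proof -
    define R where "R = (s + 1) / 2"
    have "continuous_on {0..<R} (circ (\<lambda>z. norm (f z)))"
      by (rule continuous_on_subset[OF circ_zero_limit[OF c, of R]]) (use s in \<open>auto simp: R_def\<close>)
    then have "continuous (at s within {0..<R}) (circ (\<lambda>z. norm (f z)))"
      using s by (auto simp: continuous_on_eq_continuous_within R_def)
    moreover have "at s within {0..<R} = at s within {0..<1}"
      by (rule at_within_nhd[of _ "{..<R}"]) (use s in \<open>auto simp: R_def\<close>)
    ultimately show ?thesis by simp
  qed
  then have "continuous_on {0..<1} (circ (\<lambda>z. norm (f z)))"
    by (simp add: continuous_on_eq_continuous_within)
  then show ?thesis by (rule continuous_on_eq) (auto simp: M1_def)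
qed

lemma borel_measurable_M1:
  assumes "f holomorphic_on ball 0 1"
  shows "M1 f \<in> borel_measurable borel"
proof -
  have "(\<lambda>s. indicat_real {0..<1} s *\<^sub>R M1 f s) \<in> borel_measurable borel"
    by (intro borel_measurable_continuous_on_indicator continuous_on_M1 assms) auto
  moreover have "(\<lambda>s. indicat_real {0..<1} s *\<^sub>R M1 f s) = M1 f"
    by (auto simp: M1_def fun_eq_iff split: split_indicator)
  ultimately show ?thesis by simp
qed

lemma M1_mono:
  assumes "f holomorphic_on ball 0 1" "0 \<le> r" "r \<le> s" "s < 1"
  shows "M1 f r \<le> M1 f s"
  using circ_norm_mono[OF assms] assms by (auto simp: M1_def)

lemma nn_integral_continuous_Icc:
  fixes \<phi> :: "real \<Rightarrow> real"
  assumes "continuous_on {a..b} \<phi>" "\<And>t. t \<in> {a..b} \<Longrightarrow> 0 \<le> \<phi> t"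
  shows "(\<integral>\<^sup>+t. ennreal (\<phi> t) * indicator {a..b} t \<partial>lborel) = ennreal (integral {a..b} \<phi>)"
proof -
  have si: "set_integrable lborel {a..b} \<phi>" by (rule borel_integrable_atLeastAtMost'[OF assms(1)])
  have "(\<integral>\<^sup>+t. ennreal (\<phi> t) * indicator {a..b} t \<partial>lborel) = (\<integral>\<^sup>+t. ennreal (indicator {a..b} t *\<^sub>R \<phi> t) \<partial>lborel)"
    by (intro nn_integral_cong) (auto split: split_indicator)
  also have "\<dots> = ennreal (LINT t:{a..b}|lborel. \<phi> t)"
    unfolding set_lebesgue_integral_def using si assms(2)
    by (intro nn_integral_eq_integral) (auto simp: set_integrable_def split: split_indicator)
  also have "(LINT t:{a..b}|lborel. \<phi> t) = integral {a..b} \<phi>"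
    by (rule set_borel_integral_eq_integral(2)[OF si])
  finally show ?thesis .
qed

text \<open>\<omega> is only Lebesgue measurable on [0,1) and arbitrary elsewhere. The
  representative \<open>w\<close> is Borel, nonnegative everywhere and 0 off [0,1), so it can serve
  as a density on the whole line.\<close>

definition borel_profile :: "(real \<Rightarrow> real) \<Rightarrow> (real \<Rightarrow> real) \<Rightarrow> bool" where
  "borel_profile \<omega> w \<longleftrightarrow> w \<in> borel_measurable borel \<and> (\<forall>s. 0 \<le> w s) \<and> (\<forall>s. s \<notin> {0..<1} \<longrightarrow> w s = 0)
     \<and> (AE s in lborel. indicator {0..<1} s * \<omega> s = w s) \<and> integrable lborel w"

lemma ex_borel_profile:
  assumes "radial_weight \<omega>"
  shows "\<exists>w. borel_profile \<omega> w"
proof -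
  have int: "integrable lebesgue (\<lambda>s. indicator {0..<1} s * \<omega> s)" and nn: "\<forall>s\<in>{0..<1}. 0 \<le> \<omega> s"
    using assms by (auto simp: radial_weight_def set_integrable_def)
  obtain v where v [measurable]: "v \<in> borel_measurable lborel" and ae: "AE s in lborel. indicator {0..<1} s * \<omega> s = v s"
    using completion_ex_borel_measurable_real[OF borel_measurable_integrable[OF int]] by blast
  define w where "w s = (if s \<in> {0..<1} then max 0 (v s) else 0)" for s
  have wm: "w \<in> borel_measurable borel" unfolding w_def[abs_def] using v by simp
  have aew: "AE s in lborel. indicator {0..<1} s * \<omega> s = w s"
  proof (use ae in eventually_elim)
    fix s assume "indicator {0..<1} s * \<omega> s = v s"
    then show "indicator {0..<1} s * \<omega> s = w s"
      using nn[rule_format, of s] by (auto simp: w_def split: split_indicator_asm)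
  qed
  have "integrable lebesgue w"
    by (rule integrable_cong_AE_imp[OF int]) (use wm aew AE_completion in \<open>auto intro: measurable_completion\<close>)
  then have "integrable lborel w" using wm by (subst (asm) integrable_completion) auto
  then show ?thesis using wm aew by (intro exI[of _ w]) (auto simp: borel_profile_def w_def)
qed

definition wmeas :: "(real \<Rightarrow> real) \<Rightarrow> real measure" where
  "wmeas w = density lborel (\<lambda>s. ennreal (w s))"

lemma sets_wmeas [simp, measurable_cong]: "sets (wmeas w) = sets borel"
  by (simp add: wmeas_def)

context
  fixes \<omega> w :: "real \<Rightarrow> real"
  assumes bp: "borel_profile \<omega> w"
begin

lemma w_measurable: "w \<in> borel_measurable borel"
  and w_nonneg: "0 \<le> w s" and w_outside: "s \<notin> {0..<1} \<Longrightarrow> w s = 0"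
  and w_AE: "AE s in lborel. indicator {0..<1} s * \<omega> s = w s" and w_int: "integrable lborel w"
  using bp by (auto simp: borel_profile_def)

lemma finite_measure_wmeas: "finite_measure (wmeas w)"
proof (rule finite_measureI)
  have "emeasure (wmeas w) (space (wmeas w)) = (\<integral>\<^sup>+s. ennreal (w s) \<partial>lborel)"
    unfolding wmeas_def using w_measurable by (subst emeasure_density) auto
  also have "\<dots> < \<infinity>" using integrableD(2)[OF w_int] w_nonneg by (simp add: less_top)
  finally show "emeasure (wmeas w) (space (wmeas w)) \<noteq> \<infinity>" by simp
qed

lemma AE_wmeas: "AE s in wmeas w. s \<in> {0..<1}"
proof -
  note w_measurable [measurable]
  have "0 < ennreal (w s) \<Longrightarrow> s \<in> {0..<1}" for s using w_outside[of s] by fastforce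
  then have "AE s in lborel. 0 < ennreal (w s) \<longrightarrow> s \<in> {0..<1}" by auto
  then show ?thesis unfolding wmeas_def by (subst AE_density) measurable
qed

lemma set_integral_weight:
  assumes [measurable]: "\<phi> \<in> borel_measurable borel"
  shows "(LINT s:{0..<1}|lebesgue. \<phi> s * \<omega> s) = (LINT s|wmeas w. \<phi> s)"
proof -
  note w_measurable [measurable]
  note w_measurable [measurable]
  have "(LINT s:{0..<1}|lebesgue. \<phi> s * \<omega> s) = (LINT s|lebesgue. \<phi> s * (indicator {0..<1} s * \<omega> s))"
    by (simp add: set_lebesgue_integral_def mult_ac)
  also have "\<dots> = (LINT s|lebesgue. w s * \<phi> s)"
  proof (rule integral_cong_AE)
    have ae: "AE s in lebesgue. indicator {0..<1} s * \<omega> s = w s" by (rule AE_completion[OF w_AE])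
    have "(\<lambda>s. indicator {0..<1} s * \<omega> s) \<in> borel_measurable lebesgue"
      by (rule borel_measurable_AE[of w]) (use ae in \<open>auto intro: measurable_completion elim: eventually_mono\<close>)
    then show "(\<lambda>s. \<phi> s * (indicator {0..<1} s * \<omega> s)) \<in> borel_measurable lebesgue"
      by (rule borel_measurable_times[rotated]) (auto intro: measurable_completion)
    show "AE s in lebesgue. \<phi> s * (indicator {0..<1} s * \<omega> s) = w s * \<phi> s"
      using ae by eventually_elim simp
  qed (auto intro: measurable_completion)
  also have "\<dots> = (LINT s|lborel. w s * \<phi> s)" by (rule integral_completion) simp
  also have "\<dots> = (LINT s|wmeas w. \<phi> s)"
    unfolding wmeas_def by (subst integral_real_density) (auto simp: w_nonneg)
  finally show ?thesis .
qed

lemma moment_wmeas: "moment \<omega> x = (LINT s|wmeas w. s powr x)"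
  unfolding moment_def by (rule set_integral_weight) simp

lemma weight_tail_wmeas:
  assumes "0 \<le> r"
  shows "weight_tail \<omega> r = measure (wmeas w) {r..}"
proof -
  have "weight_tail \<omega> r = (LINT s:{0..<1}|lebesgue. indicator {r..} s * \<omega> s)"
    unfolding weight_tail_def set_lebesgue_integral_def using assms
    by (intro Bochner_Integration.integral_cong) (auto split: split_indicator)
  also have "\<dots> = measure (wmeas w) {r..}"
    using finite_measure.emeasure_finite[OF finite_measure_wmeas]
    by (subst set_integral_weight) auto
  finally show ?thesis .
qed

text \<open>Carries null sets of radii to null sets of the disc, so that the almost-everywhere
  identity of \<omega> and \<open>w\<close> passes to the area integral.\<close>

lemma null_sets_norm:
  assumes "N \<in> null_sets lborel"
  shows "{z::complex. norm z \<in> N} \<inter> ball 0 1 \<in> null_sets lborel"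
proof -
  have N [measurable]: "N \<in> sets borel" using assms by auto
  have "emeasure lborel ({z::complex. norm z \<in> N} \<inter> ball 0 1)
     = (\<integral>\<^sup>+z. indicator N (norm (z::complex)) * indicator (ball 0 1) z \<partial>lborel)"
  proof (subst nn_integral_indicator[symmetric])
    show "{z::complex. norm z \<in> N} \<inter> ball 0 1 \<in> sets lborel" 
      using measurable_sets[of norm "borel :: complex measure" borel N] by (auto simp: vimage_def)
    show "(\<integral>\<^sup>+z. indicator ({z::complex. norm z \<in> N} \<inter> ball 0 1) z \<partial>lborel)
      = (\<integral>\<^sup>+z. indicator N (norm (z::complex)) * indicator (ball 0 1) z \<partial>lborel)"
      by (rule nn_integral_cong) (simp split: split_indicator)
  qed
  also have "\<dots> = (\<integral>\<^sup>+s. indicator N s * (ennreal (2 * pi * s) * indicator {0..1} s) \<partial>lborel)"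
    by (rule nn_integral_radial) simp
  also have "\<dots> = (\<integral>\<^sup>+s. 0 \<partial>(lborel :: real measure))"
    using AE_not_in[OF assms] by (intro nn_integral_cong_AE) (auto elim!: eventually_mono)
  finally show ?thesis by (auto simp: null_sets_def)
qed

lemma AE_weight_norm:
  "AE z in lborel. z \<in> ball (0::complex) 1 \<longrightarrow> \<omega> (norm z) = w (norm z)"
proof -
  obtain N where N': "{s \<in> space lborel. indicator {0..<1} s * \<omega> s \<noteq> w s} \<subseteq> N" "emeasure lborel N = 0" "N \<in> sets lborel"
    by (rule AE_E[OF w_AE])
  then have N: "N \<in> null_sets lborel" "{s \<in> space lborel. indicator {0..<1} s * \<omega> s \<noteq> w s} \<subseteq> N"
    by (auto simp: null_sets_def)
  show ?thesis
  proof (rule AE_I'[OF null_sets_norm[OF N(1)]])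
    show "{z \<in> space lborel. \<not> (z \<in> ball (0::complex) 1 \<longrightarrow> \<omega> (norm z) = w (norm z))} \<subseteq> {z. norm z \<in> N} \<inter> ball 0 1"
      using N(2) by (fastforce split: split_indicator)
  qed
qed

lemma A1_integrand:
  assumes f: "f holomorphic_on ball 0 1"
  defines "F \<equiv> \<lambda>z. indicator (ball 0 1) z *\<^sub>R (norm (f z) * \<omega> (norm z))"
  shows "F \<in> borel_measurable lebesgue" "AE z in lebesgue. 0 \<le> F z"
    "(\<integral>\<^sup>+z. ennreal (F z) \<partial>lebesgue) = (\<integral>\<^sup>+s. ennreal (s * M1 f s) \<partial>wmeas w)"
proof -
  note w_measurable [measurable]
  define h where "h z = indicator (ball 0 1) z *\<^sub>R norm (f z)" for z
  have h [measurable]: "h \<in> borel_measurable borel"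
    unfolding h_def[abs_def]
    by (intro borel_measurable_continuous_on_indicator continuous_intros holomorphic_on_imp_continuous_on f) simp
  have h0: "0 \<le> h z" for z by (simp add: h_def)
  define G where "G z = h z * w (norm z)" for z
  have G [measurable]: "G \<in> borel_measurable borel" unfolding G_def[abs_def] by simp
  have GF: "AE z in lborel. G z = F z"
    using AE_weight_norm by eventually_elim (auto simp: G_def F_def h_def split: split_indicator)
  then have GF': "AE z in lebesgue. G z = F z" by (rule AE_completion)
  show "F \<in> borel_measurable lebesgue"
    by (rule borel_measurable_AE[OF _ GF']) (simp add: measurable_completion)
  show "AE z in lebesgue. 0 \<le> F z"
    using GF' by eventually_elim (metis G_def h0 w_nonneg mult_nonneg_nonneg)
  have "(\<integral>\<^sup>+z. ennreal (F z) \<partial>lebesgue) = (\<integral>\<^sup>+z. ennreal (F z) \<partial>lborel)" by (rule nn_integral_completion)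
  also have "\<dots> = (\<integral>\<^sup>+z. ennreal (G z) * indicator (ball 0 1) z \<partial>lborel)"
    using GF by (intro nn_integral_cong_AE) (auto elim!: eventually_mono simp: G_def h_def split: split_indicator)
  also have "\<dots> = (\<integral>\<^sup>+s. (\<integral>\<^sup>+\<theta>. ennreal (G (of_real s * cis \<theta>)) * indicator {0..2*pi} \<theta> \<partial>lborel)
          * (ennreal s * indicator {0..1} s) \<partial>lborel)"
    by (rule nn_integral_polar) simp
  also have "\<dots> = (\<integral>\<^sup>+s. ennreal (w s) * ennreal (s * M1 f s) \<partial>lborel)"
  proof (rule nn_integral_cong)
    fix s :: real
    show "(\<integral>\<^sup>+\<theta>. ennreal (G (of_real s * cis \<theta>)) * indicator {0..2*pi} \<theta> \<partial>lborel) * (ennreal s * indicator {0..1} s)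
      = ennreal (w s) * ennreal (s * M1 f s)"
    proof (cases "s \<in> {0..<1}")
      case True
      have c: "continuous_on {0..2*pi} (\<lambda>t. norm (f (of_real s * cis t)))"
        using True by (intro continuous_circle[of "\<lambda>z. norm (f z)"] continuous_intros holomorphic_on_imp_continuous_on f) auto
      have "(\<integral>\<^sup>+\<theta>. ennreal (G (of_real s * cis \<theta>)) * indicator {0..2*pi} \<theta> \<partial>lborel)
        = (\<integral>\<^sup>+\<theta>. ennreal (w s) * (ennreal (norm (f (of_real s * cis \<theta>))) * indicator {0..2*pi} \<theta>) \<partial>lborel)"
        using True by (intro nn_integral_cong)
          (auto simp: G_def h_def norm_mult ennreal_mult'' mult_ac w_nonneg split: split_indicator)
      also have "\<dots> = ennreal (w s) * (\<integral>\<^sup>+\<theta>. (ennreal (norm (f (of_real s * cis \<theta>))) * indicator {0..2*pi} \<theta>) \<partial>lborel)"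
      proof (rule nn_integral_cmult)
        have "(\<lambda>\<theta>. ennreal (indicat_real {0..2*pi} \<theta> *\<^sub>R norm (f (of_real s * cis \<theta>)))) \<in> borel_measurable lborel"
          using borel_measurable_continuous_on_indicator[OF _ c] by simp
        also have "(\<lambda>\<theta>. ennreal (indicat_real {0..2*pi} \<theta> *\<^sub>R norm (f (of_real s * cis \<theta>))))
          = (\<lambda>\<theta>. ennreal (norm (f (of_real s * cis \<theta>))) * indicator {0..2*pi} \<theta>)"
          by (auto simp: fun_eq_iff split: split_indicator)
        finally show "(\<lambda>\<theta>. ennreal (norm (f (of_real s * cis \<theta>))) * indicator {0..2*pi} \<theta>) \<in> borel_measurable lborel" .
      qed
      also have "(\<integral>\<^sup>+\<theta>. (ennreal (norm (f (of_real s * cis \<theta>))) * indicator {0..2*pi} \<theta>) \<partial>lborel) = ennreal (M1 f s)"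
        using True by (subst nn_integral_continuous_Icc[OF c]) (auto simp: M1_def circ_def)
      finally show ?thesis
        using True M1_nonneg[OF f] by (simp add: ennreal_mult mult_ac)
    next
      case False
      have "M1 f s = 0" by (simp only: M1_def if_not_P[OF False])
      \<comment> \<open>The polar formula runs over the closed interval; at s = 1 the factor
        \<open>w\<close> vanishes.\<close>
      moreover have "(\<integral>\<^sup>+\<theta>. ennreal (G (of_real s * cis \<theta>)) * indicator {0..2*pi} \<theta> \<partial>lborel) = 0" if "s = 1"
        using that by (simp add: G_def w_outside norm_mult)
      ultimately show ?thesis using False by (cases "s = 1") (auto split: split_indicator)
    qed
  qed
  also have "\<dots> = (\<integral>\<^sup>+s. ennreal (s * M1 f s) \<partial>wmeas w)"
    unfolding wmeas_def using borel_measurable_M1[OF f] by (subst nn_integral_density) auto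
  finally show "(\<integral>\<^sup>+z. ennreal (F z) \<partial>lebesgue) = (\<integral>\<^sup>+s. ennreal (s * M1 f s) \<partial>wmeas w)" .
qed

lemma AE_s_M1_nonneg:
  assumes "f holomorphic_on ball 0 1"
  shows "AE s in wmeas w. 0 \<le> s * M1 f s"
  using AE_wmeas by eventually_elim (use M1_nonneg[OF assms] in auto)

lemma A1_iff: "f \<in> A1 \<omega> \<longleftrightarrow> f holomorphic_on ball 0 1 \<and> integrable (wmeas w) (\<lambda>s. s * M1 f s)"
proof (cases "f holomorphic_on ball 0 1")
  case True
  note A = A1_integrand[OF True]
  have "set_integrable lebesgue (ball 0 1) (\<lambda>z. norm (f z) * \<omega> (norm z)) \<longleftrightarrow>
     (\<integral>\<^sup>+s. ennreal (s * M1 f s) \<partial>wmeas w) < \<infinity>"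
    unfolding set_integrable_def integrable_iff_bounded A(3)[symmetric]
    using A(1,2) by (auto intro!: arg_cong[of _ _ "\<lambda>x. x < top"] nn_integral_cong_AE elim!: eventually_mono)
  also have "\<dots> \<longleftrightarrow> integrable (wmeas w) (\<lambda>s. s * M1 f s)"
    unfolding integrable_iff_bounded using borel_measurable_M1[OF True] AE_s_M1_nonneg[OF True]
    by (auto intro!: arg_cong[of _ _ "\<lambda>x. x < top"] nn_integral_cong_AE elim!: eventually_mono)
  finally show ?thesis using True by (simp add: A1_def)
qed (simp add: A1_def)

lemma A1_norm_eq:
  assumes f: "f holomorphic_on ball 0 1"
  shows "A1_norm \<omega> f = (LINT s|wmeas w. s * M1 f s) / pi"
proof -
  note A = A1_integrand[OF f]
  have "(LINT z:ball 0 1|lebesgue. norm (f z) * \<omega> (norm z)) = (LINT s|wmeas w. s * M1 f s)"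
    unfolding set_lebesgue_integral_def
    by (subst integral_eq_nn_integral[OF A(1,2)], subst A(3), subst integral_eq_nn_integral)
       (use borel_measurable_M1[OF f] AE_s_M1_nonneg[OF f] in auto)
  then show ?thesis by (simp add: A1_norm_def)
qed

end

section \<open>Moments and tails\<close>

text \<open>From here on the weight enters only through the measure \<nu>, with the doubling
  condition stated for its tails.\<close>

locale doubling_measure = finite_measure \<nu> for \<nu> :: "real measure" +
  fixes C :: real
  assumes sets_nu [simp, measurable_cong]: "sets \<nu> = sets borel"
    and AE_nu: "AE s in \<nu>. s \<in> {0..<1}"
    and tail_pos: "\<And>r. r < 1 \<Longrightarrow> 0 < measure \<nu> {r..}"
    and C_ge1: "1 \<le> C"
    and tail_doubling: "\<And>r. 0 \<le> r \<Longrightarrow> r < 1 \<Longrightarrow> measure \<nu> {r..} \<le> C * measure \<nu> {(1 + r) / 2..}"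
begin

definition T :: "real \<Rightarrow> real" where "T r = measure \<nu> {r..}"

definition mom :: "nat \<Rightarrow> real" where "mom n = (LINT s|\<nu>. s ^ n)"

lemma AE_nuI: "(\<And>s. 0 \<le> s \<Longrightarrow> s < 1 \<Longrightarrow> P s) \<Longrightarrow> AE s in \<nu>. P s"
  using AE_nu by eventually_elim auto

lemma integrable_indicator_nu [simp]: "A \<in> sets borel \<Longrightarrow> integrable \<nu> (indicat_real A)"
  by (intro integrable_real_indicator) (auto simp: less_top[symmetric])

lemma T_pos: "r < 1 \<Longrightarrow> 0 < T r" and T_nonneg: "0 \<le> T r"
  by (simp_all add: T_def tail_pos)

lemma T_antimono: "r \<le> s \<Longrightarrow> T s \<le> T r"
  unfolding T_def by (rule finite_measure_mono) auto

lemma T_measurable [measurable]: "T \<in> borel_measurable borel"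
proof -
  have "(\<lambda>x. - T x) \<in> borel_measurable borel"
    by (rule borel_measurable_mono) (auto intro!: monoI T_antimono)
  then have "(\<lambda>x. - (- T x)) \<in> borel_measurable borel" by (rule borel_measurable_uminus)
  then show ?thesis by simp
qed

lemma T_total: "r \<le> 0 \<Longrightarrow> T r = measure \<nu> UNIV"
  unfolding T_def by (rule finite_measure_eq_AE) (auto intro!: AE_nuI)

lemma T_1: "T 1 = 0"
proof -
  have "measure \<nu> {1..} = measure \<nu> {}"
    by (rule finite_measure_eq_AE) (auto intro!: AE_nuI)
  then show ?thesis by (simp add: T_def)
qed

lemma integrable_pow: "integrable \<nu> (\<lambda>s. s ^ n)"
  by (rule integrable_const_bound[of _ 1])
     (auto intro!: AE_nuI simp: power_abs power_le_one)

lemma mom_antimono: "m \<le> n \<Longrightarrow> mom n \<le> mom m"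
  unfolding mom_def
  by (rule integral_mono_AE[OF integrable_pow integrable_pow])
     (auto intro!: AE_nuI intro: power_decreasing)

lemma mom_ge:
  assumes "0 \<le> r"
  shows "r ^ n * T r \<le> mom n"
proof -
  have "r ^ n * T r = (LINT s|\<nu>. r ^ n * indicator {r..} s)"
    unfolding T_def by simp
  also have "\<dots> \<le> mom n" unfolding mom_def
  proof (rule integral_mono_AE[OF _ integrable_pow])
    show "AE s in \<nu>. r ^ n * indicator {r..} s \<le> s ^ n"
      using AE_nu by eventually_elim (use assms in \<open>auto split: split_indicator intro: power_mono\<close>)
  qed (auto intro!: integrable_mult_right)
  finally show ?thesis .
qed

lemma mom_pos: "0 < mom n"
proof -
  have "0 < (1/2) ^ n * T (1/2)" by (simp add: T_pos)
  also have "\<dots> \<le> mom n" by (rule mom_ge) simp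
  finally show ?thesis .
qed

text \<open>A general h lets the moments of orders n and 2 n be compared with one density: h s = s
  for the first, h s = s^2 for the second.\<close>

lemma layer_cake:
  assumes [measurable]: "h \<in> borel_measurable borel" and h: "AE s in \<nu>. 0 \<le> h s \<and> h s \<le> 1" and n: "0 < n"
  shows "(\<integral>\<^sup>+s. ennreal (h s ^ n) \<partial>\<nu>)
    = (\<integral>\<^sup>+t. ennreal (real n * t ^ (n - 1)) * indicator {0..1} t * emeasure \<nu> {s. t \<le> h s} \<partial>lborel)"
proof -
  interpret P: pair_sigma_finite \<nu> lborel ..
  have [measurable]: "Measurable.pred (\<nu> \<Otimes>\<^sub>M lborel) (\<lambda>p. snd p \<le> h (fst p))" by measurable
  have "(\<integral>\<^sup>+s. ennreal (h s ^ n) \<partial>\<nu>)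
     = (\<integral>\<^sup>+s. (\<integral>\<^sup>+t. ennreal (real n * t ^ (n - 1)) * indicator {0..1} t * indicator {s. t \<le> h s} s \<partial>lborel) \<partial>\<nu>)"
  proof (rule nn_integral_cong_AE)
    show "AE s in \<nu>. ennreal (h s ^ n)
      = (\<integral>\<^sup>+t. ennreal (real n * t ^ (n - 1)) * indicator {0..1} t * indicator {s. t \<le> h s} s \<partial>lborel)"
      using h
    proof eventually_elim
      fix s assume s: "0 \<le> h s \<and> h s \<le> 1"
      have "(\<integral>\<^sup>+t. ennreal (real n * t ^ (n - 1)) * indicator {0..1} t * indicator {s. t \<le> h s} s \<partial>lborel)
        = (\<integral>\<^sup>+t. ennreal (real n * t ^ (n - 1)) * indicator {0..h s} t \<partial>lborel)"
        using s by (intro nn_integral_cong) (auto split: split_indicator)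
      also have "\<dots> = ennreal (h s ^ n - 0 ^ n)"
        by (rule nn_integral_FTC_Icc)
           (use s in \<open>auto intro!: derivative_eq_intros simp: has_real_derivative_iff_has_vector_derivative[symmetric]\<close>)
      finally show "ennreal (h s ^ n) = (\<integral>\<^sup>+t. ennreal (real n * t ^ (n - 1)) * indicator {0..1} t * indicator {s. t \<le> h s} s \<partial>lborel)"
        using n by (simp add: zero_power)
    qed
  qed
  also have "\<dots> = (\<integral>\<^sup>+t. (\<integral>\<^sup>+s. ennreal (real n * t ^ (n - 1)) * indicator {0..1} t * indicator {s. t \<le> h s} s \<partial>\<nu>) \<partial>lborel)"
    by (rule P.Fubini'[symmetric]) (simp add: indicator_def)
  also have "\<dots> = (\<integral>\<^sup>+t. ennreal (real n * t ^ (n - 1)) * indicator {0..1} t * emeasure \<nu> {s. t \<le> h s} \<partial>lborel)"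
    by (intro nn_integral_cong) (simp add: nn_integral_cmult)
  finally show ?thesis .
qed

text \<open>Both moments are layer-cake integrals with the same density \<open>n t\<^sup>n\<^sup>-\<^sup>1\<close>, of the tails at
  \<open>t\<close> and at \<open>sqrt t \<le> (1 + t) / 2\<close>.\<close>

lemma mom_doubling:
  assumes "0 < n"
  shows "mom n \<le> C * mom (2 * n)"
proof -
  have nn: "ennreal (LINT s|\<nu>. s ^ k) = (\<integral>\<^sup>+s. ennreal (s ^ k) \<partial>\<nu>)" for k
    by (rule nn_integral_eq_integral[symmetric, OF integrable_pow]) (auto intro!: AE_nuI)
  have "ennreal (mom n) = (\<integral>\<^sup>+t. ennreal (real n * t ^ (n - 1)) * indicator {0..1} t * emeasure \<nu> {s. t \<le> s} \<partial>lborel)"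
    unfolding mom_def nn by (rule layer_cake[OF _ _ assms]) (auto intro!: AE_nuI)
  also have "\<dots> \<le> (\<integral>\<^sup>+t. ennreal C * (ennreal (real n * t ^ (n - 1)) * indicator {0..1} t * emeasure \<nu> {s. t \<le> s\<^sup>2}) \<partial>lborel)"
  proof (rule nn_integral_mono)
    fix t :: real
    have "emeasure \<nu> {s. t \<le> s} \<le> ennreal C * emeasure \<nu> {s. t \<le> s\<^sup>2}" if t: "0 \<le> t" "t \<le> 1"
    proof (cases "t = 1")
      case True
      then have "emeasure \<nu> {s. t \<le> s} = ennreal (T 1)"
        by (simp add: T_def emeasure_eq_measure atLeast_def)
      then show ?thesis by (simp add: T_1)
    next
      case False
      have "sqrt t \<le> (1 + t) / 2" using arith_geo_mean_sqrt[of 1 t] t by simp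
      then have sub: "{(1 + t) / 2..} \<subseteq> {s. t \<le> s\<^sup>2}"
        using t by (auto intro: sqrt_le_D)
      have "measure \<nu> {t..} \<le> C * measure \<nu> {(1 + t) / 2..}" using t False by (intro tail_doubling) auto
      also have "\<dots> \<le> C * measure \<nu> {s. t \<le> s\<^sup>2}"
        using C_ge1 sub by (intro mult_left_mono finite_measure_mono) auto
      finally show ?thesis using C_ge1
        by (simp add: emeasure_eq_measure atLeast_def flip: ennreal_mult)
    qed
    then show "ennreal (real n * t ^ (n - 1)) * indicator {0..1} t * emeasure \<nu> {s. t \<le> s}
      \<le> ennreal C * (ennreal (real n * t ^ (n - 1)) * indicator {0..1} t * emeasure \<nu> {s. t \<le> s\<^sup>2})"
      by (auto simp: mult.left_commute[of "ennreal C"] intro!: mult_left_mono split: split_indicator)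
  qed
  also have "\<dots> = ennreal C * (\<integral>\<^sup>+t. (ennreal (real n * t ^ (n - 1)) * indicator {0..1} t * emeasure \<nu> {s. t \<le> s\<^sup>2}) \<partial>lborel)"
  proof (rule nn_integral_cmult)
    have "(\<lambda>t. measure \<nu> {s. t \<le> s\<^sup>2}) \<in> borel_measurable borel"
    proof -
      have "(\<lambda>t. - measure \<nu> {s. t \<le> s\<^sup>2}) \<in> borel_measurable borel"
        by (rule borel_measurable_mono) (auto intro!: monoI finite_measure_mono)
      then have "(\<lambda>t. - (- measure \<nu> {s. t \<le> s\<^sup>2})) \<in> borel_measurable borel" by (rule borel_measurable_uminus)
      then show ?thesis by simp
    qed
    then show "(\<lambda>t. ennreal (real n * t ^ (n - 1)) * indicator {0..1} t * emeasure \<nu> {s. t \<le> s\<^sup>2}) \<in> borel_measurable lborel"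
      by (simp add: emeasure_eq_measure)
  qed
  also have "(\<integral>\<^sup>+t. (ennreal (real n * t ^ (n - 1)) * indicator {0..1} t * emeasure \<nu> {s. t \<le> s\<^sup>2}) \<partial>lborel)
     = (\<integral>\<^sup>+s. ennreal ((s\<^sup>2) ^ n) \<partial>\<nu>)"
    by (rule layer_cake[symmetric, OF _ _ assms]) (auto intro!: AE_nuI simp: power_le_one)
  also have "\<dots> = ennreal (mom (2 * n))" unfolding mom_def nn by (simp add: power_mult)
  finally show ?thesis using C_ge1 mom_pos[of "2 * n"]
    by (simp add: ennreal_le_iff flip: ennreal_mult)
qed

section \<open>Growth and variation of the reciprocal squared moments\<close>

lemma Suc_times_power_le: "0 \<le> x \<Longrightarrow> x \<le> 1 \<Longrightarrow> real (Suc m) * x ^ m * (1 - x) \<le> (1::real)"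
proof -
  assume x: "0 \<le> x" "x \<le> 1"
  have "real (Suc m) * x ^ m = (\<Sum>i<Suc m. x ^ m)" by simp
  also have "\<dots> \<le> (\<Sum>i<Suc m. x ^ i)" using x by (intro sum_mono power_decreasing) auto
  finally have "real (Suc m) * x ^ m * (1 - x) \<le> (\<Sum>i<Suc m. x ^ i) * (1 - x)"
    using x by (intro mult_right_mono) auto
  also have "\<dots> = 1 - x ^ Suc m" using one_diff_power_eq[of x "Suc m"] by (simp add: mult.commute)
  also have "\<dots> \<le> 1" using x by simp
  finally show ?thesis .
qed

text \<open>The power is split in two: (k + 1) s^k (1 - s^2) is at most 2, and the factor s^(k+1)
  remains. It gives a moment of half the order, which doubling brings back to order 2 k + 2.\<close>

lemma mom_diff: "real (k + 1) * (mom (2 * k + 1) - mom (2 * k + 3)) \<le> 2 * mom (k + 1)"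
proof -
  have "real (k + 1) * (mom (2 * k + 1) - mom (2 * k + 3)) = (LINT s|\<nu>. real (k + 1) * (s ^ (2 * k + 1) - s ^ (2 * k + 3)))"
    unfolding mom_def by (subst Bochner_Integration.integral_diff[OF integrable_pow integrable_pow, symmetric]) simp
  also have "\<dots> \<le> (LINT s|\<nu>. 2 * s ^ (k + 1))"
  proof (rule integral_mono_AE)
    show "AE s in \<nu>. real (k + 1) * (s ^ (2 * k + 1) - s ^ (2 * k + 3)) \<le> 2 * s ^ (k + 1)"
      using AE_nu
    proof eventually_elim
      fix s :: real assume s: "s \<in> {0..<1}"
      \<comment> \<open>Half of k, so that s^k is bounded by a power of s^2 and matches the factor 1
        - s^2.\<close>
      define m where "m = k div 2"
      have s2: "0 \<le> s\<^sup>2" "s\<^sup>2 \<le> 1" using s by (auto simp: power_le_one)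
      have k: "real (k + 1) \<le> 2 * real (Suc m)" by (simp add: m_def)
      have "s ^ k \<le> s ^ (2 * m)" using s by (intro power_decreasing) (auto simp: m_def)
      also have "\<dots> = (s\<^sup>2) ^ m" by (simp add: power_mult)
      finally have "real (k + 1) * s ^ k * (1 - s\<^sup>2) \<le> 2 * real (Suc m) * (s\<^sup>2) ^ m * (1 - s\<^sup>2)"
        using k s s2 by (intro mult_right_mono mult_mono) auto
      also have "\<dots> = 2 * (real (Suc m) * (s\<^sup>2) ^ m * (1 - s\<^sup>2))" by simp
      also have "\<dots> \<le> 2 * 1" by (intro mult_left_mono Suc_times_power_le[OF s2]) simp
      also have "\<dots> = 2" by simp
      finally have "(real (k + 1) * s ^ k * (1 - s\<^sup>2)) * s ^ (k + 1) \<le> 2 * s ^ (k + 1)"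
        using s by (intro mult_right_mono) auto
      also have "(real (k + 1) * s ^ k * (1 - s\<^sup>2)) * s ^ (k + 1) = real (k + 1) * (s ^ (2 * k + 1) - s ^ (2 * k + 3))"
        by (simp add: algebra_simps power_add[symmetric] numeral_eq_Suc mult_2)
      finally show "real (k + 1) * (s ^ (2 * k + 1) - s ^ (2 * k + 3)) \<le> 2 * s ^ (k + 1)" .
    qed
  qed (intro integrable_mult_right Bochner_Integration.integrable_diff integrable_pow)+
  also have "\<dots> = 2 * mom (k + 1)" by (simp add: mom_def)
  finally show ?thesis .
qed

text \<open>The multiplier that undoes the squared moments of the pairing.\<close>

definition m :: "nat \<Rightarrow> real" where "m k = 1 / (mom (2 * k + 1))\<^sup>2"

lemma m_pos: "0 < m k" using mom_pos[of "2 * k + 1"] by (simp add: m_def)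

lemma m_mono_Suc: "m k \<le> m (Suc k)"
  unfolding m_def using mom_pos[of "2 * Suc k + 1"]
  by (intro divide_left_mono power_mono mom_antimono) (auto intro!: mult_pos_pos mom_pos zero_less_power)

lemma m_diff: "real (k + 1) * (m (Suc k) - m k) \<le> 4 * C * m (Suc k)"
proof -
  define a where "a = mom (2 * k + 1)"
  define b where "b = mom (2 * k + 3)"
  have ab: "0 < b" "b \<le> a" using mom_pos mom_antimono by (auto simp: a_def b_def)
  have "mom (k + 1) \<le> C * mom (2 * (k + 1))" by (rule mom_doubling) simp
  also have "\<dots> \<le> C * a" unfolding a_def using C_ge1 by (intro mult_left_mono mom_antimono) auto
  finally have c: "mom (k + 1) \<le> C * a" .
  have "m (Suc k) - m k = (a + b) * (a - b) / (a\<^sup>2 * b\<^sup>2)"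
  proof -
    have e: "2 * Suc k + 1 = 2 * k + 3" by simp
    show ?thesis unfolding m_def e a_def[symmetric] b_def[symmetric]
      using ab by (simp add: field_simps power2_eq_square)
  qed
  then have "real (k + 1) * (m (Suc k) - m k) = (a + b) * (real (k + 1) * (a - b)) / (a\<^sup>2 * b\<^sup>2)" by simp
  also have "\<dots> \<le> (2 * a) * (2 * (C * a)) / (a\<^sup>2 * b\<^sup>2)"
  proof -
    have d: "real (k + 1) * (a - b) \<le> 2 * (C * a)" using mom_diff[of k] c by (simp add: a_def b_def)
    show ?thesis using ab by (intro divide_right_mono mult_mono[OF _ d]) auto
  qed
  also have "\<dots> = 4 * C * (1 / b\<^sup>2)" using ab by (simp add: field_simps power2_eq_square)
  also have "1 / b\<^sup>2 = m (Suc k)" by (simp add: m_def b_def numeral_3_eq_3)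
  finally show ?thesis .
qed

text \<open>Half of r^k absorbs 1 + (k + 1) (1 - r); the other half has to beat the squared moment.
  Three doublings and the tail bound \<open>mom_ge\<close> give C^3 mom (2 k + 3) \<ge> r^i T r with
  i about k / 4, and r^(2 i) is paid for by the remaining r^(k / 2). In C^8, six factors come from
  the squared doublings and two from passing to \<open>r'\<close>; 48 is 3 * 16.\<close>

lemma m_growth:
  assumes r: "0 \<le> r" "r < 1"
  shows "(1 + real (k + 1) * (1 - r)) * r ^ k * m (Suc k) \<le> 48 * C ^ 8 / (T r)\<^sup>2"
proof -
  define r' where "r' = max r (1/2)"
  have r': "r \<le> r'" "1/2 \<le> r'" "r' < 1" "0 \<le> r'" using r by (auto simp: r'_def)
  define j where "j = k - k div 2"
  \<comment> \<open>The offset 2 ensures 8 i \<ge> 2 k + 3 after three doublings, while 2 i \<le> j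
    + 4 still holds.\<close>
  define i where "i = k div 4 + 2"
  have jk: "j + k div 2 = k" by (simp add: j_def)
  have "real (k + 1) * r ^ (k div 2) * (1 - r) \<le> 2 * real (Suc (k div 2)) * r ^ (k div 2) * (1 - r)"
    using r by (intro mult_right_mono) auto
  also have "\<dots> = 2 * (real (Suc (k div 2)) * r ^ (k div 2) * (1 - r))" by simp
  also have "\<dots> \<le> 2 * 1" using r by (intro mult_left_mono Suc_times_power_le) auto
  also have "\<dots> = 2" by simp
  finally have "real (k + 1) * r ^ (k div 2) * (1 - r) \<le> 2" .
  moreover have "r ^ (k div 2) \<le> 1" using r by (intro power_le_one) auto
  ultimately have "(1 + real (k + 1) * (1 - r)) * r ^ (k div 2) \<le> 3" by (simp add: algebra_simps)
  then have "r ^ j * ((1 + real (k + 1) * (1 - r)) * r ^ (k div 2)) \<le> r ^ j * 3" using r by (intro mult_left_mono) auto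
  also have "\<dots> \<le> r' ^ j * 3" using r r' by (intro mult_right_mono power_mono) auto
  finally have 1: "(1 + real (k + 1) * (1 - r)) * r ^ k \<le> 3 * r' ^ j"
    using jk power_add[of r j "k div 2"] by (simp add: mult_ac)
  have Tr: "T r \<le> C * T r'"
  proof (cases "r \<le> 1/2")
    case True
    have "T r \<le> T 0" using r by (intro T_antimono) auto
    also have "\<dots> \<le> C * T (1/2)" using tail_doubling[of 0] by (simp add: T_def)
    finally show ?thesis using True by (simp add: r'_def max_def)
  next
    case False
    then have "r' = r" by (simp add: r'_def)
    then show ?thesis using C_ge1 T_nonneg[of r] by (simp add: mult_le_cancel_right1)
  qed
  have "mom i \<le> C * mom (2 * i)" by (rule mom_doubling) (simp add: i_def)
  also have "\<dots> \<le> C * (C * mom (2 * (2 * i)))" using C_ge1 by (intro mult_left_mono mom_doubling) (auto simp: i_def)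
  also have "\<dots> \<le> C * (C * (C * mom (2 * (2 * (2 * i)))))" using C_ge1 by (intro mult_left_mono mom_doubling) (auto simp: i_def)
  also have "\<dots> \<le> C * (C * (C * mom (2 * k + 3)))"
    using C_ge1 by (intro mult_left_mono mom_antimono) (auto simp: i_def)
  also have "\<dots> = C ^ 3 * mom (2 * k + 3)" by (simp add: power3_eq_cube)
  finally have "r' ^ i * T r' \<le> C ^ 3 * mom (2 * k + 3)"
    using mom_ge[OF r'(4), of i] by linarith
  then have "(r' ^ i * T r')\<^sup>2 \<le> (C ^ 3 * mom (2 * k + 3))\<^sup>2"
    using r' T_nonneg by (intro power_mono mult_nonneg_nonneg) auto
  then have 2: "r' ^ (2 * i) * (T r')\<^sup>2 \<le> C ^ 6 * (mom (2 * k + 3))\<^sup>2"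
    by (simp add: power_mult_distrib power_mult[symmetric] mult.commute)
  have "1 / 16 = (1/2 :: real) ^ 4" by (simp add: power_one_over)
  also have "\<dots> \<le> r' ^ 4" using r' by (intro power_mono) auto
  finally have "r' ^ j * (1 / 16) \<le> r' ^ j * r' ^ 4" using r' by (intro mult_left_mono) auto
  also have "\<dots> = r' ^ (j + 4)" by (simp add: power_add)
  also have "\<dots> \<le> r' ^ (2 * i)" using r' by (intro power_decreasing) (auto simp: i_def j_def)
  finally have 3: "r' ^ j \<le> 16 * r' ^ (2 * i)" by simp
  have "(T r)\<^sup>2 \<le> (C * T r')\<^sup>2" using Tr T_nonneg by (intro power_mono) auto
  then have "r' ^ j * (T r)\<^sup>2 \<le> (16 * r' ^ (2 * i)) * (C\<^sup>2 * (T r')\<^sup>2)"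
    using 3 r' by (intro mult_mono) (auto simp: power_mult_distrib)
  also have "\<dots> = 16 * C\<^sup>2 * (r' ^ (2 * i) * (T r')\<^sup>2)" by simp
  also have "\<dots> \<le> 16 * C\<^sup>2 * (C ^ 6 * (mom (2 * k + 3))\<^sup>2)" using 2 C_ge1 by (intro mult_left_mono) auto
  also have "\<dots> = 16 * C ^ 8 * (mom (2 * k + 3))\<^sup>2" by (simp add: power_add[symmetric])
  finally have "3 * r' ^ j * (T r)\<^sup>2 \<le> 48 * C ^ 8 * (mom (2 * k + 3))\<^sup>2" by simp
  then have "3 * r' ^ j / (mom (2 * k + 3))\<^sup>2 \<le> 48 * C ^ 8 / (T r)\<^sup>2"
    using T_pos[OF r(2)] mom_pos[of "2 * k + 3"] by (simp add: divide_simps)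
  moreover have "m (Suc k) = 1 / (mom (2 * k + 3))\<^sup>2" by (simp add: m_def numeral_3_eq_3)
  moreover have "(1 + real (k + 1) * (1 - r)) * r ^ k * m (Suc k) \<le> 3 * r' ^ j * m (Suc k)"
    using 1 m_pos[of "Suc k"] by (intro mult_right_mono) auto
  ultimately show ?thesis by simp
qed

definition B :: real where "B = 48 * C ^ 8 * (4 * C + 1)"

lemma B_pos: "0 < B" using C_ge1 by (simp add: B_def)

text \<open>These are the hypotheses of the locale \<open>atom\<close> on the circle of radius r.
  The increment splits into that of \<open>m\<close>, handled by \<open>m_diff\<close>, and that of
  r^k, whose factor 1 - r is the reason for the term (k + 1) (1 - r) in
  \<open>m_growth\<close>.\<close>

lemma multiplier_bounds:
  assumes r: "0 \<le> r" "r < 1"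
  shows "\<bar>m k * r ^ k\<bar> \<le> B / (T r)\<^sup>2"
    and "real (k + 1) * \<bar>m (Suc k) * r ^ Suc k - m k * r ^ k\<bar> \<le> B / (T r)\<^sup>2"
proof -
  note G = m_growth[OF r, of k]
  have T2: "0 < (T r)\<^sup>2" using T_pos[OF r(2)] by simp
  have Bge: "48 * C ^ 8 / (T r)\<^sup>2 \<le> B / (T r)\<^sup>2"
    using T2 C_ge1 by (intro divide_right_mono) (auto simp: B_def mult_le_cancel_left1)
  have rk: "0 \<le> r ^ k" using r by simp
  have pos: "0 \<le> real (k + 1) * (1 - r) * r ^ k * m (Suc k)" "0 \<le> r ^ k * m (Suc k)"
    using r m_pos[of "Suc k"] by simp_all
  have G1: "r ^ k * m (Suc k) \<le> 48 * C ^ 8 / (T r)\<^sup>2" "real (k + 1) * (1 - r) * r ^ k * m (Suc k) \<le> 48 * C ^ 8 / (T r)\<^sup>2"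
    using G pos by (auto simp: algebra_simps)
  have "m k * r ^ k \<le> m (Suc k) * r ^ k" using m_mono_Suc rk by (rule mult_right_mono)
  then show "\<bar>m k * r ^ k\<bar> \<le> B / (T r)\<^sup>2"
    using G1 Bge m_pos[of k] rk by (simp add: abs_mult mult.commute)
  have "m (Suc k) * r ^ Suc k - m k * r ^ k = r ^ k * (m (Suc k) - m k) - (1 - r) * r ^ k * m (Suc k)"
    by (simp add: algebra_simps)
  also have "\<bar>\<dots>\<bar> \<le> r ^ k * (m (Suc k) - m k) + (1 - r) * r ^ k * m (Suc k)"
  proof -
    have "0 \<le> r ^ k * (m (Suc k) - m k)" "0 \<le> (1 - r) * r ^ k * m (Suc k)"
      using rk r m_mono_Suc[of k] m_pos[of "Suc k"] by simp_all
    then show ?thesis by linarith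
  qed
  finally have "real (k + 1) * \<bar>m (Suc k) * r ^ Suc k - m k * r ^ k\<bar>
     \<le> real (k + 1) * (r ^ k * (m (Suc k) - m k) + (1 - r) * r ^ k * m (Suc k))"
    by (intro mult_left_mono) auto
  also have "\<dots> = r ^ k * (real (k + 1) * (m (Suc k) - m k)) + real (k + 1) * (1 - r) * r ^ k * m (Suc k)"
    by (simp add: algebra_simps)
  also have "\<dots> \<le> r ^ k * (4 * C * m (Suc k)) + real (k + 1) * (1 - r) * r ^ k * m (Suc k)"
    using mult_left_mono[OF m_diff[of k] rk] by simp
  also have "\<dots> = 4 * C * (r ^ k * m (Suc k)) + real (k + 1) * (1 - r) * r ^ k * m (Suc k)" by simp
  also have "\<dots> \<le> 4 * C * (48 * C ^ 8 / (T r)\<^sup>2) + 48 * C ^ 8 / (T r)\<^sup>2"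
    using G1 C_ge1 by (intro add_mono mult_left_mono) auto
  also have "\<dots> = B / (T r)\<^sup>2" by (simp add: B_def algebra_simps add_divide_distrib)
  finally show "real (k + 1) * \<bar>m (Suc k) * r ^ Suc k - m k * r ^ k\<bar> \<le> B / (T r)\<^sup>2" .
qed

section \<open>Integrals of inverse squares of tails\<close>

lemma measure_T_le:
  assumes "0 \<le> c"
  shows "measure \<nu> {s. T s \<le> c} \<le> c"
proof (cases "\<exists>n::nat. T (- real n) > c")
  case False
  then have "T (- real 0) \<le> c" by (meson not_le)
  then have "measure \<nu> UNIV \<le> c" using T_total[of 0] by simp
  moreover have "measure \<nu> {s. T s \<le> c} \<le> measure \<nu> UNIV" by (intro finite_measure_mono) auto
  ultimately show ?thesis by simp
next
  case True
  define X where "X = {s. T s \<le> c}"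
  have X1: "1 \<in> X" using assms by (simp add: X_def T_1)
  obtain n where n: "T (- real n) > c" using True by blast
  have lb: "- real n \<le> s" if "s \<in> X" for s
    using T_antimono[of s "- real n"] that n by (fastforce simp: X_def)
  have bdd: "bdd_below X" by (rule bdd_belowI[of _ "- real n"]) (rule lb)
  \<comment> \<open>\<open>X\<close> is a half-line starting at \<open>a\<close>. If it contains
    \<open>a\<close>, its measure is T a; otherwise it is the increasing union of closed half-lines
    inside \<open>X\<close>, each of measure at most c.\<close>
  define a where "a = Inf X"
  have up: "t \<in> X" if "s \<in> X" "s \<le> t" for s t using T_antimono[OF that(2)] that(1) by (simp add: X_def)
  show ?thesis
  proof (cases "a \<in> X")
    case True
    have "X = {a..}"
      using up[OF True] cInf_lower[OF _ bdd] by (auto simp: a_def)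
    then have "measure \<nu> X = T a" by (simp add: T_def)
    also have "\<dots> \<le> c" using True by (simp add: X_def)
    finally show ?thesis by (simp add: X_def)
  next
    case False
    have X: "X = {a<..}"
    proof (intro set_eqI iffI)
      fix x assume "x \<in> X" then show "x \<in> {a<..}"
        using cInf_lower[OF _ bdd, of x] False by (cases "x = a") (auto simp: a_def)
    next
      fix x assume "x \<in> {a<..}"
      then obtain s where "s \<in> X" "s < x" using cInf_lessD[of X x] X1 by (auto simp: a_def)
      then show "x \<in> X" using up by (meson less_imp_le)
    qed
    define A where "A n = {a + 1 / real (Suc n)..}" for n
    have "(\<lambda>n. measure \<nu> (A n)) \<longlonglongrightarrow> measure \<nu> (\<Union>n. A n)"
    proof (rule finite_Lim_measure_incseq)
      show "incseq A"
        unfolding A_def by (intro incseq_SucI) (auto simp: field_simps)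
    qed (auto simp: A_def)
    moreover have "(\<Union>n. A n) = X"
    proof (unfold X, intro set_eqI iffI)
      fix x assume "x \<in> {a<..}"
      then obtain n where "1 / real (Suc n) < x - a" using nat_approx_posE[of "x - a"] by auto
      then show "x \<in> (\<Union>n. A n)" by (auto simp: A_def intro!: exI[of _ n])
    qed (auto simp: A_def intro: less_le_trans[rotated])
    moreover have "measure \<nu> (A n) \<le> c" for n
    proof -
      have "a + 1 / real (Suc n) \<in> X" unfolding X by simp
      then show ?thesis by (simp add: X_def A_def T_def)
    qed
    ultimately show ?thesis unfolding X_def[symmetric] by (intro LIMSEQ_le_const2) auto
  qed
qed

text \<open>Dyadic decomposition by the values of T, in place of the substitution \<nu> = -dT. The
  shell c < T \<le> 2 c has measure at most 2 c and contributes at most 2 / c; the rest contributes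
  at most 4 / (2 c) by induction, which ends once c reaches T 0.\<close>

lemma integral_inverse_T_sq:
  assumes "0 < c"
  shows "T 0 \<le> 2 ^ n * c \<Longrightarrow> (LINT s|\<nu>. indicator {s. c < T s} s / (T s)\<^sup>2) \<le> 4 / c"
  using assms
proof (induction n arbitrary: c)
  case 0
  have "(LINT s|\<nu>. indicator {s. c < T s} s / (T s)\<^sup>2) = (LINT s|\<nu>. 0)"
  proof (rule integral_cong_AE)
    show "AE s in \<nu>. indicator {s. c < T s} s / (T s)\<^sup>2 = (0::real)"
      using AE_nu by eventually_elim (use 0 T_antimono[of 0] in \<open>force split: split_indicator\<close>)
  qed auto
  then show ?case using 0 by simp
next
  case (Suc n)
  have I: "integrable \<nu> (\<lambda>s. indicator {s. b < T s} s / (T s)\<^sup>2)" if "0 < b" for b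
  proof (rule integrable_const_bound[of _ "1 / b\<^sup>2"])
    show "AE s in \<nu>. norm (indicator {s. b < T s} s / (T s)\<^sup>2) \<le> 1 / b\<^sup>2"
      using that by (intro AE_I2) (auto split: split_indicator intro!: frac_le power_mono)
  qed measurable
  have J: "integrable \<nu> (\<lambda>s. 1 / c\<^sup>2 * indicator {s. T s \<le> 2 * c} s)"
    by (intro integrable_mult_right) auto
  have "(LINT s|\<nu>. indicator {s. c < T s} s / (T s)\<^sup>2) \<le>
    (LINT s|\<nu>. indicator {s. 2 * c < T s} s / (T s)\<^sup>2 + 1 / c\<^sup>2 * indicator {s. T s \<le> 2 * c} s)"
  proof (rule integral_mono[OF I[OF Suc.prems(2)] Bochner_Integration.integrable_add[OF I J]])
    fix s
    have "1 / (T s)\<^sup>2 \<le> 1 / c\<^sup>2" if "c < T s" using that Suc.prems by (intro frac_le power_mono) auto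
    then show "indicator {s. c < T s} s / (T s)\<^sup>2 \<le> indicator {s. 2 * c < T s} s / (T s)\<^sup>2 + 1 / c\<^sup>2 * indicator {s. T s \<le> 2 * c} s"
      by (auto split: split_indicator)
  qed (use Suc.prems in simp)
  also have "\<dots> = (LINT s|\<nu>. indicator {s. 2 * c < T s} s / (T s)\<^sup>2) + (LINT s|\<nu>. 1 / c\<^sup>2 * indicator {s. T s \<le> 2 * c} s)"
    using Suc.prems by (intro Bochner_Integration.integral_add I J) auto
  also have "(LINT s|\<nu>. 1 / c\<^sup>2 * indicator {s. T s \<le> 2 * c} s) = 1 / c\<^sup>2 * measure \<nu> {s. T s \<le> 2 * c}"
    by simp
  also have "\<dots> \<le> 1 / c\<^sup>2 * (2 * c)"
    using Suc.prems by (intro mult_left_mono measure_T_le) auto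
  also have "(LINT s|\<nu>. indicator {s. 2 * c < T s} s / (T s)\<^sup>2) \<le> 4 / (2 * c)"
    using Suc.prems by (intro Suc.IH) (auto simp: mult_ac)
  finally show ?case using Suc.prems by (simp add: power2_eq_square)
qed

text \<open>For s < \<rho> use T (\<rho> s) \<ge> T s, for s \<ge> \<rho> use T (\<rho> s) \<ge> T
  \<rho>. The first range gives 4 / c = 8 / T \<rho>; the second has measure T \<rho> and gives 1 /
  T \<rho>.\<close>

lemma integral_T_dilate:
  assumes \<rho>: "0 < \<rho>" "\<rho> < 1"
  shows "integrable \<nu> (\<lambda>s. 1 / (T (\<rho> * s))\<^sup>2)" and "(LINT s|\<nu>. 1 / (T (\<rho> * s))\<^sup>2) \<le> 9 / T \<rho>"
proof -
  have bd: "1 / (T (\<rho> * s))\<^sup>2 \<le> 1 / (T \<rho>)\<^sup>2" if "s \<in> {0..<1}" for s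
  proof -
    have "\<rho> * s \<le> \<rho>" using that \<rho> by (simp add: mult_left_le)
    then show ?thesis using T_pos[OF \<rho>(2)] by (intro frac_le power_mono T_antimono) auto
  qed
  show I: "integrable \<nu> (\<lambda>s. 1 / (T (\<rho> * s))\<^sup>2)"
    by (rule integrable_const_bound[of _ "1 / (T \<rho>)\<^sup>2"])
       (use bd in \<open>auto intro!: AE_nuI\<close>)
  \<comment> \<open>Halved so that c < T s holds strictly for s < \<rho>.\<close>
  define c where "c = T \<rho> / 2"
  have c: "0 < c" using T_pos[OF \<rho>(2)] by (simp add: c_def)
  have I1: "integrable \<nu> (\<lambda>s. indicator {s. c < T s} s / (T s)\<^sup>2)"
  proof (rule integrable_const_bound[of _ "1 / c\<^sup>2"])
    show "AE s in \<nu>. norm (indicator {s. c < T s} s / (T s)\<^sup>2) \<le> 1 / c\<^sup>2"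
      using c by (intro AE_I2) (auto split: split_indicator intro!: frac_le power_mono)
  qed measurable
  have I2: "integrable \<nu> (\<lambda>s. 1 / (T \<rho>)\<^sup>2 * indicator {\<rho>..} s)"
    by (intro integrable_mult_right) auto
  have "(LINT s|\<nu>. 1 / (T (\<rho> * s))\<^sup>2) \<le>
     (LINT s|\<nu>. indicator {s. c < T s} s / (T s)\<^sup>2 + 1 / (T \<rho>)\<^sup>2 * indicator {\<rho>..} s)"
  proof (rule integral_mono_AE[OF I Bochner_Integration.integrable_add[OF I1 I2]])
    show "AE s in \<nu>. 1 / (T (\<rho> * s))\<^sup>2 \<le> indicator {s. c < T s} s / (T s)\<^sup>2 + 1 / (T \<rho>)\<^sup>2 * indicator {\<rho>..} s"
      using AE_nu
    proof eventually_elim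
      fix s :: real assume s: "s \<in> {0..<1}"
      show "1 / (T (\<rho> * s))\<^sup>2 \<le> indicator {s. c < T s} s / (T s)\<^sup>2 + 1 / (T \<rho>)\<^sup>2 * indicator {\<rho>..} s"
      proof (cases "\<rho> \<le> s")
        case True
        then show ?thesis using bd[OF s] by (auto intro: add_increasing split: split_indicator)
      next
        case False
        have "\<rho> * s \<le> s" using s \<rho> by (simp add: mult_left_le_one_le)
        then have "1 / (T (\<rho> * s))\<^sup>2 \<le> 1 / (T s)\<^sup>2"
          using T_pos[of s] s by (intro frac_le power_mono T_antimono) auto
        moreover have "c < T s" using T_antimono[of s \<rho>] False c by (simp add: c_def)
        ultimately show ?thesis using False by simp
      qed
    qed
  qed
  also have "\<dots> = (LINT s|\<nu>. indicator {s. c < T s} s / (T s)\<^sup>2) + (LINT s|\<nu>. 1 / (T \<rho>)\<^sup>2 * indicator {\<rho>..} s)"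
    by (intro Bochner_Integration.integral_add I1 I2)
  also have "(LINT s|\<nu>. indicator {s. c < T s} s / (T s)\<^sup>2) \<le> 4 / c"
  proof -
    obtain n where "T 0 / c < 2 ^ n" using real_arch_pow[of 2] by auto
    then show ?thesis using c by (intro integral_inverse_T_sq[of _ n]) (auto simp: field_simps)
  qed
  also have "(LINT s|\<nu>. 1 / (T \<rho>)\<^sup>2 * indicator {\<rho>..} s) = 1 / (T \<rho>)\<^sup>2 * T \<rho>" by (simp add: T_def)
  finally show "(LINT s|\<nu>. 1 / (T (\<rho> * s))\<^sup>2) \<le> 9 / T \<rho>"
    using T_pos[OF \<rho>(2)] by (simp add: c_def power2_eq_square)
qed

end

section \<open>Multipliers acting on atoms\<close>

lemma cis_power_has_integral:
  assumes "0 < j"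
  shows "((\<lambda>t. cis t ^ j) has_integral 0) {0..2*pi}"
proof -
  have "(\<lambda>w::complex. w ^ j) holomorphic_on cball 0 1" by (intro holomorphic_intros)
  from cauchy_circle[OF this, of 0] assms show ?thesis by (simp add: zero_power)
qed

lemma parseval_finite:
  fixes c :: "nat \<Rightarrow> complex"
  shows "((\<lambda>t. (norm (\<Sum>k<n. c k * cis t ^ k))\<^sup>2) has_integral 2 * pi * (\<Sum>k<n. (norm (c k))\<^sup>2)) {0..2*pi}"
proof (induction n)
  case (Suc n)
  have sq: "(norm (x + y))\<^sup>2 = (norm x)\<^sup>2 + 2 * Re (cnj x * y) + (norm y)\<^sup>2" for x y :: complex
    unfolding cmod_power2 by (simp add: power2_eq_square algebra_simps)
  have "((\<lambda>t. \<Sum>k<n. cnj (c k) * c n * cis t ^ (n - k)) has_integral (\<Sum>k<n. cnj (c k) * c n * 0)) {0..2*pi}"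
    by (intro has_integral_sum has_integral_mult_right cis_power_has_integral) auto
  also have "(\<lambda>t. \<Sum>k<n. cnj (c k) * c n * cis t ^ (n - k)) = (\<lambda>t. cnj (\<Sum>k<n. c k * cis t ^ k) * (c n * cis t ^ n))"
  proof
    fix t
    have "cnj (cis t ^ k) * cis t ^ n = cis t ^ (n - k)" if "k < n" for k
    proof -
      have "cnj (cis t ^ k) * cis t ^ n = (cnj (cis t ^ k) * cis t ^ k) * cis t ^ (n - k)"
        using that by (simp add: power_add[symmetric])
      also have "cnj (cis t ^ k) * cis t ^ k = (cnj (cis t) * cis t) ^ k" by (simp add: power_mult_distrib)
      also have "cnj (cis t) * cis t = 1" by (simp add: cis_cnj cis_mult)
      finally show ?thesis by simp
    qed
    then show "(\<Sum>k<n. cnj (c k) * c n * cis t ^ (n - k)) = cnj (\<Sum>k<n. c k * cis t ^ k) * (c n * cis t ^ n)"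
      unfolding cnj_sum sum_distrib_right by (intro sum.cong) (auto simp: mult_ac)
  qed
  finally have "((\<lambda>t. Re (cnj (\<Sum>k<n. c k * cis t ^ k) * (c n * cis t ^ n))) has_integral Re 0) {0..2*pi}"
    by (intro has_integral_linear[OF _ bounded_linear_Re, unfolded o_def]) simp
  note H = has_integral_add[OF has_integral_add[OF Suc.IH has_integral_mult_right[OF this, of 2]] has_integral_const_real[of "(norm (c n))\<^sup>2" 0 "2*pi"]]
  have e: "(norm (\<Sum>k<Suc n. c k * cis t ^ k))\<^sup>2 = (norm (\<Sum>k<n. c k * cis t ^ k))\<^sup>2
      + 2 * Re (cnj (\<Sum>k<n. c k * cis t ^ k) * (c n * cis t ^ n)) + (norm (c n))\<^sup>2" for t
    unfolding sum.lessThan_Suc sq by (simp only: norm_mult norm_power norm_cis power_one mult_1_right)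
  show ?case unfolding e by (rule has_integral_eq_rhs[OF H]) (simp add: algebra_simps)
qed simp

text \<open>Unnormalised Fourier coefficients over the arc. Restricting to k \<ge> 0 builds the
  projection onto analytic functions into the sums formed from them.\<close>

definition fcoeff :: "(real \<Rightarrow> complex) \<Rightarrow> real \<Rightarrow> real \<Rightarrow> nat \<Rightarrow> complex" where
  "fcoeff A a b k = integral {a..b} (\<lambda>t. A t * cis (- t) ^ k)"

text \<open>The proof is by duality with the partial Fourier sum, so that \<open>A\<close> is only integrated against
  continuous functions.\<close>

lemma bessel_bounded:
  fixes A :: "real \<Rightarrow> complex"
  assumes ab: "a < b" "b \<le> a + 2 * pi"
    and I: "\<And>h. continuous_on UNIV h \<Longrightarrow> (\<lambda>t. A t * h t) integrable_on {a..b}"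
    and c: "\<And>t. t \<in> {a..b} \<Longrightarrow> norm (A t) \<le> c"
  shows "(\<Sum>k<n. (norm (fcoeff A a b k))\<^sup>2) \<le> 2 * pi * c\<^sup>2 * (b - a)"
proof -
  define f where "f = fcoeff A a b"
  define P where "P t = (\<Sum>k<n. f k * cis t ^ k)" for t
  define Q where "Q = (\<Sum>k<n. (norm (f k))\<^sup>2)"
  have cP: "continuous_on S P" for S unfolding P_def[abs_def] by (intro continuous_intros)
  have "((\<lambda>t. \<Sum>k<n. cnj (f k) * (A t * cis (- t) ^ k)) has_integral (\<Sum>k<n. cnj (f k) * f k)) {a..b}"
    unfolding f_def fcoeff_def
    by (intro has_integral_sum has_integral_mult_right integrable_integral I continuous_intros) auto
  also have "(\<lambda>t. \<Sum>k<n. cnj (f k) * (A t * cis (- t) ^ k)) = (\<lambda>t. A t * cnj (P t))"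
    unfolding P_def cnj_sum sum_distrib_left by (intro ext sum.cong) (auto simp: cis_cnj mult_ac)
  also have "(\<Sum>k<n. cnj (f k) * f k) = of_real Q"
    unfolding Q_def of_real_sum by (intro sum.cong refl) (metis complex_norm_square mult.commute)
  finally have "((\<lambda>t. Re (A t * cnj (P t))) has_integral Re (of_real Q)) {a..b}"
    by (rule has_integral_linear[OF _ bounded_linear_Re, unfolded o_def])
  then have "Q = integral {a..b} (\<lambda>t. Re (A t * cnj (P t)))" by (simp add: integral_unique)
  \<comment> \<open>The weights of this splitting are chosen so that Parseval turns the second term
    into at most Q / 2, which is then absorbed.\<close>
  also have "\<dots> \<le> integral {a..b} (\<lambda>t. pi * c\<^sup>2 + (norm (P t))\<^sup>2 / (4 * pi))"
  proof (intro integral_le)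
    fix t assume t: "t \<in> {a..b}"
    have "Re (A t * cnj (P t)) \<le> norm (A t) * norm (P t)"
      using complex_Re_le_cmod[of "A t * cnj (P t)"] by (simp add: norm_mult)
    also have "\<dots> \<le> c * norm (P t)" using c[OF t] by (intro mult_right_mono) auto
    also have "\<dots> \<le> pi * c\<^sup>2 + (norm (P t))\<^sup>2 / (4 * pi)"
    proof -
      have "0 \<le> (2 * pi * c - norm (P t))\<^sup>2 / (4 * pi)" by simp
      also have "\<dots> = pi * c\<^sup>2 + (norm (P t))\<^sup>2 / (4 * pi) - c * norm (P t)"
        by (simp add: power2_diff field_simps power2_eq_square)
      finally show ?thesis by simp
    qed
    finally show "Re (A t * cnj (P t)) \<le> pi * c\<^sup>2 + (norm (P t))\<^sup>2 / (4 * pi)" .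
  next
    have "(\<lambda>t. A t * cnj (P t)) integrable_on {a..b}" by (intro I continuous_intros cP)
    then show "(\<lambda>t. Re (A t * cnj (P t))) integrable_on {a..b}"
      by (rule integrable_linear[OF _ bounded_linear_Re, unfolded o_def])
  qed (intro integrable_continuous_real continuous_intros cP, simp)
  also have "\<dots> = pi * c\<^sup>2 * (b - a) + integral {a..b} (\<lambda>t. (norm (P t))\<^sup>2) / (4 * pi)"
    using ab by (subst integral_add)
      (auto intro!: integrable_continuous_real continuous_intros cP simp: integral_divide)
  also have "integral {a..b} (\<lambda>t. (norm (P t))\<^sup>2) \<le> integral {a..a+2*pi} (\<lambda>t. (norm (P t))\<^sup>2)"
    using ab by (intro integral_subset_le integrable_continuous_real continuous_intros cP) auto
  also have "\<dots> = integral {0..2*pi} (\<lambda>t. (norm (P t))\<^sup>2)"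
  proof (rule integral_periodic_shift)
    have "cis (t + 2 * pi) = cis t" for t by (simp add: complex_eq_iff)
    then show "(norm (P (t + 2 * pi)))\<^sup>2 = (norm (P t))\<^sup>2" for t by (simp add: P_def)
  qed (auto intro!: continuous_intros cP)
  also have "\<dots> = 2 * pi * Q" unfolding P_def Q_def by (rule integral_unique[OF parseval_finite])
  finally show ?thesis unfolding Q_def[symmetric] f_def[symmetric] by (simp add: divide_right_mono)
qed

lemma norm_cis_diff_le: "norm (cis s - cis t) \<le> \<bar>s - t\<bar>"
proof -
  have "norm (cis s - cis t) \<le> 1 * norm (s - t)"
  proof (rule differentiable_bound[of UNIV])
    show "(cis has_derivative (\<lambda>h. h *\<^sub>R (\<i> * cis x))) (at x within UNIV)" for x
      by (auto intro!: derivative_eq_intros)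
    show "onorm (\<lambda>h. h *\<^sub>R (\<i> * cis x)) \<le> 1" for x
      by (rule onorm_bound) (auto simp: norm_mult)
  qed auto
  then show ?thesis by simp
qed

text \<open>About 1 / \<delta> terms have size at most \<delta>^2, and the rest is a tail of the
  series of 1 / k^2, of size \<delta>. Comparison with the telescoping differences of 1 / (1 + k
  \<delta>) covers both ranges in one induction.\<close>

lemma sum_min_sq_bound:
  assumes "0 < (\<delta>::real)"
  shows "(\<Sum>k<n. (min 1 (real k * \<delta>))\<^sup>2 / (real k + 1)\<^sup>2) \<le> 4 * \<delta>"
proof -
  have "(\<Sum>k<n. (min 1 (real k * \<delta>))\<^sup>2 / (real k + 1)\<^sup>2) \<le> 4 * \<delta> * (1 - 1 / (1 + real n * \<delta>))"
  proof (induction n)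
    case (Suc n)
    define y where "y = (real n + 1) * \<delta>"
    have y: "0 < y" "real n * \<delta> \<le> y" using assms by (auto simp: y_def)
    have "min 1 (real n * \<delta>) \<le> 2 * y / (1 + y)"
    proof (cases "y \<le> 1")
      case True
      then have "y * (1 + y) \<le> y * 2" using y by (intro mult_left_mono) auto
      then have "y \<le> 2 * y / (1 + y)" using y by (simp add: pos_le_divide_eq mult.commute)
      then show ?thesis using y by linarith
    next
      case False
      then have "1 \<le> 2 * y / (1 + y)" using y by (simp add: pos_le_divide_eq)
      then show ?thesis by linarith
    qed
    then have "(min 1 (real n * \<delta>))\<^sup>2 \<le> (2 * y / (1 + y))\<^sup>2"
      using assms by (intro power_mono) auto
    then have "(min 1 (real n * \<delta>))\<^sup>2 / (real n + 1)\<^sup>2 \<le> (2 * y / (1 + y))\<^sup>2 / (real n + 1)\<^sup>2"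
      by (rule divide_right_mono) simp
    also have "\<dots> = 4 * \<delta>\<^sup>2 / ((1 + y) * (1 + y))"
      by (simp add: y_def power2_eq_square)
    also have "\<dots> \<le> 4 * \<delta>\<^sup>2 / ((1 + real n * \<delta>) * (1 + y))"
      using assms y by (intro divide_left_mono mult_right_mono mult_pos_pos add_pos_nonneg) auto
    also have "\<dots> = 4 * \<delta> * (1 / (1 + real n * \<delta>) - 1 / (1 + y))"
    proof -
      have "1 + real n * \<delta> \<noteq> 0" "1 + y \<noteq> 0" using assms y by (auto simp: add_pos_nonneg less_imp_neq[symmetric])
      then have "1 / (1 + real n * \<delta>) - 1 / (1 + y) = (y - real n * \<delta>) / ((1 + real n * \<delta>) * (1 + y))"
        by (simp add: divide_simps)
      also have "y - real n * \<delta> = \<delta>" by (simp add: y_def algebra_simps)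
      finally show ?thesis by (simp add: power2_eq_square)
    qed
    also have "1 + y = 1 + real (Suc n) * \<delta>" by (simp add: y_def add.commute)
    finally show ?case using Suc.IH by (simp add: algebra_simps)
  qed simp
  also have "\<dots> \<le> 4 * \<delta> * 1" using assms by (intro mult_left_mono) auto
  finally show ?thesis by simp
qed

text \<open>A multiplier \<open>a\<close> with \<open>|a\<^sub>k|\<close> and \<open>(k + 1) |a\<^sub>k\<^sub>+\<^sub>1 - a\<^sub>k|\<close> at most \<open>S\<close> maps an atom \<open>A\<close> supported on
  an arc of length \<open>\<delta>\<close> into \<open>L\<^sup>1\<close>: after multiplication by \<open>1 - q e\<^sup>-\<^sup>i\<^sup>a z\<close> with \<open>q = 1 / (1 + \<delta>)\<close>, which
  is small near the arc, Parseval's formula applies.\<close>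

locale atom =
  fixes A :: "real \<Rightarrow> complex" and a b S :: real and \<alpha> :: "nat \<Rightarrow> real"
  assumes ab: "a < b" "b \<le> a + 2 * pi"
    and int: "\<And>h. continuous_on UNIV h \<Longrightarrow> (\<lambda>t. A t * h t) integrable_on {a..b}"
    and A2: "\<And>t. t \<in> {a..b} \<Longrightarrow> norm (A t) \<le> 2"
    and A0: "integral {a..b} A = 0"
    and S: "0 < S"
    and \<alpha>: "\<And>k. \<bar>\<alpha> k\<bar> \<le> S" "\<And>k. real (k + 1) * \<bar>\<alpha> (Suc k) - \<alpha> k\<bar> \<le> S"
begin

definition "\<delta> = b - a"
definition "q = 1 / (1 + \<delta>)"
definition "\<zeta> = cis (- a)"
definition "f = fcoeff A a b"
definition "\<beta> k = of_real (\<alpha> k) * f k"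
definition "F n t = (\<Sum>k<n. \<beta> k * cis t ^ k)"
definition "\<gamma> k = \<beta> k - of_real q * \<zeta> * (if k = 0 then 0 else \<beta> (k - 1))"

lemma \<delta>: "0 < \<delta>" "\<delta> \<le> 2 * pi" using ab by (auto simp: \<delta>_def)

lemma q: "0 < q" "q < 1" "1 - q = \<delta> / (1 + \<delta>)" "1 - q \<le> \<delta>"
  using \<delta> by (auto simp: q_def field_simps)

lemma norm_\<zeta>: "norm \<zeta> = 1" by (simp add: \<zeta>_def)

lemma f_0: "f 0 = 0" using A0 by (simp add: f_def fcoeff_def)

lemma norm_integral_A:
  assumes h: "continuous_on UNIV h" "\<And>t. t \<in> {a..b} \<Longrightarrow> norm (h t) \<le> M"
  shows "norm (integral {a..b} (\<lambda>t. A t * h t)) \<le> 2 * M * \<delta>"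
proof -
  have "norm (integral {a..b} (\<lambda>t. A t * h t)) \<le> integral {a..b} (\<lambda>t. 2 * M)"
    using A2 h by (intro integral_norm_bound_integral int) (auto simp: norm_mult intro!: mult_mono)
  then show ?thesis using ab by (simp add: \<delta>_def mult_ac)
qed

text \<open>The first bound is the size of \<open>A\<close> on the arc. The second uses the mean
  zero of \<open>A\<close> to subtract the constant \<zeta>^k, which gains the factor k
  \<delta>.\<close>

lemma norm_f: "norm (f k) \<le> 2 * \<delta> * min 1 (real k * \<delta>)"
proof -
  have 1: "norm (f k) \<le> 2 * 1 * \<delta>"
    unfolding f_def fcoeff_def by (rule norm_integral_A) (auto intro!: continuous_intros simp: norm_power)
  have "f k = integral {a..b} (\<lambda>t. A t * (cis (- t) ^ k - \<zeta> ^ k))"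
  proof -
    have "((\<lambda>t. A t * cis (- t) ^ k) has_integral f k) {a..b}"
      unfolding f_def fcoeff_def by (intro integrable_integral int continuous_intros)
    moreover have "((\<lambda>t. A t * \<zeta> ^ k) has_integral 0 * \<zeta> ^ k) {a..b}"
      using int[of "\<lambda>_. 1"] A0 by (intro has_integral_mult_left) (auto simp: has_integral_iff)
    ultimately have "((\<lambda>t. A t * cis (- t) ^ k - A t * \<zeta> ^ k) has_integral f k - 0 * \<zeta> ^ k) {a..b}"
      by (rule has_integral_diff)
    then show ?thesis by (simp add: algebra_simps integral_unique)
  qed
  also have "norm \<dots> \<le> 2 * (real k * \<delta>) * \<delta>"
  proof (rule norm_integral_A)
    fix t assume t: "t \<in> {a..b}"
    have "cis (- t) ^ k - \<zeta> ^ k = cis (real k * (- t)) - cis (real k * (- a))"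
      unfolding \<zeta>_def by (simp only: Complex.DeMoivre)
    then have "norm (cis (- t) ^ k - \<zeta> ^ k) \<le> \<bar>real k * (- t) - real k * (- a)\<bar>"
      using norm_cis_diff_le by metis
    also have "real k * (- t) - real k * (- a) = real k * (a - t)" by (simp add: algebra_simps)
    also have "\<bar>real k * (a - t)\<bar> = real k * (t - a)" using t by (simp add: abs_mult)
    also have "\<dots> \<le> real k * \<delta>" using t by (intro mult_left_mono) (auto simp: \<delta>_def)
    finally show "norm (cis (- t) ^ k - \<zeta> ^ k) \<le> real k * \<delta>" .
  qed (intro continuous_intros)
  finally have 2: "norm (f k) \<le> 2 * (real k * \<delta>) * \<delta>" .
  show ?thesis using 1 2 by (auto simp: min_def mult_ac)
qed

lemma norm_\<beta>: "norm (\<beta> k) \<le> 2 * \<delta> * \<bar>\<alpha> k\<bar>"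
proof -
  have "2 * \<delta> * min 1 (real k * \<delta>) \<le> 2 * \<delta> * 1" using \<delta> by (intro mult_left_mono) auto
  with norm_f[of k] have "norm (f k) \<le> 2 * \<delta> * 1" by (rule order_trans)
  then have "\<bar>\<alpha> k\<bar> * norm (f k) \<le> \<bar>\<alpha> k\<bar> * (2 * \<delta> * 1)" by (intro mult_left_mono) auto
  then show ?thesis by (simp add: \<beta>_def norm_mult mult.commute)
qed

text \<open>\<open>\<gamma>\<close> consists of the coefficients of (1 - q \<zeta> z) F; the extra
  term is the boundary term of the truncation at n, which tends to 0 in the end.\<close>

lemma F_times: "(\<Sum>k<n. \<gamma> k * cis t ^ k)
   = (1 - of_real q * \<zeta> * cis t) * F n t + of_real q * \<zeta> * cis t ^ n * (if n = 0 then 0 else \<beta> (n - 1))"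
proof (induction n)
  case (Suc n)
  then show ?case by (simp add: F_def \<gamma>_def algebra_simps)
qed (simp add: F_def)

text \<open>Three sources of smallness: 1 - q \<le> \<delta>; f (j + 1) - \<zeta> f j, the
  coefficient of an atom damped by cis (-t) - \<zeta>, which has modulus at most \<delta> on the
  arc; and the increment of \<alpha>, which is at most S / (j + 1).\<close>

lemma norm_\<gamma>_sq:
  "(norm (\<gamma> (Suc j)))\<^sup>2 \<le> 3 * S\<^sup>2 * (\<delta>\<^sup>2 * (norm (f (Suc j)))\<^sup>2
     + (norm (fcoeff (\<lambda>t. A t * (cis (- t) - \<zeta>)) a b j))\<^sup>2 + (norm (f j))\<^sup>2 / (real j + 1)\<^sup>2)"
proof -
  define D where "D = fcoeff (\<lambda>t. A t * (cis (- t) - \<zeta>)) a b j"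
  have D: "f (Suc j) - \<zeta> * f j = D"
  proof -
    have "((\<lambda>t. A t * cis (- t) ^ Suc j - \<zeta> * (A t * cis (- t) ^ j)) has_integral f (Suc j) - \<zeta> * f j) {a..b}"
      unfolding f_def fcoeff_def
      by (intro has_integral_diff has_integral_mult_right integrable_integral int continuous_intros)
    then show ?thesis unfolding D_def fcoeff_def by (simp add: algebra_simps integral_unique)
  qed
  have "\<gamma> (Suc j) = of_real (1 - q) * \<beta> (Suc j) + of_real q * (of_real (\<alpha> (Suc j)) * D + \<zeta> * of_real (\<alpha> (Suc j) - \<alpha> j) * f j)"
    unfolding D[symmetric] \<gamma>_def \<beta>_def by (simp add: algebra_simps)
  also have "norm \<dots> \<le> norm (of_real (1 - q) * \<beta> (Suc j)) + norm (of_real q * (of_real (\<alpha> (Suc j)) * D + \<zeta> * of_real (\<alpha> (Suc j) - \<alpha> j) * f j))"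
    by (rule norm_triangle_ineq)
  also have "norm (of_real (1 - q) * \<beta> (Suc j)) = (1 - q) * (\<bar>\<alpha> (Suc j)\<bar> * norm (f (Suc j)))"
    using q by (simp only: norm_mult norm_of_real \<beta>_def)
  also have "\<dots> \<le> \<delta> * (S * norm (f (Suc j)))"
    using q \<alpha> S by (intro mult_mono mult_right_mono) auto
  also have "norm (of_real q * (of_real (\<alpha> (Suc j)) * D + \<zeta> * of_real (\<alpha> (Suc j) - \<alpha> j) * f j))
     = q * norm (of_real (\<alpha> (Suc j)) * D + \<zeta> * of_real (\<alpha> (Suc j) - \<alpha> j) * f j)"
    using q by (simp add: norm_mult)
  also have "\<dots> \<le> 1 * norm (of_real (\<alpha> (Suc j)) * D + \<zeta> * of_real (\<alpha> (Suc j) - \<alpha> j) * f j)"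
    using q by (intro mult_right_mono) auto
  also have "1 * norm (of_real (\<alpha> (Suc j)) * D + \<zeta> * of_real (\<alpha> (Suc j) - \<alpha> j) * f j)
     \<le> norm (of_real (\<alpha> (Suc j)) * D) + norm (\<zeta> * of_real (\<alpha> (Suc j) - \<alpha> j) * f j)"
    using norm_triangle_ineq by simp
  also have "norm (of_real (\<alpha> (Suc j)) * D) \<le> S * norm D"
    using \<alpha>(1) by (simp add: norm_mult mult_right_mono)
  also have "norm (\<zeta> * of_real (\<alpha> (Suc j) - \<alpha> j) * f j) = \<bar>\<alpha> (Suc j) - \<alpha> j\<bar> * norm (f j)"
    by (simp only: norm_mult norm_of_real norm_\<zeta> mult_1_left)
  also have "\<dots> \<le> S / (real j + 1) * norm (f j)"
    using \<alpha>(2)[of j] by (intro mult_right_mono) (auto simp: pos_le_divide_eq mult.commute add.commute)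
  finally have "norm (\<gamma> (Suc j)) \<le> S * (\<delta> * norm (f (Suc j)) + norm D + norm (f j) / (real j + 1))"
    by (simp add: algebra_simps)
  then have "(norm (\<gamma> (Suc j)))\<^sup>2 \<le> (S * (\<delta> * norm (f (Suc j)) + norm D + norm (f j) / (real j + 1)))\<^sup>2"
    by (intro power_mono) auto
  also have "\<dots> = S\<^sup>2 * (\<delta> * norm (f (Suc j)) + norm D + norm (f j) / (real j + 1))\<^sup>2"
    by (simp add: power_mult_distrib)
  also have "\<dots> \<le> S\<^sup>2 * (3 * ((\<delta> * norm (f (Suc j)))\<^sup>2 + (norm D)\<^sup>2 + (norm (f j) / (real j + 1))\<^sup>2))"
  proof (rule mult_left_mono)
    have "(x + y + z)\<^sup>2 \<le> 3 * (x\<^sup>2 + y\<^sup>2 + z\<^sup>2)" for x y z :: real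
      using zero_le_power2[of "x - y"] zero_le_power2[of "y - z"] zero_le_power2[of "x - z"]
      by (simp add: power2_eq_square algebra_simps)
    then show "(\<delta> * norm (f (Suc j)) + norm D + norm (f j) / (real j + 1))\<^sup>2
       \<le> 3 * ((\<delta> * norm (f (Suc j)))\<^sup>2 + (norm D)\<^sup>2 + (norm (f j) / (real j + 1))\<^sup>2)" .
  qed simp
  also have "\<dots> = 3 * S\<^sup>2 * (\<delta>\<^sup>2 * (norm (f (Suc j)))\<^sup>2 + (norm D)\<^sup>2 + (norm (f j))\<^sup>2 / (real j + 1)\<^sup>2)"
    by (simp add: power_mult_distrib power_divide algebra_simps)
  finally show ?thesis unfolding D_def .
qed

lemma sum_\<gamma>: "(\<Sum>k<n. (norm (\<gamma> k))\<^sup>2) \<le> 204 * S\<^sup>2 * \<delta> ^ 3"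
proof -
  have n: "0 < \<delta>" by (rule \<delta>)
  have 1: "(\<Sum>k<Suc n. (norm (f k))\<^sup>2) \<le> 2 * pi * 2\<^sup>2 * \<delta>"
    unfolding f_def \<delta>_def by (rule bessel_bounded[OF ab int A2])
  have "(\<Sum>j<n. (norm (f (Suc j)))\<^sup>2) \<le> (\<Sum>k<Suc n. (norm (f k))\<^sup>2)"
    unfolding sum.lessThan_Suc_shift by simp
  then have 1: "(\<Sum>j<n. (norm (f (Suc j)))\<^sup>2) \<le> 8 * pi * \<delta>" using 1 by simp
  have 2: "(\<Sum>j<n. (norm (fcoeff (\<lambda>t. A t * (cis (- t) - \<zeta>)) a b j))\<^sup>2) \<le> 2 * pi * (2 * \<delta>)\<^sup>2 * (b - a)"
  proof (rule bessel_bounded[OF ab])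
    show "(\<lambda>t. A t * (cis (- t) - \<zeta>) * h t) integrable_on {a..b}" if "continuous_on UNIV h" for h
      unfolding mult.assoc by (intro int continuous_intros that)
    fix t assume t: "t \<in> {a..b}"
    have "norm (cis (- t) - \<zeta>) \<le> \<delta>"
      using norm_cis_diff_le[of "- t" "- a"] t by (simp add: \<zeta>_def \<delta>_def)
    then show "norm (A t * (cis (- t) - \<zeta>)) \<le> 2 * \<delta>"
      unfolding norm_mult using A2[OF t] by (intro mult_mono) auto
  qed
  have "(norm (f j))\<^sup>2 / (real j + 1)\<^sup>2 \<le> 4 * \<delta>\<^sup>2 * ((min 1 (real j * \<delta>))\<^sup>2 / (real j + 1)\<^sup>2)" for j
  proof -
    have "(norm (f j))\<^sup>2 \<le> (2 * \<delta> * min 1 (real j * \<delta>))\<^sup>2" using norm_f by (intro power_mono) auto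
    then have "(norm (f j))\<^sup>2 / (real j + 1)\<^sup>2 \<le> (2 * \<delta> * min 1 (real j * \<delta>))\<^sup>2 / (real j + 1)\<^sup>2"
      by (rule divide_right_mono) simp
    then show ?thesis by (simp add: power_mult_distrib)
  qed
  then have "(\<Sum>j<n. (norm (f j))\<^sup>2 / (real j + 1)\<^sup>2) \<le> 4 * \<delta>\<^sup>2 * (\<Sum>j<n. (min 1 (real j * \<delta>))\<^sup>2 / (real j + 1)\<^sup>2)"
    unfolding sum_distrib_left by (intro sum_mono)
  also have "\<dots> \<le> 4 * \<delta>\<^sup>2 * (4 * \<delta>)" by (intro mult_left_mono sum_min_sq_bound n) simp
  finally have 3: "(\<Sum>j<n. (norm (f j))\<^sup>2 / (real j + 1)\<^sup>2) \<le> 16 * \<delta> ^ 3"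
    by (simp add: power2_eq_square power3_eq_cube)
  have "(\<Sum>k<n. (norm (\<gamma> k))\<^sup>2) \<le> (\<Sum>k<Suc n. (norm (\<gamma> k))\<^sup>2)" by simp
  also have "\<dots> = (\<Sum>j<n. (norm (\<gamma> (Suc j)))\<^sup>2)"
    unfolding sum.lessThan_Suc_shift by (simp add: \<gamma>_def \<beta>_def f_0)
  also have "\<dots> \<le> (\<Sum>j<n. 3 * S\<^sup>2 * (\<delta>\<^sup>2 * (norm (f (Suc j)))\<^sup>2
     + (norm (fcoeff (\<lambda>t. A t * (cis (- t) - \<zeta>)) a b j))\<^sup>2 + (norm (f j))\<^sup>2 / (real j + 1)\<^sup>2))"
    by (intro sum_mono norm_\<gamma>_sq)
  also have "\<dots> = 3 * S\<^sup>2 * (\<delta>\<^sup>2 * (\<Sum>j<n. (norm (f (Suc j)))\<^sup>2)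
     + (\<Sum>j<n. (norm (fcoeff (\<lambda>t. A t * (cis (- t) - \<zeta>)) a b j))\<^sup>2) + (\<Sum>j<n. (norm (f j))\<^sup>2 / (real j + 1)\<^sup>2))"
    by (simp only: sum_distrib_left[symmetric] sum.distrib)
  also have "\<dots> \<le> 3 * S\<^sup>2 * (\<delta>\<^sup>2 * (8 * pi * \<delta>) + 2 * pi * (2 * \<delta>)\<^sup>2 * (b - a) + 16 * \<delta> ^ 3)"
    using 1 2 3 by (intro mult_left_mono add_mono) auto
  also have "\<dots> = 3 * S\<^sup>2 * \<delta> ^ 3 * (16 * pi + 16)"
    unfolding \<delta>_def[symmetric] by (simp add: power2_eq_square power3_eq_cube algebra_simps)
  \<comment> \<open>16 \<pi> + 16 < 68, and 3 * 68 = 204.\<close>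
  also have "\<dots> \<le> 3 * S\<^sup>2 * \<delta> ^ 3 * 68"
    using pi_approx n by (intro mult_left_mono) auto
  finally show ?thesis by simp
qed

text \<open>Up to the factor 1 - q^2 the integrand is the Poisson kernel at q cis a, of total mass 2
  \<pi>.\<close>

lemma weight_integral:
  "((\<lambda>t. 1 / (norm (1 - of_real q * \<zeta> * cis t))\<^sup>2) has_integral 2 * pi / (1 - q\<^sup>2)) {0..2*pi}"
proof -
  define z where "z = of_real q * cis a"
  have z: "norm z = q" using q by (simp add: z_def norm_mult)
  have q2: "0 < 1 - q\<^sup>2" using q by (simp add: power_less_one_iff abs_square_less_1)
  have "((\<lambda>t. Re (of_real (poisson z t) * 1)) has_integral Re (of_real (2 * pi) * 1)) {0..2*pi}"
    by (rule has_integral_linear[OF poisson_reproduces[of "\<lambda>_. 1"] bounded_linear_Re, unfolded o_def]) (use z q in auto)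
  then have "((\<lambda>t. poisson z t / (1 - q\<^sup>2)) has_integral 2 * pi / (1 - q\<^sup>2)) {0..2*pi}"
    by (intro has_integral_divide) simp
  also have "(\<lambda>t. poisson z t / (1 - q\<^sup>2)) = (\<lambda>t. 1 / (norm (1 - of_real q * \<zeta> * cis t))\<^sup>2)"
  proof
    fix t
    have "1 - z * cis (- t) = cnj (1 - of_real q * \<zeta> * cis t)"
      by (simp add: z_def \<zeta>_def cis_cnj)
    then have "norm (1 - z * cis (- t)) = norm (1 - of_real q * \<zeta> * cis t)" by (metis complex_mod_cnj)
    then show "poisson z t / (1 - q\<^sup>2) = 1 / (norm (1 - of_real q * \<zeta> * cis t))\<^sup>2"
      using q2 by (simp add: poisson_def z)
  qed
  finally show ?thesis .
qed

lemma weight_bound: "2 * pi / (1 - q\<^sup>2) \<le> 16 * pi / \<delta>"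
proof -
  have "1 - q \<le> (1 - q) * (1 + q)" using q mult_left_mono[of 1 "1 + q" "1 - q"] by simp
  also have "\<dots> = 1 - q\<^sup>2" by (simp add: power2_eq_square algebra_simps)
  finally have "\<delta> / (1 + \<delta>) \<le> 1 - q\<^sup>2" using q by simp
  \<comment> \<open>1 + \<delta> \<le> 1 + 2 \<pi> < 8.\<close>
  moreover have "\<delta> / 8 \<le> \<delta> / (1 + \<delta>)" using \<delta> pi_approx by (intro divide_left_mono) auto
  ultimately have l: "\<delta> / 8 \<le> 1 - q\<^sup>2" by linarith
  moreover have "0 < \<delta> / 8" using \<delta> by simp
  ultimately have "2 * pi / (1 - q\<^sup>2) \<le> 2 * pi / (\<delta> / 8)"
    by (intro divide_left_mono mult_pos_pos) (auto simp del: zero_less_divide_iff intro: less_le_trans)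
  then show ?thesis by simp
qed

text \<open>Cauchy-Schwarz in additive form: |P| / w \<le> |P|^2 / (2 l) + l / (2 w^2), where P / w
  is |F| up to the truncation term. The constant 680 dominates (204 + 8) \<pi>.\<close>

lemma integral_F: "integral {0..2*pi} (\<lambda>t. norm (F n t)) \<le> 680 * S * \<delta> + 2 * pi / (1 - q) * norm (\<beta> (n - 1))"
proof -
  define P where "P t = (\<Sum>k<n. \<gamma> k * cis t ^ k)" for t
  define w where "w t = norm (1 - of_real q * \<zeta> * cis t)" for t
  \<comment> \<open>|P|^2 integrates to order S^2 \<delta>^3 and 1 / w^2 to order 1 / \<delta>; this
    l makes both terms of order S \<delta>.\<close>
  define l where "l = S * \<delta>\<^sup>2"
  have l: "0 < l" using S \<delta> by (simp add: l_def)
  have w: "1 - q \<le> w t" "0 < w t" for t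
  proof -
    show "1 - q \<le> w t"
      using norm_triangle_ineq2[of 1 "of_real q * \<zeta> * cis t"] q norm_\<zeta> by (simp add: w_def norm_mult)
    then show "0 < w t" using q by linarith
  qed
  have pt: "norm (F n t) \<le> (norm (P t))\<^sup>2 / (2 * l) + l / 2 * (1 / (w t)\<^sup>2) + norm (\<beta> (n - 1)) / (1 - q)" for t
  proof -
    have "(1 - of_real q * \<zeta> * cis t) * F n t = P t - of_real q * \<zeta> * cis t ^ n * (if n = 0 then 0 else \<beta> (n - 1))"
      using F_times[of t n] by (simp add: P_def)
    then have "w t * norm (F n t) = norm (P t - of_real q * \<zeta> * cis t ^ n * (if n = 0 then 0 else \<beta> (n - 1)))"
      by (metis norm_mult w_def)
    also have "\<dots> \<le> norm (P t) + norm (of_real q * \<zeta> * cis t ^ n * (if n = 0 then 0 else \<beta> (n - 1)))"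
      by (rule norm_triangle_ineq4)
    also have "norm (of_real q * \<zeta> * cis t ^ n * (if n = 0 then 0 else \<beta> (n - 1))) \<le> 1 * norm (\<beta> (n - 1))"
      using q norm_\<zeta> mult_right_mono[of q 1 "norm (\<beta> (n - 1))"] by (auto simp: norm_mult norm_power)
    finally have "norm (F n t) \<le> norm (P t) / w t + norm (\<beta> (n - 1)) / w t"
      using w(2)[of t] by (simp add: pos_le_divide_eq mult.commute flip: add_divide_distrib)
    also have "norm (\<beta> (n - 1)) / w t \<le> norm (\<beta> (n - 1)) / (1 - q)"
      using q(2) by (intro divide_left_mono[OF w(1)] mult_pos_pos w(2)) auto
    also have "norm (P t) / w t \<le> (norm (P t))\<^sup>2 / (2 * l) + l / 2 * (1 / (w t)\<^sup>2)"
    proof -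
      have "0 \<le> (norm (P t) / l - 1 / w t)\<^sup>2 * (l / 2)" using l by simp
      also have "\<dots> = (norm (P t))\<^sup>2 / (2 * l) + l / 2 * (1 / (w t)\<^sup>2) - norm (P t) / w t"
        using l w(2)[of t] by (simp add: power2_diff field_simps power2_eq_square)
      finally show ?thesis by simp
    qed
    finally show ?thesis by simp
  qed
  have "((\<lambda>t. (norm (P t))\<^sup>2 / (2 * l)) has_integral (2 * pi * (\<Sum>k<n. (norm (\<gamma> k))\<^sup>2)) / (2 * l)) {0..2*pi}"
    unfolding P_def by (intro has_integral_divide parseval_finite)
  moreover have "((\<lambda>t. l / 2 * (1 / (w t)\<^sup>2)) has_integral l / 2 * (2 * pi / (1 - q\<^sup>2))) {0..2*pi}"
    unfolding w_def by (intro has_integral_mult_right weight_integral)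
  moreover have "((\<lambda>t. norm (\<beta> (n - 1)) / (1 - q)) has_integral 2 * pi * (norm (\<beta> (n - 1)) / (1 - q))) {0..2*pi}"
    using has_integral_const_real[of "norm (\<beta> (n - 1)) / (1 - q)" 0 "2*pi"] by simp
  ultimately have H: "((\<lambda>t. (norm (P t))\<^sup>2 / (2 * l) + l / 2 * (1 / (w t)\<^sup>2) + norm (\<beta> (n - 1)) / (1 - q)) has_integral
     (2 * pi * (\<Sum>k<n. (norm (\<gamma> k))\<^sup>2)) / (2 * l) + l / 2 * (2 * pi / (1 - q\<^sup>2)) + 2 * pi * (norm (\<beta> (n - 1)) / (1 - q))) {0..2*pi}"
    by (intro has_integral_add)
  have "integral {0..2*pi} (\<lambda>t. norm (F n t)) \<le> 
     (2 * pi * (\<Sum>k<n. (norm (\<gamma> k))\<^sup>2)) / (2 * l) + l / 2 * (2 * pi / (1 - q\<^sup>2)) + 2 * pi * (norm (\<beta> (n - 1)) / (1 - q))"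
  proof (rule has_integral_le[OF integrable_integral H])
    show "(\<lambda>t. norm (F n t)) integrable_on {0..2*pi}"
      unfolding F_def by (intro integrable_continuous_real continuous_intros)
  qed (rule pt)
  also have "(2 * pi * (\<Sum>k<n. (norm (\<gamma> k))\<^sup>2)) / (2 * l) \<le> (2 * pi * (204 * S\<^sup>2 * \<delta> ^ 3)) / (2 * l)"
    using l by (intro divide_right_mono mult_left_mono sum_\<gamma>) auto
  also have "\<dots> = 204 * pi * S * \<delta>"
    using S \<delta> by (simp add: l_def power2_eq_square power3_eq_cube)
  also have "l / 2 * (2 * pi / (1 - q\<^sup>2)) \<le> l / 2 * (16 * pi / \<delta>)"
    using l weight_bound by (intro mult_left_mono) auto
  also have "\<dots> = 8 * pi * S * \<delta>" using \<delta> by (simp add: l_def power2_eq_square)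
  also have "204 * pi * S * \<delta> + 8 * pi * S * \<delta> = (212 * pi) * (S * \<delta>)" by (simp add: algebra_simps)
  also have "\<dots> \<le> 680 * (S * \<delta>)" using pi_approx S \<delta> by (intro mult_right_mono) auto
  finally show ?thesis by simp
qed

text \<open>Limit of \<open>integral_F\<close>: summability of \<alpha> gives uniform convergence of
  the partial sums and sends the truncation term to 0.\<close>

theorem integral_multiplier:
  assumes "summable (\<lambda>k. \<bar>\<alpha> k\<bar>)"
  shows "integral {0..2*pi} (\<lambda>t. norm (\<Sum>k. \<beta> k * cis t ^ k)) \<le> 680 * S * \<delta>"
proof -
  have ul: "uniform_limit {0..2*pi} F (\<lambda>t. \<Sum>k. \<beta> k * cis t ^ k) sequentially"
    unfolding F_def
  proof (rule Weierstrass_m_test)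
    show "summable (\<lambda>k. 2 * \<delta> * \<bar>\<alpha> k\<bar>)" using assms by (rule summable_mult)
    show "norm (\<beta> k * cis t ^ k) \<le> 2 * \<delta> * \<bar>\<alpha> k\<bar>" for k t
      using norm_\<beta> by (simp add: norm_mult norm_power)
  qed
  have ul: "uniform_limit {0..2*pi} (\<lambda>n t. norm (F n t)) (\<lambda>t. norm (\<Sum>k. \<beta> k * cis t ^ k)) sequentially"
    using ul by (rule uniform_limit_norm)
  have cF: "continuous_on {0..2*pi} (\<lambda>t. norm (F n t))" for n
    unfolding F_def by (intro continuous_intros)
  obtain I J where IJ: "\<And>n. ((\<lambda>t. norm (F n t)) has_integral I n) {0..2*pi}"
     "((\<lambda>t. norm (\<Sum>k. \<beta> k * cis t ^ k)) has_integral J) {0..2*pi}" "I \<longlonglongrightarrow> J"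
    using uniform_limit_integral[OF ul cF] by auto
  have "\<beta> \<longlonglongrightarrow> 0"
  proof (rule Lim_null_comparison)
    show "(\<lambda>k. 2 * \<delta> * \<bar>\<alpha> k\<bar>) \<longlonglongrightarrow> 0"
      using tendsto_mult_right_zero[OF summable_LIMSEQ_zero[OF assms]] .
  qed (use norm_\<beta> in auto)
  then have "(\<lambda>n. \<beta> (Suc n - 1)) \<longlonglongrightarrow> 0" by simp
  then have "(\<lambda>n. 680 * S * \<delta> + 2 * pi / (1 - q) * norm (\<beta> (Suc n - 1))) \<longlonglongrightarrow> 680 * S * \<delta> + 2 * pi / (1 - q) * norm (0::complex)"
    by (intro tendsto_intros)
  moreover have "(\<lambda>n. I (Suc n)) \<longlonglongrightarrow> J" using IJ(3) by (rule LIMSEQ_Suc)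
  moreover have "I (Suc n) \<le> 680 * S * \<delta> + 2 * pi / (1 - q) * norm (\<beta> (Suc n - 1))" for n
    using integral_F[of "Suc n"] integral_unique[OF IJ(1)[of "Suc n"]] by simp
  ultimately have "J \<le> 680 * S * \<delta> + 2 * pi / (1 - q) * norm (0::complex)"
    by (intro LIMSEQ_le[of "\<lambda>n. I (Suc n)"]) auto
  then show ?thesis using integral_unique[OF IJ(2)] by simp
qed

end

section \<open>The pairing as an integral\<close>

lemma cis_orthogonal:
  "((\<lambda>t. cis t ^ k * cnj (cis t ^ l)) has_integral (if k = l then 2 * pi else 0)) {0..2*pi}"
proof -
  have e: "cis t ^ k * cnj (cis t ^ l) = (if l \<le> k then cis t ^ (k - l) else cnj (cis t ^ (l - k)))" for t
  proof -
    have u: "cis t ^ j * cnj (cis t ^ j) = 1" for j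
      by (simp add: cis_cnj cis_mult flip: power_mult_distrib)
    show ?thesis
    proof (cases "l \<le> k")
      case True
      then have "cis t ^ k * cnj (cis t ^ l) = cis t ^ (k - l) * (cis t ^ l * cnj (cis t ^ l))"
        by (metis le_add_diff_inverse2 mult.assoc power_add)
      then show ?thesis using True u by simp
    next
      case False
      then have "cis t ^ k * cnj (cis t ^ l) = (cis t ^ k * cnj (cis t ^ k)) * cnj (cis t ^ (l - k))"
        by (metis complex_cnj_mult le_add_diff_inverse linear mult.assoc power_add)
      then show ?thesis using False u by simp
    qed
  qed
  show ?thesis
  proof (cases "k = l")
    case True
    then show ?thesis unfolding e using has_integral_const_real[of "1::complex" 0 "2*pi"] by (simp add: scaleR_conv_of_real)
  next
    case False
    have "((\<lambda>t. cnj (cis t ^ (l - k))) has_integral cnj 0) {0..2*pi}" if "k < l"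
      by (rule has_integral_linear[OF _ bounded_linear_cnj, unfolded o_def], rule cis_power_has_integral) (use that in simp)
    then show ?thesis unfolding e using False cis_power_has_integral[of "k - l"] by (cases "l < k") simp_all
  qed
qed

lemma parseval:
  fixes c d :: "nat \<Rightarrow> complex"
  assumes c: "summable (\<lambda>k. norm (c k))" and d: "summable (\<lambda>k. norm (d k))"
  shows "((\<lambda>t. (\<Sum>k. c k * cis t ^ k) * cnj (\<Sum>k. d k * cis t ^ k)) has_integral
     2 * pi * (\<Sum>k. c k * cnj (d k))) {0..2*pi}"
proof -
  have ul: "uniform_limit {0..2*pi} (\<lambda>n t. \<Sum>k<n. e k * cis t ^ k) (\<lambda>t. \<Sum>k. e k * cis t ^ k) sequentially"
    if "summable (\<lambda>k. norm (e k))" for e :: "nat \<Rightarrow> complex"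
    by (rule Weierstrass_m_test[OF _ that]) (simp add: norm_mult norm_power)
  have bd: "bounded ((\<lambda>t. \<Sum>k. e k * cis t ^ k) ` {0..2*pi})"
    if "summable (\<lambda>k. norm (e k))" for e :: "nat \<Rightarrow> complex"
  proof (rule boundedI)
    fix z assume "z \<in> (\<lambda>t. \<Sum>k. e k * cis t ^ k) ` {0..2*pi}"
    then obtain t where "z = (\<Sum>k. e k * cis t ^ k)" by blast
    also have "norm \<dots> \<le> (\<Sum>k. norm (e k))"
      using that by (intro order_trans[OF summable_norm]) (auto simp: norm_mult norm_power)
    finally show "norm z \<le> (\<Sum>k. norm (e k))" .
  qed
  have d': "summable (\<lambda>k. norm (cnj (d k)))" using d by simp
  have "uniform_limit {0..2*pi} (\<lambda>n t. cnj (\<Sum>k<n. d k * cis t ^ k)) (\<lambda>t. cnj (\<Sum>k. d k * cis t ^ k)) sequentially"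
    by (rule bounded_linear.uniform_limit[OF bounded_linear_cnj]) (rule ul[OF d])
  moreover have "bounded ((\<lambda>t. cnj (\<Sum>k. d k * cis t ^ k)) ` {0..2*pi})"
    using bounded_linear_image[OF bd[OF d] bounded_linear_cnj] by (simp add: image_image)
  ultimately have U: "uniform_limit {0..2*pi} (\<lambda>n t. (\<Sum>k<n. c k * cis t ^ k) * cnj (\<Sum>k<n. d k * cis t ^ k))
     (\<lambda>t. (\<Sum>k. c k * cis t ^ k) * cnj (\<Sum>k. d k * cis t ^ k)) sequentially"
    by (intro uniform_lim_mult ul c bd)
  have cont: "continuous_on {0..2*pi} (\<lambda>t. (\<Sum>k<n. c k * cis t ^ k) * cnj (\<Sum>k<n. d k * cis t ^ k))" for n
    by (intro continuous_intros)
  obtain I J where IJ: "\<And>n. ((\<lambda>t. (\<Sum>k<n. c k * cis t ^ k) * cnj (\<Sum>k<n. d k * cis t ^ k)) has_integral I n) {0..2*pi}"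
     "((\<lambda>t. (\<Sum>k. c k * cis t ^ k) * cnj (\<Sum>k. d k * cis t ^ k)) has_integral J) {0..2*pi}" "I \<longlonglongrightarrow> J"
    using uniform_limit_integral[OF U cont] by auto
  have fin: "((\<lambda>t. (\<Sum>k<n. c k * cis t ^ k) * cnj (\<Sum>k<n. d k * cis t ^ k)) has_integral 2 * pi * (\<Sum>k<n. c k * cnj (d k))) {0..2*pi}" for n
  proof -
    have "((\<lambda>t. \<Sum>k<n. \<Sum>l<n. c k * cnj (d l) * (cis t ^ k * cnj (cis t ^ l))) has_integral
        (\<Sum>k<n. \<Sum>l<n. c k * cnj (d l) * (if k = l then 2 * pi else 0))) {0..2*pi}"
      by (intro has_integral_sum has_integral_mult_right cis_orthogonal) auto
    also have "(\<Sum>k<n. \<Sum>l<n. c k * cnj (d l) * of_real (if k = l then 2 * pi else 0)) = 2 * pi * (\<Sum>k<n. c k * cnj (d k))"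
      unfolding sum_distrib_left by (intro sum.cong refl) (simp add: if_distrib mult_ac cong: if_cong)
    also have "(\<lambda>t. \<Sum>k<n. \<Sum>l<n. c k * cnj (d l) * (cis t ^ k * cnj (cis t ^ l)))
       = (\<lambda>t. (\<Sum>k<n. c k * cis t ^ k) * cnj (\<Sum>k<n. d k * cis t ^ k))"
      unfolding cnj_sum sum_product by (intro ext sum.cong refl) (simp add: mult_ac)
    finally show ?thesis .
  qed
  have "I = (\<lambda>n. 2 * pi * (\<Sum>k<n. c k * cnj (d k)))"
    using has_integral_unique[OF IJ(1) fin] by auto
  moreover have "summable (\<lambda>k. c k * cnj (d k))"
  proof (rule summable_norm_cancel, rule summable_comparison_test_ev)
    have "(\<lambda>k. norm (d k)) \<longlonglongrightarrow> 0" using d by (rule summable_LIMSEQ_zero)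
    then have "\<forall>\<^sub>F k in sequentially. norm (d k) < 1" by (rule order_tendstoD) simp
    then show "\<forall>\<^sub>F k in sequentially. norm (norm (c k * cnj (d k))) \<le> norm (c k)"
      by eventually_elim (simp add: norm_mult mult_left_le)
  qed (rule c)
  then have "(\<lambda>n. 2 * pi * (\<Sum>k<n. c k * cnj (d k))) \<longlonglongrightarrow> 2 * pi * (\<Sum>k. c k * cnj (d k))"
    by (intro tendsto_intros summable_LIMSEQ)
  ultimately have "J = 2 * pi * (\<Sum>k. c k * cnj (d k))" using IJ(3) LIMSEQ_unique by blast
  then show ?thesis using IJ(2) by simp
qed

lemma taylor_sums:
  assumes "f holomorphic_on ball 0 1" "norm z < 1"
  shows "(\<lambda>k. taylor_coeff f k * z ^ k) sums f z"
  using holomorphic_power_series[OF assms(1), of z] assms(2) by (simp add: taylor_coeff_def)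

lemma taylor_summable:
  assumes f: "f holomorphic_on ball 0 1" and r: "0 \<le> r" "r < 1"
  shows "summable (\<lambda>k. norm (taylor_coeff f k) * r ^ k)"
proof -
  define R where "R = (r + 1) / 2"
  have R: "r < R" "R < 1" "0 < R" using r by (auto simp: R_def)
  have "summable (\<lambda>k. taylor_coeff f k * (of_real R) ^ k)"
    using taylor_sums[OF f, of "of_real R"] R by (auto simp: sums_iff)
  from powser_insidea[OF this, of "of_real r"] show ?thesis
    using r R by (simp add: norm_mult norm_power)
qed

lemma circ_pairing_series:
  assumes f: "f holomorphic_on ball 0 1" and g: "g holomorphic_on ball 0 1" and r: "0 \<le> r" "r < 1"
  shows "circ (\<lambda>z. f z * cnj (g z)) r = 2 * pi * (\<Sum>k. taylor_coeff f k * cnj (taylor_coeff g k) * of_real (r ^ (2 * k)))"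
proof -
  have ser: "h (of_real r * cis t) = (\<Sum>k. (taylor_coeff h k * of_real (r ^ k)) * cis t ^ k)"
    if "h holomorphic_on ball 0 1" for h t
    using sums_unique[OF taylor_sums[OF that, of "of_real r * cis t"]] r
    by (simp add: norm_mult power_mult_distrib mult_ac)
  have "circ (\<lambda>z. f z * cnj (g z)) r = 2 * pi * (\<Sum>k. (taylor_coeff f k * of_real (r ^ k)) * cnj (taylor_coeff g k * of_real (r ^ k)))"
    unfolding circ_def ser[OF f] ser[OF g]
    using taylor_summable[OF f r] taylor_summable[OF g r] r
    by (intro integral_unique parseval) (auto simp: norm_mult norm_power)
  also have "(\<lambda>k. (taylor_coeff f k * of_real (r ^ k)) * cnj (taylor_coeff g k * of_real (r ^ k)))
    = (\<lambda>k. taylor_coeff f k * cnj (taylor_coeff g k) * of_real (r ^ (2 * k)))"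
    by (intro ext) (simp add: mult_2 power_add)
  finally show ?thesis .
qed

lemma pairing_coeff_summable:
  assumes f: "f holomorphic_on ball 0 1" and g: "g holomorphic_on ball 0 1" and r: "0 \<le> r" "r < 1"
  shows "summable (\<lambda>k. norm (taylor_coeff f k * cnj (taylor_coeff g k)) * r ^ (2 * k + 1))"
proof -
  have "summable (\<lambda>k. norm (taylor_coeff f k) * r ^ k)" by (rule taylor_summable[OF f r])
  moreover have "(\<lambda>k. norm (taylor_coeff g k) * r ^ k) \<longlonglongrightarrow> 0"
    using taylor_summable[OF g r] by (rule summable_LIMSEQ_zero)
  then have "\<forall>\<^sub>F k in sequentially. norm (taylor_coeff g k) * r ^ k < 1" by (rule order_tendstoD) simp
  then have "\<forall>\<^sub>F k in sequentially. norm (norm (taylor_coeff f k * cnj (taylor_coeff g k)) * r ^ (2 * k + 1)) \<le> norm (taylor_coeff f k) * r ^ k"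
  proof eventually_elim
    fix k assume k: "norm (taylor_coeff g k) * r ^ k < 1"
    have "norm (norm (taylor_coeff f k * cnj (taylor_coeff g k)) * r ^ (2 * k + 1))
       = (norm (taylor_coeff f k) * r ^ k) * (norm (taylor_coeff g k) * r ^ k * r)"
    proof -
      have "r ^ (2 * k + 1) = r ^ k * r ^ k * r" by (simp add: mult_2 power_add)
      then show ?thesis using r by (simp only: norm_mult complex_mod_cnj real_norm_def abs_mult abs_norm_cancel) (simp add: mult_ac)
    qed
    also have "\<dots> \<le> (norm (taylor_coeff f k) * r ^ k) * (1 * 1)"
      using k r by (intro mult_left_mono mult_mono) auto
    finally show "norm (norm (taylor_coeff f k * cnj (taylor_coeff g k)) * r ^ (2 * k + 1)) \<le> norm (taylor_coeff f k) * r ^ k" by simp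
  qed
  ultimately show ?thesis by (rule summable_comparison_test_ev[rotated])
qed

section \<open>The multiplicative convolution of \<nu> with itself\<close>

context doubling_measure
begin

text \<open>Alters s only on a null set, so that products of two clipped values lie in [0,1)
  everywhere and not just almost everywhere.\<close>

definition clip :: "real \<Rightarrow> real" where "clip s = (if s \<in> {0..<1} then s else 0)"

lemma clip: "0 \<le> clip s" "clip s < 1" and clip_measurable [measurable]: "clip \<in> borel_measurable borel"
  unfolding clip_def[abs_def] by (auto simp: clip_def)

text \<open>The moments of \<open>\<kappa>\<close> are the squares of the moments of \<open>\<nu>\<close>, as they occur in the pairing.\<close>

definition \<kappa> :: "real measure" where
  "\<kappa> = distr (\<nu> \<Otimes>\<^sub>M \<nu>) borel (\<lambda>(s, t). clip s * clip t)"

lemma sets_\<kappa> [simp, measurable_cong]: "sets \<kappa> = sets borel" by (simp add: \<kappa>_def)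

sublocale pair: pair_sigma_finite \<nu> \<nu> ..

lemma AE_\<kappa>: "AE x in \<kappa>. x \<in> {0..<1}"
proof -
  have "clip s * clip t \<in> {0..<1}" for s t
  proof -
    have "clip s * clip t \<le> clip s * 1" using clip[of s] clip[of t] by (intro mult_left_mono) auto
    then show ?thesis using clip[of s] clip[of t] by auto
  qed
  then show ?thesis unfolding \<kappa>_def by (subst AE_distr_iff) auto
qed

lemma finite_measure_\<kappa>: "finite_measure \<kappa>"
proof -
  interpret p: finite_measure "\<nu> \<Otimes>\<^sub>M \<nu>"
    by (rule finite_measure_pair_measure) unfold_locales
  show ?thesis unfolding \<kappa>_def by (rule p.finite_measure_distr) measurable
qed

lemma nn_integral_\<kappa>:
  assumes [measurable]: "\<phi> \<in> borel_measurable borel"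
  shows "(\<integral>\<^sup>+x. \<phi> x \<partial>\<kappa>) = (\<integral>\<^sup>+s. \<integral>\<^sup>+t. \<phi> (clip s * clip t) \<partial>\<nu> \<partial>\<nu>)"
  unfolding \<kappa>_def
  by (subst nn_integral_distr, measurable, subst nn_integral_fst[symmetric]) (auto simp: split_beta)

lemma integral_pow_\<kappa>: "(LINT x|\<kappa>. x ^ Suc n) = (mom (Suc n))\<^sup>2"
proof -
  have m: "(LINT s|\<nu>. clip s ^ Suc n) = mom (Suc n)"
    unfolding mom_def
  proof (rule integral_cong_AE)
    show "AE s in \<nu>. clip s ^ Suc n = s ^ Suc n" by (rule AE_nuI) (simp add: clip_def)
  qed measurable
  have I: "integrable \<nu> (\<lambda>s. clip s ^ Suc n)"
    by (rule integrable_const_bound[of _ 1]) (auto simp: clip less_imp_le power_abs intro!: AE_I2 power_le_one mult_le_one)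
  have "(\<integral>\<^sup>+x. ennreal (x ^ Suc n) \<partial>\<kappa>) = (\<integral>\<^sup>+s. \<integral>\<^sup>+t. ennreal (clip s ^ Suc n) * ennreal (clip t ^ Suc n) \<partial>\<nu> \<partial>\<nu>)"
    by (subst nn_integral_\<kappa>) (auto simp: power_mult_distrib clip mult_ac simp flip: ennreal_mult intro!: nn_integral_cong)
  also have "\<dots> = (\<integral>\<^sup>+s. ennreal (clip s ^ Suc n) \<partial>\<nu>) * (\<integral>\<^sup>+t. ennreal (clip t ^ Suc n) \<partial>\<nu>)"
    by (subst nn_integral_cmult, measurable, subst nn_integral_multc) auto
  also have "(\<integral>\<^sup>+s. ennreal (clip s ^ Suc n) \<partial>\<nu>) = ennreal (mom (Suc n))"
    unfolding m[symmetric] by (rule nn_integral_eq_integral[OF I]) (auto simp: clip)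
  finally have e: "(\<integral>\<^sup>+x. ennreal (x ^ Suc n) \<partial>\<kappa>) = ennreal ((mom (Suc n))\<^sup>2)"
    using mom_pos[of "Suc n"] by (simp add: power2_eq_square ennreal_mult less_imp_le)
  have "(LINT x|\<kappa>. x ^ Suc n) = enn2real (\<integral>\<^sup>+x. ennreal (x ^ Suc n) \<partial>\<kappa>)"
    by (rule integral_eq_nn_integral) (use AE_\<kappa> in \<open>auto elim!: eventually_mono\<close>)
  also have "\<dots> = (mom (Suc n))\<^sup>2" unfolding e by simp
  finally show ?thesis .
qed

text \<open>For \<open>s \<le> t\<close> the integrand at \<open>s t \<le> s\<close> is at most \<open>u s / T s\<close>, and integrating over \<open>t \<ge> s\<close>
  cancels \<open>T s\<close>.\<close>

lemma nn_integral_\<kappa>_tail: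
  assumes [measurable]: "u \<in> borel_measurable borel"
    and u: "\<And>s. 0 \<le> u s" and mono: "\<And>r s. 0 \<le> r \<Longrightarrow> r \<le> s \<Longrightarrow> s < 1 \<Longrightarrow> u r \<le> u s"
  shows "(\<integral>\<^sup>+x. ennreal (u x / T x) \<partial>\<kappa>) \<le> 2 * (\<integral>\<^sup>+s. ennreal (u s) \<partial>\<nu>)"
proof -
  define Q where "Q x = u (clip x) / T (clip x)" for x
  have [measurable]: "Q \<in> borel_measurable borel" unfolding Q_def[abs_def] by measurable
  have Qm: "u r / T r \<le> u s / T s" if "0 \<le> r" "r \<le> s" "s < 1" for r s
    using that u T_pos by (intro frac_le mono T_antimono) auto
  have Q0: "0 \<le> Q x" for x using u T_nonneg by (simp add: Q_def)
  have half: "(\<integral>\<^sup>+t. ennreal (Q s) * indicator {s..} t \<partial>\<nu>) = ennreal (u s)" if "0 \<le> s" "s < 1" for s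
  proof -
    have "(\<integral>\<^sup>+t. ennreal (Q s) * indicator {s..} t \<partial>\<nu>) = ennreal (Q s) * ennreal (T s)"
    proof (subst nn_integral_cmult)
      show "(indicator {s..} :: real \<Rightarrow> ennreal) \<in> borel_measurable \<nu>" by (rule borel_measurable_indicator) simp
    qed (simp add: T_def emeasure_eq_measure)
    then show ?thesis using that T_pos[of s] Q0[of s] by (simp add: Q_def clip_def flip: ennreal_mult)
  qed
  have "(\<integral>\<^sup>+x. ennreal (u x / T x) \<partial>\<kappa>) = (\<integral>\<^sup>+s. \<integral>\<^sup>+t. ennreal (u (clip s * clip t) / T (clip s * clip t)) \<partial>\<nu> \<partial>\<nu>)"
    by (rule nn_integral_\<kappa>) measurable
  also have "\<dots> \<le> (\<integral>\<^sup>+s. \<integral>\<^sup>+t. ennreal (Q s) * indicator {s..} t + ennreal (Q t) * indicator {t..} s \<partial>\<nu> \<partial>\<nu>)"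
  proof (rule nn_integral_mono_AE)
    show "AE s in \<nu>. (\<integral>\<^sup>+t. ennreal (u (clip s * clip t) / T (clip s * clip t)) \<partial>\<nu>)
       \<le> (\<integral>\<^sup>+t. ennreal (Q s) * indicator {s..} t + ennreal (Q t) * indicator {t..} s \<partial>\<nu>)"
    proof (rule AE_nuI, rule nn_integral_mono_AE, rule AE_nuI)
      fix s t :: real assume st: "0 \<le> s" "s < 1" "0 \<le> t" "t < 1"
      have c: "clip s = s" "clip t = t" using st by (auto simp: clip_def)
      have "s * t \<le> s" "s * t \<le> t" using st by (auto simp: mult_left_le mult_left_le_one_le)
      then have "u (s * t) / T (s * t) \<le> Q s" "u (s * t) / T (s * t) \<le> Q t"
        unfolding Q_def c using st by (auto intro!: Qm)
      then show "ennreal (u (clip s * clip t) / T (clip s * clip t))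
         \<le> ennreal (Q s) * indicator {s..} t + ennreal (Q t) * indicator {t..} s"
        unfolding c by (cases "s \<le> t") (auto split: split_indicator intro: ennreal_leI add_increasing2)
    qed
  qed
  also have "\<dots> = (\<integral>\<^sup>+s. (\<integral>\<^sup>+t. ennreal (Q s) * indicator {s..} t \<partial>\<nu>) + (\<integral>\<^sup>+t. ennreal (Q t) * indicator {t..} s \<partial>\<nu>) \<partial>\<nu>)"
    by (intro nn_integral_cong nn_integral_add) (auto simp: indicator_def)
  also have "\<dots> = (\<integral>\<^sup>+s. (\<integral>\<^sup>+t. ennreal (Q s) * indicator {s..} t \<partial>\<nu>) \<partial>\<nu>) + (\<integral>\<^sup>+s. (\<integral>\<^sup>+t. ennreal (Q t) * indicator {t..} s \<partial>\<nu>) \<partial>\<nu>)"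
    by (rule nn_integral_add) (simp_all add: indicator_def)
  also have "(\<integral>\<^sup>+s. (\<integral>\<^sup>+t. ennreal (Q t) * indicator {t..} s \<partial>\<nu>) \<partial>\<nu>) = (\<integral>\<^sup>+t. (\<integral>\<^sup>+s. ennreal (Q t) * indicator {t..} s \<partial>\<nu>) \<partial>\<nu>)"
    by (rule pair.Fubini') (simp add: indicator_def)
  also have "(\<integral>\<^sup>+s. (\<integral>\<^sup>+t. ennreal (Q s) * indicator {s..} t \<partial>\<nu>) \<partial>\<nu>) = (\<integral>\<^sup>+s. ennreal (u s) \<partial>\<nu>)"
    by (intro nn_integral_cong_AE AE_nuI half)
  finally show ?thesis by (simp add: mult_2)
qed

text \<open>The pairing sum at r is the \<kappa>-integral of Bf (r x), where Bf x is the power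
  series with coefficients c k and exponents 2 k + 1. The majorant W = K u / T is nondecreasing, so
  it dominates Bf (r x) for every r at once, and dominated convergence applies. Its integral is at
  most 2 K times that of u, and 2 K = N / \<pi>.\<close>

theorem pairing_limit:
  assumes f: "f holomorphic_on ball 0 1" and g: "g holomorphic_on ball 0 1"
    and int: "integrable \<nu> (\<lambda>s. s * M1 f s)" and N: "0 \<le> N"
    and bound: "\<And>\<rho>. 0 < \<rho> \<Longrightarrow> \<rho> < 1 \<Longrightarrow> norm (circ (\<lambda>z. f z * cnj (g z)) \<rho>) \<le> N / T \<rho> * M1 f \<rho>"
  obtains l where "((\<lambda>r. \<Sum>k. taylor_coeff f k * cnj (taylor_coeff g k) * of_real (r ^ (2 * k + 1) * (mom (2 * k + 1))\<^sup>2)) \<longlongrightarrow> l) (at_left 1)"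
    "norm l \<le> N / pi * (LINT s|\<nu>. s * M1 f s)"
proof -
  interpret k: finite_measure \<kappa> by (rule finite_measure_\<kappa>)
  define c where "c k = taylor_coeff f k * cnj (taylor_coeff g k)" for k
  \<comment> \<open>The factor x turns the even powers in the circle mean into the odd powers whose
    \<kappa>-moments are the squared moments of the pairing.\<close>
  define Bf where "Bf x = (if x \<in> {0..<1} then of_real x * circ (\<lambda>z. f z * cnj (g z)) x / (2 * pi) else 0)" for x
  have ccirc: "continuous_on (ball 0 1) (\<lambda>z. f z * cnj (g z))"
    by (intro continuous_intros holomorphic_on_imp_continuous_on f g)
  have cB: "isCont Bf x" if x: "0 < x" "x < 1" for x
  proof -
    define R where "R = (1 + x) / 2"
    have "continuous_on {0..R} (circ (\<lambda>z. f z * cnj (g z)))"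
      by (rule circ_zero_limit[OF ccirc]) (use x in \<open>auto simp: R_def\<close>)
    then have "continuous_on {0..R} (\<lambda>x. of_real x * circ (\<lambda>z. f z * cnj (g z)) x / (2 * pi))"
      by (intro continuous_intros) auto
    then have "continuous_on {0<..<R} Bf"
      by (rule continuous_on_eq[OF continuous_on_subset]) (use x in \<open>auto simp: Bf_def R_def\<close>)
    then show ?thesis using x by (auto simp: continuous_on_eq_continuous_at R_def)
  qed
  have B0: "Bf 0 = 0" by (simp add: Bf_def)
  have Bm [measurable]: "Bf \<in> borel_measurable borel"
  proof -
    have "continuous_on {0<..<1} Bf" using cB by (auto simp: continuous_on_eq_continuous_at)
    then have "(\<lambda>x. indicat_real {0<..<1} x *\<^sub>R Bf x) \<in> borel_measurable borel"
      by (intro borel_measurable_continuous_on_indicator) auto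
    also have "(\<lambda>x. indicat_real {0<..<1} x *\<^sub>R Bf x) = Bf"
      by (auto simp: fun_eq_iff Bf_def split: split_indicator)
    finally show ?thesis .
  qed
  have Bser: "Bf x = (\<Sum>k. c k * of_real (x ^ (2 * k + 1)))" if x: "0 \<le> x" "x < 1" for x
  proof -
    have "summable (\<lambda>k. c k * of_real (x ^ (2 * k)))"
    proof (cases "x = 0")
      case False
      have "summable (\<lambda>k. norm (c k) * x ^ (2 * k + 1) * inverse x)"
        unfolding c_def by (intro summable_mult2 pairing_coeff_summable f g x)
      then have "summable (\<lambda>k. norm (c k * of_real (x ^ (2 * k))))"
        using False x by (simp add: norm_mult norm_power field_simps)
      then show ?thesis by (rule summable_norm_cancel)
    next
      case True
      have "summable (\<lambda>k. if k = 0 then c 0 else 0)" by (rule summable_single)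
      then show ?thesis by (rule summable_cong[THEN iffD1, rotated]) (auto simp: True)
    qed
    then have "of_real x * (\<Sum>k. c k * of_real (x ^ (2 * k))) = (\<Sum>k. of_real x * (c k * of_real (x ^ (2 * k))))"
      by (rule suminf_mult[symmetric])
    then show ?thesis using x
      by (simp add: Bf_def circ_pairing_series[OF f g x] c_def mult_ac)
  qed
  define u where "u s = (if s \<in> {0..<1} then s * M1 f s else 0)" for s
  have um [measurable]: "u \<in> borel_measurable borel"
    unfolding u_def[abs_def] using borel_measurable_M1[OF f] by measurable
  have u0: "0 \<le> u s" for s unfolding u_def using M1_nonneg[OF f] by auto
  have umono: "u r \<le> u s" if "0 \<le> r" "r \<le> s" "s < 1" for r s
    using that M1_nonneg[OF f] by (auto simp: u_def intro!: mult_mono M1_mono f)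
  define K where "K = N / (2 * pi)"
  have K: "0 \<le> K" using N by (simp add: K_def)
  define W where "W x = K * (u x / T x)" for x
  have Wm [measurable]: "W \<in> borel_measurable borel" unfolding W_def[abs_def] by measurable
  have BW: "norm (Bf x) \<le> W x" if "0 \<le> x" "x < 1" for x
  proof (cases "x = 0")
    case True then show ?thesis using B0 K u0 T_nonneg by (simp add: W_def)
  next
    case False
    have "norm (Bf x) = x * norm (circ (\<lambda>z. f z * cnj (g z)) x) / (2 * pi)"
      using that by (simp add: Bf_def norm_mult norm_divide)
    also have "\<dots> \<le> x * (N / T x * M1 f x) / (2 * pi)"
      using that False by (intro divide_right_mono mult_left_mono bound) auto
    also have "\<dots> = W x" using that by (simp add: W_def K_def u_def mult_ac)
    finally show ?thesis .
  qed
  have Wmono: "W r \<le> W s" if "0 \<le> r" "r \<le> s" "s < 1" for r s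
    unfolding W_def using that K u0 T_pos by (intro mult_left_mono frac_le umono T_antimono) auto
  have BWr: "norm (Bf (r * x)) \<le> W x" if "0 < r" "r < 1" "0 \<le> x" "x < 1" for r x
  proof -
    have "r * x \<le> x" using that by (simp add: mult_left_le_one_le)
    then show ?thesis using BW[of "r * x"] Wmono[of "r * x" x] that by auto
  qed
  have W0: "0 \<le> W x" for x using K u0 T_nonneg by (simp add: W_def)
  have uint: "integrable \<nu> u" and uI: "(LINT s|\<nu>. u s) = (LINT s|\<nu>. s * M1 f s)"
  proof -
    have ae: "AE s in \<nu>. s * M1 f s = u s" by (rule AE_nuI) (simp add: u_def)
    show "integrable \<nu> u" by (rule integrable_cong_AE_imp[OF int]) (use ae in \<open>auto elim: eventually_mono\<close>)
    show "(LINT s|\<nu>. u s) = (LINT s|\<nu>. s * M1 f s)"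
      by (rule integral_cong_AE) (use ae borel_measurable_M1[OF f] in \<open>auto elim: eventually_mono\<close>)
  qed
  have Wnn: "(\<integral>\<^sup>+x. ennreal (W x) \<partial>\<kappa>) \<le> ennreal (K * (2 * (LINT s|\<nu>. s * M1 f s)))"
  proof -
    have "(\<integral>\<^sup>+x. ennreal (W x) \<partial>\<kappa>) = ennreal K * (\<integral>\<^sup>+x. ennreal (u x / T x) \<partial>\<kappa>)"
    proof -
      have "ennreal (W x) = ennreal K * ennreal (u x / T x)" for x
        unfolding W_def by (rule ennreal_mult) (use K u0 T_nonneg in auto)
      then show ?thesis by (simp add: nn_integral_cmult)
    qed
    also have "\<dots> \<le> ennreal K * (2 * (\<integral>\<^sup>+s. ennreal (u s) \<partial>\<nu>))"
      by (intro mult_left_mono nn_integral_\<kappa>_tail um u0 umono) auto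
    also have "(\<integral>\<^sup>+s. ennreal (u s) \<partial>\<nu>) = ennreal (LINT s|\<nu>. s * M1 f s)"
      unfolding uI[symmetric] by (rule nn_integral_eq_integral[OF uint]) (simp add: u0)
    also have "ennreal K * (2 * ennreal (LINT s|\<nu>. s * M1 f s)) = ennreal (K * (2 * (LINT s|\<nu>. s * M1 f s)))"
      using K integral_nonneg_AE[of u \<nu>] u0 by (simp add: ennreal_mult uI[symmetric] flip: ennreal_numeral)
    finally show ?thesis .
  qed
  have Wint: "integrable \<kappa> W"
    by (rule integrableI_bounded) (use Wnn W0 in \<open>auto intro: le_less_trans\<close>)
  have WI: "(LINT x|\<kappa>. W x) \<le> K * (2 * (LINT s|\<nu>. s * M1 f s))"
  proof -
    have "ennreal (LINT x|\<kappa>. W x) = (\<integral>\<^sup>+x. ennreal (W x) \<partial>\<kappa>)"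
      by (rule nn_integral_eq_integral[symmetric, OF Wint]) (simp add: W0)
    moreover have "0 \<le> K * (2 * (LINT s|\<nu>. s * M1 f s))"
      using K integral_nonneg_AE[of u \<nu>] u0 by (simp add: uI[symmetric])
    ultimately show ?thesis using Wnn by (metis ennreal_le_iff)
  qed
  have ps: "(\<Sum>k. c k * of_real (r ^ (2 * k + 1) * (mom (2 * k + 1))\<^sup>2)) = (LINT x|\<kappa>. Bf (r * x))"
    if r: "0 < r" "r < 1" for r
  proof -
    define h where "h k x = c k * of_real ((r * clip x) ^ (2 * k + 1))" for k x
    have hm [measurable]: "h k \<in> borel_measurable \<kappa>" for k unfolding h_def[abs_def] by measurable
    have hb: "norm (h k x) \<le> norm (c k) * r ^ (2 * k + 1)" for k x
    proof -
      have "(r * clip x) ^ (2 * k + 1) \<le> r ^ (2 * k + 1)"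
        using r clip[of x] by (intro power_mono) (auto simp: mult_left_le)
      then show ?thesis using r clip(1)[of x] unfolding h_def norm_mult
        by (intro mult_left_mono) (simp_all only: norm_of_real abs_of_nonneg mult_nonneg_nonneg zero_le_power less_imp_le norm_ge_zero)
    qed
    have hi: "integrable \<kappa> (h k)" for k
      by (rule k.integrable_const_bound[of _ "norm (c k) * r ^ (2 * k + 1)"]) (use hb in auto)
    have sm: "summable (\<lambda>k. norm (c k) * r ^ (2 * k + 1))"
      unfolding c_def using pairing_coeff_summable[OF f g] r by simp
    have "(\<lambda>k. LINT x|\<kappa>. h k x) sums (LINT x|\<kappa>. (\<Sum>k. h k x))"
    proof (rule sums_integral[OF hi])
      show "AE x in \<kappa>. summable (\<lambda>k. norm (h k x))"
        by (intro AE_I2 summable_comparison_test[OF _ sm]) (use hb in auto)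
      show "summable (\<lambda>k. LINT x|\<kappa>. norm (h k x))"
      proof (rule summable_comparison_test)
        show "summable (\<lambda>k. norm (c k) * r ^ (2 * k + 1) * measure \<kappa> (space \<kappa>))" by (rule summable_mult2[OF sm])
        have "norm (LINT x|\<kappa>. norm (h k x)) \<le> norm (c k) * r ^ (2 * k + 1) * measure \<kappa> (space \<kappa>)" for k
        proof -
          have "(LINT x|\<kappa>. norm (h k x)) \<le> (LINT x|\<kappa>. norm (c k) * r ^ (2 * k + 1))"
            by (intro integral_mono integrable_norm hi hb) auto
          also have "\<dots> = measure \<kappa> (space \<kappa>) * (norm (c k) * r ^ (2 * k + 1))"
            unfolding lebesgue_integral_const by (simp only: real_scaleR_def)
          finally show ?thesis
            unfolding real_norm_def by (subst abs_of_nonneg) (auto simp only: mult.commute intro!: integral_nonneg_AE AE_I2 norm_ge_zero)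
        qed
        then show "\<exists>N. \<forall>k\<ge>N. norm (LINT x|\<kappa>. norm (h k x)) \<le> norm (c k) * r ^ (2 * k + 1) * measure \<kappa> (space \<kappa>)"
          by blast
      qed
    qed
    moreover have "(LINT x|\<kappa>. h k x) = c k * of_real (r ^ (2 * k + 1) * (mom (2 * k + 1))\<^sup>2)" for k
    proof -
      have "(LINT x|\<kappa>. h k x) = (LINT x|\<kappa>. (c k * of_real (r ^ (2 * k + 1))) * of_real (x ^ Suc (2 * k)))"
      proof (rule integral_cong_AE)
        show "AE x in \<kappa>. h k x = (c k * of_real (r ^ (2 * k + 1))) * of_real (x ^ Suc (2 * k))"
          using AE_\<kappa> by eventually_elim (auto simp: h_def clip_def power_mult_distrib)
      qed measurable
      also have "\<dots> = (c k * of_real (r ^ (2 * k + 1))) * (LINT x|\<kappa>. of_real (x ^ Suc (2 * k)))"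
        by (rule integral_mult_right_zero)
      also have "(LINT x|\<kappa>. complex_of_real (x ^ Suc (2 * k))) = of_real (LINT x|\<kappa>. x ^ Suc (2 * k))"
      proof (rule integral_of_real)
        have "AE x in \<kappa>. norm (x ^ Suc (2 * k)) \<le> 1"
          using AE_\<kappa> by eventually_elim (simp only: norm_power, rule power_le_one, auto)
        then show "integrable \<kappa> (\<lambda>x. x ^ Suc (2 * k))" by (rule k.integrable_const_bound) measurable
      qed
      also have "(LINT x|\<kappa>. x ^ Suc (2 * k)) = (mom (2 * k + 1))\<^sup>2" unfolding integral_pow_\<kappa> by simp
      finally show ?thesis by (simp add: mult_ac)
    qed
    moreover have "(LINT x|\<kappa>. (\<Sum>k. h k x)) = (LINT x|\<kappa>. Bf (r * x))"
    proof (rule integral_cong_AE)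
      show "AE x in \<kappa>. (\<Sum>k. h k x) = Bf (r * x)"
        using AE_\<kappa>
      proof eventually_elim
        fix x :: real assume x: "x \<in> {0..<1}"
        have "r * x < 1 * 1" using x r by (intro mult_strict_mono) auto
        then show "(\<Sum>k. h k x) = Bf (r * x)" using x r by (subst Bser) (auto simp: h_def clip_def)
      qed
    qed measurable
    ultimately show ?thesis by (simp add: sums_iff)
  qed
  define l where "l = (LINT x|\<kappa>. Bf x)"
  have lim: "((\<lambda>r. \<Sum>k. c k * of_real (r ^ (2 * k + 1) * (mom (2 * k + 1))\<^sup>2)) \<longlongrightarrow> l) (at_left 1)"
  proof (rule tendsto_at_left_sequentially[of 0])
    fix S :: "nat \<Rightarrow> real" assume S: "\<And>n. S n < 1" "\<And>n. 0 < S n" "incseq S" "S \<longlonglongrightarrow> 1"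
    have "(\<lambda>n. LINT x|\<kappa>. Bf (S n * x)) \<longlonglongrightarrow> l"
      unfolding l_def
    proof (rule integral_dominated_convergence[OF _ _ Wint])
      show "AE x in \<kappa>. (\<lambda>n. Bf (S n * x)) \<longlonglongrightarrow> Bf x"
        using AE_\<kappa>
      proof eventually_elim
        fix x :: real assume x: "x \<in> {0..<1}"
        show "(\<lambda>n. Bf (S n * x)) \<longlonglongrightarrow> Bf x"
        proof (cases "x = 0")
          case False
          have "(\<lambda>n. S n * x) \<longlonglongrightarrow> 1 * x" by (intro tendsto_intros S)
          then show ?thesis using cB[of x] x False isCont_tendsto_compose[of x Bf] by auto
        qed simp
      qed
      show "AE x in \<kappa>. norm (Bf (S n * x)) \<le> W x" for n
        using AE_\<kappa> by eventually_elim (use BWr S in auto)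
    qed measurable
    then show "(\<lambda>n. \<Sum>k. c k * of_real (S n ^ (2 * k + 1) * (mom (2 * k + 1))\<^sup>2)) \<longlonglongrightarrow> l"
      using ps S by simp
  qed simp
  have BWae: "AE x in \<kappa>. norm (Bf x) \<le> W x" using AE_\<kappa> by eventually_elim (use BW in auto)
  have Bint: "integrable \<kappa> Bf"
    by (rule Bochner_Integration.integrable_bound[OF Wint]) (use BWae W0 in \<open>auto elim: eventually_mono\<close>)
  have "norm l \<le> (LINT x|\<kappa>. norm (Bf x))" unfolding l_def by (rule integral_norm_bound)
  also have "\<dots> \<le> (LINT x|\<kappa>. W x)"
    by (rule integral_mono_AE[OF integrable_norm[OF Bint] Wint BWae])
  also have "\<dots> \<le> N / pi * (LINT s|\<nu>. s * M1 f s)" using WI by (simp add: K_def)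
  finally show thesis using lim that unfolding c_def by blast
qed

end

section \<open>Dilates and oscillation\<close>

lemma continuous_on_circle_UNIV:
  assumes "g holomorphic_on ball 0 1" "0 \<le> \<rho>" "\<rho> < 1"
  shows "continuous_on S (\<lambda>t. g (of_real \<rho> * cis t))"
  using continuous_circle[OF holomorphic_on_imp_continuous_on] assms by blast

text \<open>A dilate is continuous on the closed unit disc, so its radial limits exist at every t
  and are its values there.\<close>

lemma boundary_fun_dilate:
  assumes g: "g holomorphic_on ball 0 1" and \<rho>: "0 < \<rho>" "\<rho> < 1"
  shows "boundary_fun (dilate \<rho> g) = (\<lambda>t. g (of_real \<rho> * cis t))"
proof
  fix t
  have "isCont g (of_real \<rho> * cis t)"
    using holomorphic_on_imp_continuous_on[OF g] \<rho>
    by (simp add: continuous_on_eq_continuous_at norm_mult)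
  moreover have "((\<lambda>r. of_real \<rho> * (of_real r * cis t)) \<longlongrightarrow> of_real \<rho> * (of_real 1 * cis t)) (at_left 1)"
    by (intro tendsto_intros)
  ultimately have "((\<lambda>r. g (of_real \<rho> * (of_real r * cis t))) \<longlongrightarrow> g (of_real \<rho> * cis t)) (at_left 1)"
    using isCont_tendsto_compose by fastforce
  then show "boundary_fun (dilate \<rho> g) t = g (of_real \<rho> * cis t)"
    unfolding boundary_fun_def dilate_def by (intro tendsto_Lim) auto
qed

lemma set_integral_continuous:
  fixes u :: "real \<Rightarrow> 'a::euclidean_space"
  assumes "continuous_on UNIV u"
  shows "(LINT t:{a..b}|lebesgue. u t) = integral {a..b} u"
proof (rule set_lebesgue_integral_eq_integral(2))
  have c: "continuous_on {a..b} u" using assms continuous_on_subset by blast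
  show "set_integrable lebesgue {a..b} u"
    using absolutely_integrable_continuous_real[OF c] .
qed

lemma mean_osc_continuous:
  assumes u: "continuous_on UNIV u"
  shows "mean_osc u (a, b) = integral {a..b} (\<lambda>t. norm (u t - avg u a b)) / (b - a)"
proof -
  have "mean u (a, b) = avg u a b" unfolding mean_def avg_def by (simp add: set_integral_continuous[OF u])
  then show ?thesis unfolding mean_osc_def mean_def using u
    by (simp, subst set_integral_continuous) (auto intro!: continuous_intros simp: divide_inverse_commute)
qed

lemma mean_osc_nonneg:
  assumes u: "continuous_on UNIV u" and "a < b"
  shows "0 \<le> mean_osc u (a, b)"
  unfolding mean_osc_continuous[OF u] using \<open>a < b\<close> u
  by (intro divide_nonneg_nonneg integral_nonneg integrable_continuous_UNIV continuous_intros) auto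

lemma mean_osc_bdd_above:
  assumes g: "g holomorphic_on ball 0 1" and \<rho>: "0 < \<rho>" "\<rho> < 1"
  shows "bdd_above (mean_osc (\<lambda>t. g (of_real \<rho> * cis t)) ` arcs)"
proof -
  let ?u = "\<lambda>t. g (of_real \<rho> * cis t)"
  have u: "continuous_on UNIV ?u" by (rule continuous_on_circle_UNIV[OF g]) (use \<rho> in auto)
  have "continuous_on (cball 0 \<rho>) (\<lambda>z. norm (g z))"
    by (intro continuous_intros holomorphic_on_imp_continuous_on holomorphic_on_subset[OF g]) (use \<rho> in auto)
  then obtain z0 where "\<forall>z\<in>cball 0 \<rho>. norm (g z) \<le> norm (g z0)"
    using continuous_attains_sup[of "cball 0 \<rho>" "\<lambda>z. norm (g z)"] \<rho> by auto
  then have M: "norm (?u t) \<le> norm (g z0)" for t using \<rho> by (simp add: norm_mult)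
  define M where "M = norm (g z0)"
  have "mean_osc ?u I \<le> 2 * M" if I: "I \<in> arcs" for I
  proof -
    obtain a b where ab: "I = (a, b)" "a < b" using I by (auto simp: arcs_def)
    have "norm (avg ?u a b - 0) \<le> integral {a..b} (\<lambda>t. norm (?u t - 0)) / (b - a)"
      by (rule norm_avg_diff_le[OF u ab(2)])
    also have "integral {a..b} (\<lambda>t. norm (?u t - 0)) \<le> integral {a..b} (\<lambda>t. M)"
      using M by (intro integral_le integrable_continuous_UNIV continuous_intros u) (auto simp: M_def)
    finally have av: "norm (avg ?u a b) \<le> M" using ab by (simp add: divide_right_mono)
    have "norm (?u t - avg ?u a b) \<le> 2 * M" for t
      using norm_triangle_ineq4[of "?u t" "avg ?u a b"] M[of t] av by (simp add: M_def)
    then have "integral {a..b} (\<lambda>t. norm (?u t - avg ?u a b)) \<le> integral {a..b} (\<lambda>t. 2 * M)"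
      by (intro integral_le integrable_continuous_UNIV continuous_intros u) auto
    then show ?thesis unfolding ab(1) mean_osc_continuous[OF u] using ab by (simp add: pos_divide_le_eq mult_ac)
  qed
  then show ?thesis by (intro bdd_aboveI2)
qed

text \<open>Supplies the membership clause of \<open>BMOA_inf\<close> for the representing function,
  of which only the growth is estimated separately.\<close>

lemma dilate_BMOA:
  assumes g: "g holomorphic_on ball 0 1" and \<rho>: "0 < \<rho>" "\<rho> < 1"
  shows "dilate \<rho> g \<in> BMOA"
proof -
  have im: "(\<lambda>z. of_real \<rho> * z) ` ball 0 1 \<subseteq> ball (0::complex) 1"
  proof (clarsimp simp: norm_mult)
    fix z :: complex assume "norm z < 1"
    then have "\<rho> * norm z < 1 * 1" using \<rho> by (intro mult_strict_mono) auto
    then show "\<bar>\<rho>\<bar> * norm z < 1" using \<rho> by simp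
  qed
  have hd: "dilate \<rho> g holomorphic_on ball 0 1"
    unfolding dilate_def[abs_def]
    by (rule holomorphic_on_compose_gen[OF _ g im, unfolded o_def]) (intro holomorphic_intros)
  have e: "(LINT t:{0..2*pi}|lebesgue. norm (dilate \<rho> g (of_real r * cis t))) = circ (\<lambda>z. norm (g z)) (\<rho> * r)"
    if r: "0 < r" "r < 1" for r
  proof -
    have "\<rho> * r < 1 * 1" using \<rho> r by (intro mult_strict_mono) auto
    then have "continuous_on UNIV (\<lambda>t. g (of_real (\<rho> * r) * cis t))"
      using \<rho> r by (intro continuous_on_circle_UNIV[OF g]) auto
    then have "continuous_on UNIV (\<lambda>t. norm (g (of_real (\<rho> * r) * cis t)))" by (rule continuous_on_norm)
    from set_integral_continuous[OF this] show ?thesis by (simp add: dilate_def circ_def mult.assoc)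
  qed
  have "(LINT t:{0..2*pi}|lebesgue. norm (dilate \<rho> g (of_real r * cis t))) / (2 * pi) \<le> circ (\<lambda>z. norm (g z)) \<rho> / (2 * pi)"
    if r: "r \<in> {0<..<1}" for r
  proof -
    have "circ (\<lambda>z. norm (g z)) (\<rho> * r) \<le> circ (\<lambda>z. norm (g z)) \<rho>"
      using r \<rho> by (intro circ_norm_mono[OF g]) (auto simp: mult_left_le)
    then show ?thesis using r e[of r] by (auto intro: divide_right_mono)
  qed
  then have "bdd_above ((\<lambda>r. (LINT t:{0..2*pi}|lebesgue. norm (dilate \<rho> g (of_real r * cis t))) / (2 * pi)) ` {0<..<1})"
    by (intro bdd_aboveI2)
  with hd have "dilate \<rho> g \<in> H1" by (simp add: H1_def)
  then show ?thesis
    using mean_osc_bdd_above[OF g \<rho>] by (simp add: BMOA_def boundary_fun_dilate[OF g \<rho>])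
qed

lemma BMOA_norm_dilate:
  assumes g: "g holomorphic_on ball 0 1" and \<rho>: "0 < \<rho>" "\<rho> < 1"
  shows "BMOA_norm (dilate \<rho> g) = norm (g 0) + (SUP I\<in>arcs. mean_osc (\<lambda>t. g (of_real \<rho> * cis t)) I)"
  unfolding BMOA_norm_def boundary_fun_dilate[OF g \<rho>] by (simp add: dilate_def)

lemma arcs_nonempty: "(0, 1) \<in> arcs"
  using pi_gt3 by (simp add: arcs_def)

lemma circ_le_BMOA_norm:
  assumes f: "f holomorphic_on ball 0 1" and g: "g holomorphic_on ball 0 1" and \<rho>: "0 < \<rho>" "\<rho> < 1"
  shows "norm (circ (\<lambda>z. f z * cnj (g z)) \<rho>) \<le> 648 * BMOA_norm (dilate \<rho> g) * M1 f \<rho>"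
proof -
  let ?u = "\<lambda>t. g (of_real \<rho> * cis t)"
  have u: "continuous_on UNIV ?u" by (rule continuous_on_circle_UNIV[OF g]) (use \<rho> in auto)
  define K where "K = (SUP I\<in>arcs. mean_osc ?u I)"
  have up: "mean_osc ?u I \<le> K" if "I \<in> arcs" for I
    unfolding K_def by (rule cSUP_upper[OF that mean_osc_bdd_above[OF g \<rho>]])
  have K0: "0 \<le> K" using up[OF arcs_nonempty] mean_osc_nonneg[OF u, of 0 1] by simp
  have "integral {a..b} (\<lambda>t. norm (?u t - avg ?u a b)) \<le> K * (b - a)" if "a < b" "b \<le> a + 2 * pi" for a b
    using up[of "(a, b)"] that by (simp add: mean_osc_continuous[OF u] arcs_def pos_divide_le_eq)
  then have "norm (circ (\<lambda>z. f z * cnj (g z)) \<rho>) \<le> (648 * K + norm (g 0)) * circ (\<lambda>z. norm (f z)) \<rho>"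
    by (rule fefferman_inequality[OF f g \<rho> K0])
  also have "circ (\<lambda>z. norm (f z)) \<rho> = M1 f \<rho>" using \<rho> by (simp add: M1_def)
  also have "(648 * K + norm (g 0)) * M1 f \<rho> \<le> (648 * BMOA_norm (dilate \<rho> g)) * M1 f \<rho>"
    using M1_nonneg[OF f] by (intro mult_right_mono) (auto simp: BMOA_norm_dilate[OF g \<rho>] K_def)
  finally show ?thesis .
qed

section \<open>Taylor coefficients\<close>

text \<open>Parseval's formula on the circle of radius 1/2: the difference of the two series
  vanishes there, and pairing it with one monomial isolates one coefficient.\<close>

lemma taylor_coeff_unique:
  assumes sums: "\<And>z. norm z < 1 \<Longrightarrow> (\<lambda>k. a k * z ^ k) sums f z"
  shows "f holomorphic_on ball 0 1" and "taylor_coeff f j = a j"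
proof -
  show f: "f holomorphic_on ball 0 1"
    by (rule power_series_holomorphic[of 0 1 a]) (use sums in auto)
  define c where "c k = (a k - taylor_coeff f k) * of_real ((1/2) ^ k)" for k
  define d where "d k = (if k = j then 1 else 0 :: complex)" for k
  have s: "(\<lambda>k. (a k - taylor_coeff f k) * z ^ k) sums 0" if "norm z < 1" for z
    using sums_diff[OF sums[OF that] taylor_sums[OF f that]] by (simp add: algebra_simps)
  have sc: "summable (\<lambda>k. norm (c k))"
  proof -
    \<comment> \<open>Convergence at 3/4 gives absolute convergence at 1/2.\<close>
    have "summable (\<lambda>k. (a k - taylor_coeff f k) * (of_real (3/4)) ^ k)"
      using s[of "of_real (3/4)"] by (auto simp: sums_iff)
    from powser_insidea[OF this, of "of_real (1/2)"] show ?thesis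
      unfolding c_def by (simp add: norm_mult norm_power norm_divide)
  qed
  have sd: "summable (\<lambda>k. norm (d k))"
    by (rule summable_finite[of "{j}"]) (auto simp: d_def)
  have z: "(\<Sum>k. c k * cis t ^ k) = 0" for t
  proof -
    have "norm (of_real (1/2) * cis t) < 1" by (simp add: norm_mult norm_divide)
    then have "(\<lambda>k. (a k - taylor_coeff f k) * (of_real (1/2) * cis t) ^ k) sums 0" by (rule s)
    also have "(\<lambda>k. (a k - taylor_coeff f k) * (of_real (1/2) * cis t) ^ k) = (\<lambda>k. c k * cis t ^ k)"
      by (intro ext) (simp only: c_def power_mult_distrib of_real_power mult.assoc)
    finally show ?thesis by (rule sums_unique[symmetric])
  qed
  have "2 * pi * (\<Sum>k. c k * cnj (d k)) = 0"
    using integral_unique[OF parseval[OF sc sd]] by (simp add: z)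
  moreover have "(\<Sum>k. c k * cnj (d k)) = c j"
    by (subst suminf_finite[of "{j}"]) (auto simp: d_def)
  ultimately have "c j = 0" by simp
  then show "taylor_coeff f j = a j" by (simp add: c_def)
qed

lemma taylor_coeff_add:
  assumes "f holomorphic_on ball 0 1" "g holomorphic_on ball 0 1"
  shows "taylor_coeff (\<lambda>z. f z + g z) k = taylor_coeff f k + taylor_coeff g k"
  by (rule taylor_coeff_unique(2)) (use sums_add[OF taylor_sums[OF assms(1)] taylor_sums[OF assms(2)]] in \<open>simp add: algebra_simps\<close>)

lemma taylor_coeff_cmult:
  assumes "f holomorphic_on ball 0 1"
  shows "taylor_coeff (\<lambda>z. c * f z) k = c * taylor_coeff f k"
  by (rule taylor_coeff_unique(2)) (use sums_mult[OF taylor_sums[OF assms]] in \<open>simp add: mult.assoc\<close>)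

lemma taylor_coeff_monomial: "taylor_coeff (\<lambda>z. z ^ n) k = (if k = n then 1 else 0)"
proof (rule taylor_coeff_unique(2))
  fix z :: complex
  have "(\<lambda>k. if k = n then z ^ k else 0) sums z ^ n" by (rule sums_single)
  then show "(\<lambda>k. (if k = n then 1 else 0) * z ^ k) sums z ^ n"
    by (simp add: if_distrib[of "\<lambda>x. x * _"] cong: if_cong)
qed

section \<open>Bounded functionals\<close>

context doubling_measure
begin

text \<open>The space \<open>A1 \<omega>\<close>, expressed through \<nu> alone.\<close>

definition X :: "(complex \<Rightarrow> complex) set" where
  "X = {f. f holomorphic_on ball 0 1 \<and> integrable \<nu> (\<lambda>s. s * M1 f s)}"

definition nrm :: "(complex \<Rightarrow> complex) \<Rightarrow> real" where
  "nrm f = (LINT s|\<nu>. s * M1 f s) / pi"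

lemma XD: "f \<in> X \<Longrightarrow> f holomorphic_on ball 0 1" "f \<in> X \<Longrightarrow> integrable \<nu> (\<lambda>s. s * M1 f s)"
  by (auto simp: X_def)

lemma nrm_nonneg:
  assumes "f holomorphic_on ball 0 1"
  shows "0 \<le> nrm f"
  unfolding nrm_def using M1_nonneg[OF assms]
  by (intro divide_nonneg_nonneg integral_nonneg_AE AE_nuI) auto

lemma M1_le:
  assumes f: "f holomorphic_on ball 0 1" and s: "0 \<le> s" "s < 1" and h: "continuous_on {0..2*pi} h"
    and le: "\<And>t. norm (f (of_real s * cis t)) \<le> h t"
  shows "M1 f s \<le> integral {0..2*pi} h"
  unfolding M1_def circ_def using s
  by (auto intro!: integral_le integrable_continuous_real h le continuous_on_norm continuous_on_circle_UNIV[OF f])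

lemma XI:
  assumes f: "f holomorphic_on ball 0 1" and I: "integrable \<nu> b"
    and le: "\<And>s. 0 \<le> s \<Longrightarrow> s < 1 \<Longrightarrow> s * M1 f s \<le> b s"
  shows "f \<in> X" "nrm f \<le> (LINT s|\<nu>. b s) / pi"
proof -
  have "norm (s * M1 f s) \<le> norm (b s)" if "0 \<le> s" "s < 1" for s
    using le[OF that] M1_nonneg[OF f, of s] that by (simp add: abs_mult)
  then have "integrable \<nu> (\<lambda>s. s * M1 f s)"
    by (intro Bochner_Integration.integrable_bound[OF I]) (use borel_measurable_M1[OF f] in \<open>auto intro!: AE_nuI\<close>)
  then show "f \<in> X" "nrm f \<le> (LINT s|\<nu>. b s) / pi"
    using f I le by (auto simp: X_def nrm_def intro!: divide_right_mono integral_mono_AE AE_nuI)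
qed

lemma bounded_X:
  assumes f: "f holomorphic_on ball 0 1" and le: "\<And>z. norm z < 1 \<Longrightarrow> norm (f z) \<le> e"
  shows "f \<in> X" "nrm f \<le> 2 * e * mom 1"
proof -
  have b: "s * M1 f s \<le> (2 * pi * e) * s ^ 1" if s: "0 \<le> s" "s < 1" for s
  proof -
    have "M1 f s \<le> integral {0..2*pi} (\<lambda>t. e)"
      using s by (intro M1_le f le) (auto simp: norm_mult)
    then have "s * M1 f s \<le> s * (2 * pi * e)" using s by (intro mult_left_mono) auto
    then show ?thesis by (simp add: mult_ac)
  qed
  have I: "integrable \<nu> (\<lambda>s. (2 * pi * e) * s ^ 1)" by (intro integrable_mult_right integrable_pow)
  show "f \<in> X" by (rule XI(1)[OF f I b])
  have "nrm f \<le> (LINT s|\<nu>. (2 * pi * e) * s ^ 1) / pi" by (rule XI(2)[OF f I b])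
  also have "(LINT s|\<nu>. (2 * pi * e) * s ^ 1) = 2 * pi * e * mom 1" unfolding mom_def by simp
  finally show "nrm f \<le> 2 * e * mom 1" by simp
qed

lemma monomial_X: "(\<lambda>z. z ^ k) \<in> X" "nrm (\<lambda>z. z ^ k) \<le> 2 * mom 1"
  using bounded_X[of "\<lambda>z. z ^ k" 1, OF holomorphic_on_power[OF holomorphic_on_ident]]
  by (auto simp: norm_power power_le_one)

lemma cmult_X:
  assumes "f \<in> X"
  shows "(\<lambda>z. c * f z) \<in> X" "nrm (\<lambda>z. c * f z) = norm c * nrm f"
proof -
  have M: "M1 (\<lambda>z. c * f z) s = norm c * M1 f s" for s by (simp add: M1_def circ_def norm_mult)
  show "(\<lambda>z. c * f z) \<in> X"
    using assms by (auto simp: X_def M mult.left_commute[of _ "norm c"] intro!: holomorphic_intros integrable_mult_right)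
  show "nrm (\<lambda>z. c * f z) = norm c * nrm f" by (simp add: nrm_def M mult.left_commute[of _ "norm c"])
qed

section \<open>Bounded functionals evaluated on power series\<close>

definition linear_functional :: "((complex \<Rightarrow> complex) \<Rightarrow> complex) \<Rightarrow> real \<Rightarrow> bool" where
  "linear_functional L D \<longleftrightarrow> 0 \<le> D \<and> (\<forall>f\<in>X. \<forall>g\<in>X. L (\<lambda>z. f z + g z) = L f + L g) \<and>
     (\<forall>c. \<forall>f\<in>X. L (\<lambda>z. c * f z) = c * L f) \<and> (\<forall>f\<in>X. norm (L f) \<le> D * nrm f)"

context
  fixes L D
  assumes L: "linear_functional L D"
begin

lemma L_add: "f \<in> X \<Longrightarrow> g \<in> X \<Longrightarrow> L (\<lambda>z. f z + g z) = L f + L g"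
  and L_cmult: "f \<in> X \<Longrightarrow> L (\<lambda>z. c * f z) = c * L f"
  and L_bound: "f \<in> X \<Longrightarrow> norm (L f) \<le> D * nrm f" and D: "0 \<le> D"
  using L by (auto simp: linear_functional_def)

lemma L_diff: "f \<in> X \<Longrightarrow> g \<in> X \<Longrightarrow> L (\<lambda>z. f z - g z) = L f - L g"
  using L_add[of f "\<lambda>z. (-1) * g z"] L_cmult[of g "-1"] cmult_X(1)[of g "-1"] by simp

lemma poly_X: "(\<lambda>z. \<Sum>k<n. c k * z ^ k) \<in> X" and L_poly: "L (\<lambda>z. \<Sum>k<n. c k * z ^ k) = (\<Sum>k<n. c k * L (\<lambda>z. z ^ k))"
proof -
  have P: "(\<lambda>z. \<Sum>k<n. c k * z ^ k) \<in> X" for n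
  proof (rule bounded_X(1)[of _ "\<Sum>k<n. norm (c k)"])
    fix z :: complex assume z: "norm z < 1"
    have "norm (c k * z ^ k) \<le> norm (c k)" for k
      using z mult_left_mono[of "norm z ^ k" 1 "norm (c k)"] by (simp add: norm_mult norm_power power_le_one)
    then show "norm (\<Sum>k<n. c k * z ^ k) \<le> (\<Sum>k<n. norm (c k))"
      by (intro order_trans[OF norm_sum] sum_mono)
  qed (intro holomorphic_intros)
  then show "(\<lambda>z. \<Sum>k<n. c k * z ^ k) \<in> X" .
  show "L (\<lambda>z. \<Sum>k<n. c k * z ^ k) = (\<Sum>k<n. c k * L (\<lambda>z. z ^ k))"
  proof (induction n)
    case 0
    show ?case using L_cmult[OF monomial_X(1)[of 0], of 0] by simp
  next
    case (Suc n)
    have "L (\<lambda>z. (\<Sum>k<n. c k * z ^ k) + c n * z ^ n) = L (\<lambda>z. \<Sum>k<n. c k * z ^ k) + L (\<lambda>z. c n * z ^ n)"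
      by (intro L_add P cmult_X monomial_X)
    also have "L (\<lambda>z. c n * z ^ n) = c n * L (\<lambda>z. z ^ n)" by (intro L_cmult monomial_X)
    finally show ?case using Suc by simp
  qed
qed

text \<open>The supremum over the disc dominates \<open>nrm\<close>, so an absolutely convergent
  power series converges in \<open>X\<close>, and \<open>L\<close> may be applied term by
  term.\<close>

lemma L_series:
  assumes c: "summable (\<lambda>k. norm (c k))" and F: "\<And>z. norm z < 1 \<Longrightarrow> F z = (\<Sum>k. c k * z ^ k)"
  shows "F \<in> X" "(\<lambda>k. c k * L (\<lambda>z. z ^ k)) sums L F"
proof -
  have sm: "summable (\<lambda>k. c k * z ^ k)" "norm (c k * z ^ k) \<le> norm (c k)" if z: "norm z < 1" for z k
  proof -
    show b: "norm (c k * z ^ k) \<le> norm (c k)" for k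
      using z mult_left_mono[of "norm z ^ k" 1 "norm (c k)"] by (simp add: norm_mult norm_power power_le_one)
    show "summable (\<lambda>k. c k * z ^ k)"
      by (rule summable_norm_cancel, rule summable_comparison_test[OF _ c]) (use b in auto)
  qed
  have hol: "F holomorphic_on ball 0 1"
    by (rule taylor_coeff_unique(1)[of c]) (use F sm summable_sums in auto)
  define tail where "tail n = (\<Sum>k. norm (c (k + n)))" for n
  have diff: "norm (F z - (\<Sum>k<n. c k * z ^ k)) \<le> tail n" if z: "norm z < 1" for z n
  proof -
    have "F z - (\<Sum>k<n. c k * z ^ k) = (\<Sum>k. c (k + n) * z ^ (k + n))"
      unfolding F[OF z] using suminf_split_initial_segment[OF sm(1)[OF z], of n] by simp
    also have "norm \<dots> \<le> tail n"
      unfolding tail_def using summable_ignore_initial_segment[OF c, of n] sm(2)[OF z]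
      by (intro norm_suminf_le) auto
    finally show ?thesis .
  qed
  have dh: "(\<lambda>z. F z - (\<Sum>k<n. c k * z ^ k)) holomorphic_on ball 0 1" for n
    by (intro holomorphic_intros hol)
  show FX: "F \<in> X"
    by (rule bounded_X(1)[OF hol, of "tail 0"]) (use diff[of _ 0] in simp)
  have "norm (L F - (\<Sum>k<n. c k * L (\<lambda>z. z ^ k))) \<le> D * (2 * tail n * mom 1)" for n
  proof -
    have "L F - (\<Sum>k<n. c k * L (\<lambda>z. z ^ k)) = L (\<lambda>z. F z - (\<Sum>k<n. c k * z ^ k))"
      using L_diff[OF FX poly_X] L_poly by simp
    also have "norm \<dots> \<le> D * nrm (\<lambda>z. F z - (\<Sum>k<n. c k * z ^ k))"
      by (rule L_bound, rule bounded_X(1)[OF dh diff])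
    also have "\<dots> \<le> D * (2 * tail n * mom 1)"
      by (intro mult_left_mono bounded_X(2)[OF dh diff] D)
    finally show ?thesis .
  qed
  note bd = this
  have "tail \<longlonglongrightarrow> 0"
    unfolding tail_def[abs_def] by (rule suminf_exist_split2[OF c])
  then have "(\<lambda>n. D * (2 * tail n * mom 1)) \<longlonglongrightarrow> D * (2 * 0 * mom 1)"
    by (intro tendsto_intros)
  then have lim: "(\<lambda>n. D * (2 * tail n * mom 1)) \<longlonglongrightarrow> 0" by simp
  have "(\<lambda>n. L F - (\<Sum>k<n. c k * L (\<lambda>z. z ^ k))) \<longlonglongrightarrow> 0"
    by (rule Lim_null_comparison[OF always_eventually lim]) (rule allI, rule bd)
  from tendsto_diff[OF tendsto_const[of "L F"] this] show "(\<lambda>k. c k * L (\<lambda>z. z ^ k)) sums L F"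
    by (simp add: sums_def)
qed

lemma L_monomial_bound: "norm (L (\<lambda>z. z ^ k)) \<le> D * (2 * mom 1)"
  using L_bound[OF monomial_X(1), of k] mult_left_mono[OF monomial_X(2)[of k] D] by linarith

end

end

section \<open>Representation of functionals\<close>

text \<open>Meant for atoms, which contain \<open>sgn\<close> and are in general
  discontinuous.\<close>

lemma integrable_bounded_times_continuous:
  fixes \<sigma> h :: "real \<Rightarrow> complex"
  assumes [measurable]: "\<sigma> \<in> borel_measurable borel" and \<sigma>: "\<And>t. norm (\<sigma> t) \<le> M"
    and h: "continuous_on UNIV h"
  shows "(\<lambda>t. \<sigma> t * h t) integrable_on {a..b}"
proof -
  have [measurable]: "h \<in> borel_measurable borel" by (rule borel_measurable_continuous_onI[OF h])
  have "compact (h ` {a..b})" by (rule compact_continuous_image[OF continuous_on_subset[OF h]]) auto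
  then obtain H where H: "\<And>t. t \<in> {a..b} \<Longrightarrow> norm (h t) \<le> H"
    by (meson bounded_iff compact_imp_bounded imageI)
  have M: "0 \<le> M" using norm_ge_zero[of "\<sigma> 0"] \<sigma>[of 0] by linarith
  have "set_integrable lborel {a..b} (\<lambda>t. \<sigma> t * h t)"
    unfolding set_integrable_def
  proof (rule integrableI_bounded_set_indicator[where B="M * H"])
    show "AE t\<in>{a..b} in lborel. norm (\<sigma> t * h t) \<le> M * H"
      using M by (intro AE_I2) (auto simp: norm_mult intro!: mult_mono \<sigma> H)
  qed (auto simp: emeasure_lborel_Icc_eq)
  then show ?thesis by (rule set_borel_integral_eq_integral(1))
qed

lemma integral_times_series:
  fixes A u :: "real \<Rightarrow> complex" and c :: "nat \<Rightarrow> complex"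
  assumes int: "\<And>h. continuous_on UNIV h \<Longrightarrow> (\<lambda>t. A t * h t) integrable_on {a..b}"
    and A: "\<And>t. t \<in> {a..b} \<Longrightarrow> norm (A t) \<le> M"
    and c: "summable (\<lambda>k. norm (c k))" and u: "continuous_on UNIV u"
    and us: "\<And>t. (\<lambda>k. c k * cis (- t) ^ k) sums u t" and ab: "a \<le> b"
  shows "(\<lambda>k. c k * fcoeff A a b k) sums integral {a..b} (\<lambda>t. A t * u t)"
proof -
  have p: "integral {a..b} (\<lambda>t. A t * (\<Sum>k<n. c k * cis (- t) ^ k)) = (\<Sum>k<n. c k * fcoeff A a b k)" for n
  proof -
    have "((\<lambda>t. \<Sum>k<n. c k * (A t * cis (- t) ^ k)) has_integral (\<Sum>k<n. c k * fcoeff A a b k)) {a..b}"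
      unfolding fcoeff_def by (intro has_integral_sum has_integral_mult_right integrable_integral int continuous_intros) auto
    then show ?thesis by (simp add: integral_unique sum_distrib_left mult_ac)
  qed
  define tail where "tail n = (\<Sum>k. norm (c (k + n)))" for n
  have tl: "norm (u t - (\<Sum>k<n. c k * cis (- t) ^ k)) \<le> tail n" for t n
  proof -
    have sm: "summable (\<lambda>k. c k * cis (- t) ^ k)" using us sums_iff by blast
    have "u t - (\<Sum>k<n. c k * cis (- t) ^ k) = (\<Sum>k. c (k + n) * cis (- t) ^ (k + n))"
      using suminf_split_initial_segment[OF sm, of n] sums_unique[OF us[of t]] by simp
    also have "norm \<dots> \<le> tail n"
      unfolding tail_def using summable_ignore_initial_segment[OF c, of n]
      by (intro norm_suminf_le) (auto simp: norm_mult norm_power)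
    finally show ?thesis .
  qed
  have bd: "norm (integral {a..b} (\<lambda>t. A t * u t) - (\<Sum>k<n. c k * fcoeff A a b k)) \<le> M * tail n * (b - a)" for n
  proof -
    have cn: "continuous_on UNIV (\<lambda>t. u t - (\<Sum>k<n. c k * cis (- t) ^ k))" by (intro continuous_intros u)
    have "integral {a..b} (\<lambda>t. A t * u t) - (\<Sum>k<n. c k * fcoeff A a b k)
       = integral {a..b} (\<lambda>t. A t * u t - A t * (\<Sum>k<n. c k * cis (- t) ^ k))"
      unfolding p[symmetric] by (intro integral_diff[symmetric] int u continuous_intros)
    also have "\<dots> = integral {a..b} (\<lambda>t. A t * (u t - (\<Sum>k<n. c k * cis (- t) ^ k)))"
      by (simp add: right_diff_distrib)
    also have "norm \<dots> \<le> integral {a..b} (\<lambda>t. M * tail n)"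
    proof (intro integral_norm_bound_integral int cn)
      fix t assume t: "t \<in> {a..b}"
      show "norm (A t * (u t - (\<Sum>k<n. c k * cis (- t) ^ k))) \<le> M * tail n"
        unfolding norm_mult using A[OF t] tl[of t n] order_trans[OF norm_ge_zero A[OF t]] by (intro mult_mono) auto
    qed auto
    also have "\<dots> = M * tail n * (b - a)" using ab by simp
    finally show ?thesis .
  qed
  have "tail \<longlonglongrightarrow> 0" unfolding tail_def[abs_def] by (rule suminf_exist_split2[OF c])
  then have "(\<lambda>n. M * tail n * (b - a)) \<longlonglongrightarrow> M * 0 * (b - a)" by (intro tendsto_intros)
  then have lim: "(\<lambda>n. M * tail n * (b - a)) \<longlonglongrightarrow> 0" by simp
  have "(\<lambda>n. integral {a..b} (\<lambda>t. A t * u t) - (\<Sum>k<n. c k * fcoeff A a b k)) \<longlonglongrightarrow> 0"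
    by (rule Lim_null_comparison[OF always_eventually lim]) (rule allI, rule bd)
  from tendsto_diff[OF tendsto_const[of "integral {a..b} (\<lambda>t. A t * u t)"] this] show ?thesis
    by (simp add: sums_def)
qed

text \<open>The oscillation of \<open>u\<close> on an arc is attained by testing \<open>u\<close> against the atom
  \<open>sgn (u - avg u) - avg (sgn (u - avg u))\<close>.\<close>

lemma oscillation_atom:
  fixes u :: "real \<Rightarrow> complex"
  assumes u: "continuous_on UNIV u" and ab: "a < b"
  obtains A where "\<And>h. continuous_on UNIV h \<Longrightarrow> (\<lambda>t. A t * h t) integrable_on {a..b}"
    "\<And>t. norm (A t) \<le> 2" "integral {a..b} A = 0"
    "of_real (integral {a..b} (\<lambda>t. norm (u t - avg u a b))) = integral {a..b} (\<lambda>t. A t * cnj (u t))"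
proof -
  define c where "c = avg u a b"
  define \<sigma> where "\<sigma> t = sgn (u t - c)" for t
  have um [measurable]: "u \<in> borel_measurable borel" by (rule borel_measurable_continuous_onI[OF u])
  have \<sigma>m: "\<sigma> \<in> borel_measurable borel" unfolding \<sigma>_def[abs_def] sgn_div_norm by measurable
  have \<sigma>1: "norm (\<sigma> t) \<le> 1" for t by (simp add: \<sigma>_def norm_sgn)
  define s where "s = integral {a..b} \<sigma> / of_real (b - a)"
  define A where "A t = \<sigma> t - s" for t
  have \<sigma>i: "\<sigma> integrable_on {a..b}"
    using integrable_bounded_times_continuous[OF \<sigma>m \<sigma>1, of "\<lambda>_. 1" a b] by simp
  have s1: "norm s \<le> 1"
  proof -
    have "norm (integral {a..b} \<sigma>) \<le> integral {a..b} (\<lambda>t. 1)"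
      by (rule integral_norm_bound_integral[OF \<sigma>i]) (use \<sigma>1 in auto)
    also have "\<dots> = b - a" using ab by simp
    finally show ?thesis unfolding s_def using ab by (simp add: norm_divide flip: of_real_diff)
  qed
  have Am: "A \<in> borel_measurable borel" unfolding A_def[abs_def] using \<sigma>m by simp
  have A2: "norm (A t) \<le> 2" for t
    using norm_triangle_ineq4[of "\<sigma> t" s] \<sigma>1[of t] s1 by (simp add: A_def)
  note int = integrable_bounded_times_continuous[OF Am A2]
  have A0: "(A has_integral 0) {a..b}"
  proof -
    have "((\<lambda>t. \<sigma> t - s) has_integral (integral {a..b} \<sigma> - (b - a) *\<^sub>R s)) {a..b}"
      using ab has_integral_const_real[of s a b] by (intro has_integral_diff integrable_integral \<sigma>i) simp
    then show ?thesis using ab by (simp add: A_def[abs_def] s_def scaleR_conv_of_real)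
  qed
  have u0: "((\<lambda>t. cnj (u t - c)) has_integral 0) {a..b}"
  proof -
    have "((\<lambda>t. u t - c) has_integral (integral {a..b} u - (b - a) *\<^sub>R c)) {a..b}"
      using ab has_integral_const_real[of c a b] by (intro has_integral_diff integrable_integral integrable_continuous_UNIV[OF u]) simp
    then have "((\<lambda>t. u t - c) has_integral 0) {a..b}" using ab by (simp add: c_def avg_def)
    from has_integral_linear[OF this bounded_linear_cnj] show ?thesis by (simp add: o_def)
  qed
  \<comment> \<open>The two added terms integrate to zero, because \<open>A\<close> and u - c both
    have mean zero. They cancel the constants s and c, so that the integrand becomes \<sigma> cnj (u
    - c) = |u - c|.\<close>
  have "((\<lambda>t. A t * cnj (u t) - A t * cnj c + s * cnj (u t - c)) has_integral
      (integral {a..b} (\<lambda>t. A t * cnj (u t)) - 0 * cnj c + s * 0)) {a..b}"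
    by (intro has_integral_add has_integral_diff has_integral_mult_left has_integral_mult_right u0 A0 integrable_integral int continuous_intros u)
  moreover have "A t * cnj (u t) - A t * cnj c + s * cnj (u t - c) = of_real (norm (u t - c))" for t
  proof -
    have "A t * cnj (u t) - A t * cnj c + s * cnj (u t - c) = \<sigma> t * cnj (u t - c)"
      by (simp add: A_def algebra_simps)
    also have "\<dots> = of_real (norm (u t - c))"
    proof (cases "u t = c")
      case False
      then have n: "norm (u t - c) \<noteq> 0" by simp
      have "\<sigma> t * cnj (u t - c) = ((u t - c) * cnj (u t - c)) / of_real (norm (u t - c))"
        by (simp add: \<sigma>_def sgn_eq)
      also have "(u t - c) * cnj (u t - c) = of_real (norm (u t - c)) * of_real (norm (u t - c))"
        using complex_norm_square[of "u t - c"] by (simp add: power2_eq_square)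
      finally show ?thesis using n by simp
    qed (simp add: \<sigma>_def)
    finally show ?thesis .
  qed
  ultimately have "((\<lambda>t. complex_of_real (norm (u t - c))) has_integral integral {a..b} (\<lambda>t. A t * cnj (u t))) {a..b}" by simp
  moreover have "((\<lambda>t. complex_of_real (norm (u t - c))) has_integral of_real (integral {a..b} (\<lambda>t. norm (u t - c)))) {a..b}"
    by (intro has_integral_of_real integrable_integral integrable_continuous_UNIV continuous_intros u)
  ultimately have "of_real (integral {a..b} (\<lambda>t. norm (u t - c))) = integral {a..b} (\<lambda>t. A t * cnj (u t))"
    by (rule has_integral_unique[rotated])
  then show thesis using int A2 A0 by (intro that[of A]) (auto simp: c_def integral_unique)
qed

section \<open>From a functional to its representing function\<close>

context doubling_measure
begin

text \<open>m k R^k is bounded at a larger radius R, which leaves a geometric series in r /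
  R.\<close>

lemma m_growth_summable:
  assumes "0 \<le> r" "r < 1"
  shows "summable (\<lambda>k. m k * r ^ k)"
proof -
  define R where "R = (1 + r) / 2"
  have R: "0 < R" "r < R" "R < 1" using assms by (auto simp: R_def)
  have "summable (\<lambda>k. B / (T R)\<^sup>2 * (r / R) ^ k)"
    using R assms by (intro summable_mult summable_geometric) (simp add: abs_of_nonneg)
  moreover have "norm (m k * r ^ k) \<le> B / (T R)\<^sup>2 * (r / R) ^ k" for k
  proof -
    have "norm (m k * r ^ k) = \<bar>m k * R ^ k\<bar> * (r / R) ^ k"
      using R assms m_pos[of k] by (simp add: abs_mult power_divide abs_of_pos)
    also have "\<dots> \<le> B / (T R)\<^sup>2 * (r / R) ^ k"
      using multiplier_bounds(1)[of R k] R assms by (intro mult_right_mono) auto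
    finally show ?thesis .
  qed
  ultimately show ?thesis by (intro summable_comparison_test[OF _ \<open>summable _\<close>]) auto
qed

context
  fixes L D
  assumes L: "linear_functional L D"
begin

text \<open>F is the image of the atom under m k \<rho>^k. On the circle of radius s it is the image
  under the multiplier for radius \<rho> s, so its circle mean is at most 680 B (b - a) / T(\<rho>
  s)^2, and this is integrated over s.\<close>

lemma L_F_bound:
  fixes A :: "real \<Rightarrow> complex"
  assumes ab: "a < b" "b \<le> a + 2 * pi"
    and int: "\<And>h. continuous_on UNIV h \<Longrightarrow> (\<lambda>t. A t * h t) integrable_on {a..b}"
    and A2: "\<And>t. norm (A t) \<le> 2" and A0: "integral {a..b} A = 0"
    and \<rho>: "0 < \<rho>" "\<rho> < 1"
  shows "summable (\<lambda>k. of_real (m k * \<rho> ^ k) * fcoeff A a b k * L (\<lambda>z. z ^ k))"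
    "norm (\<Sum>k. of_real (m k * \<rho> ^ k) * fcoeff A a b k * L (\<lambda>z. z ^ k)) \<le> 2040 * B * D / T \<rho> * (b - a)"
proof -
  define f where "f = fcoeff A a b"
  define c where "c k = of_real (m k * \<rho> ^ k) * f k" for k
  have at: "atom A a b (B / (T (\<rho> * s))\<^sup>2) (\<lambda>k. m k * (\<rho> * s) ^ k)" if s: "0 \<le> s" "s < 1" for s
  proof -
    have "\<rho> * s < 1 * 1" using s \<rho> by (intro mult_strict_mono) auto
    then have r: "0 \<le> \<rho> * s" "\<rho> * s < 1" using s \<rho> by auto
    show ?thesis
      by unfold_locales (use ab int A2 A0 multiplier_bounds[OF r] B_pos T_pos[OF r(2)] in auto)
  qed
  have fb: "norm (f k) \<le> 2 * (b - a) * 1" for k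
  proof -
    have "norm (f k) \<le> 2 * (b - a) * min 1 (real k * (b - a))"
      using atom.norm_f[OF at[of 0], of k] by (simp add: f_def atom.f_def[OF at[of 0]] atom.\<delta>_def[OF at[of 0]])
    also have "\<dots> \<le> 2 * (b - a) * 1" using ab by (intro mult_left_mono) auto
    finally show ?thesis .
  qed
  have cs: "summable (\<lambda>k. norm (c k))"
  proof (rule summable_comparison_test)
    show "summable (\<lambda>k. m k * \<rho> ^ k * (2 * (b - a)))" using \<rho> by (intro summable_mult2 m_growth_summable) auto
    have "norm (norm (c k)) \<le> m k * \<rho> ^ k * (2 * (b - a))" for k
    proof -
      have "norm (norm (c k)) = (m k * \<rho> ^ k) * norm (f k)"
        using \<rho> m_pos[of k] by (simp only: c_def norm_mult norm_of_real) (simp add: abs_mult)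
      also have "\<dots> \<le> m k * \<rho> ^ k * (2 * (b - a))"
        using fb[of k] \<rho> m_pos[of k] by (intro mult_left_mono) auto
      finally show ?thesis .
    qed
    then show "\<exists>N. \<forall>k\<ge>N. norm (norm (c k)) \<le> m k * \<rho> ^ k * (2 * (b - a))" by blast
  qed
  define F where "F z = (\<Sum>k. c k * z ^ k)" for z
  note LS = L_series[OF L cs, of F, OF F_def]
  show "summable (\<lambda>k. of_real (m k * \<rho> ^ k) * fcoeff A a b k * L (\<lambda>z. z ^ k))"
    using LS(2) by (simp add: c_def f_def sums_iff)
  have hol: "F holomorphic_on ball 0 1" using LS(1) XD by blast
  define G where "G s = 680 * B * (b - a) * (1 / (T (\<rho> * s))\<^sup>2)" for s
  have GI: "integrable \<nu> G" unfolding G_def[abs_def] by (intro integrable_mult_right integral_T_dilate \<rho>)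
  have MF: "s * M1 F s \<le> G s" if s: "0 \<le> s" "s < 1" for s
  proof -
    have "\<rho> * s < 1 * 1" using s \<rho> by (intro mult_strict_mono) auto
    then have r: "0 \<le> \<rho> * s" "\<rho> * s < 1" using s \<rho> by auto
    have sm: "summable (\<lambda>k. \<bar>m k * (\<rho> * s) ^ k\<bar>)"
      using m_growth_summable[OF r] m_pos r by (simp add: abs_mult abs_of_pos)
    have "M1 F s = integral {0..2*pi} (\<lambda>t. norm (\<Sum>k. of_real (m k * (\<rho> * s) ^ k) * f k * cis t ^ k))"
      using s by (simp add: M1_def circ_def F_def c_def power_mult_distrib mult_ac)
    also have "\<dots> \<le> 680 * (B / (T (\<rho> * s))\<^sup>2) * (b - a)"
      using atom.integral_multiplier[OF at[OF s] sm]
      by (simp add: atom.\<delta>_def[OF at[OF s]] atom.\<beta>_def[OF at[OF s]] atom.f_def[OF at[OF s]] f_def)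
    also have "\<dots> = G s" by (simp add: G_def)
    finally have "M1 F s \<le> G s" .
    moreover have "s * M1 F s \<le> 1 * M1 F s" using s M1_nonneg[OF hol] by (intro mult_right_mono) auto
    ultimately show ?thesis by simp
  qed
  have "norm (L F) \<le> D * nrm F" by (rule L_bound[OF L LS(1)])
  also have "\<dots> \<le> D * ((LINT s|\<nu>. G s) / pi)"
    by (intro mult_left_mono XI(2)[OF hol GI MF] D[OF L])
  also have "(LINT s|\<nu>. G s) = 680 * B * (b - a) * (LINT s|\<nu>. 1 / (T (\<rho> * s))\<^sup>2)"
    unfolding G_def by (rule integral_mult_right_zero)
  \<comment> \<open>680 * 9 / 3 = 2040: the factor 1 / \<pi> of the norm is estimated by 1 /
    3.\<close>
  also have "D * (680 * B * (b - a) * (LINT s|\<nu>. 1 / (T (\<rho> * s))\<^sup>2) / pi) \<le> D * (680 * B * (b - a) * (9 / T \<rho>) / 3)"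
    using integral_T_dilate(2)[OF \<rho>] B_pos ab D[OF L] pi_gt3 T_nonneg
    by (intro mult_left_mono frac_le) auto
  also have "\<dots> = 2040 * B * D / T \<rho> * (b - a)" by simp
  finally have "norm (L F) \<le> 2040 * B * D / T \<rho> * (b - a)" .
  moreover have "L F = (\<Sum>k. of_real (m k * \<rho> ^ k) * fcoeff A a b k * L (\<lambda>z. z ^ k))"
    using LS(2) by (simp add: c_def f_def sums_iff)
  ultimately show "norm (\<Sum>k. of_real (m k * \<rho> ^ k) * fcoeff A a b k * L (\<lambda>z. z ^ k)) \<le> 2040 * B * D / T \<rho> * (b - a)" by simp
qed

text \<open>The summand 2 T 0 / mom 1 accounts for |g 0| = |L 1| m 0, which is at most 2 D / mom
  1.\<close>

theorem BMOA_norm_le: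
  assumes g: "g holomorphic_on ball 0 1" and gk: "\<And>k. taylor_coeff g k = cnj (L (\<lambda>z. z ^ k)) * of_real (m k)"
    and \<rho>: "0 < \<rho>" "\<rho> < 1"
  shows "BMOA_norm (dilate \<rho> g) * T \<rho> \<le> (2040 * B + 2 * T 0 / mom 1) * D"
proof -
  let ?u = "\<lambda>t. g (of_real \<rho> * cis t)"
  have u: "continuous_on UNIV ?u" by (rule continuous_on_circle_UNIV[OF g]) (use \<rho> in auto)
  have D0: "0 \<le> D" by (rule D[OF L])
  have osc: "mean_osc ?u I \<le> 2040 * B * D / T \<rho>" if I: "I \<in> arcs" for I
  proof -
    obtain a b where ab: "I = (a, b)" "a < b" "b \<le> a + 2 * pi" using I by (auto simp: arcs_def)
    obtain A where A: "\<And>h. continuous_on UNIV h \<Longrightarrow> (\<lambda>t. A t * h t) integrable_on {a..b}"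
      "\<And>t. norm (A t) \<le> 2" "integral {a..b} A = 0"
      "of_real (integral {a..b} (\<lambda>t. norm (?u t - avg ?u a b))) = integral {a..b} (\<lambda>t. A t * cnj (?u t))"
      using oscillation_atom[OF u ab(2)] by blast
    define d where "d k = cnj (taylor_coeff g k) * of_real (\<rho> ^ k)" for k
    have ds: "summable (\<lambda>k. norm (d k))"
      using taylor_summable[OF g, of \<rho>] \<rho> by (simp add: d_def norm_mult norm_power)
    have us: "(\<lambda>k. d k * cis (- t) ^ k) sums cnj (?u t)" for t
    proof -
      have "(\<lambda>k. taylor_coeff g k * (of_real \<rho> * cis t) ^ k) sums ?u t"
        using \<rho> by (intro taylor_sums g) (simp add: norm_mult)
      then have "(\<lambda>k. cnj (taylor_coeff g k * (of_real \<rho> * cis t) ^ k)) sums cnj (?u t)" by (simp only: sums_cnj)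
      then show ?thesis by (simp add: d_def power_mult_distrib cis_cnj mult_ac)
    qed
    have "(\<lambda>k. d k * fcoeff A a b k) sums integral {a..b} (\<lambda>t. A t * cnj (?u t))"
      by (rule integral_times_series[OF A(1) A(2) ds _ us]) (use ab u in \<open>auto intro!: continuous_intros\<close>)
    moreover have "d k * fcoeff A a b k = of_real (m k * \<rho> ^ k) * fcoeff A a b k * L (\<lambda>z. z ^ k)" for k
      by (simp add: d_def gk mult_ac)
    ultimately have "of_real (integral {a..b} (\<lambda>t. norm (?u t - avg ?u a b)))
       = (\<Sum>k. of_real (m k * \<rho> ^ k) * fcoeff A a b k * L (\<lambda>z. z ^ k))"
      using A(4) by (simp add: sums_iff)
    then have "norm (complex_of_real (integral {a..b} (\<lambda>t. norm (?u t - avg ?u a b)))) \<le> 2040 * B * D / T \<rho> * (b - a)"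
      using L_F_bound(2)[OF ab(2,3) A(1-3) \<rho>] by simp
    then have "integral {a..b} (\<lambda>t. norm (?u t - avg ?u a b)) \<le> 2040 * B * D / T \<rho> * (b - a)" by simp
    then show ?thesis unfolding ab(1) mean_osc_continuous[OF u] using ab by (simp add: pos_divide_le_eq)
  qed
  have "(SUP I\<in>arcs. mean_osc ?u I) \<le> 2040 * B * D / T \<rho>"
    using arcs_nonempty by (intro cSUP_least osc) auto
  then have 1: "(SUP I\<in>arcs. mean_osc ?u I) * T \<rho> \<le> 2040 * B * D"
    using T_pos[OF \<rho>(2)] by (simp add: pos_le_divide_eq)
  have "g 0 = taylor_coeff g 0" by (simp add: taylor_coeff_def)
  then have "norm (g 0) = norm (L (\<lambda>z. z ^ 0)) * m 0" using m_pos[of 0] gk[of 0] by (simp add: norm_mult)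
  also have "\<dots> \<le> D * (2 * mom 1) * m 0"
    using L_monomial_bound[OF L, of 0] m_pos[of 0] by (intro mult_right_mono) auto
  also have "\<dots> = 2 * D / mom 1" using mom_pos[of 1] by (simp add: m_def power2_eq_square)
  finally have "norm (g 0) * T \<rho> \<le> (2 * D / mom 1) * T 0"
    using \<rho> T_nonneg D0 mom_pos[of 1] by (intro mult_mono T_antimono) auto
  then show ?thesis using 1 unfolding BMOA_norm_dilate[OF g \<rho>] by (simp add: algebra_simps)
qed

lemma ex_representing_function:
  obtains g where "g holomorphic_on ball 0 1" "\<And>k. taylor_coeff g k = cnj (L (\<lambda>z. z ^ k)) * of_real (m k)"
proof -
  define e where "e k = cnj (L (\<lambda>z. z ^ k)) * of_real (m k)" for k
  define g where "g z = (\<Sum>k. e k * z ^ k)" for z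
  have "(\<lambda>k. e k * z ^ k) sums g z" if z: "norm z < 1" for z
  proof -
    have "summable (\<lambda>k. e k * z ^ k)"
    proof (rule summable_norm_cancel, rule summable_comparison_test)
      show "summable (\<lambda>k. D * (2 * mom 1) * (m k * norm z ^ k))"
        using z by (intro summable_mult m_growth_summable) auto
      have "norm (norm (e k * z ^ k)) \<le> D * (2 * mom 1) * (m k * norm z ^ k)" for k
      proof -
        have "norm (norm (e k * z ^ k)) = norm (L (\<lambda>z. z ^ k)) * (m k * norm z ^ k)"
          using m_pos[of k] by (simp add: e_def norm_mult norm_power)
        also have "\<dots> \<le> D * (2 * mom 1) * (m k * norm z ^ k)"
          using m_pos[of k] by (intro mult_right_mono L_monomial_bound[OF L]) auto
        finally show ?thesis .
      qed
      then show "\<exists>N. \<forall>k\<ge>N. norm (norm (e k * z ^ k)) \<le> D * (2 * mom 1) * (m k * norm z ^ k)" by blast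
    qed
    then show ?thesis unfolding g_def by (rule summable_sums)
  qed
  from taylor_coeff_unique[OF this] show thesis using that unfolding e_def by blast
qed

text \<open>Since m k cancels the squared moment and S^(2k+1) = S (S^2)^k, the pairing sum at S is S
  times L of the dilate of f by S^2. These dilates tend to f in norm: the circle means of the
  difference tend to 0 and are at most 2 \<open>M1 f\<close>, so dominated convergence
  applies.\<close>

theorem L_eq_pairing_limit:
  assumes f: "f \<in> X" and gk: "\<And>k. taylor_coeff g k = cnj (L (\<lambda>z. z ^ k)) * of_real (m k)"
  shows "((\<lambda>r. \<Sum>k. taylor_coeff f k * cnj (taylor_coeff g k) * of_real (r ^ (2 * k + 1) * (mom (2 * k + 1))\<^sup>2)) \<longlongrightarrow> L f) (at_left 1)"
proof (rule tendsto_at_left_sequentially[of 0])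
  note hf = XD[OF f]
  fix S :: "nat \<Rightarrow> real" assume S: "\<And>n. S n < 1" "\<And>n. 0 < S n" "incseq S" "S \<longlonglongrightarrow> 1"
  define r where "r n = (S n)\<^sup>2" for n
  have r: "0 < r n" "r n < 1" for n
    using S(1,2)[of n] mult_strict_mono[of "S n" 1 "S n" 1] by (auto simp: r_def power2_eq_square)
  have rl: "r \<longlonglongrightarrow> 1" unfolding r_def[abs_def] using tendsto_power[OF S(4), of 2] by simp
  have ps: "(\<Sum>k. taylor_coeff f k * cnj (taylor_coeff g k) * of_real (S n ^ (2 * k + 1) * (mom (2 * k + 1))\<^sup>2))
     = of_real (S n) * L (dilate (r n) f)" and dX: "dilate (r n) f \<in> X" for n
  proof -
    define c where "c k = taylor_coeff f k * of_real (r n ^ k)" for k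
    have cs: "summable (\<lambda>k. norm (c k))"
      using taylor_summable[OF hf(1), of "r n"] r[of n] by (simp add: c_def norm_mult norm_power less_imp_le)
    have F: "dilate (r n) f z = (\<Sum>k. c k * z ^ k)" if "norm z < 1" for z
    proof -
      have "r n * norm z < 1 * 1" using that r[of n] by (intro mult_strict_mono) auto
      then have "(\<lambda>k. taylor_coeff f k * (of_real (r n) * z) ^ k) sums f (of_real (r n) * z)"
        using r[of n] by (intro taylor_sums hf) (simp add: norm_mult)
      from sums_unique[OF this] show ?thesis by (simp add: dilate_def c_def power_mult_distrib mult_ac)
    qed
    show "dilate (r n) f \<in> X" by (rule L_series(1)[OF L cs F])
    have s: "(\<lambda>k. c k * L (\<lambda>z. z ^ k)) sums L (dilate (r n) f)" by (rule L_series(2)[OF L cs F])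
    have e: "taylor_coeff f k * cnj (taylor_coeff g k) * of_real (S n ^ (2 * k + 1) * (mom (2 * k + 1))\<^sup>2)
        = of_real (S n) * (c k * L (\<lambda>z. z ^ k))" for k
    proof -
      have mm: "m k * (mom (2 * k + 1))\<^sup>2 = 1" using mom_pos[of "2 * k + 1"] by (simp add: m_def)
      have "S n ^ (2 * k + 1) = S n * r n ^ k" by (simp add: r_def power_mult)
      then have e1: "complex_of_real (S n ^ (2 * k + 1) * (mom (2 * k + 1))\<^sup>2)
          = of_real (S n) * of_real (r n ^ k) * of_real ((mom (2 * k + 1))\<^sup>2)" by (simp only: of_real_mult)
      have "taylor_coeff f k * cnj (taylor_coeff g k) * of_real (S n ^ (2 * k + 1) * (mom (2 * k + 1))\<^sup>2)
        = of_real (S n) * (c k * L (\<lambda>z. z ^ k)) * of_real (m k * (mom (2 * k + 1))\<^sup>2)"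
        unfolding e1 unfolding gk c_def of_real_mult
        by (simp only: mult_ac complex_cnj_mult complex_cnj_cnj complex_cnj_complex_of_real)
      then show ?thesis unfolding mm by (simp only: of_real_1 mult_1_right)
    qed
    show "(\<Sum>k. taylor_coeff f k * cnj (taylor_coeff g k) * of_real (S n ^ (2 * k + 1) * (mom (2 * k + 1))\<^sup>2))
      = of_real (S n) * L (dilate (r n) f)"
      unfolding e using s by (simp add: suminf_mult sums_iff)
  qed
  define h where "h n z = dilate (r n) f z - f z" for n z
  have hh: "h n holomorphic_on ball 0 1" for n
    unfolding h_def[abs_def] by (intro holomorphic_intros hf XD(1)[OF dX])
  have c: "continuous_on (ball 0 1) f" by (rule holomorphic_on_imp_continuous_on[OF hf(1)])
  have hM: "M1 (h n) s \<le> 2 * M1 f s" if s: "0 \<le> s" "s < 1" for n s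
  proof -
    have rs: "0 \<le> r n * s" "r n * s \<le> s" "r n * s < 1"
      using s r[of n] mult_left_le_one_le[of s "r n"] by (auto intro: le_less_trans)
    have ci: "continuous_on {0..2*pi} (\<lambda>t. norm (f (of_real q * cis t)))" if "0 \<le> q" "q < 1" for q
      by (intro continuous_on_norm continuous_on_circle_UNIV[OF hf(1) that])
    have "M1 (h n) s \<le> integral {0..2*pi} (\<lambda>t. norm (f (of_real (r n * s) * cis t)) + norm (f (of_real s * cis t)))"
    proof (rule M1_le[OF hh s])
      show "norm (h n (of_real s * cis t)) \<le> norm (f (of_real (r n * s) * cis t)) + norm (f (of_real s * cis t))" for t
        unfolding h_def dilate_def using norm_triangle_ineq4 by (simp add: mult.assoc)
    qed (intro continuous_on_add ci rs s)
    also have "\<dots> = integral {0..2*pi} (\<lambda>t. norm (f (of_real (r n * s) * cis t)))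
        + integral {0..2*pi} (\<lambda>t. norm (f (of_real s * cis t)))"
      by (rule integral_add) (intro integrable_continuous_real ci rs s)+
    also have "\<dots> = M1 f (r n * s) + M1 f s" using s rs by (simp add: M1_def circ_def)
    also have "M1 f (r n * s) \<le> M1 f s" by (rule M1_mono[OF hf(1) rs(1,2) s(2)])
    finally show ?thesis by simp
  qed
  have b: "s * M1 (h n) s \<le> 2 * (s * M1 f s)" if "0 \<le> s" "s < 1" for n s
    using mult_left_mono[OF hM[OF that, of n] that(1)] by simp
  have I2: "integrable \<nu> (\<lambda>s. 2 * (s * M1 f s))" by (rule integrable_mult_right[OF hf(2)])
  have hX: "h n \<in> X" for n by (rule XI(1)[OF hh I2 b])
  have ptw: "(\<lambda>n. M1 (h n) s) \<longlonglongrightarrow> 0" if s: "0 \<le> s" "s < 1" for s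
  proof -
    define \<Phi> where "\<Phi> x = integral (cbox 0 (2*pi)) (\<lambda>t. norm (f (of_real (x * s) * cis t) - f (of_real s * cis t)))" for x
    have "continuous_on ({0..1} \<times> cbox 0 (2*pi)) (\<lambda>(x, t). norm (f (of_real (x * s) * cis t) - f (of_real s * cis t)))"
      unfolding split_beta
    proof (intro continuous_on_norm continuous_on_diff)
      show "continuous_on ({0..1} \<times> cbox 0 (2*pi)) (\<lambda>p. f (of_real (fst p * s) * cis (snd p)))"
      proof (rule continuous_on_compose2[OF c], intro continuous_intros, rule image_subsetI)
        fix p :: "real \<times> real" assume p: "p \<in> {0..1} \<times> cbox 0 (2*pi)"
        have "0 \<le> fst p * s" "fst p * s \<le> s" using p s by (auto simp: mult_left_le_one_le)
        then show "complex_of_real (fst p * s) * cis (snd p) \<in> ball 0 1"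
          using s unfolding mem_ball_0 norm_mult norm_of_real norm_cis by simp
      qed
      show "continuous_on ({0..1} \<times> cbox 0 (2*pi)) (\<lambda>p. f (of_real s * cis (snd p)))"
        by (rule continuous_on_compose2[OF c], intro continuous_intros) (use s in \<open>auto simp: norm_mult\<close>)
    qed
    then have "continuous_on {0..1} \<Phi>" unfolding \<Phi>_def[abs_def] by (rule integral_continuous_on_param)
    then have "(\<lambda>n. \<Phi> (r n)) \<longlonglongrightarrow> \<Phi> 1"
      by (rule continuous_on_tendsto_compose[OF _ rl]) (use r in \<open>auto intro!: always_eventually less_imp_le\<close>)
    moreover have "\<Phi> 1 = 0" by (simp add: \<Phi>_def)
    moreover have "\<Phi> (r n) = M1 (h n) s" for n
      using s by (simp add: \<Phi>_def M1_def circ_def h_def dilate_def mult.assoc)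
    ultimately show ?thesis by simp
  qed
  have "(\<lambda>n. LINT s|\<nu>. s * M1 (h n) s) \<longlonglongrightarrow> (LINT s|\<nu>. 0)"
  proof (rule integral_dominated_convergence[OF _ _ I2])
    show "AE s in \<nu>. (\<lambda>n. s * M1 (h n) s) \<longlonglongrightarrow> 0"
      by (rule AE_nuI) (use tendsto_mult_right_zero[OF ptw] in auto)
    show "AE s in \<nu>. norm (s * M1 (h n) s) \<le> 2 * (s * M1 f s)" for n
      by (rule AE_nuI) (use b M1_nonneg[OF hh] in \<open>auto simp: abs_mult\<close>)
  qed (use borel_measurable_M1[OF hh] in auto)
  then have nl: "(\<lambda>n. D * (nrm (h n))) \<longlonglongrightarrow> D * (0 / pi)"
    unfolding nrm_def by (intro tendsto_intros) auto
  have "(\<lambda>n. L (dilate (r n) f) - L f) \<longlonglongrightarrow> 0"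
  proof (rule Lim_null_comparison[OF always_eventually])
    show "(\<lambda>n. D * (nrm (h n))) \<longlonglongrightarrow> 0" using nl by simp
    show "\<forall>n. norm (L (dilate (r n) f) - L f) \<le> D * nrm (h n)"
      using L_bound[OF L hX] L_diff[OF L dX f] unfolding h_def[abs_def] by simp
  qed
  from tendsto_add[OF this tendsto_const[of "L f"]] have "(\<lambda>n. L (dilate (r n) f)) \<longlonglongrightarrow> L f" by simp
  then have "(\<lambda>n. of_real (S n) * L (dilate (r n) f)) \<longlonglongrightarrow> of_real 1 * L f"
    by (intro tendsto_intros S)
  then show "(\<lambda>n. \<Sum>k. taylor_coeff f k * cnj (taylor_coeff g k) * of_real (S n ^ (2 * k + 1) * (mom (2 * k + 1))\<^sup>2)) \<longlonglongrightarrow> L f"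
    unfolding ps by simp
qed simp

end

end

section \<open>From a function to its functional, and the equivalence of norms\<close>

context doubling_measure
begin

definition psum :: "(complex \<Rightarrow> complex) \<Rightarrow> (complex \<Rightarrow> complex) \<Rightarrow> real \<Rightarrow> complex" where
  "psum f g r = (\<Sum>k. taylor_coeff f k * cnj (taylor_coeff g k) * of_real (r ^ (2 * k + 1) * (mom (2 * k + 1))\<^sup>2))"

definition plim :: "(complex \<Rightarrow> complex) \<Rightarrow> (complex \<Rightarrow> complex) \<Rightarrow> complex" where
  "plim f g = Lim (at_left 1) (psum f g)"

lemma plimI: "(psum f g \<longlongrightarrow> l) (at_left 1) \<Longrightarrow> plim f g = l"
  unfolding plim_def by (rule tendsto_Lim) auto

lemma psum_summable:
  assumes f: "f holomorphic_on ball 0 1" and g: "g holomorphic_on ball 0 1" and r: "0 < r" "r < 1"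
  shows "summable (\<lambda>k. taylor_coeff f k * cnj (taylor_coeff g k) * of_real (r ^ (2 * k + 1) * (mom (2 * k + 1))\<^sup>2))"
proof (rule summable_norm_cancel, rule summable_comparison_test)
  show "summable (\<lambda>k. norm (taylor_coeff f k * cnj (taylor_coeff g k)) * r ^ (2 * k + 1) * (mom 0)\<^sup>2)"
    using r by (intro summable_mult2 pairing_coeff_summable f g) auto
  have "norm (norm (taylor_coeff f k * cnj (taylor_coeff g k) * of_real (r ^ (2 * k + 1) * (mom (2 * k + 1))\<^sup>2)))
     \<le> norm (taylor_coeff f k * cnj (taylor_coeff g k)) * r ^ (2 * k + 1) * (mom 0)\<^sup>2" for k
  proof -
    have e: "norm (complex_of_real (r ^ (2 * k + 1) * (mom (2 * k + 1))\<^sup>2)) = r ^ (2 * k + 1) * (mom (2 * k + 1))\<^sup>2"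
      unfolding norm_of_real using r by (intro abs_of_nonneg mult_nonneg_nonneg) auto
    have "(mom (2 * k + 1))\<^sup>2 \<le> (mom 0)\<^sup>2"
      using mom_pos[of "2 * k + 1"] by (intro power_mono mom_antimono) auto
    then have "r ^ (2 * k + 1) * (mom (2 * k + 1))\<^sup>2 \<le> r ^ (2 * k + 1) * (mom 0)\<^sup>2"
      using r by (intro mult_left_mono) auto
    then have "norm (taylor_coeff f k * cnj (taylor_coeff g k)) * (r ^ (2 * k + 1) * (mom (2 * k + 1))\<^sup>2)
      \<le> norm (taylor_coeff f k * cnj (taylor_coeff g k)) * (r ^ (2 * k + 1) * (mom 0)\<^sup>2)"
      by (rule mult_left_mono) simp
    then show ?thesis unfolding real_norm_def abs_norm_cancel unfolding norm_mult[of _ "of_real _"] e by (simp only: mult.assoc)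
  qed
  then show "\<exists>N. \<forall>k\<ge>N. norm (norm (taylor_coeff f k * cnj (taylor_coeff g k) * of_real (r ^ (2 * k + 1) * (mom (2 * k + 1))\<^sup>2)))
     \<le> norm (taylor_coeff f k * cnj (taylor_coeff g k)) * r ^ (2 * k + 1) * (mom 0)\<^sup>2" by blast
qed

lemma eventually_at_left_1: "(\<And>r. 0 < r \<Longrightarrow> r < 1 \<Longrightarrow> P r) \<Longrightarrow> eventually P (at_left (1::real))"
  unfolding eventually_at_left_field by (intro exI[of _ 0]) auto

lemma psum_tendsto_add:
  assumes "f holomorphic_on ball 0 1" "h holomorphic_on ball 0 1" "g holomorphic_on ball 0 1"
    and "(psum f g \<longlongrightarrow> l) (at_left 1)" "(psum h g \<longlongrightarrow> l') (at_left 1)"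
  shows "(psum (\<lambda>z. f z + h z) g \<longlongrightarrow> l + l') (at_left 1)"
proof (rule Lim_transform_eventually[OF tendsto_add[OF assms(4,5)]], rule eventually_at_left_1)
  fix r :: real assume r: "0 < r" "r < 1"
  show "psum f g r + psum h g r = psum (\<lambda>z. f z + h z) g r"
    unfolding psum_def taylor_coeff_add[OF assms(1,2)] distrib_right
    by (rule suminf_add[OF psum_summable[OF assms(1,3) r] psum_summable[OF assms(2,3) r]])
qed

lemma psum_tendsto_cmult:
  assumes "f holomorphic_on ball 0 1" "g holomorphic_on ball 0 1" "(psum f g \<longlongrightarrow> l) (at_left 1)"
  shows "(psum (\<lambda>z. c * f z) g \<longlongrightarrow> c * l) (at_left 1)"
proof (rule Lim_transform_eventually[OF tendsto_mult[OF tendsto_const[of c] assms(3)]], rule eventually_at_left_1)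
  fix r :: real assume r: "0 < r" "r < 1"
  show "c * psum f g r = psum (\<lambda>z. c * f z) g r"
    unfolding psum_def taylor_coeff_cmult[OF assms(1)] mult.assoc
    by (rule suminf_mult[symmetric], rule psum_summable[OF assms(1,2) r, unfolded mult.assoc])
qed

lemma plim_monomial: "plim (\<lambda>z. z ^ k) g = cnj (taylor_coeff g k) * of_real ((mom (2 * k + 1))\<^sup>2)"
proof (rule plimI)
  have "psum (\<lambda>z. z ^ k) g = (\<lambda>r. cnj (taylor_coeff g k) * of_real (r ^ (2 * k + 1) * (mom (2 * k + 1))\<^sup>2))"
    unfolding psum_def taylor_coeff_monomial by (intro ext, subst suminf_finite[of "{k}"]) auto
  moreover have "((\<lambda>r. cnj (taylor_coeff g k) * of_real (r ^ (2 * k + 1) * (mom (2 * k + 1))\<^sup>2))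
     \<longlongrightarrow> cnj (taylor_coeff g k) * of_real (1 ^ (2 * k + 1) * (mom (2 * k + 1))\<^sup>2)) (at_left 1)"
    by (intro tendsto_intros)
  ultimately show "(psum (\<lambda>z. z ^ k) g \<longlongrightarrow> cnj (taylor_coeff g k) * of_real ((mom (2 * k + 1))\<^sup>2)) (at_left 1)"
    by simp
qed

text \<open>Monomials recover g from its functional. This yields uniqueness and shows that g is the
  representing function of its own functional.\<close>

lemma taylor_coeff_plim: "taylor_coeff g k = cnj (plim (\<lambda>z. z ^ k) g) * of_real (m k)"
proof -
  have "(mom (2 * k + 1))\<^sup>2 * m k = 1" using mom_pos[of "2 * k + 1"] by (simp add: m_def)
  then have "complex_of_real ((mom (2 * k + 1))\<^sup>2) * of_real (m k) = 1" by (metis of_real_1 of_real_mult)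
  then show ?thesis unfolding plim_monomial by (simp only: complex_cnj_mult complex_cnj_cnj complex_cnj_complex_of_real mult.assoc mult_1_right)
qed

text \<open>Membership in \<open>BMOA_inf \<omega>\<close> together with a bound N for the norm, so
  that constants can be followed.\<close>

definition BMOA_growth :: "(complex \<Rightarrow> complex) \<Rightarrow> real \<Rightarrow> bool" where
  "BMOA_growth g N \<longleftrightarrow> g holomorphic_on ball 0 1 \<and> 0 \<le> N \<and> (\<forall>\<rho>. 0 < \<rho> \<longrightarrow> \<rho> < 1 \<longrightarrow> BMOA_norm (dilate \<rho> g) * T \<rho> \<le> N)"

lemma psum_limit:
  assumes g: "BMOA_growth g N" and f: "f \<in> X"
  shows "(psum f g \<longlongrightarrow> plim f g) (at_left 1)" "norm (plim f g) \<le> 648 * N * nrm f"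
proof -
  have gh: "g holomorphic_on ball 0 1" and N: "0 \<le> N"
    and le: "\<And>\<rho>. 0 < \<rho> \<Longrightarrow> \<rho> < 1 \<Longrightarrow> BMOA_norm (dilate \<rho> g) * T \<rho> \<le> N"
    using g by (auto simp: BMOA_growth_def)
  have bound: "norm (circ (\<lambda>z. f z * cnj (g z)) \<rho>) \<le> (648 * N) / T \<rho> * M1 f \<rho>" if \<rho>: "0 < \<rho>" "\<rho> < 1" for \<rho>
  proof -
    have "norm (circ (\<lambda>z. f z * cnj (g z)) \<rho>) \<le> 648 * BMOA_norm (dilate \<rho> g) * M1 f \<rho>"
      by (rule circ_le_BMOA_norm[OF XD(1)[OF f] gh \<rho>])
    also have "BMOA_norm (dilate \<rho> g) \<le> N / T \<rho>" using le[OF \<rho>] T_pos[OF \<rho>(2)] by (simp add: pos_le_divide_eq)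
    then have "648 * BMOA_norm (dilate \<rho> g) * M1 f \<rho> \<le> 648 * (N / T \<rho>) * M1 f \<rho>"
      using M1_nonneg[OF XD(1)[OF f]] by (intro mult_right_mono mult_left_mono) auto
    finally show ?thesis by simp
  qed
  obtain l where l: "(psum f g \<longlongrightarrow> l) (at_left 1)" "norm l \<le> 648 * N / pi * (LINT s|\<nu>. s * M1 f s)"
    using pairing_limit[OF XD(1)[OF f] gh XD(2)[OF f] _ bound] N unfolding psum_def[abs_def] by auto
  show "(psum f g \<longlongrightarrow> plim f g) (at_left 1)" "norm (plim f g) \<le> 648 * N * nrm f"
    using l plimI[OF l(1)] by (auto simp: nrm_def)
qed

lemma linear_functional_plim:
  assumes g: "BMOA_growth g N" and D: "0 \<le> D" "\<And>f. f \<in> X \<Longrightarrow> norm (plim f g) \<le> D * nrm f"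
  shows "linear_functional (\<lambda>f. plim f g) D"
  unfolding linear_functional_def
  using D psum_limit[OF g] g
  by (auto intro!: plimI psum_tendsto_add psum_tendsto_cmult dest: XD(1) simp: BMOA_growth_def)

lemma nrm_0: "(\<lambda>_. 0) \<in> X" "nrm (\<lambda>_. 0) = 0"
proof -
  show "(\<lambda>_. 0) \<in> X" by (rule bounded_X(1)[of _ 0]) auto
  show "nrm (\<lambda>_. 0) = 0" using bounded_X(2)[of "\<lambda>_. 0" 0] nrm_nonneg[of "\<lambda>_. 0"] by simp
qed

text \<open>The upper estimate is \<open>psum_limit\<close>. For the lower one, g represents its own
  functional by \<open>taylor_coeff_plim\<close>, so the bound \<open>BMOA_norm_le\<close> for
  representing functions applies with the functional norm as D.\<close>

theorem BMOA_growth_functional_norm: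
  assumes g: "BMOA_growth g N"
  defines "D \<equiv> (SUP f\<in>{f \<in> X. nrm f \<le> 1}. norm (plim f g))"
  shows "D \<le> 648 * N" "BMOA_growth g ((2040 * B + 2 * T 0 / mom 1) * D)"
proof -
  have N: "0 \<le> N" and gh: "g holomorphic_on ball 0 1" using g by (auto simp: BMOA_growth_def)
  have up: "norm (plim f g) \<le> 648 * N" if "f \<in> {f \<in> X. nrm f \<le> 1}" for f
  proof -
    have "648 * N * nrm f \<le> 648 * N * 1" using that N by (intro mult_left_mono) auto
    then show ?thesis using psum_limit(2)[OF g, of f] that by auto
  qed
  have ne: "(\<lambda>_. 0) \<in> {f \<in> X. nrm f \<le> 1}" using nrm_0 by simp
  then show "D \<le> 648 * N" unfolding D_def by (intro cSUP_least up) auto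
  have le: "norm (plim f g) \<le> D" if "f \<in> {f \<in> X. nrm f \<le> 1}" for f
    unfolding D_def using that up by (intro cSUP_upper bdd_aboveI2) auto
  have D0: "0 \<le> D" using le[OF ne] norm_ge_zero order_trans by blast
  \<comment> \<open>Normalising f requires nrm f > 0; for nrm f = 0 the bound from
    \<open>psum_limit\<close> already gives 0.\<close>
  have bd: "norm (plim f g) \<le> D * nrm f" if f: "f \<in> X" for f
  proof (cases "nrm f = 0")
    case True
    then show ?thesis using psum_limit(2)[OF g f] by simp
  next
    case False
    then have n: "0 < nrm f" using nrm_nonneg[OF XD(1)[OF f]] by simp
    define c where "c = complex_of_real (1 / nrm f)"
    have c: "norm c * nrm f = 1" using n by (simp add: c_def norm_divide)
    have "plim (\<lambda>z. c * f z) g = c * plim f g"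
      by (rule plimI, rule psum_tendsto_cmult[OF XD(1)[OF f] gh psum_limit(1)[OF g f]])
    moreover have "norm (plim (\<lambda>z. c * f z) g) \<le> D"
      by (rule le) (use cmult_X[OF f, of c] c in auto)
    ultimately have "norm c * norm (plim f g) \<le> D" by (simp add: norm_mult)
    then have "norm (plim f g) / nrm f \<le> D" using n by (simp add: c_def norm_divide)
    then show ?thesis using n by (simp add: pos_divide_le_eq)
  qed
  have lf: "linear_functional (\<lambda>f. plim f g) D" by (rule linear_functional_plim[OF g D0 bd])
  show "BMOA_growth g ((2040 * B + 2 * T 0 / mom 1) * D)"
    unfolding BMOA_growth_def
    using gh BMOA_norm_le[OF lf gh taylor_coeff_plim] D0 B_pos T_nonneg mom_pos[of 1]
    by (auto intro!: mult_nonneg_nonneg add_nonneg_nonneg divide_nonneg_nonneg)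
qed

end

section \<open>Transfer from \<nu> to \<open>A1 \<omega>\<close> and
  \<open>BMOA_inf \<omega>\<close>\<close>

theorem theorem4:
  fixes \<omega> :: "real \<Rightarrow> real"
  assumes "\<omega> \<in> D_hat"
  shows "(\<forall>g\<in>BMOA_inf \<omega>. (\<forall>f\<in>A1 \<omega>. pairing_exists \<omega> f g) \<and>
            bounded_functional_on (A1 \<omega>) (A1_norm \<omega>) (\<lambda>f. pairing \<omega> f g)) \<and>
         (\<forall>L. bounded_functional_on (A1 \<omega>) (A1_norm \<omega>) L \<longrightarrow>
            (\<exists>g\<in>BMOA_inf \<omega>. (\<forall>f\<in>A1 \<omega>. L f = pairing \<omega> f g) \<and>
               (\<forall>h\<in>BMOA_inf \<omega>. (\<forall>f\<in>A1 \<omega>. L f = pairing \<omega> f h) \<longrightarrow>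
                  (\<forall>z\<in>ball 0 1. h z = g z)))) \<and>
         (\<exists>c>0. \<exists>C>0. \<forall>g\<in>BMOA_inf \<omega>.
            c * BMOA_inf_norm \<omega> g \<le> functional_norm (A1 \<omega>) (A1_norm \<omega>) (\<lambda>f. pairing \<omega> f g) \<and>
            functional_norm (A1 \<omega>) (A1_norm \<omega>) (\<lambda>f. pairing \<omega> f g) \<le> C * BMOA_inf_norm \<omega> g)"
proof -
  obtain C where rw: "radial_weight \<omega>" and C: "1 \<le> C"
    "\<And>r. r \<in> {0..<1} \<Longrightarrow> weight_tail \<omega> r \<le> C * weight_tail \<omega> ((1 + r) / 2)"
    using assms by (auto simp: D_hat_def)
  obtain w where bp: "borel_profile \<omega> w" using ex_borel_profile[OF rw] by blast
  note tail = weight_tail_wmeas[OF bp]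
  interpret F: finite_measure "wmeas w" by (rule finite_measure_wmeas[OF bp])
  interpret doubling_measure "wmeas w" C
  proof
    show "AE s in wmeas w. s \<in> {0..<1}" by (rule AE_wmeas[OF bp])
    show "0 < measure (wmeas w) {r..}" if "r < 1" for r
    proof -
      \<comment> \<open>Tails of the weight start at radius 0; for negative r the larger half-line
        contains the one at 0.\<close>
      have "max 0 r \<in> {0..<1}" using that by simp
      then have "0 < weight_tail \<omega> (max 0 r)" using rw unfolding radial_weight_def by blast
      also have "\<dots> = measure (wmeas w) {max 0 r..}" by (rule tail) simp
      also have "\<dots> \<le> measure (wmeas w) {r..}" by (rule F.finite_measure_mono) auto
      finally show ?thesis .
    qed
    show "measure (wmeas w) {r..} \<le> C * measure (wmeas w) {(1 + r) / 2..}" if "0 \<le> r" "r < 1" for r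
      using C(2)[of r] that by (simp add: tail)
  qed (use C in auto)
  have T_eq: "weight_tail \<omega> r = T r" if "0 \<le> r" for r using tail[OF that] by (simp add: T_def)
  have mom_eq: "moment \<omega> (real (2 * k + 1)) = mom (2 * k + 1)" for k
    unfolding moment_wmeas[OF bp] mom_def
  proof (rule integral_cong_AE)
    show "AE s in wmeas w. s powr real (2 * k + 1) = s ^ (2 * k + 1)"
    proof (rule AE_nuI)
      fix s :: real assume "0 \<le> s"
      \<comment> \<open>At s = 0 both sides are 0, because the exponent is positive.\<close>
      then show "s powr real (2 * k + 1) = s ^ (2 * k + 1)"
        by (cases "s = 0") (simp_all only: powr_realpow, auto)
    qed
  qed measurable
  have A1_eq: "A1 \<omega> = X" using A1_iff[OF bp] by (auto simp: X_def)
  have norm_eq: "A1_norm \<omega> f = nrm f" if "f \<in> X" for f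
    using A1_norm_eq[OF bp XD(1)[OF that]] by (simp add: nrm_def)
  have psum_eq: "pairing_sum \<omega> f g = psum f g" for f g
    unfolding pairing_sum_def[abs_def] psum_def[abs_def] mom_eq ..
  have pairing_eq: "pairing \<omega> f g = plim f g" for f g
    unfolding pairing_def plim_def psum_eq ..
  define N where "N = BMOA_inf_norm \<omega>"
  have growth: "BMOA_growth g (N g)" if g: "g \<in> BMOA_inf \<omega>" for g
  proof -
    have gh: "g holomorphic_on ball 0 1" and bdd: "bdd_above ((\<lambda>r. BMOA_norm (dilate r g) * weight_tail \<omega> r) ` {0<..<1})"
      using g by (auto simp: BMOA_inf_def)
    have le: "BMOA_norm (dilate \<rho> g) * T \<rho> \<le> N g" if "0 < \<rho>" "\<rho> < 1" for \<rho>
      using cSUP_upper[OF _ bdd, of \<rho>] that by (simp add: N_def BMOA_inf_norm_def T_eq)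
    \<comment> \<open>The norm bound N g is nonnegative because the BMOA norm of one dilate is; the
      radius 1/2 is an arbitrary choice.\<close>
    have u: "continuous_on UNIV (\<lambda>t. g (of_real (1/2) * cis t))" by (rule continuous_on_circle_UNIV[OF gh]) auto
    have "0 \<le> mean_osc (\<lambda>t. g (of_real (1/2) * cis t)) (0, 1)" by (rule mean_osc_nonneg[OF u]) simp
    also have "\<dots> \<le> (SUP I\<in>arcs. mean_osc (\<lambda>t. g (of_real (1/2) * cis t)) I)"
      by (rule cSUP_upper[OF arcs_nonempty mean_osc_bdd_above[OF gh]]) auto
    finally have "0 \<le> BMOA_norm (dilate (1/2) g)" using BMOA_norm_dilate[OF gh, of "1/2"] by simp
    then have "0 \<le> N g" using le[of "1/2"] T_nonneg[of "1/2"] by (intro order_trans[OF mult_nonneg_nonneg le[of "1/2"]]) auto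
    then show ?thesis using gh le by (simp add: BMOA_growth_def)
  qed
  have growthI: "g \<in> BMOA_inf \<omega>" "N g \<le> K" if "BMOA_growth g K" for g K
  proof -
    have gh: "g holomorphic_on ball 0 1" and le: "\<And>\<rho>. \<rho> \<in> {0<..<1} \<Longrightarrow> BMOA_norm (dilate \<rho> g) * weight_tail \<omega> \<rho> \<le> K"
      using that by (auto simp: BMOA_growth_def T_eq)
    have "bdd_above ((\<lambda>r. BMOA_norm (dilate r g) * weight_tail \<omega> r) ` {0<..<1})"
      by (rule bdd_aboveI2) (rule le)
    then show "g \<in> BMOA_inf \<omega>"
      unfolding BMOA_inf_def using gh dilate_BMOA[OF gh] by auto
    show "N g \<le> K" unfolding N_def BMOA_inf_norm_def by (rule cSUP_least) (use le in auto)
  qed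
  have lin: "linear_functional (\<lambda>f. plim f g) (648 * N g)" if "g \<in> BMOA_inf \<omega>" for g
    using growth[OF that] psum_limit(2)[OF growth[OF that]]
    by (intro linear_functional_plim) (auto simp: BMOA_growth_def)
  define K where "K = 2040 * B + 2 * T 0 / mom 1"
  have K: "0 < K" unfolding K_def using B_pos T_nonneg[of 0] mom_pos[of 1] by (intro add_pos_nonneg) auto
  have fn: "functional_norm (A1 \<omega>) (A1_norm \<omega>) (\<lambda>f. pairing \<omega> f g) = (SUP f\<in>{f \<in> X. nrm f \<le> 1}. norm (plim f g))" for g
  proof -
    have "{f \<in> X. A1_norm \<omega> f \<le> 1} = {f \<in> X. nrm f \<le> 1}" using norm_eq by auto
    then show ?thesis unfolding functional_norm_def A1_eq pairing_eq by simp
  qed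
  have part1: "pairing_exists \<omega> f g" if "g \<in> BMOA_inf \<omega>" "f \<in> A1 \<omega>" for f g
    using psum_limit(1)[OF growth[OF that(1)]] that(2) unfolding pairing_exists_def psum_eq A1_eq by blast
  have part2: "bounded_functional_on (A1 \<omega>) (A1_norm \<omega>) (\<lambda>f. pairing \<omega> f g)" if "g \<in> BMOA_inf \<omega>" for g
    using lin[OF that] unfolding bounded_functional_on_def A1_eq pairing_eq linear_functional_def
    by (auto simp: norm_eq)
  have part3: "\<exists>g\<in>BMOA_inf \<omega>. (\<forall>f\<in>A1 \<omega>. L f = pairing \<omega> f g) \<and>
      (\<forall>h\<in>BMOA_inf \<omega>. (\<forall>f\<in>A1 \<omega>. L f = pairing \<omega> f h) \<longrightarrow> (\<forall>z\<in>ball 0 1. h z = g z))"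
    if bf: "bounded_functional_on (A1 \<omega>) (A1_norm \<omega>) L" for L
  proof -
    obtain D where D: "\<forall>f\<in>X. norm (L f) \<le> D * nrm f"
      using bf unfolding bounded_functional_on_def A1_eq by (auto simp: norm_eq)
    \<comment> \<open>\<open>bounded_functional_on\<close> does not prescribe the sign of its
      constant, while \<open>linear_functional\<close> asks for a nonnegative one.\<close>
    have "norm (L f) \<le> max 0 D * nrm f" if "f \<in> X" for f
      using D that mult_right_mono[of D "max 0 D" "nrm f"] nrm_nonneg[OF XD(1)[OF that]] by force
    then have L: "linear_functional L (max 0 D)"
      using bf unfolding bounded_functional_on_def A1_eq linear_functional_def by auto
    obtain g where g: "g holomorphic_on ball 0 1" "\<And>k. taylor_coeff g k = cnj (L (\<lambda>z. z ^ k)) * of_real (m k)"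
      using ex_representing_function[OF L] by blast
    have "BMOA_growth g (K * max 0 D)"
      unfolding BMOA_growth_def using g(1) BMOA_norm_le[OF L g, folded K_def] K by simp
    then have gB: "g \<in> BMOA_inf \<omega>" by (rule growthI)
    have "L f = pairing \<omega> f g" if "f \<in> A1 \<omega>" for f
      unfolding pairing_eq
      using plimI[of f g "L f"] L_eq_pairing_limit[OF L _ g(2)] that unfolding psum_def[abs_def] A1_eq by simp
    moreover have "h z = g z" if h: "h \<in> BMOA_inf \<omega>" "\<forall>f\<in>A1 \<omega>. L f = pairing \<omega> f h" and z: "z \<in> ball 0 1" for h z
    proof -
      have hh: "h holomorphic_on ball 0 1" using h(1) by (simp add: BMOA_inf_def)
      have "taylor_coeff h k = taylor_coeff g k" for k
        using h(2) monomial_X(1)[of k] unfolding taylor_coeff_plim[of h k] g(2) A1_eq pairing_eq by simp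
      then show ?thesis
        using sums_unique2[OF taylor_sums[OF hh, of z]] taylor_sums[OF g(1), of z] z by simp
    qed
    ultimately show ?thesis using gB by blast
  qed
  have part4: "1 / K * BMOA_inf_norm \<omega> g \<le> functional_norm (A1 \<omega>) (A1_norm \<omega>) (\<lambda>f. pairing \<omega> f g) \<and>
      functional_norm (A1 \<omega>) (A1_norm \<omega>) (\<lambda>f. pairing \<omega> f g) \<le> 648 * BMOA_inf_norm \<omega> g"
    if "g \<in> BMOA_inf \<omega>" for g
  proof -
    note G = BMOA_growth_functional_norm[OF growth[OF that], folded K_def fn]
    have "N g \<le> K * functional_norm (A1 \<omega>) (A1_norm \<omega>) (\<lambda>f. pairing \<omega> f g)"
      by (rule growthI(2)[OF G(2)])
    then have "N g / K \<le> functional_norm (A1 \<omega>) (A1_norm \<omega>) (\<lambda>f. pairing \<omega> f g)"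
      using K by (simp only: pos_divide_le_eq mult.commute)
    then show ?thesis using G(1) unfolding N_def by (simp only: times_divide_eq_left mult_1_left)
  qed
  have K': "0 < 1 / K" using K by simp
  have part5: "\<exists>c>0. \<exists>C>0. \<forall>g\<in>BMOA_inf \<omega>.
      c * BMOA_inf_norm \<omega> g \<le> functional_norm (A1 \<omega>) (A1_norm \<omega>) (\<lambda>f. pairing \<omega> f g) \<and>
      functional_norm (A1 \<omega>) (A1_norm \<omega>) (\<lambda>f. pairing \<omega> f g) \<le> C * BMOA_inf_norm \<omega> g"
    by (rule exI[of _ "1 / K"], rule conjI[OF K'], rule exI[of _ 648], rule conjI[OF _ ballI[OF part4]]) simp
  show ?thesis by (intro conjI ballI allI impI part1 part2 part3 part5)
qed

end
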